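(* Let $T$ be a fixed closed Lipschitz subdomain of the unit ball $B_1\subset\mathbb{R}^3$, and for $\varepsilon\in(0,1)$ set $\Omega_\varepsilon:=B_1\setminus\varepsilon T$. For a source function $f$ on $\Omega_\varepsilon$ consider the Dirichlet problem $$(\mathrm{P}_{\varepsilon,f})\qquad -\Delta u=\operatorname{div} f\ \text{ in }\Omega_\varepsilon,\qquad u=0\ \text{ on }\partial\Omega_\varepsilon=\partial B_1\cup\varepsilon\,\partial T .$$ (i) There exists $f\in C^\infty(\overline{B_1};\mathbb{R}^3)$ such that for every $3<p<\infty$: if there exist solutions $u_\varepsilon\in W^{1,p}_0(\Omega_\varepsilon)$ to $(\mathrm{P}_{\varepsilon,f})$ for all sufficiently small $\varepsilon>0$, then $$\liminf_{\varepsilon\to0}\|\nabla u_\varepsilon\|_{L^p(\Omega_\varepsilon)}=\infty .$$ (ii) Suppose furthermore that $T$ has $C^1$ boundary. Then for every $1<p<3/2$ and every $0<\varepsilon<1$ there exists $f_\varepsilon\in L^p(\Omega_\varepsilon;\mathbb{R}^3)$ with $\|f_\varepsilon\|_{L^p(\Omega_\varepsilon)}=1$ such that the unique solutions $u_\varepsilon\in W^{1,p}_0(\Omega_\varepsilon)$ to $(\mathrm{P}_{\varepsilon,f_\varepsilon})$ satisfy $$\liminf_{\varepsilon\to0}\|\nabla u_\varepsilon\|_{L^p(\Omega_\varepsilon)}=\infty .$$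
   Context: $B_1:=\{x\in\mathbb{R}^3:|x|<1\}$. $T\subset B_1$ is a closed subdomain with Lipschitz boundary, fixed and independent of $\varepsilon$. $\varepsilon T:=\{\varepsilon x: x\in T\}$. Solutions are weak solutions: $u\in W^{1,p}_0(\Omega_\varepsilon)$ and $\int_{\Omega_\varepsilon}\nabla u\cdot\nabla\phi\,dx=-\int_{\Omega_\varepsilon}f\cdot\nabla\phi\,dx$ for all $\phi\in C_c^\infty(\Omega_\varepsilon)$. When $T$ has $C^1$ boundary, existence and uniqueness in $W^{1,p}_0(\Omega_\varepsilon)$ for every $1<p<\infty$ and each fixed $\varepsilon$ is a known result of Jerison and Kenig. *)

theory Defs
  imports "HOL-Analysis.Analysis"
begin

text \<open>Classical differentiability; the set \<open>S\<close> is meant to be open, since the derivatives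
  are taken with respect to \<open>at x\<close>.\<close>

primrec Ck_on :: "nat \<Rightarrow> 'a::euclidean_space set \<Rightarrow> ('a \<Rightarrow> 'b::euclidean_space) \<Rightarrow> bool" where
  "Ck_on 0 S f \<longleftrightarrow> continuous_on S f"
| "Ck_on (Suc k) S f \<longleftrightarrow>
     (\<forall>x\<in>S. f differentiable (at x)) \<and> (\<forall>v. Ck_on k S (\<lambda>x. frechet_derivative f (at x) v))"

definition smooth_on :: "'a::euclidean_space set \<Rightarrow> ('a \<Rightarrow> 'b::euclidean_space) \<Rightarrow> bool" where
  "smooth_on S f \<longleftrightarrow> (\<forall>k. Ck_on k S f)"

text \<open>\<open>C\<^sup>\<infinity>(K)\<close> for a closed set \<open>K\<close>: smooth on some open neighbourhood of \<open>K\<close>.\<close>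

definition smooth_on_closed :: "'a::euclidean_space set \<Rightarrow> ('a \<Rightarrow> 'b::euclidean_space) \<Rightarrow> bool" where
  "smooth_on_closed K f \<longleftrightarrow> (\<exists>U. open U \<and> K \<subseteq> U \<and> smooth_on U f)"

definition grad :: "('a::euclidean_space \<Rightarrow> real) \<Rightarrow> 'a \<Rightarrow> 'a" where
  "grad \<phi> x = (THE D. GDERIV \<phi> x :> D)"

text \<open>\<open>C\<^sub>c\<^sup>\<infinity>(\<Omega>)\<close>, its elements being extended by zero to the whole space.\<close>

definition test_functions :: "'a::euclidean_space set \<Rightarrow> ('a \<Rightarrow> real) set" where
  "test_functions \<Omega> = {\<phi>. smooth_on UNIV \<phi> \<and>
     compact (closure (support_on UNIV \<phi>)) \<and> closure (support_on UNIV \<phi>) \<subseteq> \<Omega>}"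

text \<open>Elements of Lebesgue and Sobolev spaces are represented by functions on the whole space; only
  their values almost everywhere on \<open>\<Omega>\<close> matter.\<close>

definition Lp :: "real \<Rightarrow> 'a::euclidean_space set \<Rightarrow> ('a \<Rightarrow> 'b::euclidean_space) set" where
  "Lp p \<Omega> = {f \<in> borel_measurable (lebesgue_on \<Omega>).
     integrable (lebesgue_on \<Omega>) (\<lambda>x. norm (f x) powr p)}"

text \<open>The norm is only meaningful for elements of \<open>Lp p \<Omega>\<close>.\<close>

definition Lp_norm :: "real \<Rightarrow> 'a::euclidean_space set \<Rightarrow> ('a \<Rightarrow> 'b::euclidean_space) \<Rightarrow> real" where
  "Lp_norm p \<Omega> f = (LINT x|lebesgue_on \<Omega>. norm (f x) powr p) powr (1 / p)"

definition locally_integrable ::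
  "'a::euclidean_space set \<Rightarrow> ('a \<Rightarrow> 'b::euclidean_space) \<Rightarrow> bool" where
  "locally_integrable \<Omega> f \<longleftrightarrow> (\<forall>K. compact K \<and> K \<subseteq> \<Omega> \<longrightarrow> integrable (lebesgue_on K) f)"

definition has_weak_gradient ::
  "'a::euclidean_space set \<Rightarrow> ('a \<Rightarrow> real) \<Rightarrow> ('a \<Rightarrow> 'a) \<Rightarrow> bool" where
  "has_weak_gradient \<Omega> u G \<longleftrightarrow> locally_integrable \<Omega> u \<and> locally_integrable \<Omega> G \<and>
     (\<forall>\<phi>\<in>test_functions \<Omega>.
        (LINT x|lebesgue_on \<Omega>. u x *\<^sub>R grad \<phi> x) = - (LINT x|lebesgue_on \<Omega>. \<phi> x *\<^sub>R G x))"

text \<open>Weak gradients are determined almost everywhere on \<open>\<Omega>\<close>.\<close>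

definition weak_gradient :: "'a::euclidean_space set \<Rightarrow> ('a \<Rightarrow> real) \<Rightarrow> 'a \<Rightarrow> 'a" where
  "weak_gradient \<Omega> u = (SOME G. has_weak_gradient \<Omega> u G)"

definition W1p :: "real \<Rightarrow> 'a::euclidean_space set \<Rightarrow> ('a \<Rightarrow> real) set" where
  "W1p p \<Omega> = {u \<in> Lp p \<Omega>. \<exists>G\<in>Lp p \<Omega>. has_weak_gradient \<Omega> u G}"

definition W1p_norm :: "real \<Rightarrow> 'a::euclidean_space set \<Rightarrow> ('a \<Rightarrow> real) \<Rightarrow> real" where
  "W1p_norm p \<Omega> u = Lp_norm p \<Omega> u + Lp_norm p \<Omega> (weak_gradient \<Omega> u)"

definition W1p_0 :: "real \<Rightarrow> 'a::euclidean_space set \<Rightarrow> ('a \<Rightarrow> real) set" where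
  "W1p_0 p \<Omega> = {u \<in> W1p p \<Omega>. \<exists>\<phi>. (\<forall>n. \<phi> n \<in> test_functions \<Omega>) \<and>
     (\<lambda>n::nat. W1p_norm p \<Omega> (\<lambda>x. u x - \<phi> n x)) \<longlonglongrightarrow> 0}"

text \<open>Solutions in \<open>W\<^sub>0\<^sup>1\<^sup>,\<^sup>p(\<Omega>)\<close> of \<open>-\<Delta>u = div f\<close> in \<open>\<Omega>\<close>, \<open>u = 0\<close> on the boundary.\<close>

definition weak_solution ::
  "real \<Rightarrow> 'a::euclidean_space set \<Rightarrow> ('a \<Rightarrow> 'a) \<Rightarrow> ('a \<Rightarrow> real) \<Rightarrow> bool" where
  "weak_solution p \<Omega> f u \<longleftrightarrow> u \<in> W1p_0 p \<Omega> \<and>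
     (\<forall>\<phi>\<in>test_functions \<Omega>.
        (LINT x|lebesgue_on \<Omega>. weak_gradient \<Omega> u x \<bullet> grad \<phi> x) =
        - (LINT x|lebesgue_on \<Omega>. f x \<bullet> grad \<phi> x))"

definition closed_domain :: "'a::euclidean_space set \<Rightarrow> bool" where
  "closed_domain T \<longleftrightarrow>
     interior T \<noteq> {} \<and> connected (interior T) \<and> closure (interior T) = T"

text \<open>Near each boundary point, in suitable orthonormal coordinates centred at that point, the closed
  set \<open>T\<close> is the region above the graph of a function \<open>\<gamma>\<close> with the regularity \<open>reg\<close>.
  Continuity of \<open>\<gamma>\<close> then forces \<open>\<gamma> 0 = 0\<close>, and locally the boundary is the graph of \<open>\<gamma>\<close>.\<close>

definition boundary_locally_graph ::
  "((real^2) set \<Rightarrow> (real^2 \<Rightarrow> real) \<Rightarrow> bool) \<Rightarrow> (real^3) set \<Rightarrow> bool" where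
  "boundary_locally_graph reg T \<longleftrightarrow>
     (\<forall>x0\<in>frontier T. \<exists>(Q :: real^3 \<Rightarrow> real^3) (\<gamma> :: real^2 \<Rightarrow> real) r h.
        orthogonal_transformation Q \<and> 0 < r \<and> 0 < h \<and> reg (ball 0 r) \<gamma> \<and>
        (\<forall>y\<in>ball 0 r. \<forall>t. \<bar>t\<bar> < h \<longrightarrow>
           (x0 + Q (vector [y $ 1, y $ 2, t]) \<in> T \<longleftrightarrow> \<gamma> y \<le> t)))"

definition lipschitz_boundary :: "(real^3) set \<Rightarrow> bool" where
  "lipschitz_boundary = boundary_locally_graph (\<lambda>U \<gamma>. \<exists>L. L-lipschitz_on U \<gamma>)"

definition C1_boundary :: "(real^3) set \<Rightarrow> bool" where
  "C1_boundary = boundary_locally_graph (Ck_on 1)"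

definition perforated_ball :: "(real^3) set \<Rightarrow> real \<Rightarrow> (real^3) set" where
  "perforated_ball T \<epsilon> = ball 0 1 - (\<lambda>x. \<epsilon> *\<^sub>R x) ` T"

end

theory Submission
  imports Defs
begin

text \<open>Let \<open>a\<close> be an interior point of \<open>T\<close> and \<open>X(x) = - (x - \<epsilon>a) / |x - \<epsilon>a|\<^sup>3\<close>, a field
  without divergence on \<open>\<Omega>\<^sub>\<epsilon>\<close>.  Cutting off its potential \<open>1 / |x - \<epsilon>a| - 1\<close> near the pole and near
  the unit sphere gives a test function \<open>w\<close> on \<open>\<Omega>\<^sub>\<epsilon>\<close> whose integral stays bounded below, while
  \<open>\<nabla>w - X\<close> tends to \<open>0\<close> in \<open>L\<^sup>q(\<Omega>\<^sub>\<epsilon>)\<close> for every \<open>q < 3/2\<close>.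

  For (i) take \<open>f(x) = x\<close>.  Testing with \<open>w\<close> gives \<open>\<integral> \<nabla>u \<bullet> \<nabla>w = 3 \<integral> w\<close>, and \<open>\<integral> \<nabla>u \<bullet> X = 0\<close> because \<open>u\<close>
  vanishes on the boundary; by Hoelder's inequality \<open>3 \<integral> w\<close> is at most the product of the norm of \<open>\<nabla>u\<close> in
  \<open>L\<^sup>p\<close> and that of \<open>\<nabla>w - X\<close> in \<open>L\<^sup>q\<close>, with \<open>q = p / (p - 1) < 3/2\<close>.  For (ii) take for \<open>f\<close> the
  field \<open>X - \<nabla>w\<close> divided by its norm; the solution is \<open>w\<close> divided by the same norm.

  Uniqueness of that solution is proved directly: a weakly harmonic function with zero boundary
  values vanishes, by Kato's inequality tested with a superharmonic function that is
  \<open>O(d\<^sup>\<alpha>)\<close> in the distance \<open>d\<close> to the boundary.  Since the boundary is \<open>C\<^sup>1\<close>, it has exterior cones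
  arbitrarily close to half spaces, and \<open>\<alpha> < 1\<close> can be taken as close to \<open>1\<close> as the exponent \<open>p\<close>
  requires.\<close>

section \<open>Smooth functions\<close>

text \<open>The field X has size |z|^(-2), which lies in L^q near the pole exactly when 2q < 3; this
  is the threshold 3/2 and, by conjugation, 3. The cut-off error is at most a multiple of |z|^(-2)
  uniformly in \<epsilon>, so dominated convergence applies. The harder half is uniqueness. As p
  lies below 2, a solution cannot be inserted as a test function into its own equation, and there is
  no energy estimate; Kato's inequality works at the level of L^1 instead. The barrier is an infimum
  of functions attached to single boundary points and has no Laplacian, so its superharmonicity is
  stated with second differences: these pass to infima and move across integrals by translation.
  Localising away from the boundary costs one power of the strip width \<delta>. The gain is
  \<delta>^\<alpha> from the barrier and \<delta>^(1/q) from Hoelder's inequality on a strip of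
  measure O(\<delta>), where 1/p + 1/q = 1. Hence \<alpha> must exceed 1/p, and this approaches 1 as
  p approaches 1: a fixed exterior cone would not do.\<close>

definition dd :: "'a::euclidean_space \<Rightarrow> ('a \<Rightarrow> 'b::euclidean_space) \<Rightarrow> 'a \<Rightarrow> 'b" where
  "dd v f = (\<lambda>x. frechet_derivative f (at x) v)"

abbreviation smooth :: "('a::euclidean_space \<Rightarrow> 'b::euclidean_space) \<Rightarrow> bool" where
  "smooth f \<equiv> smooth_on UNIV f"

lemma dd_eqI: "(f has_derivative f') (at x) \<Longrightarrow> dd v f x = f' v"
  unfolding dd_def using frechet_derivative_at by metis

lemma differentiable_dd: "f differentiable (at x) \<Longrightarrow> (f has_derivative (\<lambda>v. dd v f x)) (at x)"
  by (simp add: dd_def frechet_derivative_works)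

lemma Ck_on_Suc_dd:
  "Ck_on (Suc k) UNIV f \<longleftrightarrow> (\<forall>x. f differentiable (at x)) \<and> (\<forall>v. Ck_on k UNIV (dd v f))"
  by (simp add: dd_def)

declare Ck_on.simps(2) [simp del]

lemma Ck_on_SucD: "Ck_on (Suc k) UNIV f \<Longrightarrow> Ck_on k UNIV f"
proof (induction k arbitrary: f)
  case 0
  then have "f differentiable (at x)" for x unfolding Ck_on_Suc_dd by blast
  then have "isCont f x" for x by (rule differentiable_imp_continuous_within)
  then show ?case by (simp add: continuous_at_imp_continuous_on)
next
  case (Suc k)
  then show ?case by (metis Ck_on_Suc_dd)
qed

text \<open>The quantifier over all orders absorbs the shift by one, so smoothness can be shown by
  naming the derivative and recognising it as smooth, without an induction on the order.\<close>

lemma smooth_iff: "smooth f \<longleftrightarrow> (\<forall>x. f differentiable (at x)) \<and> (\<forall>v. smooth (dd v f))"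
  unfolding smooth_on_def
  by (metis Ck_on_SucD Ck_on_Suc_dd)

lemma smooth_differentiable: "smooth f \<Longrightarrow> f differentiable (at x)"
  using smooth_iff by blast

lemma smooth_dd: "smooth f \<Longrightarrow> smooth (dd v f)"
  using smooth_iff by blast

lemma smooth_has_derivative: "smooth f \<Longrightarrow> (f has_derivative (\<lambda>v. dd v f x)) (at x)"
  by (intro differentiable_dd smooth_differentiable)

lemma smooth_continuous: "smooth f \<Longrightarrow> continuous_on S f"
  by (rule continuous_at_imp_continuous_on) (blast intro: differentiable_imp_continuous_within smooth_differentiable)

lemma Ck_on_const: "Ck_on k UNIV (\<lambda>x. c)"
proof (induction k arbitrary: c)
  case (Suc k)
  have "dd v (\<lambda>x. c) = (\<lambda>x. 0)" for v :: 'a by (simp add: dd_def)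
  then show ?case using Suc by (auto simp: Ck_on_Suc_dd)
qed auto

lemma dd_add:
  assumes "f differentiable (at x)" "g differentiable (at x)"
  shows "dd v (\<lambda>x. f x + g x) x = dd v f x + dd v g x"
  by (simp add: dd_eqI[OF has_derivative_add[OF assms[THEN differentiable_dd]]])

lemma dd_mult:
  fixes f g :: "'a::euclidean_space \<Rightarrow> real"
  assumes "f differentiable (at x)" "g differentiable (at x)"
  shows "dd v (\<lambda>x. f x * g x) x = f x * dd v g x + dd v f x * g x"
  by (simp add: dd_eqI[OF has_derivative_mult[OF assms[THEN differentiable_dd]]])

lemma dd_chain:
  fixes f :: "'a::euclidean_space \<Rightarrow> real" and g :: "real \<Rightarrow> real"
  assumes "f differentiable (at x)" "g differentiable (at (f x))"
  shows "dd v (\<lambda>x. g (f x)) x = dd 1 g (f x) * dd v f x"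
proof -
  have 1: "(g has_derivative (\<lambda>v. v * dd 1 g (f x))) (at (f x))"
  proof -
    have "linear (frechet_derivative g (at (f x)))"
      using assms(2) linear_frechet_derivative by blast
    then have "frechet_derivative g (at (f x)) = (\<lambda>v. v * dd 1 g (f x))"
      unfolding dd_def by (metis linear_times_of_real mult.right_neutral linear_scale real_scaleR_def)
    then show ?thesis using assms(2) by (metis frechet_derivative_works)
  qed
  have 2: "(f has_derivative (\<lambda>v. dd v f x)) (at x)"
    using assms(1) by (rule differentiable_dd)
  have "((\<lambda>x. g (f x)) has_derivative (\<lambda>v. dd v f x * dd 1 g (f x))) (at x)"
    using has_derivative_compose[OF 2 1] .
  then show ?thesis by (simp add: dd_eqI mult.commute)
qed

lemma Ck_on_add: "Ck_on k UNIV f \<Longrightarrow> Ck_on k UNIV g \<Longrightarrow> Ck_on k UNIV (\<lambda>x. f x + g x)"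
proof (induction k arbitrary: f g)
  case (Suc k)
  have d: "f differentiable (at x)" "g differentiable (at x)" for x
    using Suc.prems by (auto simp: Ck_on_Suc_dd)
  have "dd v (\<lambda>x. f x + g x) = (\<lambda>x. dd v f x + dd v g x)" for v
    using d by (auto simp: dd_add)
  then show ?case using Suc d by (auto simp: Ck_on_Suc_dd)
qed (auto intro: continuous_on_add continuous_on_mult)

lemma Ck_on_mult:
  fixes f g :: "'a::euclidean_space \<Rightarrow> real"
  shows "Ck_on k UNIV f \<Longrightarrow> Ck_on k UNIV g \<Longrightarrow> Ck_on k UNIV (\<lambda>x. f x * g x)"
proof (induction k arbitrary: f g)
  case (Suc k)
  have d: "f differentiable (at x)" "g differentiable (at x)" for x
    using Suc.prems by (auto simp: Ck_on_Suc_dd)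
  have "dd v (\<lambda>x. f x * g x) = (\<lambda>x. f x * dd v g x + dd v f x * g x)" for v
    using d by (auto simp: dd_mult)
  moreover have "Ck_on k UNIV f" "Ck_on k UNIV g" using Suc.prems Ck_on_SucD by blast+
  moreover have "Ck_on k UNIV (dd v f)" "Ck_on k UNIV (dd v g)" for v
    using Suc.prems by (auto simp: Ck_on_Suc_dd)
  ultimately show ?case using Suc.IH d
    by (auto simp: Ck_on_Suc_dd intro!: Ck_on_add differentiable_mult)
qed (auto intro: continuous_on_add continuous_on_mult)

lemma Ck_on_compose:
  fixes f :: "'a::euclidean_space \<Rightarrow> real" and g :: "real \<Rightarrow> real"
  shows "Ck_on k UNIV f \<Longrightarrow> Ck_on k UNIV g \<Longrightarrow> Ck_on k UNIV (\<lambda>x. g (f x))"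
proof (induction k arbitrary: f g)
  case 0
  then show ?case
    by (metis Ck_on.simps(1) continuous_on_compose2 subset_UNIV)
next
  case (Suc k)
  have d: "f differentiable (at x)" "g differentiable (at y)" for x y
    using Suc.prems by (auto simp: Ck_on_Suc_dd)
  have "dd v (\<lambda>x. g (f x)) = (\<lambda>x. dd 1 g (f x) * dd v f x)" for v
    using d by (auto simp: dd_chain)
  moreover have "Ck_on k UNIV f" using Suc.prems Ck_on_SucD by blast
  moreover have "Ck_on k UNIV (dd v f)" "Ck_on k UNIV (dd 1 g)" for v
    using Suc.prems by (auto simp: Ck_on_Suc_dd)
  moreover have "(\<lambda>x. g (f x)) differentiable (at x)" for x
    using differentiable_chain_at[of f x g] d by (simp add: o_def)
  ultimately show ?case using Suc.IH
    by (auto simp: Ck_on_Suc_dd intro!: Ck_on_mult)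
qed

lemma smooth_const [simp]: "smooth (\<lambda>x. c)"
  by (simp add: smooth_on_def Ck_on_const)

lemma smooth_add: "smooth f \<Longrightarrow> smooth g \<Longrightarrow> smooth (\<lambda>x. f x + g x)"
  by (simp add: smooth_on_def Ck_on_add)

lemma smooth_mult: "smooth f \<Longrightarrow> smooth g \<Longrightarrow> smooth (\<lambda>x. f x * g x :: real)"
  by (simp add: smooth_on_def Ck_on_mult)

lemma smooth_compose: "smooth f \<Longrightarrow> smooth g \<Longrightarrow> smooth (\<lambda>x. g (f x :: real) :: real)"
  by (simp add: smooth_on_def Ck_on_compose)

lemma smooth_cmult: "smooth f \<Longrightarrow> smooth (\<lambda>x. c * f x :: real)"
  by (rule smooth_mult[OF smooth_const])

lemma smooth_diff: "smooth f \<Longrightarrow> smooth g \<Longrightarrow> smooth (\<lambda>x. f x - g x :: real)"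
  using smooth_add[of f "\<lambda>x. - 1 * g x"] smooth_cmult[of g "-1"] by simp

lemma smooth_linear: "bounded_linear f \<Longrightarrow> smooth f"
proof (subst smooth_iff, intro conjI allI)
  assume f: "bounded_linear f"
  then show "f differentiable (at x)" for x by (simp add: bounded_linear_imp_differentiable)
  show "smooth (dd v f)" for v
  proof -
    have "dd v f = (\<lambda>x. f v)"
      using f by (auto intro!: ext dd_eqI bounded_linear_imp_has_derivative)
    then show ?thesis by simp
  qed
qed

lemma smooth_inner_self: "smooth (\<lambda>x. x \<bullet> x)"
proof (subst smooth_iff, intro conjI allI)
  fix x v :: 'a
  have *: "((\<lambda>x. x \<bullet> x) has_derivative (\<lambda>v. 2 * (v \<bullet> x))) (at x)" for x :: 'a
    by (auto intro!: derivative_eq_intros simp: inner_commute)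
  then show "(\<lambda>x. x \<bullet> x) differentiable (at x)" by (auto simp: differentiable_def)
  have "dd v (\<lambda>x. x \<bullet> x) = (\<lambda>x. 2 * (v \<bullet> x))" using dd_eqI[OF *] by auto
  moreover have "bounded_linear (\<lambda>x. 2 * (v \<bullet> x))"
    by (simp add: bounded_linear_const_mult bounded_linear_inner_right)
  ultimately show "smooth (dd v (\<lambda>x. x \<bullet> x))" using smooth_linear by metis
qed

lemma dd_affine:
  assumes "f differentiable (at (c *\<^sub>R x + a))"
  shows "dd v (\<lambda>x. f (c *\<^sub>R x + a)) x = c *\<^sub>R dd v f (c *\<^sub>R x + a)"
    and "(\<lambda>x. f (c *\<^sub>R x + a)) differentiable (at x)"
proof -
  have 1: "((\<lambda>x. c *\<^sub>R x + a) has_derivative (\<lambda>v. c *\<^sub>R v)) (at x)"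
    by (auto intro!: derivative_eq_intros)
  have 2: "(f has_derivative (\<lambda>v. dd v f (c *\<^sub>R x + a))) (at (c *\<^sub>R x + a))"
    using assms by (rule differentiable_dd)
  have 3: "((\<lambda>x. f (c *\<^sub>R x + a)) has_derivative (\<lambda>v. dd (c *\<^sub>R v) f (c *\<^sub>R x + a))) (at x)"
    using has_derivative_compose[OF 1 2] .
  have "linear (frechet_derivative f (at (c *\<^sub>R x + a)))"
    using assms linear_frechet_derivative by blast
  then have "dd (c *\<^sub>R v) f (c *\<^sub>R x + a) = c *\<^sub>R dd v f (c *\<^sub>R x + a)"
    unfolding dd_def by (rule linear_scale)
  then show "dd v (\<lambda>x. f (c *\<^sub>R x + a)) x = c *\<^sub>R dd v f (c *\<^sub>R x + a)"
    using dd_eqI[OF 3, of v] by simp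
  show "(\<lambda>x. f (c *\<^sub>R x + a)) differentiable (at x)" using 3 by (auto simp: differentiable_def)
qed

lemma Ck_on_affine:
  fixes f :: "'a::euclidean_space \<Rightarrow> real"
  shows "Ck_on k UNIV f \<Longrightarrow> Ck_on k UNIV (\<lambda>x. f (c *\<^sub>R x + a))"
proof (induction k arbitrary: f)
  case 0
  then show ?case by (auto intro!: continuous_on_compose2[of UNIV f] continuous_intros)
next
  case (Suc k)
  have d: "f differentiable (at x)" for x
    using Suc.prems by (auto simp: Ck_on_Suc_dd)
  have "dd v (\<lambda>x. f (c *\<^sub>R x + a)) = (\<lambda>x. c * dd v f (c *\<^sub>R x + a))" for v
    using dd_affine[OF d] by auto
  then show ?case using Suc dd_affine[OF d]
    by (auto simp: Ck_on_Suc_dd Ck_on_const intro!: Ck_on_mult)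
qed

lemma smooth_affine: "smooth f \<Longrightarrow> smooth (\<lambda>x. f (c *\<^sub>R x + a) :: real)"
  by (simp add: smooth_on_def Ck_on_affine)

lemma smooth_prod: "(\<And>i. i \<in> I \<Longrightarrow> smooth (f i)) \<Longrightarrow> smooth (\<lambda>x. \<Prod>i\<in>I. f i x :: real)"
  by (induction I rule: infinite_finite_induct) (auto intro: smooth_mult)

text \<open>The family \<open>t\<^sup>-\<^sup>n exp (-1/t)\<close> is closed under differentiation up to linear combinations.\<close>

definition expm :: "nat \<Rightarrow> real \<Rightarrow> real" where
  "expm n t = (if 0 < t then (inverse t) ^ n * exp (- inverse t) else 0)"

text \<open>Quadratic decay at 0 makes the difference quotient of \<open>expm n\<close> at 0 tend to
  0. With y = 1/t the bound is a single term of the exponential series, of degree n + 2, compared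
  with \<open>exp y\<close>.\<close>

lemma expm_bound: "\<bar>expm n t\<bar> \<le> fact (n + 2) * t\<^sup>2"
proof (cases "0 < t")
  case True
  define y where "y = inverse t"
  have y: "y > 0" using True by (simp add: y_def)
  define c :: real where "c = fact (n + 2)"
  have c: "c > 0" unfolding c_def by (rule fact_gt_zero)
  have "(\<Sum>k\<in>{n+2}. inverse (fact k) *\<^sub>R y ^ k) \<le> exp y"
    unfolding exp_def using y by (intro sum_le_suminf summable_exp_generic) auto
  then have "y ^ (n + 2) / c \<le> exp y" by (simp add: c_def divide_inverse mult.commute)
  then have "y ^ n * exp (- y) \<le> c * (inverse y)\<^sup>2"
    using y c by (simp add: exp_minus field_simps power2_eq_square)
  then show ?thesis using True by (simp add: expm_def y_def c_def)
qed (simp add: expm_def)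

lemma expm_deriv: "(expm n has_real_derivative (expm (n + 2) t - real n * expm (n + 1) t)) (at t)"
proof -
  consider "t > 0" | "t < 0" | "t = 0" by linarith
  then show ?thesis
  proof cases
    case 1
    have "((\<lambda>t. (inverse t) ^ n * exp (- inverse t)) has_real_derivative
        (expm (n + 2) t - real n * expm (n + 1) t)) (at t)"
      using 1 apply (auto intro!: derivative_eq_intros simp: expm_def power2_eq_square)
      apply (cases n) by (auto simp: field_simps)
    then show ?thesis
      by (rule has_field_derivative_transform_within_open[of _ _ _ "{0<..}"]) (use 1 in \<open>auto simp: expm_def\<close>)
  next
    case 2
    have "((\<lambda>t. 0) has_real_derivative (expm (n + 2) t - real n * expm (n + 1) t)) (at t)"
      using 2 by (auto simp: expm_def)
    then show ?thesis
      by (rule has_field_derivative_transform_within_open[of _ _ _ "{..<0}"]) (use 2 in \<open>auto simp: expm_def\<close>)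
  next
    case 3
    have "((\<lambda>h. (expm n (0 + h) - expm n 0) / h) \<longlongrightarrow> 0) (at 0)"
    proof (rule Lim_null_comparison[where g="\<lambda>h. fact (n + 2) * \<bar>h\<bar>"])
      show "\<forall>\<^sub>F h in at 0. norm ((expm n (0 + h) - expm n 0) / h) \<le> fact (n + 2) * \<bar>h\<bar>"
      proof (rule eventually_at_filter[THEN iffD2], rule always_eventually, intro allI impI)
        fix h :: real assume "h \<noteq> 0"
        then show "norm ((expm n (0 + h) - expm n 0) / h) \<le> fact (n + 2) * \<bar>h\<bar>"
          using expm_bound[of n h] by (simp add: expm_def[of n 0] pos_divide_le_eq mult.assoc power2_eq_square del: fact_Suc)
      qed
      show "((\<lambda>h. fact (n + 2) * \<bar>h\<bar>) \<longlongrightarrow> (0::real)) (at 0)"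
        by (auto intro!: tendsto_eq_intros)
    qed
    then show ?thesis using 3 by (simp add: DERIV_def expm_def)
  qed
qed

lemma smooth_expm: "smooth (expm n)"
proof -
  have "Ck_on k UNIV (expm n)" for k
  proof (induction k arbitrary: n)
    case 0
    then show ?case
      by (simp, meson DERIV_isCont continuous_at_imp_continuous_on expm_deriv)
  next
    case (Suc k)
    have "dd v (expm n) = (\<lambda>t. v * expm (n + 2) t + (- v * real n) * expm (n + 1) t)" for v
      using dd_eqI[OF expm_deriv[unfolded has_field_derivative_def]]
      by (auto simp: algebra_simps)
    moreover have "expm n differentiable (at t)" for t
      using expm_deriv real_differentiable_def by blast
    moreover have "Ck_on k UNIV (\<lambda>t. v * expm (n + 2) t + (- v * real n) * expm (n + 1) t)" for v
      by (intro Ck_on_add Ck_on_mult Ck_on_const Suc)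
    ultimately show ?case unfolding Ck_on_Suc_dd by metis
  qed
  then show ?thesis by (simp add: smooth_on_def)
qed

text \<open>The integrand is a bump on (1, 2), so the transition takes place there. For t < 1 the
  interval \<open>{1..t}\<close> is empty and its integral is 0, which saves a case
  distinction.\<close>

definition smooth_step :: "real \<Rightarrow> real" where
  "smooth_step t = integral {1..t} (\<lambda>r. expm 0 (r - 1) * expm 0 (2 - r)) /
     integral {1..2} (\<lambda>r. expm 0 (r - 1) * expm 0 (2 - r))"

lemma smooth_step:
  shows smooth_smooth_step: "smooth smooth_step"
    and smooth_step_zero: "t \<le> 1 \<Longrightarrow> smooth_step t = 0"
    and smooth_step_one: "2 \<le> t \<Longrightarrow> smooth_step t = 1"
    and smooth_step_nonneg: "0 \<le> smooth_step t"
    and smooth_step_le_1: "smooth_step t \<le> 1"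
    and smooth_step_deriv_bounded: "\<exists>C. \<forall>t. \<bar>dd 1 smooth_step t\<bar> \<le> C"
proof -
  define \<beta> where "\<beta> = (\<lambda>r. expm 0 (r - 1) * expm 0 (2 - r))"
  define c where "c = integral {1..2} \<beta>"
  have sm: "smooth \<beta>" unfolding \<beta>_def
    using smooth_mult[OF smooth_affine[OF smooth_expm, of 0 1 "-1"] smooth_affine[OF smooth_expm, of 0 "-1" 2]]
    by (simp add: algebra_simps)
  have cont: "continuous_on S \<beta>" for S by (rule smooth_continuous[OF sm])
  have int: "\<beta> integrable_on {a..b}" for a b by (rule integrable_continuous_real[OF cont])
  have nn: "0 \<le> \<beta> r" for r by (simp add: \<beta>_def expm_def)
  have z1: "\<beta> r = 0" if "r \<le> 1" for r using that by (simp add: \<beta>_def expm_def)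
  have z2: "\<beta> r = 0" if "2 \<le> r" for r using that by (simp add: \<beta>_def expm_def)
  have c: "c > 0"
  proof -
    have "c \<noteq> 0"
    proof
      assume "c = 0"
      then have "\<forall>x\<in>cbox 1 2. \<beta> x = 0"
        using integral_eq_0_iff[of 1 2 \<beta>] cont nn by (simp add: c_def)
      then have "\<beta> (3/2) = 0" by auto
      then show False by (simp add: \<beta>_def expm_def)
    qed
    moreover have "c \<ge> 0" unfolding c_def by (rule integral_nonneg[OF int nn])
    ultimately show ?thesis by simp
  qed
  have S: "smooth_step = (\<lambda>t. integral {1..t} \<beta> / c)"
    by (auto simp: smooth_step_def \<beta>_def c_def)
  show zero: "smooth_step t = 0" if "t \<le> 1" for t
    using that by (cases "t = 1") (auto simp: S)
  show one: "smooth_step t = 1" if "2 \<le> t" for t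
  proof -
    have "integral {1..2} \<beta> + integral {2..t} \<beta> = integral {1..t} \<beta>"
      by (rule Henstock_Kurzweil_Integration.integral_combine) (use that int in auto)
    moreover have "integral {2..t} \<beta> = 0"
      by (intro integral_unique[OF has_integral_is_0]) (use z2 in auto)
    ultimately show ?thesis using c by (simp add: S c_def)
  qed
  show "0 \<le> smooth_step t" for t
    using c integral_nonneg[OF int nn] by (simp add: S)
  show "smooth_step t \<le> 1" for t
  proof (cases "t \<le> 2")
    case True
    have "integral {1..t} \<beta> \<le> c" unfolding c_def
      by (rule integral_subset_le) (use True int nn in auto)
    then show ?thesis using c by (simp add: S)
  qed (use one in simp)
  have der: "(smooth_step has_real_derivative \<beta> t / c) (at t)" for t
  proof (cases "t < 1")
    case True
    have "((\<lambda>_. 0) has_real_derivative \<beta> t / c) (at t)" using z1 True by simp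
    then show ?thesis
      by (rule has_field_derivative_transform_within_open[of _ _ _ "{..<1}"]) (use True zero in auto)
  next
    case False
    \<comment> \<open>Integration starts at 0 instead of 1 so that every t \<ge> 1 is interior to
      the interval and the derivative within it is a two-sided derivative.\<close>
    have "((\<lambda>u. integral {0..u} \<beta>) has_real_derivative \<beta> t) (at t within {0..t+1})"
      by (rule integral_has_real_derivative) (use False cont in auto)
    then have "((\<lambda>u. integral {0..u} \<beta>) has_real_derivative \<beta> t) (at t)"
      using at_within_Icc_at[of 0 t "t+1"] False by auto
    then have "((\<lambda>u. integral {0..u} \<beta> / c) has_real_derivative \<beta> t / c) (at t)"
      by (rule DERIV_cdivide)
    then show ?thesis
    proof (rule has_field_derivative_transform_within_open[of _ _ _ "{0<..}"])
      fix u :: real assume u: "u \<in> {0<..}"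
      show "integral {0..u} \<beta> / c = smooth_step u"
      proof (cases "u \<ge> 1")
        case True
        have "integral {0..1} \<beta> + integral {1..u} \<beta> = integral {0..u} \<beta>"
          by (rule Henstock_Kurzweil_Integration.integral_combine) (use True int in auto)
        moreover have "integral {0..1} \<beta> = 0"
          by (intro integral_unique[OF has_integral_is_0]) (use z1 in auto)
        ultimately show ?thesis by (simp add: S)
      next
        case False
        have "integral {0..u} \<beta> = 0"
          by (intro integral_unique[OF has_integral_is_0]) (use z1 False in auto)
        then show ?thesis using zero[of u] False by simp
      qed
    qed (use False in auto)
  qed
  have dd: "dd v smooth_step = (\<lambda>t. (v / c) * \<beta> t)" for v
    using dd_eqI[OF der[unfolded has_field_derivative_def]] by auto
  show "smooth smooth_step"
    unfolding smooth_iff[of smooth_step] dd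
    using der smooth_cmult[OF sm] unfolding real_differentiable_def by blast
  have "bounded (\<beta> ` {1..2})"
    by (intro compact_imp_bounded compact_continuous_image cont) auto
  then obtain B where B: "\<And>t. t \<in> {1..2} \<Longrightarrow> \<bar>\<beta> t\<bar> \<le> B"
    unfolding bounded_iff by (simp only: ball_simps real_norm_def) blast
  have "\<bar>\<beta> t\<bar> \<le> B" for t
    using B[of t] B[of 1] z1[of t] z2[of t] by (cases "t \<in> {1..2}") auto
  then have "\<bar>dd 1 smooth_step t\<bar> \<le> B / c" for t
    using c by (simp add: dd abs_mult divide_right_mono)
  then show "\<exists>C. \<forall>t. \<bar>dd 1 smooth_step t\<bar> \<le> C" by blast
qed

section \<open>Test functions\<close>

text \<open>\<open>grad\<close> is a definite description; differentiability supplies existence and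
  uniqueness, and from here on gradients are handled through their components
  \<open>dd i f\<close>.\<close>

lemma grad_eq:
  fixes f :: "'a::euclidean_space \<Rightarrow> real"
  assumes "f differentiable (at x)"
  shows "grad f x = (\<Sum>i\<in>Basis. dd i f x *\<^sub>R i)" and grad_inner: "grad f x \<bullet> v = dd v f x"
proof -
  have d: "(f has_derivative (\<lambda>v. dd v f x)) (at x)" by (rule differentiable_dd[OF assms])
  then have lin: "linear (\<lambda>v. dd v f x)" by (rule has_derivative_linear)
  let ?D = "\<Sum>i\<in>Basis. dd i f x *\<^sub>R i"
  have D: "v \<bullet> ?D = dd v f x" for v
  proof -
    have "dd v f x = dd (\<Sum>i\<in>Basis. (v \<bullet> i) *\<^sub>R i) f x" by (simp only: euclidean_representation)
    also have "\<dots> = (\<Sum>i\<in>Basis. (v \<bullet> i) * dd i f x)"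
      by (simp only: linear_sum[OF lin, of "\<lambda>i. (v \<bullet> i) *\<^sub>R i" Basis] linear_scale[OF lin] real_scaleR_def)
    also have "\<dots> = v \<bullet> ?D" by (simp add: inner_sum_right mult.commute)
    finally show ?thesis by (rule sym)
  qed
  have g: "GDERIV f x :> ?D"
    unfolding gderiv_def D by (rule d)
  moreover have "D' = ?D" if "GDERIV f x :> D'" for D'
  proof -
    have "(\<lambda>h. h \<bullet> D') = (\<lambda>h. h \<bullet> ?D)"
      using that g unfolding gderiv_def by (rule has_derivative_unique)
    then show ?thesis by (simp add: fun_eq_iff vector_eq_ldot)
  qed
  ultimately show e: "grad f x = ?D" unfolding grad_def by (rule the_equality)
  show "grad f x \<bullet> v = dd v f x" by (simp only: e inner_commute[of ?D v] D)
qed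

lemma dd_linear: "smooth f \<Longrightarrow> linear (\<lambda>v. dd v f x)"
  using has_derivative_linear smooth_has_derivative by blast

lemma dd_cong_open:
  assumes "open U" "x \<in> U" "\<And>y. y \<in> U \<Longrightarrow> f y = g y" "g differentiable (at x)"
  shows "dd v f x = dd v g x"
  using has_derivative_transform_within_open[OF differentiable_dd[OF assms(4)] assms(1,2)] assms(3)
  by (intro dd_eqI) auto

lemma dd_zero_off:
  assumes "closed K" "\<And>y. y \<notin> K \<Longrightarrow> f y = 0" "x \<notin> K"
  shows "dd v f x = 0"
proof -
  have "dd v f x = dd v (\<lambda>_. 0) x"
    by (rule dd_cong_open[of "- K"]) (use assms in auto)
  then show ?thesis by (simp add: dd_def)
qed

lemma test_functionsI:
  assumes "smooth \<phi>" "compact K" "K \<subseteq> \<Omega>" "\<And>x. x \<notin> K \<Longrightarrow> \<phi> x = 0"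
  shows "\<phi> \<in> test_functions \<Omega>"
proof -
  have "closure (support_on UNIV \<phi>) \<subseteq> K"
    by (rule closure_minimal) (use assms in \<open>auto simp: support_on_def compact_imp_closed\<close>)
  then show ?thesis using assms
    by (auto simp: test_functions_def compact_closure intro: bounded_subset[OF compact_imp_bounded[OF assms(2)]] closure_subset[THEN subsetD])
qed

lemma test_functions_smooth: "\<phi> \<in> test_functions \<Omega> \<Longrightarrow> smooth \<phi>"
  by (simp add: test_functions_def)

lemma test_functionsE:
  assumes "\<phi> \<in> test_functions \<Omega>"
  obtains K where "smooth \<phi>" "compact K" "K \<subseteq> \<Omega>" "\<And>x. x \<notin> K \<Longrightarrow> \<phi> x = 0"
proof (rule that[of "closure (support_on UNIV \<phi>)"])
  show "\<phi> x = 0" if "x \<notin> closure (support_on UNIV \<phi>)" for x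
    using that closure_subset[of "support_on UNIV \<phi>"] by (auto simp: support_on_def)
qed (use assms in \<open>auto simp: test_functions_def\<close>)

lemma test_functions_mono: "\<Omega> \<subseteq> \<Omega>' \<Longrightarrow> test_functions \<Omega> \<subseteq> test_functions \<Omega>'"
  by (auto simp: test_functions_def)

lemma test_functions_dd:
  assumes "\<phi> \<in> test_functions \<Omega>"
  shows "dd v \<phi> \<in> test_functions \<Omega>"
proof -
  obtain K where K: "smooth \<phi>" "compact K" "K \<subseteq> \<Omega>" "\<And>x. x \<notin> K \<Longrightarrow> \<phi> x = 0"
    by (rule test_functionsE[OF assms]) blast
  then show ?thesis
    by (intro test_functionsI[of _ K] smooth_dd dd_zero_off[of K]) (auto simp: compact_imp_closed)
qed

lemma test_functions_add:
  assumes "\<phi> \<in> test_functions \<Omega>" "\<psi> \<in> test_functions \<Omega>"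
  shows "(\<lambda>x. a * \<phi> x + b * \<psi> x) \<in> test_functions \<Omega>"
proof -
  obtain K where K: "smooth \<phi>" "compact K" "K \<subseteq> \<Omega>" "\<And>x. x \<notin> K \<Longrightarrow> \<phi> x = 0"
    by (rule test_functionsE[OF assms(1)]) blast
  obtain L where L: "smooth \<psi>" "compact L" "L \<subseteq> \<Omega>" "\<And>x. x \<notin> L \<Longrightarrow> \<psi> x = 0"
    by (rule test_functionsE[OF assms(2)]) blast
  show ?thesis
    using K L by (intro test_functionsI[of _ "K \<union> L"] smooth_add smooth_cmult) auto
qed

lemma test_functions_mult:
  assumes "\<phi> \<in> test_functions \<Omega>" "smooth f"
  shows "(\<lambda>x. f x * \<phi> x) \<in> test_functions \<Omega>"
proof -
  obtain K where K: "smooth \<phi>" "compact K" "K \<subseteq> \<Omega>" "\<And>x. x \<notin> K \<Longrightarrow> \<phi> x = 0"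
    by (rule test_functionsE[OF assms(1)]) blast
  then show ?thesis using assms(2)
    by (intro test_functionsI[of _ K] smooth_mult) auto
qed

lemma test_functions_bounded:
  assumes "\<phi> \<in> test_functions \<Omega>"
  obtains B where "B > 0" "\<And>x. \<bar>\<phi> x\<bar> \<le> B"
proof -
  obtain K where K: "smooth \<phi>" "compact K" "K \<subseteq> \<Omega>" "\<And>x. x \<notin> K \<Longrightarrow> \<phi> x = 0"
    by (rule test_functionsE[OF assms(1)]) blast
  have "bounded (\<phi> ` K)"
    using K by (intro compact_imp_bounded compact_continuous_image smooth_continuous)
  then obtain B where B: "B > 0" "\<forall>y\<in>\<phi> ` K. norm y \<le> B" unfolding bounded_pos by blast
  have "\<bar>\<phi> x\<bar> \<le> B" for x using B K(4)[of x] by (cases "x \<in> K") auto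
  with B(1) show ?thesis using that by blast
qed

lemma test_functions_support_bounded:
  assumes "\<phi> \<in> test_functions \<Omega>"
  obtains R where "R > 0" "\<And>x. norm x \<ge> R \<Longrightarrow> \<phi> x = 0"
proof -
  obtain K where K: "smooth \<phi>" "compact K" "K \<subseteq> \<Omega>" "\<And>x. x \<notin> K \<Longrightarrow> \<phi> x = 0"
    by (rule test_functionsE[OF assms(1)]) blast
  then obtain R where R: "R > 0" "\<And>x. x \<in> K \<Longrightarrow> norm x \<le> R"
    using compact_imp_bounded bounded_pos by metis
  have "\<phi> x = 0" if "norm x \<ge> R + 1" for x using that R(2)[of x] K(4)[of x] by fastforce
  then show ?thesis using that[of "R + 1"] R(1) by auto
qed

lemma smooth_borel: "smooth f \<Longrightarrow> f \<in> borel_measurable borel"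
  by (rule borel_measurable_continuous_onI[OF smooth_continuous])

lemma integrable_cont_compact_support:
  fixes f :: "'a::euclidean_space \<Rightarrow> 'b::euclidean_space"
  assumes "continuous_on UNIV f" "compact K" "\<And>x. x \<notin> K \<Longrightarrow> f x = 0"
  shows "integrable lborel f"
proof -
  have "integrable lborel (\<lambda>x. indicator K x *\<^sub>R f x)"
    using assms by (intro borel_integrable_compact continuous_on_subset[OF assms(1)]) auto
  moreover have "(\<lambda>x. indicator K x *\<^sub>R f x) = f"
    using assms(3) by (auto simp: indicator_def)
  ultimately show ?thesis by simp
qed

lemma test_functions_integrable: "\<phi> \<in> test_functions \<Omega> \<Longrightarrow> integrable lborel \<phi>"
  by (erule test_functionsE) (auto intro: integrable_cont_compact_support smooth_continuous)

lemma grad_continuous: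
  assumes "smooth f"
  shows "continuous_on S (grad f)"
proof -
  have "grad f = (\<lambda>x. \<Sum>i\<in>Basis. dd i f x *\<^sub>R i)"
    using assms by (auto simp: grad_eq smooth_differentiable)
  then show ?thesis
    using smooth_continuous[OF smooth_dd[OF assms]] by (auto intro!: continuous_intros)
qed

lemma grad_borel: "smooth f \<Longrightarrow> grad f \<in> borel_measurable borel"
  by (rule borel_measurable_continuous_onI[OF grad_continuous])

lemma grad_zero_off:
  assumes "smooth f" "closed K" "\<And>y. y \<notin> K \<Longrightarrow> f y = 0" "x \<notin> K"
  shows "grad f x = 0"
  using assms by (simp add: grad_eq smooth_differentiable dd_zero_off)

lemma test_functions_grad_integrable: "\<phi> \<in> test_functions \<Omega> \<Longrightarrow> integrable lborel (grad \<phi>)"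
  by (erule test_functionsE, rule integrable_cont_compact_support)
    (auto intro: grad_continuous grad_zero_off compact_imp_closed)

lemma smooth_line_deriv:
  assumes "smooth (f :: 'a::euclidean_space \<Rightarrow> real)"
  shows "((\<lambda>t. f (x + t *\<^sub>R v)) has_real_derivative dd v f (x + t *\<^sub>R v)) (at t)"
proof -
  have 1: "((\<lambda>t. x + t *\<^sub>R v) has_derivative (\<lambda>s. s *\<^sub>R v)) (at t)"
    by (auto intro!: derivative_eq_intros)
  have "((\<lambda>t. f (x + t *\<^sub>R v)) has_derivative (\<lambda>s. dd (s *\<^sub>R v) f (x + t *\<^sub>R v))) (at t)"
    using has_derivative_compose[OF 1 smooth_has_derivative[OF assms]] by simp
  then show ?thesis
    unfolding has_field_derivative_def
    by (simp add: linear_scale[OF dd_linear[OF assms]] mult_commute_abs)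
qed

lemma integral_translate:
  fixes f :: "'a::euclidean_space \<Rightarrow> 'b::euclidean_space"
  shows "(\<integral>x. f (x + a) \<partial>lborel) = (\<integral>x. f x \<partial>lborel)"
    and integrable_translate: "integrable lborel (\<lambda>x. f (x + a)) \<longleftrightarrow> integrable lborel f"
proof -
  have m: "(\<lambda>x::'a. a + x) \<in> lborel \<rightarrow>\<^sub>M lborel" by simp
  have *: "distr lborel lborel ((+) a) = lborel"
    using lborel_distr_plus[of a] by (simp cong: distr_cong)
  have 1: "integrable lborel (\<lambda>x. f (x + a))" if "integrable lborel f" for f :: "'a \<Rightarrow> 'b" and a
  proof -
    have "distr lborel lborel ((+) a) = lborel"
      using lborel_distr_plus[of a] by (simp cong: distr_cong)
    then show ?thesis
      using that integrable_distr[of "(+) a" lborel lborel f] by (simp add: add.commute)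
  qed
  show 2: "integrable lborel (\<lambda>x. f (x + a)) \<longleftrightarrow> integrable lborel f"
    using 1[of f a] 1[of "\<lambda>x. f (x + a)" "- a"] by auto
  show "(\<integral>x. f (x + a) \<partial>lborel) = (\<integral>x. f x \<partial>lborel)"
  proof (cases "integrable lborel f")
    case True
    then have f: "f \<in> borel_measurable lborel" by simp
    have "(\<integral>x. f x \<partial>distr lborel lborel ((+) a)) = (\<integral>x. f (a + x) \<partial>lborel)"
      by (rule integral_distr[OF m f])
    then show ?thesis by (simp add: * add.commute)
  next
    case False
    \<comment> \<open>Neither function is integrable, so both integrals have the default value
      0.\<close>
    then show ?thesis using 2 by (simp add: not_integrable_integral_eq)
  qed
qed

text \<open>Translation invariance makes the integral of every difference quotient zero. The mean
  value theorem bounds the quotients by the supremum of \<open>dd v \<phi>\<close>, and steps of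
  size at most 1 keep their supports in one ball, so dominated convergence passes to the
  derivative.\<close>

lemma integral_dd_eq_0:
  assumes "\<phi> \<in> test_functions UNIV"
  shows "(\<integral>x. dd v \<phi> x \<partial>lborel) = 0"
proof -
  have sm: "smooth \<phi>" using assms by (rule test_functions_smooth)
  obtain B where B: "B > 0" "\<And>x. \<bar>dd v \<phi> x\<bar> \<le> B"
    using test_functions_bounded[OF test_functions_dd[OF assms, of v]] by blast
  obtain R where R: "R > 0" "\<And>x. norm x \<ge> R \<Longrightarrow> \<phi> x = 0"
    using test_functions_support_bounded[OF assms] by blast
  define s where "s n = inverse (real (Suc n))" for n
  define F where "F n x = (\<phi> (x + s n *\<^sub>R v) - \<phi> x) / s n" for n x
  have s: "s n > 0" "s n \<le> 1" "s \<longlonglongrightarrow> 0" for n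
    using LIMSEQ_inverse_real_of_nat by (auto simp: s_def[abs_def] inverse_eq_divide)
  have int: "integrable lborel \<phi>" by (rule test_functions_integrable[OF assms])
  have F0: "(\<integral>x. F n x \<partial>lborel) = 0" for n
    using int by (simp add: F_def integral_translate integrable_translate Bochner_Integration.integral_diff)
  have "(\<lambda>n. \<integral>x. F n x \<partial>lborel) \<longlonglongrightarrow> (\<integral>x. dd v \<phi> x \<partial>lborel)"
  proof (rule integral_dominated_convergence)
    show "integrable lborel (\<lambda>x. indicator (cball 0 (R + norm v)) x *\<^sub>R B)"
      by (rule borel_integrable_compact) auto
    show "dd v \<phi> \<in> borel_measurable lborel" using sm by (simp add: smooth_borel smooth_dd)
    show "F n \<in> borel_measurable lborel" for n
    proof -
      have "continuous_on UNIV (F n)" unfolding F_def using s(1)[of n]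
        by (intro continuous_intros continuous_on_compose2[OF smooth_continuous[OF sm, of UNIV]]
              smooth_continuous[OF sm]) auto
      then show ?thesis by (simp add: borel_measurable_continuous_onI)
    qed
    show "AE x in lborel. (\<lambda>n. F n x) \<longlonglongrightarrow> dd v \<phi> x"
    proof (rule AE_I2)
      fix x
      have "((\<lambda>t. (\<phi> (x + t *\<^sub>R v) - \<phi> x) / t) \<longlongrightarrow> dd v \<phi> x) (at 0)"
        using smooth_line_deriv[OF sm, of x v 0] by (simp add: DERIV_def)
      moreover have "filterlim s (at 0) sequentially"
        using s(1,3) by (auto simp: filterlim_at intro!: always_eventually) (metis less_irrefl)
      ultimately show "(\<lambda>n. F n x) \<longlonglongrightarrow> dd v \<phi> x"
        unfolding F_def by (rule filterlim_compose)
    qed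
    show "AE x in lborel. norm (F n x) \<le> indicator (cball 0 (R + norm v)) x *\<^sub>R B" for n
    proof (rule AE_I2)
      fix x
      show "norm (F n x) \<le> indicator (cball 0 (R + norm v)) x *\<^sub>R B"
      proof (cases "norm x \<le> R + norm v")
        case True
        obtain z where "\<phi> (x + s n *\<^sub>R v) - \<phi> (x + 0 *\<^sub>R v) = (s n - 0) * dd v \<phi> (x + z *\<^sub>R v)"
          using MVT2[of 0 "s n", OF s(1) smooth_line_deriv[OF sm]] by blast
        then have "F n x = dd v \<phi> (x + z *\<^sub>R v)" using s(1)[of n] by (simp add: F_def)
        then show ?thesis using True B(2) by (simp add: indicator_def)
      next
        case False
        have "norm x - norm (s n *\<^sub>R v) \<le> norm (x + s n *\<^sub>R v)"
          by (metis add_diff_cancel_right' norm_diff_triangle_ineq norm_triangle_ineq4 diff_le_eq)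
        moreover have "norm (s n *\<^sub>R v) \<le> norm v"
          using s(1,2)[of n] by (simp add: mult_left_le_one_le)
        ultimately have "\<phi> (x + s n *\<^sub>R v) = 0" "\<phi> x = 0"
          using False R norm_ge_zero[of v] by (auto intro!: R(2) simp del: norm_ge_zero)
        then show ?thesis using False by (simp add: F_def)
      qed
    qed
  qed
  then show ?thesis by (simp add: F0 LIMSEQ_const_iff)
qed

lemma integral_by_parts:
  assumes "\<phi> \<in> test_functions UNIV" "smooth f"
  shows "(\<integral>x. f x * dd v \<phi> x \<partial>lborel) = - (\<integral>x. dd v f x * \<phi> x \<partial>lborel)"
proof -
  have 1: "(\<lambda>x. f x * \<phi> x) \<in> test_functions UNIV" by (rule test_functions_mult[OF assms])
  have 2: "integrable lborel (\<lambda>x. f x * dd v \<phi> x)" "integrable lborel (\<lambda>x. dd v f x * \<phi> x)"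
    using assms by (auto intro!: test_functions_integrable[of _ UNIV] test_functions_mult test_functions_dd smooth_dd)
  have "dd v (\<lambda>x. f x * \<phi> x) = (\<lambda>x. f x * dd v \<phi> x + dd v f x * \<phi> x)"
    using assms(2) test_functions_smooth[OF assms(1)] by (auto simp: dd_mult smooth_differentiable)
  then show ?thesis using integral_dd_eq_0[OF 1, of v] 2 by simp
qed

section \<open>Weak gradients and weak solutions\<close>

lemma borel_imp_lebesgue [simp]:
  "f \<in> borel_measurable borel \<Longrightarrow> f \<in> borel_measurable lebesgue"
  by (rule measurable_completion) simp

text \<open>The problem is posed on \<open>lebesgue_on \<Omega>\<close>, but translation, Fubini and
  convolution are used on \<open>lborel\<close>. Borel functions extended by zero move freely
  between the two.\<close>

lemma integral_lebesgue_on_eq: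
  fixes f :: "'a::euclidean_space \<Rightarrow> 'b::euclidean_space"
  assumes "\<Omega> \<in> sets lebesgue" "f \<in> borel_measurable borel" "\<And>x. x \<notin> \<Omega> \<Longrightarrow> f x = 0"
  shows "(LINT x|lebesgue_on \<Omega>. f x) = (\<integral>x. f x \<partial>lborel)"
    and integrable_lebesgue_on_eq: "integrable (lebesgue_on \<Omega>) f \<longleftrightarrow> integrable lborel f"
proof -
  have *: "(\<lambda>x. indicator \<Omega> x *\<^sub>R f x) = f" using assms(3) by (auto simp: indicator_def)
  show "(LINT x|lebesgue_on \<Omega>. f x) = (\<integral>x. f x \<partial>lborel)"
    using assms by (simp add: integral_restrict_space * integral_completion)
  show "integrable (lebesgue_on \<Omega>) f \<longleftrightarrow> integrable lborel f"
    using assms by (simp add: integrable_restrict_space * integrable_completion)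
qed

text \<open>Products of one-dimensional steps that steepen with n. As \<open>smooth_step\<close>
  vanishes up to 1 and equals 1 from 2 on, the n-th product vanishes outside the open box and equals
  1 at points whose distance to every face is at least 2/n.\<close>

lemma box_indicator_limit:
  fixes a b :: "'a::euclidean_space"
  assumes "cbox a b \<subseteq> \<Omega>"
  obtains \<xi> where "\<And>n. \<xi> n \<in> test_functions \<Omega>" "\<And>n x. 0 \<le> \<xi> n x \<and> \<xi> n x \<le> 1"
    "\<And>n x. x \<notin> cbox a b \<Longrightarrow> \<xi> n x = 0"
    "\<And>x. (\<lambda>n::nat. \<xi> n x) \<longlonglongrightarrow> indicator (box a b) x"
proof -
  define \<xi> where "\<xi> n x = (\<Prod>i\<in>Basis. smooth_step (real n * (x \<bullet> i - a \<bullet> i)) *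
    smooth_step (real n * (b \<bullet> i - x \<bullet> i)))" for n and x :: 'a
  have sm: "smooth (\<xi> n)" for n
  proof -
    have l: "smooth (\<lambda>x::'a. x \<bullet> i)" for i
      by (intro smooth_linear bounded_linear_inner_left)
    have "smooth (\<lambda>x::'a. smooth_step (real n * (x \<bullet> i - a \<bullet> i)))"
         "smooth (\<lambda>x::'a. smooth_step (real n * (b \<bullet> i - x \<bullet> i)))" for i
      by (intro smooth_compose[OF _ smooth_smooth_step] smooth_cmult smooth_diff l smooth_const)+
    then show ?thesis unfolding \<xi>_def by (intro smooth_prod smooth_mult) auto
  qed
  have zero: "\<xi> n x = 0" if "x \<notin> box a b" for n x
  proof -
    have "\<exists>i\<in>Basis. x \<bullet> i - a \<bullet> i \<le> 0 \<or> b \<bullet> i - x \<bullet> i \<le> 0"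
      using that by (force simp: mem_box not_less)
    then obtain i where i: "i \<in> Basis" "x \<bullet> i - a \<bullet> i \<le> 0 \<or> b \<bullet> i - x \<bullet> i \<le> 0"
      by blast
    then have "real n * (x \<bullet> i - a \<bullet> i) \<le> 1 \<or> real n * (b \<bullet> i - x \<bullet> i) \<le> 1"
      by (metis mult_nonneg_nonpos of_nat_0_le_iff order_trans zero_le_one)
    then show ?thesis
      using i(1) smooth_step_zero by (auto simp: \<xi>_def intro!: prod_zero)
  qed
  have zero': "\<xi> n x = 0" if "x \<notin> cbox a b" for n x
    using zero that box_subset_cbox by blast
  show ?thesis
  proof (rule that[of \<xi>])
    show "\<xi> n \<in> test_functions \<Omega>" for n
      by (rule test_functionsI[OF sm compact_cbox assms zero'])
    show "0 \<le> \<xi> n x \<and> \<xi> n x \<le> 1" for n x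
      unfolding \<xi>_def using smooth_step_nonneg smooth_step_le_1
      by (auto intro!: prod_nonneg prod_le_1 mult_nonneg_nonneg mult_le_one)
    show "(\<lambda>n. \<xi> n x) \<longlonglongrightarrow> indicator (box a b) x" for x
    proof (cases "x \<in> box a b")
      case False
      then show ?thesis by (simp add: zero)
    next
      case True
      define d where "d = Min ((\<lambda>i. min (x \<bullet> i - a \<bullet> i) (b \<bullet> i - x \<bullet> i)) ` Basis)"
      have d: "d > 0" unfolding d_def using True by (subst Min_gr_iff) (auto simp: mem_box)
      have dle: "d \<le> x \<bullet> i - a \<bullet> i" "d \<le> b \<bullet> i - x \<bullet> i" if "i \<in> Basis" for i
      proof -
        have "d \<le> min (x \<bullet> i - a \<bullet> i) (b \<bullet> i - x \<bullet> i)"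
          unfolding d_def using that by (intro Min_le) auto
        then show "d \<le> x \<bullet> i - a \<bullet> i" "d \<le> b \<bullet> i - x \<bullet> i" by auto
      qed
      have "\<forall>\<^sub>F n in sequentially. \<xi> n x = 1"
        using eventually_ge_at_top[of "nat \<lceil>2 / d\<rceil>"]
      proof eventually_elim
        case (elim n)
        then have "2 / d \<le> real n" by linarith
        then have n: "2 \<le> real n * d" using d by (simp add: field_simps)
        have "2 \<le> real n * (x \<bullet> i - a \<bullet> i)" "2 \<le> real n * (b \<bullet> i - x \<bullet> i)" if "i \<in> Basis" for i
          using mult_left_mono[OF dle(1)[OF that], of "real n"]
            mult_left_mono[OF dle(2)[OF that], of "real n"] n by auto
        then show ?case by (simp add: \<xi>_def smooth_step_one)
      qed
      then show ?thesis using True by (auto intro: tendsto_eventually)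
    qed
  qed (use zero' in auto)
qed

lemma locally_integrableD:
  "locally_integrable \<Omega> G \<Longrightarrow> compact K \<Longrightarrow> K \<subseteq> \<Omega> \<Longrightarrow> integrable lebesgue (\<lambda>x. indicator K x *\<^sub>R G x)"
  unfolding locally_integrable_def
  using integrable_restrict_space[of K lebesgue G] by (auto simp: lmeasurable_compact fmeasurableD)

lemma locally_integrable_test:
  fixes G :: "'a::euclidean_space \<Rightarrow> 'b::euclidean_space"
  assumes "locally_integrable \<Omega> G" "\<phi> \<in> test_functions \<Omega>" "\<Omega> \<in> sets lebesgue"
  shows "integrable (lebesgue_on \<Omega>) (\<lambda>x. \<phi> x *\<^sub>R G x)"
proof -
  obtain K where K: "smooth \<phi>" "compact K" "K \<subseteq> \<Omega>" "\<And>x. x \<notin> K \<Longrightarrow> \<phi> x = 0"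
    by (rule test_functionsE[OF assms(2)]) blast
  obtain B where B: "B > 0" "\<And>x. \<bar>\<phi> x\<bar> \<le> B"
    using test_functions_bounded[OF assms(2)] by blast
  have 1: "integrable lebesgue (\<lambda>x. indicator K x *\<^sub>R G x)"
    by (rule locally_integrableD[OF assms(1) K(2,3)])
  have "integrable lebesgue (\<lambda>x. \<phi> x *\<^sub>R (indicator K x *\<^sub>R G x))"
  proof (rule Bochner_Integration.integrable_bound)
    show "integrable lebesgue (\<lambda>x. B *\<^sub>R norm (indicator K x *\<^sub>R G x))"
      using 1 by (intro integrable_scaleR_right integrable_norm)
    show "(\<lambda>x. \<phi> x *\<^sub>R (indicator K x *\<^sub>R G x)) \<in> borel_measurable lebesgue"
      using borel_measurable_integrable[OF 1] borel_imp_lebesgue[OF smooth_borel[OF K(1)]]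
      by (rule borel_measurable_scaleR[rotated])
    show "AE x in lebesgue. norm (\<phi> x *\<^sub>R (indicator K x *\<^sub>R G x)) \<le> norm (B *\<^sub>R norm (indicator K x *\<^sub>R G x))"
      using B by (intro AE_I2) (simp add: norm_scaleR[of "\<phi> _"] mult_right_mono del: scaleR_scaleR)
  qed
  moreover have "(\<lambda>x. indicator \<Omega> x *\<^sub>R (\<phi> x *\<^sub>R G x)) = (\<lambda>x. \<phi> x *\<^sub>R (indicator K x *\<^sub>R G x))"
    using K(3,4) by (intro ext) (auto simp: indicator_def)
  ultimately show ?thesis using assms(3) by (simp add: integrable_restrict_space)
qed

lemma sigma_finite_lebesgue: "sigma_finite_measure (lebesgue :: 'a::euclidean_space measure)"
proof
  obtain A :: "'a set set" where "countable A" "A \<subseteq> sets lborel" "\<Union>A = space lborel"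
    "\<And>a. a \<in> A \<Longrightarrow> emeasure lborel a \<noteq> \<infinity>"
    using lborel.sigma_finite_countable by metis
  then show "\<exists>A. countable A \<and> A \<subseteq> sets lebesgue \<and> \<Union>A = space lebesgue \<and>
      (\<forall>a\<in>A. emeasure (lebesgue :: 'a measure) a \<noteq> \<infinity>)"
    by (intro exI[of _ A]) (auto simp: subset_eq)
qed

text \<open>A pi-lambda argument: open boxes are stable under intersection and generate the Borel
  sets. The hypothesis on the total integral serves the complement step. A Lebesgue set differs from
  a Borel set by a null set.\<close>

lemma AE_zero_if_box_integrals_zero:
  fixes g :: "'a::euclidean_space \<Rightarrow> 'b::euclidean_space"
  assumes g: "integrable lebesgue g" "(\<integral>x. g x \<partial>lebesgue) = 0"
    and box: "\<And>c d. (\<integral>x. indicator (box c d) x *\<^sub>R g x \<partial>lebesgue) = 0"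
  shows "AE x in lebesgue. g x = 0"
proof (rule sigma_finite_measure.density_zero[OF sigma_finite_lebesgue g(1)])
  have ig: "integrable lebesgue (\<lambda>x. indicator A x *\<^sub>R g x)" if "A \<in> sets lebesgue" for A
    by (rule integrable_mult_indicator[OF that g(1)])
  have borel: "(\<integral>x. indicator A x *\<^sub>R g x \<partial>lebesgue) = 0" if "A \<in> sets borel" for A
  proof -
    have "A \<in> sigma_sets UNIV (range (\<lambda>(a, b). box a b))"
      using that by (simp add: borel_eq_box sets_measure_of_conv)
    then show ?thesis
    proof (rule sigma_sets_induct_disjoint[rotated 2])
      show "Int_stable (range (\<lambda>(a, b). box a b :: 'a set))"
        by (auto simp: Int_stable_def box_Int_box)
      show "range (\<lambda>(a, b). box a b :: 'a set) \<subseteq> Pow UNIV" by simp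
    next
      fix A :: "'a set" assume "A \<in> range (\<lambda>(a, b). box a b)"
      then show "(\<integral>x. indicator A x *\<^sub>R g x \<partial>lebesgue) = 0" using box by auto
    next
      show "(\<integral>x. indicator {} x *\<^sub>R g x \<partial>lebesgue) = 0" by simp
    next
      fix A :: "'a set" assume A: "A \<in> sigma_sets UNIV (range (\<lambda>(a, b). box a b))"
        and IH: "(\<integral>x. indicator A x *\<^sub>R g x \<partial>lebesgue) = 0"
      have "A \<in> sets lebesgue" using A by (simp add: borel_eq_box sets_measure_of_conv)
      have "(\<integral>x. indicator (UNIV - A) x *\<^sub>R g x \<partial>lebesgue)
          = (\<integral>x. g x - indicator A x *\<^sub>R g x \<partial>lebesgue)"
        by (rule Bochner_Integration.integral_cong) (auto simp: indicator_def)
      also have "\<dots> = 0" using ig[OF \<open>A \<in> sets lebesgue\<close>] g IH by simp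
      finally show "(\<integral>x. indicator (UNIV - A) x *\<^sub>R g x \<partial>lebesgue) = 0" .
    next
      fix A :: "nat \<Rightarrow> 'a set" assume d: "disjoint_family A"
        and A: "range A \<subseteq> sigma_sets UNIV (range (\<lambda>(a, b). box a b))"
        and IH: "\<And>i. (\<integral>x. indicator (A i) x *\<^sub>R g x \<partial>lebesgue) = 0"
      have Am: "A i \<in> sets lebesgue" for i using subsetD[OF A, of "A i"] by (simp add: borel_eq_box sets_measure_of_conv)
      have "(LINT x:(\<Union>i. A i)|lebesgue. g x) = (\<Sum>i. (LINT x:(A i)|lebesgue. g x))"
        by (rule lebesgue_integral_countable_add)
          (use Am d ig in \<open>auto simp: disjoint_family_on_def set_integrable_def\<close>)
      then show "(\<integral>x. indicator (\<Union>i. A i) x *\<^sub>R g x \<partial>lebesgue) = 0"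
        by (simp add: set_lebesgue_integral_def IH)
    qed
  qed
  fix A :: "'a set" assume "A \<in> sets lebesgue"
  then obtain S N N' where A: "A = S \<union> N" "N \<subseteq> N'" "N' \<in> null_sets lborel" "S \<in> sets lborel"
    by (rule sets_completionE)
  have "AE x in lebesgue. x \<notin> N'"
    by (rule AE_not_in) (use A in \<open>auto intro: null_sets_completionI\<close>)
  then have "AE x in lebesgue. indicator A x *\<^sub>R g x = indicator S x *\<^sub>R g x"
    by (rule AE_mp) (use A in \<open>auto intro!: AE_I2 simp: indicator_def\<close>)
  then have "(\<integral>x. indicator A x *\<^sub>R g x \<partial>lebesgue) = (\<integral>x. indicator S x *\<^sub>R g x \<partial>lebesgue)"
    using ig[OF \<open>A \<in> sets lebesgue\<close>] ig[of S] A(4) by (intro integral_cong_AE) auto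
  then show "set_lebesgue_integral lebesgue A g = 0"
    using borel A(4) by (simp add: set_lebesgue_integral_def)
qed

text \<open>The fundamental lemma of the calculus of variations. Test functions converging to
  indicators of boxes show that box integrals vanish; on each closed box in \<Omega> these determine
  the function almost everywhere, and countably many boxes cover \<Omega>.\<close>

lemma AE_zero_of_test_integrals:
  fixes G :: "'a::euclidean_space \<Rightarrow> 'b::euclidean_space"
  assumes "open \<Omega>" "locally_integrable \<Omega> G"
    and test: "\<And>\<phi>. \<phi> \<in> test_functions \<Omega> \<Longrightarrow> (LINT x|lebesgue_on \<Omega>. \<phi> x *\<^sub>R G x) = 0"
  shows "AE x in lebesgue_on \<Omega>. G x = 0"
proof -
  have \<Omega>: "\<Omega> \<in> sets lebesgue" using assms(1) by simp
  have box0: "(\<integral>x. indicator (box a b) x *\<^sub>R G x \<partial>lebesgue) = 0" if ab: "cbox a b \<subseteq> \<Omega>" for a b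
  proof -
    obtain \<xi> where \<xi>: "\<And>n. \<xi> n \<in> test_functions \<Omega>" "\<And>n x. 0 \<le> \<xi> n x \<and> \<xi> n x \<le> 1"
      "\<And>n x. x \<notin> cbox a b \<Longrightarrow> \<xi> n x = 0"
      "\<And>x. (\<lambda>n::nat. \<xi> n x) \<longlonglongrightarrow> indicator (box a b) x"
      using box_indicator_limit[OF ab] by blast
    have i: "integrable lebesgue (\<lambda>x. indicator (cbox a b) x *\<^sub>R G x)"
      by (rule locally_integrableD[OF assms(2) compact_cbox ab])
    have eq: "(\<lambda>x. \<xi> n x *\<^sub>R (indicator (cbox a b) x *\<^sub>R G x)) = (\<lambda>x. indicator \<Omega> x *\<^sub>R (\<xi> n x *\<^sub>R G x))" for n
      using \<xi>(3) ab by (intro ext) (auto simp: indicator_def)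
    have eq': "(\<lambda>x. indicator (box a b) x *\<^sub>R (indicator (cbox a b) x *\<^sub>R G x)) = (\<lambda>x. indicator (box a b) x *\<^sub>R G x)"
      using box_subset_cbox by (intro ext) (auto simp: indicator_def)
    have "(\<lambda>n. \<integral>x. \<xi> n x *\<^sub>R (indicator (cbox a b) x *\<^sub>R G x) \<partial>lebesgue)
        \<longlonglongrightarrow> (\<integral>x. indicator (box a b) x *\<^sub>R (indicator (cbox a b) x *\<^sub>R G x) \<partial>lebesgue)"
    proof (rule integral_dominated_convergence)
      show "integrable lebesgue (\<lambda>x. norm (indicator (cbox a b) x *\<^sub>R G x))"
        by (rule integrable_norm[OF i])
      show "(\<lambda>x. indicator (box a b) x *\<^sub>R (indicator (cbox a b) x *\<^sub>R G x)) \<in> borel_measurable lebesgue"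
        by (rule borel_measurable_scaleR[OF _ borel_measurable_integrable[OF i]]) simp
      show "(\<lambda>x. \<xi> n x *\<^sub>R (indicator (cbox a b) x *\<^sub>R G x)) \<in> borel_measurable lebesgue" for n
        using borel_imp_lebesgue[OF smooth_borel[OF test_functions_smooth[OF \<xi>(1)]]]
          borel_measurable_integrable[OF i] by (rule borel_measurable_scaleR)
      show "AE x in lebesgue. (\<lambda>n. \<xi> n x *\<^sub>R (indicator (cbox a b) x *\<^sub>R G x))
          \<longlonglongrightarrow> indicator (box a b) x *\<^sub>R (indicator (cbox a b) x *\<^sub>R G x)"
        by (intro AE_I2 tendsto_scaleR \<xi> tendsto_const)
      show "AE x in lebesgue. norm (\<xi> n x *\<^sub>R (indicator (cbox a b) x *\<^sub>R G x))
          \<le> norm (indicator (cbox a b) x *\<^sub>R G x)" for n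
        using \<xi>(2)[of n] by (intro AE_I2, subst norm_scaleR, intro mult_left_le_one_le) auto
    qed
    moreover have "(\<integral>x. \<xi> n x *\<^sub>R (indicator (cbox a b) x *\<^sub>R G x) \<partial>lebesgue) = 0" for n
      unfolding eq using test[OF \<xi>(1)[of n]] \<Omega> by (simp add: integral_restrict_space)
    ultimately show ?thesis unfolding eq' by (simp add: LIMSEQ_const_iff)
  qed
  have cb: "AE x in lebesgue. x \<in> cbox a b \<longrightarrow> G x = 0" if ab: "cbox a b \<subseteq> \<Omega>" for a b
  proof -
    have i: "integrable lebesgue (\<lambda>x. indicator (box a b) x *\<^sub>R G x)"
    proof -
      have "integrable lebesgue (\<lambda>x. indicator (box a b) x *\<^sub>R (indicator (cbox a b) x *\<^sub>R G x))"
        by (intro integrable_mult_indicator locally_integrableD[OF assms(2) compact_cbox ab]) auto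
      moreover have "(\<lambda>x. indicator (box a b) x *\<^sub>R (indicator (cbox a b) x *\<^sub>R G x)) = (\<lambda>x. indicator (box a b) x *\<^sub>R G x)"
        using box_subset_cbox by (intro ext) (auto simp: indicator_def)
      ultimately show ?thesis by simp
    qed
    have "AE x in lebesgue. indicator (box a b) x *\<^sub>R G x = 0"
    proof (rule AE_zero_if_box_integrals_zero[OF i box0[OF ab]])
      fix c d :: 'a
      \<comment> \<open>Only boxes whose closure lies in \<Omega> are known to have integral zero. A
        nonempty intersection with \<open>box a b\<close> is such a box, its closure being contained
        in \<open>cbox a b\<close>.\<close>
      obtain e f where ef: "box c d \<inter> box a b = box e f" using box_Int_box by blast
      have "cbox e f \<subseteq> \<Omega> \<or> box e f = {}"
      proof (cases "box e f = {}")
        case False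
        then have "closure (box e f) = cbox e f" by (rule closure_box)
        moreover have "closure (box e f) \<subseteq> cbox a b"
          by (rule closure_minimal) (use ef box_subset_cbox in auto)
        ultimately show ?thesis using ab by auto
      qed auto
      then have "(\<integral>x. indicator (box e f) x *\<^sub>R G x \<partial>lebesgue) = 0" using box0 by auto
      moreover have "(\<lambda>x. indicator (box c d) x *\<^sub>R (indicator (box a b) x *\<^sub>R G x)) = (\<lambda>x. indicator (box e f) x *\<^sub>R G x)"
        unfolding ef[symmetric] by (intro ext) (auto simp: indicator_def)
      ultimately show "(\<integral>x. indicator (box c d) x *\<^sub>R (indicator (box a b) x *\<^sub>R G x) \<partial>lebesgue) = 0" by simp
    qed
    moreover have "AE x in lebesgue. x \<notin> cbox a b - box a b"
      by (rule AE_not_in) (simp add: negligible_frontier_interval flip: negligible_iff_null_sets)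
    ultimately show ?thesis by eventually_elim (auto simp: indicator_def split: if_splits)
  qed
  obtain D where D: "countable D" "D \<subseteq> Pow \<Omega>" "\<And>X. X \<in> D \<Longrightarrow> \<exists>a b. X = cbox a b" "\<Union>D = \<Omega>"
    using open_countable_Union_open_cbox[OF assms(1)] by metis
  have "AE x in lebesgue. \<forall>X\<in>D. x \<in> X \<longrightarrow> G x = 0"
  proof (rule AE_ball_countable')
    fix X assume "X \<in> D"
    then obtain a b where "X = cbox a b" "cbox a b \<subseteq> \<Omega>" using D by blast
    then show "AE x in lebesgue. x \<in> X \<longrightarrow> G x = 0" using cb by simp
  qed (rule D(1))
  then have "AE x in lebesgue. x \<in> \<Omega> \<longrightarrow> G x = 0"
    by eventually_elim (use D(4) in blast)
  then show ?thesis using \<Omega> by (simp add: AE_restrict_space_iff)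
qed

text \<open>Local integrability speaks of compact subsets only; measurability on \<Omega> is glued
  from countably many closed boxes.\<close>

lemma locally_integrable_measurable:
  fixes G :: "'a::euclidean_space \<Rightarrow> 'b::euclidean_space"
  assumes "open \<Omega>" "locally_integrable \<Omega> G"
  shows "G \<in> borel_measurable (lebesgue_on \<Omega>)"
proof -
  obtain D where D: "countable D" "D \<subseteq> Pow \<Omega>" "\<And>X. X \<in> D \<Longrightarrow> \<exists>a b. X = cbox a b" "\<Union>D = \<Omega>"
    using open_countable_Union_open_cbox[OF assms(1)] by metis
  show ?thesis
  proof (rule measurable_piecewise_restrict[OF D(1)])
    show "space (lebesgue_on \<Omega>) \<subseteq> \<Union>D" using D(4) by simp
    fix X assume X: "X \<in> D"
    then obtain a b where ab: "X = cbox a b" "cbox a b \<subseteq> \<Omega>" using D by blast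
    show "X \<inter> space (lebesgue_on \<Omega>) \<in> sets (lebesgue_on \<Omega>)"
      using ab assms(1) by (auto simp: sets_restrict_space_iff Int_absorb2)
    have "integrable (lebesgue_on (cbox a b)) G"
      using assms(2) ab unfolding locally_integrable_def by auto
    then have "G \<in> borel_measurable (lebesgue_on (cbox a b))" by simp
    moreover have "restrict_space (lebesgue_on \<Omega>) X = lebesgue_on (cbox a b)"
      using ab by (simp add: restrict_restrict_space assms(1) Int_absorb1)
    ultimately show "G \<in> borel_measurable (restrict_space (lebesgue_on \<Omega>) X)" by simp
  qed
qed

lemma has_weak_gradient_unique:
  assumes "open \<Omega>" "has_weak_gradient \<Omega> u G" "has_weak_gradient \<Omega> u H"
  shows "AE x in lebesgue_on \<Omega>. G x = H x"
proof -
  have \<Omega>: "\<Omega> \<in> sets lebesgue" using assms(1) by simp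
  have li: "locally_integrable \<Omega> G" "locally_integrable \<Omega> H"
    using assms by (auto simp: has_weak_gradient_def)
  have "AE x in lebesgue_on \<Omega>. G x - H x = 0"
  proof (rule AE_zero_of_test_integrals[OF assms(1)])
    show "locally_integrable \<Omega> (\<lambda>x. G x - H x)"
      using li by (auto simp: locally_integrable_def)
    fix \<phi> assume \<phi>: "\<phi> \<in> test_functions \<Omega>"
    have "(LINT x|lebesgue_on \<Omega>. \<phi> x *\<^sub>R G x) = (LINT x|lebesgue_on \<Omega>. \<phi> x *\<^sub>R H x)"
      using assms(2,3) \<phi> unfolding has_weak_gradient_def by (metis neg_equal_iff_equal)
    then show "(LINT x|lebesgue_on \<Omega>. \<phi> x *\<^sub>R (G x - H x)) = 0"
      using locally_integrable_test[OF li(1) \<phi> \<Omega>] locally_integrable_test[OF li(2) \<phi> \<Omega>]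
      by (simp add: scaleR_diff_right)
  qed
  then show ?thesis by simp
qed

text \<open>\<open>weak_gradient\<close> is an arbitrary choice. Uniqueness lets any explicit weak
  gradient replace it under integrals and norms.\<close>

lemma weak_gradient_AE_eq:
  assumes "open \<Omega>" "has_weak_gradient \<Omega> u G"
  shows "has_weak_gradient \<Omega> u (weak_gradient \<Omega> u)"
    and "AE x in lebesgue_on \<Omega>. weak_gradient \<Omega> u x = G x"
proof -
  show "has_weak_gradient \<Omega> u (weak_gradient \<Omega> u)"
    unfolding weak_gradient_def by (rule someI[of _ G]) (rule assms)
  then show "AE x in lebesgue_on \<Omega>. weak_gradient \<Omega> u x = G x"
    using assms has_weak_gradient_unique by blast
qed

lemma locally_integrable_continuous:
  assumes "continuous_on UNIV f"
  shows "locally_integrable \<Omega> f"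
  unfolding locally_integrable_def
proof (intro allI impI)
  fix K assume K: "compact K \<and> K \<subseteq> \<Omega>"
  have "integrable lborel (\<lambda>x. indicator K x *\<^sub>R f x)"
    using K by (intro borel_integrable_compact continuous_on_subset[OF assms]) auto
  then have "integrable lebesgue (\<lambda>x. indicator K x *\<^sub>R f x)"
    by (subst integrable_completion) auto
  then show "integrable (lebesgue_on K) f"
    using K by (simp add: integrable_restrict_space lmeasurable_compact fmeasurableD)
qed

lemma has_weak_gradient_smooth:
  assumes "smooth f" "\<Omega> \<in> sets lebesgue"
  shows "has_weak_gradient \<Omega> f (grad f)"
  unfolding has_weak_gradient_def
proof (intro conjI ballI)
  show "locally_integrable \<Omega> f" by (intro locally_integrable_continuous smooth_continuous assms)
  show "locally_integrable \<Omega> (grad f)" by (intro locally_integrable_continuous grad_continuous assms)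
  fix \<phi> assume \<phi>: "\<phi> \<in> test_functions \<Omega>"
  have \<phi>U: "\<phi> \<in> test_functions UNIV" using \<phi> test_functions_mono[of \<Omega> UNIV] by auto
  obtain K where K: "smooth \<phi>" "compact K" "K \<subseteq> \<Omega>" "\<And>x. x \<notin> K \<Longrightarrow> \<phi> x = 0"
    by (rule test_functionsE[OF \<phi>]) blast
  have gz: "grad \<phi> x = 0" if "x \<notin> \<Omega>" for x
    using that K by (intro grad_zero_off[OF K(1) compact_imp_closed[OF K(2)]]) auto
  have 1: "integrable lborel (\<lambda>x. f x *\<^sub>R grad \<phi> x)"
    using K by (intro integrable_cont_compact_support[of _ K] continuous_intros smooth_continuous
      grad_continuous assms) (auto simp: grad_zero_off[OF K(1) compact_imp_closed[OF K(2)]])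
  have 2: "integrable lborel (\<lambda>x. \<phi> x *\<^sub>R grad f x)"
    using K by (intro integrable_cont_compact_support[of _ K] continuous_intros smooth_continuous
      grad_continuous assms) auto
  have "(\<integral>x. f x *\<^sub>R grad \<phi> x \<partial>lborel) = - (\<integral>x. \<phi> x *\<^sub>R grad f x \<partial>lborel)"
  proof (rule euclidean_eqI)
    fix i :: 'a assume i: "i \<in> Basis"
    have "(\<integral>x. f x *\<^sub>R grad \<phi> x \<partial>lborel) \<bullet> i = (\<integral>x. f x * dd i \<phi> x \<partial>lborel)"
      using 1 K(1) by (simp add: grad_inner smooth_differentiable flip: integral_inner_left)
    also have "\<dots> = - (\<integral>x. dd i f x * \<phi> x \<partial>lborel)"
      by (rule integral_by_parts[OF \<phi>U assms(1)])
    also have "\<dots> = (- (\<integral>x. \<phi> x *\<^sub>R grad f x \<partial>lborel)) \<bullet> i"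
      using 2 assms(1)
      by (simp add: grad_inner smooth_differentiable mult.commute[of "\<phi> _"] flip: integral_inner_left)
    finally show "(\<integral>x. f x *\<^sub>R grad \<phi> x \<partial>lborel) \<bullet> i = (- (\<integral>x. \<phi> x *\<^sub>R grad f x \<partial>lborel)) \<bullet> i" .
  qed
  moreover have "(LINT x|lebesgue_on \<Omega>. f x *\<^sub>R grad \<phi> x) = (\<integral>x. f x *\<^sub>R grad \<phi> x \<partial>lborel)"
    by (rule integral_lebesgue_on_eq[OF assms(2)])
      (use 1 gz in \<open>auto dest: borel_measurable_integrable\<close>)
  moreover have "(LINT x|lebesgue_on \<Omega>. \<phi> x *\<^sub>R grad f x) = (\<integral>x. \<phi> x *\<^sub>R grad f x \<partial>lborel)"
    by (rule integral_lebesgue_on_eq[OF assms(2)])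
      (use 2 K in \<open>auto dest: borel_measurable_integrable\<close>)
  ultimately show "(LINT x|lebesgue_on \<Omega>. f x *\<^sub>R grad \<phi> x) = - (LINT x|lebesgue_on \<Omega>. \<phi> x *\<^sub>R grad f x)"
    by simp
qed

lemma has_weak_gradient_diff:
  assumes "open \<Omega>" "has_weak_gradient \<Omega> u G" "has_weak_gradient \<Omega> v H"
  shows "has_weak_gradient \<Omega> (\<lambda>x. u x - v x) (\<lambda>x. G x - H x)"
proof -
  have \<Omega>: "\<Omega> \<in> sets lebesgue" using assms(1) by simp
  have li: "locally_integrable \<Omega> G" "locally_integrable \<Omega> H" "locally_integrable \<Omega> u" "locally_integrable \<Omega> v"
    using assms by (auto simp: has_weak_gradient_def)
  show ?thesis unfolding has_weak_gradient_def
  proof (intro conjI ballI)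
    show "locally_integrable \<Omega> (\<lambda>x. u x - v x)" "locally_integrable \<Omega> (\<lambda>x. G x - H x)"
      using li by (auto simp: locally_integrable_def)
    fix \<phi> assume \<phi>: "\<phi> \<in> test_functions \<Omega>"
    have ig: "integrable (lebesgue_on \<Omega>) (\<lambda>x. w x *\<^sub>R grad \<phi> x)"
      if "locally_integrable \<Omega> w" for w :: "'a \<Rightarrow> real"
    proof -
      have "(\<lambda>x. w x *\<^sub>R grad \<phi> x) = (\<lambda>x. \<Sum>i\<in>Basis. (dd i \<phi> x *\<^sub>R w x) *\<^sub>R i)"
        using test_functions_smooth[OF \<phi>]
        by (auto simp: grad_eq smooth_differentiable scaleR_sum_right mult.commute)
      then show ?thesis
        using locally_integrable_test[OF that test_functions_dd[OF \<phi>] \<Omega>]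
        by (auto intro!: Bochner_Integration.integrable_sum integrable_scaleR_left)
    qed
    show "(LINT x|lebesgue_on \<Omega>. (u x - v x) *\<^sub>R grad \<phi> x) = - (LINT x|lebesgue_on \<Omega>. \<phi> x *\<^sub>R (G x - H x))"
      using ig[OF li(3)] ig[OF li(4)] locally_integrable_test[OF li(1) \<phi> \<Omega>]
        locally_integrable_test[OF li(2) \<phi> \<Omega>] assms(2,3) \<phi>
      by (simp add: scaleR_diff_right scaleR_diff_left has_weak_gradient_def)
  qed
qed

lemma has_weak_gradient_cong_AE:
  assumes "open \<Omega>" "has_weak_gradient \<Omega> v H" "locally_integrable \<Omega> u"
    and "AE x in lebesgue_on \<Omega>. u x = v x"
  shows "has_weak_gradient \<Omega> u H"
  unfolding has_weak_gradient_def
proof (intro conjI ballI)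
  show "locally_integrable \<Omega> u" "locally_integrable \<Omega> H" using assms by (auto simp: has_weak_gradient_def)
  fix \<phi> assume \<phi>: "\<phi> \<in> test_functions \<Omega>"
  have m: "u \<in> borel_measurable (lebesgue_on \<Omega>)" "v \<in> borel_measurable (lebesgue_on \<Omega>)"
    using assms by (auto intro!: locally_integrable_measurable simp: has_weak_gradient_def)
  have "grad \<phi> \<in> borel_measurable (lebesgue_on \<Omega>)"
    using borel_imp_lebesgue[OF grad_borel[OF test_functions_smooth[OF \<phi>]]]
    by (rule measurable_restrict_space1)
  then have "(LINT x|lebesgue_on \<Omega>. u x *\<^sub>R grad \<phi> x) = (LINT x|lebesgue_on \<Omega>. v x *\<^sub>R grad \<phi> x)"
    using m assms(4) by (intro integral_cong_AE borel_measurable_scaleR) auto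
  then show "(LINT x|lebesgue_on \<Omega>. u x *\<^sub>R grad \<phi> x) = - (LINT x|lebesgue_on \<Omega>. \<phi> x *\<^sub>R H x)"
    using assms(2) \<phi> by (simp add: has_weak_gradient_def)
qed

lemma Lp_norm_nonneg: "0 \<le> Lp_norm p \<Omega> f"
  by (simp add: Lp_norm_def)

lemma Lp_cong_AE:
  assumes "f \<in> borel_measurable (lebesgue_on \<Omega>)" "g \<in> borel_measurable (lebesgue_on \<Omega>)"
    and "AE x in lebesgue_on \<Omega>. f x = g x"
  shows "f \<in> Lp p \<Omega> \<longleftrightarrow> g \<in> Lp p \<Omega>" and Lp_norm_cong_AE: "Lp_norm p \<Omega> f = Lp_norm p \<Omega> g"
proof -
  have ae: "AE x in lebesgue_on \<Omega>. norm (f x) powr p = norm (g x) powr p"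
    using assms(3) by eventually_elim simp
  have m: "(\<lambda>x. norm (f x) powr p) \<in> borel_measurable (lebesgue_on \<Omega>)"
     "(\<lambda>x. norm (g x) powr p) \<in> borel_measurable (lebesgue_on \<Omega>)"
    using assms by measurable
  show "f \<in> Lp p \<Omega> \<longleftrightarrow> g \<in> Lp p \<Omega>"
    using assms integrable_cong_AE[OF m ae] by (simp add: Lp_def)
  show "Lp_norm p \<Omega> f = Lp_norm p \<Omega> g"
    using integral_cong_AE[OF m ae] by (simp add: Lp_norm_def)
qed

text \<open>\<open>W1p_norm\<close> of the difference of u and \<phi> n involves the gradient chosen
  for that difference, which equals the difference of the gradients only almost everywhere. Once
  this is settled, each of the two nonnegative summands tends to 0.\<close>

lemma weak_solution_approx:
  assumes "open \<Omega>" "weak_solution p \<Omega> f u"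
  shows "u \<in> Lp p \<Omega>" "weak_gradient \<Omega> u \<in> Lp p \<Omega>"
    "has_weak_gradient \<Omega> u (weak_gradient \<Omega> u)"
    "\<exists>\<phi>. (\<forall>n. \<phi> n \<in> test_functions \<Omega>) \<and> (\<lambda>n::nat. Lp_norm p \<Omega> (\<lambda>x. u x - \<phi> n x)) \<longlonglongrightarrow> 0 \<and>
      (\<lambda>n. Lp_norm p \<Omega> (\<lambda>x. weak_gradient \<Omega> u x - grad (\<phi> n) x)) \<longlonglongrightarrow> 0"
proof -
  have \<Omega>: "\<Omega> \<in> sets lebesgue" using assms(1) by simp
  have u: "u \<in> W1p_0 p \<Omega>" using assms(2) by (simp add: weak_solution_def)
  then show "u \<in> Lp p \<Omega>" by (simp add: W1p_0_def W1p_def)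
  obtain G where G: "G \<in> Lp p \<Omega>" "has_weak_gradient \<Omega> u G"
    using u by (auto simp: W1p_0_def W1p_def)
  show W: "has_weak_gradient \<Omega> u (weak_gradient \<Omega> u)"
    by (rule weak_gradient_AE_eq[OF assms(1) G(2)])
  have meas: "H \<in> borel_measurable (lebesgue_on \<Omega>)" if "has_weak_gradient \<Omega> v H" for v H
    using that assms(1) by (auto simp: has_weak_gradient_def intro: locally_integrable_measurable)
  show "weak_gradient \<Omega> u \<in> Lp p \<Omega>"
    using Lp_cong_AE(1)[OF meas[OF W] meas[OF G(2)] weak_gradient_AE_eq(2)[OF assms(1) G(2)]] G(1) by simp
  obtain \<phi> where \<phi>: "\<And>n. \<phi> n \<in> test_functions \<Omega>"
    "(\<lambda>n::nat. W1p_norm p \<Omega> (\<lambda>x. u x - \<phi> n x)) \<longlonglongrightarrow> 0"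
    using u by (auto simp: W1p_0_def)
  have D: "has_weak_gradient \<Omega> (\<lambda>x. u x - \<phi> n x) (\<lambda>x. weak_gradient \<Omega> u x - grad (\<phi> n) x)" for n
    by (intro has_weak_gradient_diff assms(1) W has_weak_gradient_smooth test_functions_smooth[OF \<phi>(1)] \<Omega>)
  have "W1p_norm p \<Omega> (\<lambda>x. u x - \<phi> n x) = Lp_norm p \<Omega> (\<lambda>x. u x - \<phi> n x) +
      Lp_norm p \<Omega> (\<lambda>x. weak_gradient \<Omega> u x - grad (\<phi> n) x)" for n
    unfolding W1p_norm_def
    using Lp_norm_cong_AE[OF meas[OF weak_gradient_AE_eq(1)[OF assms(1) D]] meas[OF D]
        weak_gradient_AE_eq(2)[OF assms(1) D]] by simp
  then have lim: "(\<lambda>n. Lp_norm p \<Omega> (\<lambda>x. u x - \<phi> n x) +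
      Lp_norm p \<Omega> (\<lambda>x. weak_gradient \<Omega> u x - grad (\<phi> n) x)) \<longlonglongrightarrow> 0"
    using \<phi>(2) by simp
  have "(\<lambda>n. Lp_norm p \<Omega> (\<lambda>x. u x - \<phi> n x)) \<longlonglongrightarrow> 0"
    by (rule tendsto_sandwich[OF _ _ tendsto_const lim]) (auto simp: Lp_norm_nonneg)
  moreover have "(\<lambda>n. Lp_norm p \<Omega> (\<lambda>x. weak_gradient \<Omega> u x - grad (\<phi> n) x)) \<longlonglongrightarrow> 0"
    by (rule tendsto_sandwich[OF _ _ tendsto_const lim]) (auto simp: Lp_norm_nonneg)
  ultimately show "\<exists>\<phi>. (\<forall>n. \<phi> n \<in> test_functions \<Omega>) \<and> (\<lambda>n::nat. Lp_norm p \<Omega> (\<lambda>x. u x - \<phi> n x)) \<longlonglongrightarrow> 0 \<and>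
      (\<lambda>n. Lp_norm p \<Omega> (\<lambda>x. weak_gradient \<Omega> u x - grad (\<phi> n) x)) \<longlonglongrightarrow> 0"
    using \<phi>(1) by blast
qed

text \<open>Turns knowledge of u almost everywhere into a gradient norm: a solution that agrees with
  an explicit smooth function inherits the classical gradient of that function.\<close>

lemma weak_gradient_eq_smooth_AE:
  assumes "open \<Omega>" "weak_solution p \<Omega> f u" "smooth v" "AE x in lebesgue_on \<Omega>. u x = v x"
  shows "Lp_norm q \<Omega> (weak_gradient \<Omega> u) = Lp_norm q \<Omega> (grad v)"
proof -
  have v: "has_weak_gradient \<Omega> v (grad v)" using assms by (intro has_weak_gradient_smooth) auto
  have li: "locally_integrable \<Omega> u"
    using weak_solution_approx(3)[OF assms(1,2)] by (simp add: has_weak_gradient_def)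
  have u: "has_weak_gradient \<Omega> u (grad v)"
    by (rule has_weak_gradient_cong_AE[OF assms(1) v li assms(4)])
  have meas: "H \<in> borel_measurable (lebesgue_on \<Omega>)" if "has_weak_gradient \<Omega> v H" for v H
    using that assms(1) by (auto simp: has_weak_gradient_def intro: locally_integrable_measurable)
  show ?thesis
    using weak_gradient_AE_eq[OF assms(1) u] meas u by (intro Lp_norm_cong_AE) blast+
qed

lemma Lp_compact_support:
  assumes "continuous_on UNIV f" "compact K" "K \<subseteq> \<Omega>" "\<And>x. x \<notin> K \<Longrightarrow> f x = 0" "p > 0" "\<Omega> \<in> sets lebesgue"
  shows "f \<in> Lp p \<Omega>"
proof -
  have f: "f \<in> borel_measurable borel" by (rule borel_measurable_continuous_onI[OF assms(1)])
  have "f \<in> borel_measurable (lebesgue_on \<Omega>)"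
    by (rule measurable_restrict_space1[OF borel_imp_lebesgue[OF f]])
  moreover have "integrable lborel (\<lambda>x. norm (f x) powr p)"
    using assms by (intro integrable_cont_compact_support[of _ K] continuous_on_powr' continuous_intros) auto
  then have "integrable (lebesgue_on \<Omega>) (\<lambda>x. norm (f x) powr p)"
    using f assms by (subst integrable_lebesgue_on_eq) auto
  ultimately show ?thesis by (simp add: Lp_def)
qed

lemma test_functions_Lp:
  assumes "\<phi> \<in> test_functions \<Omega>" "p > 0" "\<Omega> \<in> sets lebesgue"
  shows "\<phi> \<in> Lp p \<Omega>" "grad \<phi> \<in> Lp p \<Omega>"
proof -
  obtain K where K: "smooth \<phi>" "compact K" "K \<subseteq> \<Omega>" "\<And>x. x \<notin> K \<Longrightarrow> \<phi> x = 0"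
    by (rule test_functionsE[OF assms(1)]) blast
  show "\<phi> \<in> Lp p \<Omega>"
    by (rule Lp_compact_support[OF smooth_continuous[OF K(1)] K(2,3,4) assms(2,3)])
  show "grad \<phi> \<in> Lp p \<Omega>"
    by (rule Lp_compact_support[OF grad_continuous[OF K(1)] K(2,3) grad_zero_off[OF K(1) compact_imp_closed[OF K(2)] K(4)] assms(2,3)])
qed

lemma weak_solution_testI:
  assumes "open \<Omega>" "p > 0" "w \<in> test_functions \<Omega>"
    and "\<And>\<phi>. \<phi> \<in> test_functions \<Omega> \<Longrightarrow>
      (LINT x|lebesgue_on \<Omega>. grad w x \<bullet> grad \<phi> x) = - (LINT x|lebesgue_on \<Omega>. f x \<bullet> grad \<phi> x)"
  shows "weak_solution p \<Omega> f w"
proof -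
  have \<Omega>: "\<Omega> \<in> sets lebesgue" using assms(1) by simp
  have w: "smooth w" by (rule test_functions_smooth[OF assms(3)])
  have wg: "has_weak_gradient \<Omega> w (grad w)" by (rule has_weak_gradient_smooth[OF w \<Omega>])
  have meas: "H \<in> borel_measurable (lebesgue_on \<Omega>)" if "has_weak_gradient \<Omega> v H" for v H
    using that assms(1) by (auto simp: has_weak_gradient_def intro: locally_integrable_measurable)
  have z: "has_weak_gradient \<Omega> (\<lambda>x. 0) (\<lambda>x. 0)"
    by (auto simp: has_weak_gradient_def locally_integrable_def)
  \<comment> \<open>The gradient chosen for the zero function is zero only almost everywhere, so
    even this norm needs uniqueness of weak gradients. It makes the constant sequence
    \<open>w\<close> an approximation of \<open>w\<close>.\<close>
  have n0: "W1p_norm p \<Omega> (\<lambda>x. 0) = 0"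
    unfolding W1p_norm_def
    using Lp_norm_cong_AE[OF meas[OF weak_gradient_AE_eq(1)[OF assms(1) z]] meas[OF z]
      weak_gradient_AE_eq(2)[OF assms(1) z], of p] assms(2)
    by (simp add: Lp_norm_def)
  have "w \<in> W1p_0 p \<Omega>"
    unfolding W1p_0_def W1p_def
    using test_functions_Lp[OF assms(3,2) \<Omega>] wg assms(3) n0
    by (auto intro!: exI[of _ "\<lambda>_. w"])
  moreover have "(LINT x|lebesgue_on \<Omega>. weak_gradient \<Omega> w x \<bullet> grad \<phi> x)
      = (LINT x|lebesgue_on \<Omega>. grad w x \<bullet> grad \<phi> x)" if "\<phi> \<in> test_functions \<Omega>" for \<phi>
  proof (rule integral_cong_AE)
    have "grad \<phi> \<in> borel_measurable (lebesgue_on \<Omega>)"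
      by (rule measurable_restrict_space1[OF borel_imp_lebesgue[OF grad_borel[OF test_functions_smooth[OF that]]]])
    then show "(\<lambda>x. weak_gradient \<Omega> w x \<bullet> grad \<phi> x) \<in> borel_measurable (lebesgue_on \<Omega>)"
      "(\<lambda>x. grad w x \<bullet> grad \<phi> x) \<in> borel_measurable (lebesgue_on \<Omega>)"
      using meas[OF wg] meas[OF weak_gradient_AE_eq(1)[OF assms(1) wg]]
      by (auto intro!: borel_measurable_inner)
    show "AE x in lebesgue_on \<Omega>. weak_gradient \<Omega> w x \<bullet> grad \<phi> x = grad w x \<bullet> grad \<phi> x"
      using weak_gradient_AE_eq(2)[OF assms(1) wg] by eventually_elim simp
  qed
  ultimately show ?thesis using assms(4) by (simp add: weak_solution_def)
qed

section \<open>A superharmonic barrier\<close>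

text \<open>Strict concavity of the power, quantified. Up to sign its second derivative is \<alpha>
  (1 - \<alpha>) (1 + t)^(\<alpha> - 2), and 1 + t \<le> 2 makes the last factor at least 1/4; half
  of this is the constant 1/8. The right side minus the left is therefore convex and lies above its
  tangent at 0, which is zero.\<close>

lemma powr_one_plus_le:
  fixes \<alpha> t :: real
  assumes \<alpha>: "0 < \<alpha>" "\<alpha> < 1" and t: "\<bar>t\<bar> \<le> 1"
  shows "(1 + t) powr \<alpha> \<le> 1 + \<alpha> * t - \<alpha> * (1 - \<alpha>) / 8 * t\<^sup>2"
proof (cases "t = -1")
  case True
  \<comment> \<open>At t = -1 the power has no derivative; its value there is 0 and the inequality
    is checked by hand.\<close>
  have "0 \<le> (1 - \<alpha>) * (1 - \<alpha> / 8)" using \<alpha> by (intro mult_nonneg_nonneg) auto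
  also have "\<dots> = 1 + \<alpha> * t - \<alpha> * (1 - \<alpha>) / 8 * t\<^sup>2" using True by (simp add: field_simps)
  finally show ?thesis using True by simp
next
  case False
  define c where "c = \<alpha> * (1 - \<alpha>) / 8"
  define g where "g t = 1 + \<alpha> * t - c * t\<^sup>2 - (1 + t) powr \<alpha>" for t
  define g' where "g' t = \<alpha> - 2 * c * t - \<alpha> * (1 + t) powr (\<alpha> - 1)" for t
  define g'' where "g'' t = - 2 * c - \<alpha> * (\<alpha> - 1) * (1 + t) powr (\<alpha> - 2)" for t
  have d1: "(g has_real_derivative g' x) (at x)" if "x > -1" for x
    unfolding g_def g'_def using that by (auto intro!: derivative_eq_intros)
  have d2: "(g' has_real_derivative g'' x) (at x)" if "x > -1" for x
    unfolding g''_def g'_def using that by (auto intro!: derivative_eq_intros)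
  have pos: "g'' x \<ge> 0" if x: "x \<in> {-1<..1}" for x
  proof -
    have "2 powr (-2) \<le> 2 powr (\<alpha> - 2)" using \<alpha> by (intro powr_mono) auto
    also have "\<dots> \<le> (1 + x) powr (\<alpha> - 2)" using x \<alpha> by (intro powr_mono2') auto
    finally have *: "1 / 4 \<le> (1 + x) powr (\<alpha> - 2)" by (simp add: powr_minus powr_numeral)
    have "\<alpha> * (1 - \<alpha>) * (1 / 4) \<le> \<alpha> * (1 - \<alpha>) * (1 + x) powr (\<alpha> - 2)"
      using \<alpha> by (intro mult_left_mono *) auto
    moreover have "g'' x = \<alpha> * (1 - \<alpha>) * (1 + x) powr (\<alpha> - 2) - \<alpha> * (1 - \<alpha>) * (1 / 4)"
      unfolding g''_def c_def by (simp add: field_simps)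
    ultimately show ?thesis by simp
  qed
  have conv: "convex_on {-1<..1} g"
    by (rule f''_ge0_imp_convex[of _ g g' g'']) (use d1 d2 pos in auto)
  have "g t - g 0 \<ge> g' 0 * (t - 0)"
  proof (rule convex_on_imp_above_tangent[OF conv])
    show "(g has_real_derivative g' 0) (at 0 within {-1<..1})"
      using d1[of 0] by (auto intro: has_field_derivative_at_within)
    show "0 \<in> interior {-1<..1::real}"
      by (rule interiorI[of "{-1<..<1}"]) auto
  qed (use t False in auto)
  then show ?thesis by (simp add: g_def g'_def c_def)
qed

lemma powr_add_le:
  fixes \<alpha> L h :: real
  assumes \<alpha>: "0 < \<alpha>" "\<alpha> < 1" and "L > 0" "\<bar>h\<bar> \<le> L"
  shows "(L + h) powr \<alpha> \<le> L powr \<alpha> + \<alpha> * L powr (\<alpha> - 1) * h - \<alpha> * (1 - \<alpha>) / 8 * L powr (\<alpha> - 2) * h\<^sup>2"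
proof -
  have "(1 + h / L) powr \<alpha> \<le> 1 + \<alpha> * (h / L) - \<alpha> * (1 - \<alpha>) / 8 * (h / L)\<^sup>2"
    using assms by (intro powr_one_plus_le) (auto simp: abs_le_iff field_simps)
  then have "L powr \<alpha> * (1 + h / L) powr \<alpha> \<le> L powr \<alpha> * (1 + \<alpha> * (h / L) - \<alpha> * (1 - \<alpha>) / 8 * (h / L)\<^sup>2)"
    by (intro mult_left_mono) auto
  moreover have "L powr \<alpha> * (1 + h / L) powr \<alpha> = (L + h) powr \<alpha>"
  proof -
    have "L * (1 + h / L) = L + h" using assms by (simp add: field_simps)
    moreover have "0 \<le> 1 + h / L" using assms by (simp add: field_simps abs_le_iff)
    ultimately show ?thesis using assms powr_mult[of L "1 + h / L" \<alpha>] by simp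
  qed
  moreover have "L powr (\<alpha> - 1) = L powr \<alpha> / L" "L powr (\<alpha> - 2) = L powr \<alpha> / L\<^sup>2"
    using assms by (simp_all add: powr_diff powr_numeral)
  ultimately show ?thesis by (simp add: algebra_simps power_divide)
qed

text \<open>Second differences, not divided by \<open>s\<^sup>2\<close>. They make sense for infima
  and absolute values, and if two functions agree at x while one is larger at the neighbours of x,
  then its \<open>dlap\<close> at x is larger.\<close>

definition dlap :: "real \<Rightarrow> ('a::euclidean_space \<Rightarrow> real) \<Rightarrow> 'a \<Rightarrow> real" where
  "dlap s f x = (\<Sum>i\<in>Basis. f (x + s *\<^sub>R i) + f (x - s *\<^sub>R i) - 2 * f x)"

text \<open>Each norm a on the left is at most (a^2 + |z|^2) / (2 |z|), the arithmetic-geometric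
  mean inequality, and the parallelogram law evaluates the sum of the two squares.\<close>

lemma norm_second_difference:
  fixes z e :: "'a::euclidean_space"
  assumes "z \<noteq> 0" "norm e = 1"
  shows "norm (z + s *\<^sub>R e) + norm (z - s *\<^sub>R e) - 2 * norm z \<le> s\<^sup>2 / norm z"
proof -
  have amgm: "a \<le> (a\<^sup>2 + (norm z)\<^sup>2) / (2 * norm z)" for a
  proof -
    have "0 \<le> (a - norm z)\<^sup>2" by simp
    then show ?thesis using assms(1) by (simp add: field_simps power2_eq_square)
  qed
  have sq: "(norm (z + s *\<^sub>R e))\<^sup>2 + (norm (z - s *\<^sub>R e))\<^sup>2 = 2 * (norm z)\<^sup>2 + 2 * s\<^sup>2"
    using assms(2) unfolding power2_norm_eq_inner
    by (simp add: inner_add_left inner_add_right inner_diff_left inner_diff_right inner_commute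
        power2_eq_square norm_eq_1)
  have "norm (z + s *\<^sub>R e) + norm (z - s *\<^sub>R e)
      \<le> ((norm (z + s *\<^sub>R e))\<^sup>2 + (norm (z - s *\<^sub>R e))\<^sup>2 + 2 * (norm z)\<^sup>2) / (2 * norm z)"
    using amgm[of "norm (z + s *\<^sub>R e)"] amgm[of "norm (z - s *\<^sub>R e)"]
    by (simp add: add_divide_distrib)
  also have "\<dots> = 2 * norm z + s\<^sup>2 / norm z"
    unfolding sq using assms(1) by (simp add: field_simps power2_eq_square)
  finally show ?thesis by simp
qed

text \<open>\<open>\<ell>\<close> is a small perturbation of a linear function, and the concavity of \<open>t\<^sup>\<alpha>\<close> beats the
  Laplacian of the perturbation.\<close>

lemma dlap_cone_barrier:
  fixes n z :: "'a::euclidean_space"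
  assumes \<alpha>: "0 < \<alpha>" "\<alpha> < 1" and lam: "lam = (1 - \<alpha>) / (100 * real DIM('a))" and n: "norm n = 1"
    and z: "z \<noteq> 0" and s: "0 < s" "2 * s \<le> lam * norm z - z \<bullet> n"
  shows "dlap s (\<lambda>z. (lam * norm z - z \<bullet> n) powr \<alpha>) z
      \<le> - (\<alpha> * (1 - \<alpha>) / 10) * (lam * norm z - z \<bullet> n) powr (\<alpha> - 2) * s\<^sup>2"
proof -
  define l where "l z = lam * norm z - z \<bullet> n" for z
  define L where "L = l z"
  define N where "N = real DIM('a)"
  have N: "N \<ge> 1" by (simp add: N_def Suc_leI)
  have lam0: "0 < lam" "lam * N = (1 - \<alpha>) / 100" "lam \<le> 1 / 100"
  proof -
    show "0 < lam" "lam * N = (1 - \<alpha>) / 100" unfolding lam using \<alpha> by (auto simp: N_def)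
    then have "lam * N \<le> 1 / 100" using \<alpha> by simp
    moreover have "lam \<le> lam * N" using N \<open>0 < lam\<close> mult_left_mono[of 1 N lam] by simp
    ultimately show "lam \<le> 1 / 100" by (rule order_trans[rotated])
  qed
  have L: "2 * s \<le> L" "0 < L" using s by (auto simp: L_def l_def)
  have Lz: "L \<le> 2 * norm z"
  proof -
    have "- (z \<bullet> n) \<le> norm z" using Cauchy_Schwarz_ineq2[of z n] n by (simp add: abs_le_iff)
    moreover have "lam * norm z \<le> 1 * norm z" using lam0 by (intro mult_right_mono) auto
    ultimately show ?thesis by (simp add: L_def l_def)
  qed
  define hp where "hp i = l (z + s *\<^sub>R i) - L" for i
  define hm where "hm i = l (z - s *\<^sub>R i) - L" for i
  define A where "A = \<alpha> * L powr (\<alpha> - 1)"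
  define C where "C = \<alpha> * (1 - \<alpha>) / 8 * L powr (\<alpha> - 2)"
  have A: "A \<ge> 0" and C: "C \<ge> 0" using \<alpha> by (auto simp: A_def C_def)
  have nd: "\<bar>norm (z + s *\<^sub>R i) - norm z\<bar> \<le> s" "\<bar>norm (z - s *\<^sub>R i) - norm z\<bar> \<le> s" if "i \<in> Basis" for i
    using norm_triangle_ineq3[of "z + s *\<^sub>R i" z] norm_triangle_ineq3[of "z - s *\<^sub>R i" z] that s(1)
    by auto
  have ni: "\<bar>n \<bullet> i\<bar> \<le> 1" if "i \<in> Basis" for i
    using Basis_le_norm[OF that, of n] n by simp
  have hp: "hp i = lam * (norm (z + s *\<^sub>R i) - norm z) - s * (n \<bullet> i)"
    and hm: "hm i = lam * (norm (z - s *\<^sub>R i) - norm z) + s * (n \<bullet> i)" for i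
    by (simp_all add: hp_def hm_def l_def L_def algebra_simps inner_commute)
  \<comment> \<open>The expansion of the power requires increments of at most \<open>L\<close>. Here
    they are at most (lam + 1) s \<le> 2 s, which is where the hypothesis on s enters.\<close>
  have small: "\<bar>hp i\<bar> \<le> L" "\<bar>hm i\<bar> \<le> L" if i: "i \<in> Basis" for i
  proof -
    have 1: "lam * \<bar>norm (z + s *\<^sub>R i) - norm z\<bar> \<le> 1 * s" "lam * \<bar>norm (z - s *\<^sub>R i) - norm z\<bar> \<le> 1 * s"
      using lam0 nd[OF i] by (intro mult_mono; simp)+
    have 2: "s * \<bar>n \<bullet> i\<bar> \<le> s" using ni[OF i] s mult_left_mono[of "\<bar>n \<bullet> i\<bar>" 1 s] by simp
    show "\<bar>hp i\<bar> \<le> L"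
      using 1 2 L s lam0 abs_triangle_ineq4[of "lam * (norm (z + s *\<^sub>R i) - norm z)" "s * (n \<bullet> i)"]
      unfolding hp abs_mult abs_of_pos[OF lam0(1)] abs_of_pos[OF s(1)] by linarith
    show "\<bar>hm i\<bar> \<le> L"
      using 1 2 L s lam0 abs_triangle_ineq[of "lam * (norm (z - s *\<^sub>R i) - norm z)" "s * (n \<bullet> i)"]
      unfolding hm abs_mult abs_of_pos[OF lam0(1)] abs_of_pos[OF s(1)] by linarith
  qed
  have summand: "l (z + s *\<^sub>R i) powr \<alpha> + l (z - s *\<^sub>R i) powr \<alpha> - 2 * L powr \<alpha>
      \<le> A * (hp i + hm i) - C * ((hp i)\<^sup>2 + (hm i)\<^sup>2)" if i: "i \<in> Basis" for i
  proof -
    have "l (z + s *\<^sub>R i) powr \<alpha> \<le> L powr \<alpha> + A * hp i - C * (hp i)\<^sup>2"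
      using powr_add_le[OF \<alpha> L(2) small(1)[OF i]] by (simp add: hp_def A_def C_def)
    moreover have "l (z - s *\<^sub>R i) powr \<alpha> \<le> L powr \<alpha> + A * hm i - C * (hm i)\<^sup>2"
      using powr_add_le[OF \<alpha> L(2) small(2)[OF i]] by (simp add: hm_def A_def C_def)
    ultimately show ?thesis by (simp add: algebra_simps)
  qed
  have sum1: "hp i + hm i \<le> lam * (s\<^sup>2 / norm z)" if i: "i \<in> Basis" for i
  proof -
    have "hp i + hm i = lam * (norm (z + s *\<^sub>R i) + norm (z - s *\<^sub>R i) - 2 * norm z)"
      by (simp add: hp hm algebra_simps)
    also have "\<dots> \<le> lam * (s\<^sup>2 / norm z)"
      using lam0 i by (intro mult_left_mono norm_second_difference z) auto
    finally show ?thesis .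
  qed
  have sum2: "2 * s\<^sup>2 * (n \<bullet> i)\<^sup>2 - 4 * lam * s\<^sup>2 \<le> (hp i)\<^sup>2 + (hm i)\<^sup>2" if i: "i \<in> Basis" for i
  proof -
    have *: "s\<^sup>2 * (n \<bullet> i)\<^sup>2 - 2 * lam * s\<^sup>2 \<le> (lam * a + (s * (n \<bullet> i)) * \<sigma>)\<^sup>2"
      if a: "\<bar>a\<bar> \<le> s" and sg: "\<sigma> = 1 \<or> \<sigma> = -1" for a \<sigma> :: real
    proof -
      have "\<bar>a * (n \<bullet> i)\<bar> \<le> s * 1" unfolding abs_mult using a ni[OF i] s by (intro mult_mono) auto
      then have "\<bar>(a * (n \<bullet> i)) * \<sigma>\<bar> \<le> s" using sg by (auto simp: abs_mult)
      then have "- s \<le> a * (n \<bullet> i) * \<sigma>" by linarith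
      then have "2 * lam * s * (- s) \<le> 2 * lam * s * (a * (n \<bullet> i) * \<sigma>)"
        using lam0 s by (intro mult_left_mono) auto
      moreover have "(lam * a + (s * (n \<bullet> i)) * \<sigma>)\<^sup>2 = (lam * a)\<^sup>2 + s\<^sup>2 * (n \<bullet> i)\<^sup>2 + 2 * lam * s * (a * (n \<bullet> i) * \<sigma>)"
        using sg by (auto simp: power2_eq_square algebra_simps)
      moreover have "0 \<le> (lam * a)\<^sup>2" by simp
      moreover have "2 * lam * s * (- s) = - (2 * lam * s\<^sup>2)" by (simp add: power2_eq_square)
      ultimately show ?thesis by linarith
    qed
    show ?thesis
      using *[OF nd(1)[OF i], of "-1"] *[OF nd(2)[OF i], of 1] by (simp add: hp hm)
  qed
  have nn: "(\<Sum>i\<in>Basis. (n \<bullet> i)\<^sup>2) = 1"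
    using n euclidean_inner[of n n] by (simp add: norm_eq_1 power2_eq_square)
  have "dlap s (\<lambda>z. l z powr \<alpha>) z \<le> (\<Sum>i\<in>Basis. A * (hp i + hm i) - C * ((hp i)\<^sup>2 + (hm i)\<^sup>2))"
    unfolding dlap_def using summand by (intro sum_mono) (simp add: L_def)
  also have "\<dots> \<le> (\<Sum>i\<in>Basis. A * (lam * (s\<^sup>2 / norm z)) - C * (2 * s\<^sup>2 * (n \<bullet> i)\<^sup>2 - 4 * lam * s\<^sup>2))"
    using A C sum1 sum2 by (intro sum_mono diff_mono mult_left_mono) auto
  also have "\<dots> = A * ((lam * N) * (s\<^sup>2 / norm z)) - C * (2 * s\<^sup>2 - 4 * (lam * N) * s\<^sup>2)"
    by (simp add: sum_subtractf sum_distrib_left[symmetric] nn N_def algebra_simps)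
  also have "\<dots> \<le> A * ((lam * N) * (2 * s\<^sup>2 / L)) - C * (1 * s\<^sup>2)"
  proof (intro diff_mono mult_left_mono A C)
    show "s\<^sup>2 / norm z \<le> 2 * s\<^sup>2 / L" using Lz L z s by (simp add: field_simps mult_left_mono)
    show "1 * s\<^sup>2 \<le> 2 * s\<^sup>2 - 4 * (lam * N) * s\<^sup>2"
    proof -
      have "4 * (lam * N) * s\<^sup>2 \<le> 1 * s\<^sup>2" unfolding lam0 using \<alpha> by (intro mult_right_mono) auto
      then show ?thesis by linarith
    qed
    show "0 \<le> lam * N" using lam0 N by simp
  qed
  \<comment> \<open>Since \<open>lam * N\<close> is (1 - \<alpha>) / 100, the norm term costs
    \<alpha> (1 - \<alpha>) / 50 against the gain \<alpha> (1 - \<alpha>) / 8 from concavity. As 1/8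
    - 1/50 = 0.105, the factor 1/10 remains; the 100 in \<open>lam\<close> is chosen for
    this.\<close>
  also have "\<dots> = - (\<alpha> * (1 - \<alpha>) * (1/8 - 1/50)) * L powr (\<alpha> - 2) * s\<^sup>2"
  proof -
    have "L powr (\<alpha> - 1) / L = L powr (\<alpha> - 2)"
      using L by (simp add: powr_diff powr_numeral power2_eq_square)
    then show ?thesis unfolding lam0 A_def C_def using L by (simp add: field_simps)
  qed
  also have "\<dots> \<le> - (\<alpha> * (1 - \<alpha>) / 10) * L powr (\<alpha> - 2) * s\<^sup>2"
  proof (intro mult_right_mono)
    show "- (\<alpha> * (1 - \<alpha>) * (1/8 - 1/50)) \<le> - (\<alpha> * (1 - \<alpha>) / 10)"
      using mult_pos_pos[of \<alpha> "1 - \<alpha>"] \<alpha> by simp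
  qed auto
  finally show ?thesis by (simp add: L_def l_def)
qed

text \<open>For small \<kappa> the cone is nearly a half space. The radius may depend on \<kappa>
  but not on the boundary point; the axis may depend on both. This is the form in which the C^1
  boundary enters the uniqueness proof.\<close>

definition flat_exterior_cones :: "'a::euclidean_space set \<Rightarrow> bool" where
  "flat_exterior_cones \<Omega> \<longleftrightarrow> (\<forall>\<kappa>>0. \<exists>r>0. \<forall>x0\<in>frontier \<Omega>. \<exists>n. norm n = 1 \<and>
     (\<forall>x. norm (x - x0) \<le> r \<and> \<kappa> * norm (x - x0) \<le> (x - x0) \<bullet> n \<longrightarrow> x \<notin> \<Omega>))"

text \<open>The distance to the complement is attained, and the segment to a minimiser meets the
  frontier. The crossing point is no farther away and not in \<Omega>, so it is a minimiser as
  well.\<close>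

lemma nearest_frontier_point:
  fixes \<Omega> :: "'a::euclidean_space set"
  assumes "open \<Omega>" "\<Omega> \<noteq> UNIV" "x \<in> \<Omega>"
  obtains y where "y \<in> frontier \<Omega>" "dist x y = infdist x (- \<Omega>)"
proof -
  obtain x0 where x0: "x0 \<in> - \<Omega>" "infdist x (- \<Omega>) = dist x x0"
    using infdist_attains_inf[of "- \<Omega>" x] assms by auto
  have "closed_segment x x0 \<inter> frontier \<Omega> \<noteq> {}"
    by (rule connected_Int_frontier) (use assms x0 in auto)
  then obtain y where y: "y \<in> closed_segment x x0" "y \<in> frontier \<Omega>" by blast
  have "y \<notin> \<Omega>" using y(2) assms(1) by (simp add: frontier_def interior_open)
  then have "infdist x (- \<Omega>) \<le> dist x y" by (intro infdist_le) auto
  moreover have "dist x y \<le> dist x x0" using segment_bound(1)[OF y(1)] by (simp add: dist_norm norm_minus_commute)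
  ultimately show ?thesis using that[OF y(2)] x0(2) by simp
qed

lemma infdist_compl_pos:
  assumes "open \<Omega>" "\<Omega> \<noteq> UNIV" "x \<in> \<Omega>"
  shows "0 < infdist x (- \<Omega>)"
  using assms infdist_pos_not_in_closed[of "- \<Omega>" x] by auto

text \<open>\<open>b\<close> is the infimum, over a countable dense set of boundary points x0, of
  local barriers: the power of a cone function near x0, capped by a concave paraboloid that takes
  over away from x0. The cone function vanishes at x0, so density gives the decay in the distance to
  the boundary. Superharmonicity passes to the infimum, because the function that gives the value of
  a local barrier at x bounds \<open>b\<close> at all neighbours of x. Countability keeps
  \<open>b\<close> Borel.\<close>

lemma superharmonic_barrier:
  fixes \<Omega> :: "'a::euclidean_space set"
  assumes \<Omega>: "open \<Omega>" "\<Omega> \<subseteq> ball 0 1" "flat_exterior_cones \<Omega>" and \<alpha>: "0 < \<alpha>" "\<alpha> < 1"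
  obtains b :: "'a \<Rightarrow> real" and C c where "C > 0" "c > 0" "b \<in> borel_measurable borel"
    "\<And>x. 0 \<le> b x" "\<And>x. b x \<le> C * infdist x (- \<Omega>) powr \<alpha>"
    "\<And>K. compact K \<Longrightarrow> K \<subseteq> \<Omega> \<Longrightarrow> \<exists>s0>0. \<forall>x\<in>K. \<forall>s. 0 < s \<and> s \<le> s0 \<longrightarrow> dlap s b x \<le> - c * s\<^sup>2"
proof (cases "\<Omega> = {}")
  case True
  then show ?thesis
    by (intro that[of 1 1 "\<lambda>_. 0"]) (auto intro!: exI[of _ 1])
next
  case False
  have nU: "\<Omega> \<noteq> UNIV" using \<Omega>(2) bounded_subset[OF bounded_ball] not_bounded_UNIV by metis
  define N where "N = real DIM('a)"
  have N: "N \<ge> 1" by (simp add: N_def Suc_leI)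
  define lam where "lam = (1 - \<alpha>) / (100 * real DIM('a))"
  have lam: "0 < lam" "lam \<le> 1"
    using \<alpha> N by (auto simp: lam_def N_def[symmetric] field_simps)
  \<comment> \<open>The cones are taken with slope \<open>lam / 2\<close> while the barrier uses
    \<open>lam\<close>; the gap keeps \<open>l x0\<close> above \<open>lam / 2\<close> times the
    distance to x0 at points of \<Omega> near x0.\<close>
  obtain r where r: "r > 0" "\<And>x0. x0 \<in> frontier \<Omega> \<Longrightarrow> \<exists>n. norm n = 1 \<and>
     (\<forall>x. norm (x - x0) \<le> r \<and> (lam / 2) * norm (x - x0) \<le> (x - x0) \<bullet> n \<longrightarrow> x \<notin> \<Omega>)"
    using \<Omega>(3)[unfolded flat_exterior_cones_def, rule_format, OF half_gt_zero[OF lam(1)]] by blast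
  then obtain n where n: "\<And>x0. x0 \<in> frontier \<Omega> \<Longrightarrow> norm (n x0) = 1"
    "\<And>x0 x. x0 \<in> frontier \<Omega> \<Longrightarrow> norm (x - x0) \<le> r \<Longrightarrow>
       (lam / 2) * norm (x - x0) \<le> (x - x0) \<bullet> n x0 \<Longrightarrow> x \<notin> \<Omega>" by metis
  obtain D where D: "countable D" "D \<subseteq> frontier \<Omega>" "frontier \<Omega> \<subseteq> closure D"
    using separable[of "frontier \<Omega>"] by blast
  have "frontier \<Omega> \<noteq> {}" using False nU frontier_eq_empty by blast
  then have Dne: "D \<noteq> {}" using D(3) by auto
  \<comment> \<open>At distance at least r/2 from x0 the cone function is at least
    \<open>lam * r / 4\<close>, so its power is at least 4 m, an upper bound of \<open>cap\<close>.
    The minimum is then \<open>cap\<close>, and the switch at distance r creates no jump.\<close>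
  define m where "m = ((lam * r / 4) powr \<alpha>) / 4"
  have m: "m > 0" using lam r by (simp add: m_def)
  define cap where "cap x = m * (4 - (norm x)\<^sup>2)" for x :: 'a
  define l where "l x0 x = lam * norm (x - x0) - (x - x0) \<bullet> n x0" for x0 x
  define B where "B x0 x = (if x \<in> \<Omega> then if norm (x - x0) < r then min (cap x) (l x0 x powr \<alpha>) else cap x else 0)"
    for x0 x
  define b where "b x = (INF x0\<in>D. B x0 x)" for x
  have cap: "0 \<le> cap x" "cap x \<le> 4 * m" if "x \<in> \<Omega>" for x
  proof -
    have "norm x < 1" using that \<Omega>(2) by auto
    then have "(norm x)\<^sup>2 \<le> 1" by (simp add: power_le_one)
    then show "0 \<le> cap x" using m by (simp add: cap_def)
    have "m * (norm x)\<^sup>2 \<ge> 0" using m by simp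
    then show "cap x \<le> 4 * m" by (simp add: cap_def algebra_simps)
  qed
  have B0: "0 \<le> B x0 x" for x0 x using cap[of x] by (auto simp: B_def)
  have bdd: "bdd_below ((\<lambda>x0. B x0 x) ` D)" for x by (rule bdd_belowI2[of _ 0]) (rule B0)
  have b0: "0 \<le> b x" for x unfolding b_def using Dne B0 by (rule cINF_greatest)
  have bB: "b x \<le> B x0 x" if "x0 \<in> D" for x x0 unfolding b_def using bdd that by (rule cINF_lower)
  have bcap: "b x \<le> cap x" if "x \<in> \<Omega>" for x
    using Dne bB that unfolding B_def by (metis all_not_in_conv min.bounded_iff)
  have bl: "b x \<le> l x0 x powr \<alpha>" if "x \<in> \<Omega>" "norm (x - x0) < r" "x0 \<in> D" for x x0
    using bB[OF that(3), of x] that by (simp add: B_def)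
  have lpos: "(lam / 2) * norm (x - x0) < l x0 x" if "x \<in> \<Omega>" "norm (x - x0) \<le> r" "x0 \<in> D" for x x0
    using n(2)[of x0 x] that D(2) by (force simp: l_def)
  have lle: "l x0 x \<le> 2 * norm (x - x0)" if "x0 \<in> D" for x x0
  proof -
    have "- ((x - x0) \<bullet> n x0) \<le> norm (x - x0)"
      using Cauchy_Schwarz_ineq2[of "x - x0" "n x0"] n(1)[of x0] that D(2) by (auto simp: abs_le_iff)
    moreover have "lam * norm (x - x0) \<le> 1 * norm (x - x0)" using lam by (intro mult_right_mono) auto
    ultimately show ?thesis by (simp add: l_def)
  qed
  define C where "C = 4 powr \<alpha> + 4 * m * (2 / r) powr \<alpha>"
  show ?thesis
  proof (rule that[of C "min (2 * N * m) (\<alpha> * (1 - \<alpha>) / 10 * 4 powr (\<alpha> - 2))" b])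
    show "C > 0" using m r by (simp add: C_def add_pos_nonneg)
    show "min (2 * N * m) (\<alpha> * (1 - \<alpha>) / 10 * 4 powr (\<alpha> - 2)) > 0" using N m \<alpha> by simp
    show "b \<in> borel_measurable borel"
      unfolding b_def
    proof (rule borel_measurable_cINF_real[OF D(1)])
      fix x0 assume "x0 \<in> D"
      have [measurable]: "\<Omega> \<in> sets borel" using \<Omega>(1) by simp
      have [measurable]: "(\<lambda>x. cap x) \<in> borel_measurable borel" "(\<lambda>x. l x0 x) \<in> borel_measurable borel"
        unfolding cap_def l_def by (intro borel_measurable_continuous_onI continuous_intros)+
      show "(\<lambda>x. B x0 x) \<in> borel_measurable borel" unfolding B_def by measurable
    qed
    show "0 \<le> b x" for x by (rule b0)
    show "b x \<le> C * infdist x (- \<Omega>) powr \<alpha>" for x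
    proof (cases "x \<in> \<Omega>")
      case False
      obtain x0 where "x0 \<in> D" using Dne by blast
      then have "b x \<le> 0" using bB[of x0 x] False by (simp add: B_def)
      also have "0 \<le> C * infdist x (- \<Omega>) powr \<alpha>" using m by (simp add: C_def)
      finally show ?thesis .
    next
      case True
      define d where "d = infdist x (- \<Omega>)"
      have d: "d > 0" unfolding d_def by (rule infdist_compl_pos[OF \<Omega>(1) nU True])
      have C: "4 powr \<alpha> * d powr \<alpha> \<le> C * d powr \<alpha>" "4 * m * (2 / r) powr \<alpha> * d powr \<alpha> \<le> C * d powr \<alpha>"
        using m by (auto intro!: mult_right_mono simp: C_def)
      show ?thesis
      proof (cases "2 * d < r")
        case small: True
        obtain y where y: "y \<in> frontier \<Omega>" "dist x y = d"
          using nearest_frontier_point[OF \<Omega>(1) nU True] d_def by metis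
        \<comment> \<open>A point of \<open>D\<close> within d of the nearest boundary point has
          distance below 2 d from x, so the cone function is at most 4 d: hence the term
          \<open>4 powr \<alpha>\<close> in \<open>C\<close>.\<close>
        then obtain x0 where x0: "x0 \<in> D" "dist x0 y < d"
          using D(3) d closure_approachable by blast
        have xx: "norm (x - x0) < 2 * d"
          using dist_triangle[of x x0 y] y(2) x0(2) by (simp add: dist_norm norm_minus_commute[of y x0])
        have "l x0 x > 0" using lpos[OF True _ x0(1)] xx small lam
          by (smt (verit) mult_nonneg_nonneg norm_ge_zero half_gt_zero)
        moreover have "l x0 x \<le> 4 * d" using lle[OF x0(1), of x] xx by simp
        ultimately have "l x0 x powr \<alpha> \<le> (4 * d) powr \<alpha>" using \<alpha> by (intro powr_mono2) auto
        then have "b x \<le> 4 powr \<alpha> * d powr \<alpha>" using bl[OF True _ x0(1)] xx small d by (simp add: powr_mult)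
        then show ?thesis using C by (simp add: d_def)
      next
        case large: False
        have "1 \<le> (2 / r * d) powr \<alpha>" using large r \<alpha> by (intro ge_one_powr_ge_zero) (auto simp: field_simps)
          then have "1 \<le> (2 / r) powr \<alpha> * d powr \<alpha>" using r d by (subst powr_mult[symmetric]) auto
        then have "4 * m * 1 \<le> 4 * m * ((2 / r) powr \<alpha> * d powr \<alpha>)"
          using m by (intro mult_left_mono) auto
        then show ?thesis using bcap[OF True] cap(2)[OF True] C by (simp add: d_def mult.assoc)
      qed
    qed
    fix K assume K: "compact K" "K \<subseteq> \<Omega>"
    obtain \<delta> where \<delta>: "\<delta> > 0" "\<And>x y. x \<in> K \<Longrightarrow> dist x y < \<delta> \<Longrightarrow> y \<in> \<Omega>"
    proof -
      obtain e where "e > 0" "(\<Union>x\<in>K. ball x e) \<subseteq> \<Omega>"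
        by (rule compact_subset_open_imp_ball_epsilon_subset[OF K(1) \<Omega>(1) K(2)])
      then show ?thesis by (intro that[of e]) (auto simp: subset_eq)
    qed
    \<comment> \<open>The three bounds keep the neighbours of x in \<Omega>, keep them within r of
      any x0 that is within r/2 of x, and give \<open>2 * s \<le> l x0 x\<close>, since x0 has
      distance at least \<delta> from x.\<close>
    define s0 where "s0 = min (\<delta> / 2) (min (r / 4) (lam * \<delta> / 4))"
    have "s0 > 0" using \<delta> r lam by (simp add: s0_def)
    moreover have "dlap s b x \<le> - min (2 * N * m) (\<alpha> * (1 - \<alpha>) / 10 * 4 powr (\<alpha> - 2)) * s\<^sup>2"
      if x: "x \<in> K" and s: "0 < s" "s \<le> s0" for x s
    proof -
      define c where "c = min (2 * N * m) (\<alpha> * (1 - \<alpha>) / 10 * 4 powr (\<alpha> - 2))"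
      define Sg where "Sg f = (\<Sum>i\<in>Basis. f (x + s *\<^sub>R i) + f (x - s *\<^sub>R i))" for f :: "'a \<Rightarrow> real"
      have dl: "dlap s f x = Sg f - 2 * N * f x" for f
        by (simp add: dlap_def Sg_def sum_subtractf N_def sum.distrib)
      have s': "s < \<delta>" "s < r / 2" "2 * s \<le> (lam / 2) * \<delta>" using s \<delta> r lam by (auto simp: s0_def)
      have x\<Omega>: "x \<in> \<Omega>" using x K by blast
      have pm: "x + s *\<^sub>R i \<in> \<Omega>" "x - s *\<^sub>R i \<in> \<Omega>" if "i \<in> Basis" for i
        using that s s' \<delta>(2)[OF x] by (auto simp: dist_norm)
      have Sgcap: "Sg cap = 2 * N * cap x - 2 * N * m * s\<^sup>2"
      proof -
        have "cap (x + s *\<^sub>R i) + cap (x - s *\<^sub>R i) = 2 * cap x - 2 * m * s\<^sup>2" if "i \<in> Basis" for i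
          using that unfolding cap_def power2_norm_eq_inner
          by (simp add: inner_add_left inner_add_right inner_diff_left inner_diff_right inner_commute
              power2_eq_square algebra_simps)
        then have "Sg cap = (\<Sum>i\<in>(Basis :: 'a set). 2 * cap x - 2 * m * s\<^sup>2)"
          unfolding Sg_def by (rule sum.cong[OF refl])
        then show ?thesis by (simp add: N_def algebra_simps)
      qed
      have Sgb: "Sg b \<le> Sg cap" unfolding Sg_def using bcap pm by (intro sum_mono add_mono) auto
      have cs: "c * s\<^sup>2 \<le> 2 * N * m * s\<^sup>2" "c * s\<^sup>2 \<le> \<alpha> * (1 - \<alpha>) / 10 * 4 powr (\<alpha> - 2) * s\<^sup>2"
        unfolding c_def by (intro mult_right_mono min.cobounded1 min.cobounded2 zero_le_power2)+
      \<comment> \<open>The left side does not depend on x0, so a bound by every local barrier is a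
        bound by the infimum. Whichever of \<open>cap\<close> and the cone power is the value at x
        also dominates \<open>b\<close> at the neighbours of x.\<close>
      have key: "Sg b + c * s\<^sup>2 \<le> 2 * N * B x0 x" if x0: "x0 \<in> D" for x0
      proof (cases "norm (x - x0) < r \<and> l x0 x powr \<alpha> < cap x")
        case False
        then have "B x0 x = cap x" using x\<Omega> by (auto simp: B_def)
        then show ?thesis using Sgb Sgcap cs by simp
      next
        case True
        then have BB: "B x0 x = l x0 x powr \<alpha>" using x\<Omega> by (simp add: B_def)
        have lp: "(lam / 2) * norm (x - x0) < l x0 x" using lpos[OF x\<Omega> _ x0] True by simp
        have "x0 \<notin> \<Omega>" using x0 D(2) \<Omega>(1) by (auto simp: frontier_def interior_open)
        then have nx: "\<delta> \<le> norm (x - x0)" using \<delta>(2)[OF x, of x0] by (auto simp: dist_norm not_less[symmetric])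
        have ll: "2 * s \<le> l x0 x"
        proof -
          have "(lam / 2) * \<delta> \<le> (lam / 2) * norm (x - x0)" using nx lam by (intro mult_left_mono) auto
          then show ?thesis using lp s' by linarith
        qed
        have near: "norm (x - x0) < r / 2"
        proof (rule ccontr)
          assume "\<not> norm (x - x0) < r / 2"
          then have "(lam / 2) * (r / 2) \<le> (lam / 2) * norm (x - x0)" using lam by (intro mult_left_mono) auto
          then have "lam * r / 4 \<le> l x0 x" using lp by simp
          then have "(lam * r / 4) powr \<alpha> \<le> l x0 x powr \<alpha>" using lam r \<alpha> by (intro powr_mono2) auto
          then have "4 * m \<le> l x0 x powr \<alpha>" by (simp add: m_def)
          then show False using True cap(2)[OF x\<Omega>] by simp
        qed
        have nn: "norm (x + s *\<^sub>R i - x0) < r" "norm (x - s *\<^sub>R i - x0) < r" if "i \<in> Basis" for i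
          using norm_triangle_ineq[of "x - x0" "s *\<^sub>R i"] norm_triangle_ineq4[of "x - x0" "s *\<^sub>R i"] near s' s that
          by (auto simp: algebra_simps)
        have "Sg b \<le> Sg (\<lambda>y. l x0 y powr \<alpha>)"
          unfolding Sg_def using bl[OF _ _ x0] pm nn by (intro sum_mono add_mono) auto
        also have "\<dots> = dlap s (\<lambda>z. (lam * norm z - z \<bullet> n x0) powr \<alpha>) (x - x0) + 2 * N * l x0 x powr \<alpha>"
        proof -
          have e: "x + s *\<^sub>R i - x0 = (x - x0) + s *\<^sub>R i" "x - s *\<^sub>R i - x0 = (x - x0) - s *\<^sub>R i" for i by simp_all
          show ?thesis
            unfolding dlap_def Sg_def l_def e by (simp add: sum_subtractf N_def sum.distrib)
        qed
        also have "\<dots> \<le> - (\<alpha> * (1 - \<alpha>) / 10) * l x0 x powr (\<alpha> - 2) * s\<^sup>2 + 2 * N * l x0 x powr \<alpha>"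
        proof -
          have "x0 \<in> frontier \<Omega>" "x - x0 \<noteq> 0" using x0 D(2) nx \<delta>(1) by auto
          then show ?thesis
            using dlap_cone_barrier[OF \<alpha> lam_def n(1) _ s(1), of x0 "x - x0"] ll by (simp add: l_def)
        qed
        also have "\<dots> \<le> - (\<alpha> * (1 - \<alpha>) / 10 * 4 powr (\<alpha> - 2) * s\<^sup>2) + 2 * N * l x0 x powr \<alpha>"
        proof -
          have "norm x < 1" using x\<Omega> \<Omega>(2) by auto
          moreover have "norm x0 \<le> 1"
          proof -
            have "x0 \<in> closure \<Omega>" using x0 D(2) by (auto simp: frontier_def)
            also have "closure \<Omega> \<subseteq> cball 0 1" by (rule closure_minimal) (use \<Omega>(2) in auto)
            finally show ?thesis by simp
          qed
          ultimately have "norm (x - x0) \<le> 2" using norm_triangle_ineq4[of x x0] by simp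
          then have l4: "l x0 x \<le> 4" using lle[OF x0, of x] by simp
          have "4 powr (\<alpha> - 2) \<le> l x0 x powr (\<alpha> - 2)"
            using ll s l4 \<alpha> by (intro powr_mono2') auto
          then have "\<alpha> * (1 - \<alpha>) / 10 * s\<^sup>2 * 4 powr (\<alpha> - 2) \<le> \<alpha> * (1 - \<alpha>) / 10 * s\<^sup>2 * l x0 x powr (\<alpha> - 2)"
            using \<alpha> by (intro mult_left_mono) auto
          then show ?thesis by (simp add: mult_ac)
        qed
        finally show ?thesis using cs BB by simp
      qed
      have "(Sg b + c * s\<^sup>2) / (2 * N) \<le> b x"
        unfolding b_def[of x]
      proof (rule cINF_greatest[OF Dne])
        fix x0 assume "x0 \<in> D"
        then show "(Sg b + c * s\<^sup>2) / (2 * N) \<le> B x0 x"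
          using key[of x0] N by (simp add: field_simps)
      qed
      then have "Sg b + c * s\<^sup>2 \<le> 2 * N * b x" using N by (simp add: field_simps)
      then show ?thesis using dl[of b] by (simp add: c_def)
    qed
    ultimately show "\<exists>s0>0. \<forall>x\<in>K. \<forall>s. 0 < s \<and> s \<le> s0 \<longrightarrow>
        dlap s b x \<le> - min (2 * N * m) (\<alpha> * (1 - \<alpha>) / 10 * 4 powr (\<alpha> - 2)) * s\<^sup>2"
      by blast
  qed
qed

section \<open>Kato's inequality\<close>

definition lap :: "('a::euclidean_space \<Rightarrow> real) \<Rightarrow> 'a \<Rightarrow> real" where
  "lap f x = (\<Sum>i\<in>Basis. dd i (dd i f) x)"

lemma second_order_taylor:
  assumes "smooth (f :: 'a::euclidean_space \<Rightarrow> real)"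
  obtains t where "\<bar>t\<bar> \<le> \<bar>s\<bar>" "f (x + s *\<^sub>R v) = f x + s * dd v f x + s\<^sup>2 / 2 * dd v (dd v f) (x + t *\<^sub>R v)"
proof -
  define D where "D m t = ((dd v ^^ m) f) (x + t *\<^sub>R v)" for m t
  have sm: "smooth ((dd v ^^ m) f)" for m by (induction m) (auto simp: assms smooth_dd)
  have "\<forall>m t. (D m has_real_derivative D (Suc m) t) (at t)"
    using smooth_line_deriv[OF sm] by (auto simp: D_def[abs_def])
  then obtain t where "\<bar>t\<bar> \<le> \<bar>s\<bar>" "D 0 s = (\<Sum>m<2. D m 0 / fact m * s ^ m) + D 2 t / fact 2 * s ^ 2"
    using Maclaurin_all_le[of D "D 0" s 2] by auto
  then show ?thesis by (intro that[of t]) (simp_all add: D_def numeral_2_eq_2 mult.commute)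
qed

text \<open>Taylor's formula with remainder points in each direction serves twice: it yields the
  limit of the quotient and, through bounded second derivatives, the majorant for dominated
  convergence.\<close>

lemma dlap_over_square:
  assumes "smooth (f :: 'a::euclidean_space \<Rightarrow> real)" "s > 0"
  obtains t1 t2 where "\<And>i. \<bar>t1 i\<bar> \<le> s" "\<And>i. \<bar>t2 i\<bar> \<le> s"
    "dlap s f x / s\<^sup>2 = (\<Sum>i\<in>Basis. (dd i (dd i f) (x + t1 i *\<^sub>R i) + dd i (dd i f) (x + t2 i *\<^sub>R i)) / 2)"
proof -
  have "\<exists>t. \<bar>t\<bar> \<le> \<bar>s\<bar> \<and> f (x + s *\<^sub>R i) = f x + s * dd i f x + s\<^sup>2 / 2 * dd i (dd i f) (x + t *\<^sub>R i)" for i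
    using second_order_taylor[OF assms(1), of s x i] by metis
  then obtain t1 where t1: "\<And>i. \<bar>t1 i\<bar> \<le> \<bar>s\<bar>"
    "\<And>i. f (x + s *\<^sub>R i) = f x + s * dd i f x + s\<^sup>2 / 2 * dd i (dd i f) (x + t1 i *\<^sub>R i)" by metis
  have "\<exists>t. \<bar>t\<bar> \<le> \<bar>- s\<bar> \<and> f (x + (- s) *\<^sub>R i) = f x + (- s) * dd i f x + (- s)\<^sup>2 / 2 * dd i (dd i f) (x + t *\<^sub>R i)" for i
    using second_order_taylor[OF assms(1), of "- s" x i] by metis
  then obtain t2 where t2: "\<And>i. \<bar>t2 i\<bar> \<le> \<bar>- s\<bar>"
    "\<And>i. f (x + (- s) *\<^sub>R i) = f x + (- s) * dd i f x + (- s)\<^sup>2 / 2 * dd i (dd i f) (x + t2 i *\<^sub>R i)" by metis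
  have "dlap s f x = (\<Sum>i\<in>Basis. s\<^sup>2 * ((dd i (dd i f) (x + t1 i *\<^sub>R i) + dd i (dd i f) (x + t2 i *\<^sub>R i)) / 2))"
    unfolding dlap_def using t1(2) t2(2) by (intro sum.cong) (auto simp: algebra_simps add_divide_distrib)
  then have "dlap s f x / s\<^sup>2 = (\<Sum>i\<in>Basis. (dd i (dd i f) (x + t1 i *\<^sub>R i) + dd i (dd i f) (x + t2 i *\<^sub>R i)) / 2)"
    using assms(2) by (simp only: sum_distrib_left[symmetric]) simp
  then show ?thesis using t1(1) t2(1) assms(2) by (intro that[of t1 t2]) auto
qed

lemma dlap_tendsto_lap:
  assumes "smooth f" "\<And>n. s n > 0" "s \<longlonglongrightarrow> 0"
  shows "(\<lambda>n. dlap (s n) f x / (s n)\<^sup>2) \<longlonglongrightarrow> lap f x"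
proof -
  define P where "P n t1 t2 \<longleftrightarrow> (\<forall>i. \<bar>t1 i\<bar> \<le> s n) \<and> (\<forall>i. \<bar>t2 i\<bar> \<le> s n) \<and> dlap (s n) f x / (s n)\<^sup>2 =
     (\<Sum>i\<in>Basis. (dd i (dd i f) (x + t1 i *\<^sub>R i) + dd i (dd i f) (x + t2 i *\<^sub>R i)) / 2)" for n t1 t2
  have "\<exists>t1 t2. P n t1 t2" for n
    by (rule dlap_over_square[OF assms(1,2), of n x]) (unfold P_def, blast)
  then obtain t1 t2 where P: "\<And>n. P n (t1 n) (t2 n)" by metis
  have t: "\<And>n i. \<bar>t1 n i\<bar> \<le> s n" "\<And>n i. \<bar>t2 n i\<bar> \<le> s n"
     "\<And>n. dlap (s n) f x / (s n)\<^sup>2 =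
     (\<Sum>i\<in>Basis. (dd i (dd i f) (x + t1 n i *\<^sub>R i) + dd i (dd i f) (x + t2 n i *\<^sub>R i)) / 2)"
    using P unfolding P_def by blast+
  have lim: "(\<lambda>n. dd i (dd i f) (x + \<tau> n i *\<^sub>R i)) \<longlonglongrightarrow> dd i (dd i f) x"
    if "\<And>n i. \<bar>\<tau> n i\<bar> \<le> s n" for \<tau> and i :: 'a
  proof -
    have "(\<lambda>n. \<tau> n i) \<longlonglongrightarrow> 0"
      by (rule Lim_null_comparison[OF _ assms(3)]) (use that in auto)
    then have "(\<lambda>n. x + \<tau> n i *\<^sub>R i) \<longlonglongrightarrow> x" by (auto intro!: tendsto_eq_intros)
    moreover have "continuous_on UNIV (dd i (dd i f))"
      by (intro smooth_continuous smooth_dd assms)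
    then have "isCont (dd i (dd i f)) x" by (simp add: continuous_on_eq_continuous_at)
    ultimately show ?thesis by (rule isCont_tendsto_compose[rotated])
  qed
  have "(\<lambda>n. \<Sum>i\<in>Basis. (dd i (dd i f) (x + t1 n i *\<^sub>R i) + dd i (dd i f) (x + t2 n i *\<^sub>R i)) / 2)
      \<longlonglongrightarrow> (\<Sum>i\<in>Basis. (dd i (dd i f) x + dd i (dd i f) x) / 2)"
    by (intro tendsto_sum tendsto_divide tendsto_add lim t tendsto_const) auto
  then show ?thesis unfolding t(3) by (simp add: lap_def)
qed

lemma integrable_bounded_mult:
  fixes b g :: "'a::euclidean_space \<Rightarrow> real"
  assumes "b \<in> borel_measurable borel" "\<And>x. \<bar>b x\<bar> \<le> M" "integrable lborel g"
  shows "integrable lborel (\<lambda>x. b x * g x)"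
proof (rule Bochner_Integration.integrable_bound)
  show "integrable lborel (\<lambda>x. M * g x)" using assms(3) by simp
  show "(\<lambda>x. b x * g x) \<in> borel_measurable lborel" using assms by simp
  have "M \<ge> 0" using assms(2)[of undefined] by linarith
  then show "AE x in lborel. norm (b x * g x) \<le> norm (M * g x)"
    using assms(2) by (intro AE_I2) (auto simp: abs_mult intro!: mult_right_mono)
qed

text \<open>Translation invariance moves each shift from g to b with the opposite sign, and the two
  shifts in a coordinate direction swap roles. Thus \<open>b\<close> is never
  differentiated.\<close>

lemma integral_dlap_symmetric:
  fixes b g :: "'a::euclidean_space \<Rightarrow> real"
  assumes b: "b \<in> borel_measurable borel" "\<And>x. \<bar>b x\<bar> \<le> M" and g: "integrable lborel g"
  shows "(\<integral>x. b x * dlap s g x \<partial>lborel) = (\<integral>x. dlap s b x * g x \<partial>lborel)"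
    and "integrable lborel (\<lambda>x. b x * dlap s g x)" and "integrable lborel (\<lambda>x. dlap s b x * g x)"
proof -
  have tr: "integrable lborel (\<lambda>x. g (x + h))" for h using g by (simp add: integrable_translate)
  have bt: "(\<lambda>x. b (x + h)) \<in> borel_measurable borel" for h using b(1) by simp
  have i1: "integrable lborel (\<lambda>x. b x * g (x + h))" for h
    by (rule integrable_bounded_mult[OF b tr])
  have i2: "integrable lborel (\<lambda>x. b (x + h) * g x)" for h
    by (rule integrable_bounded_mult[OF bt b(2) g])
  have sh: "(\<integral>x. b x * g (x + h) \<partial>lborel) = (\<integral>x. b (x + (- h)) * g x \<partial>lborel)" for h
    using integral_translate[of "\<lambda>x. b (x + (- h)) * g x" h] by simp
  have e1: "b x * dlap s g x = (\<Sum>i\<in>Basis. b x * g (x + s *\<^sub>R i) + b x * g (x + (- (s *\<^sub>R i))) - 2 * (b x * g (x + 0)))" for x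
    unfolding dlap_def sum_distrib_left by (intro sum.cong refl) (simp add: algebra_simps)
  have e2: "dlap s b x * g x = (\<Sum>i\<in>Basis. b (x + s *\<^sub>R i) * g x + b (x + (- (s *\<^sub>R i))) * g x - 2 * (b (x + 0) * g x))" for x
    unfolding dlap_def sum_distrib_right by (intro sum.cong refl) (simp add: algebra_simps)
  show "integrable lborel (\<lambda>x. b x * dlap s g x)" unfolding e1
    by (intro Bochner_Integration.integrable_sum Bochner_Integration.integrable_diff
        Bochner_Integration.integrable_add integrable_mult_right i1)
  show "integrable lborel (\<lambda>x. dlap s b x * g x)" unfolding e2
    by (intro Bochner_Integration.integrable_sum Bochner_Integration.integrable_diff
        Bochner_Integration.integrable_add integrable_mult_right i2)
  have "(\<integral>x. b x * dlap s g x \<partial>lborel) = (\<Sum>i\<in>Basis. (\<integral>x. b x * g (x + s *\<^sub>R i) \<partial>lborel)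
      + (\<integral>x. b x * g (x + (- (s *\<^sub>R i))) \<partial>lborel) - 2 * (\<integral>x. b x * g (x + 0) \<partial>lborel))"
    unfolding e1 using i1 by (simp add: Bochner_Integration.integral_sum del: add_0_right add_uminus_conv_diff)
  also have "\<dots> = (\<Sum>i\<in>Basis. (\<integral>x. b (x + s *\<^sub>R i) * g x \<partial>lborel)
      + (\<integral>x. b (x + (- (s *\<^sub>R i))) * g x \<partial>lborel) - 2 * (\<integral>x. b (x + 0) * g x \<partial>lborel))"
    unfolding sh by (intro sum.cong refl) simp
  also have "\<dots> = (\<integral>x. dlap s b x * g x \<partial>lborel)"
    unfolding e2 using i2 by (simp add: Bochner_Integration.integral_sum del: add_0_right add_uminus_conv_diff)
  finally show "(\<integral>x. b x * dlap s g x \<partial>lborel) = (\<integral>x. dlap s b x * g x \<partial>lborel)" .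
qed

text \<open>Kato's inequality \<open>-\<Delta>|f| \<le> |\<Delta>f|\<close>, tested with the superharmonic function \<open>b\<close>.  Its discrete
  version is just the triangle inequality.\<close>

lemma kato_barrier:
  fixes b f :: "'a::euclidean_space \<Rightarrow> real"
  assumes b: "b \<in> borel_measurable borel" "\<And>x. 0 \<le> b x" "\<And>x. b x \<le> M"
    and f: "smooth f" "compact K" "\<And>x. x \<notin> K \<Longrightarrow> f x = 0"
    and super: "\<exists>s0>0. \<forall>x\<in>K. \<forall>s. 0 < s \<and> s \<le> s0 \<longrightarrow> dlap s b x \<le> - c * s\<^sup>2"
  shows "c * (\<integral>x. \<bar>f x\<bar> \<partial>lborel) \<le> (\<integral>x. b x * \<bar>lap f x\<bar> \<partial>lborel)"
proof -
  obtain s0 where s0: "s0 > 0" "\<And>x s. x \<in> K \<Longrightarrow> 0 < s \<Longrightarrow> s \<le> s0 \<Longrightarrow> dlap s b x \<le> - c * s\<^sup>2"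
    using super by blast
  have ft: "f \<in> test_functions UNIV" by (rule test_functionsI[OF f(1,2) _ f(3)]) auto
  have bM: "\<bar>b x\<bar> \<le> M" for x using b(2,3)[of x] by simp
  have fi: "integrable lborel f" by (rule test_functions_integrable[OF ft])
  have afi: "integrable lborel (\<lambda>x. \<bar>f x\<bar>)" using fi by simp
  have disc: "c * (\<integral>x. \<bar>f x\<bar> \<partial>lborel) \<le> (\<integral>x. b x * \<bar>dlap s f x / s\<^sup>2\<bar> \<partial>lborel)"
    if s: "0 < s" "s \<le> s0" for s
  proof -
    have di: "integrable lborel (\<lambda>x. dlap s f x)"
    proof -
      have "integrable lborel (\<lambda>x. f (x + h))" "integrable lborel (\<lambda>x. f (x - h))" for h
        using integrable_translate[of f h] integrable_translate[of f "- h"] fi by simp_all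
      then show ?thesis unfolding dlap_def using fi
        by (intro Bochner_Integration.integrable_sum Bochner_Integration.integrable_diff
            Bochner_Integration.integrable_add integrable_mult_right) auto
    qed
    have "c * s\<^sup>2 * (\<integral>x. \<bar>f x\<bar> \<partial>lborel) = (\<integral>x. c * s\<^sup>2 * \<bar>f x\<bar> \<partial>lborel)" by simp
    also have "\<dots> \<le> (\<integral>x. - (dlap s b x * \<bar>f x\<bar>) \<partial>lborel)"
    proof (rule integral_mono)
      show "integrable lborel (\<lambda>x. c * s\<^sup>2 * \<bar>f x\<bar>)" using fi by simp
      show "integrable lborel (\<lambda>x. - (dlap s b x * \<bar>f x\<bar>))"
        using integral_dlap_symmetric(3)[OF b(1) bM afi] by simp
      show "c * s\<^sup>2 * \<bar>f x\<bar> \<le> - (dlap s b x * \<bar>f x\<bar>)" for x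
      proof (cases "x \<in> K")
        case True
        have "c * s\<^sup>2 * \<bar>f x\<bar> \<le> (- dlap s b x) * \<bar>f x\<bar>"
          using s0(2)[OF True s] by (intro mult_right_mono) auto
        then show ?thesis by simp
      qed (simp add: f(3))
    qed
    also have "\<dots> = (\<integral>x. - (b x * dlap s (\<lambda>x. \<bar>f x\<bar>) x) \<partial>lborel)"
      using integral_dlap_symmetric(1)[OF b(1) bM afi, of s] by simp
    also have "\<dots> \<le> (\<integral>x. b x * \<bar>dlap s f x\<bar> \<partial>lborel)"
    proof (rule integral_mono)
      show "integrable lborel (\<lambda>x. - (b x * dlap s (\<lambda>x. \<bar>f x\<bar>) x))"
        using integral_dlap_symmetric(2)[OF b(1) bM afi] by simp
      show "integrable lborel (\<lambda>x. b x * \<bar>dlap s f x\<bar>)"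
        using di by (intro integrable_bounded_mult[OF b(1) bM]) simp
      fix x
      have "- dlap s (\<lambda>x. \<bar>f x\<bar>) x \<le> \<bar>dlap s f x\<bar>"
      proof -
        have "\<bar>2 * real DIM('a) * f x\<bar> \<le> \<bar>dlap s f x\<bar> + \<bar>\<Sum>i\<in>Basis. f (x + s *\<^sub>R i) + f (x - s *\<^sub>R i)\<bar>"
          by (simp add: dlap_def sum_subtractf)
        also have "\<dots> \<le> \<bar>dlap s f x\<bar> + (\<Sum>i\<in>Basis. \<bar>f (x + s *\<^sub>R i)\<bar> + \<bar>f (x - s *\<^sub>R i)\<bar>)"
          by (intro add_left_mono order_trans[OF sum_abs] sum_mono abs_triangle_ineq)
        finally show ?thesis by (simp add: dlap_def sum_subtractf abs_mult)
      qed
      then show "- (b x * dlap s (\<lambda>x. \<bar>f x\<bar>) x) \<le> b x * \<bar>dlap s f x\<bar>"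
        using mult_left_mono[OF _ b(2)] by fastforce
    qed
    finally have "s\<^sup>2 * (c * (\<integral>x. \<bar>f x\<bar> \<partial>lborel)) \<le> (\<integral>x. b x * \<bar>dlap s f x\<bar> \<partial>lborel)"
      by (simp add: mult_ac)
    then have "c * (\<integral>x. \<bar>f x\<bar> \<partial>lborel) \<le> (\<integral>x. b x * \<bar>dlap s f x\<bar> \<partial>lborel) / s\<^sup>2"
      using s by (simp add: pos_le_divide_eq mult.commute)
    then show ?thesis by (simp add: abs_divide)
  qed
  define s where "s n = min s0 (inverse (real (Suc n)))" for n
  have s: "0 < s n" "s n \<le> s0" "s n \<le> 1" for n using s0 by (auto simp: s_def min_le_iff_disj inverse_le_1_iff)
  have slim: "s \<longlonglongrightarrow> 0"
  proof (rule Lim_null_comparison[OF _ LIMSEQ_inverse_real_of_nat])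
    show "\<forall>\<^sub>F n in sequentially. norm (s n) \<le> inverse (real (Suc n))"
      using s(1) by (intro always_eventually) (auto simp: s_def)
  qed
  obtain R where R: "R > 0" "\<And>x. norm x \<ge> R \<Longrightarrow> f x = 0"
    using test_functions_support_bounded[OF ft] by blast
  have "\<forall>i. \<exists>B. \<forall>x. \<bar>dd i (dd i f) x\<bar> \<le> B"
    using test_functions_bounded[OF test_functions_dd[OF test_functions_dd[OF ft]]] by metis
  then obtain B where B: "\<And>i x. \<bar>dd i (dd i f) x\<bar> \<le> B i" by metis
  have M0: "M \<ge> 0" using b(2,3) order_trans by blast
  have "(\<lambda>n. \<integral>x. b x * \<bar>dlap (s n) f x / (s n)\<^sup>2\<bar> \<partial>lborel) \<longlonglongrightarrow> (\<integral>x. b x * \<bar>lap f x\<bar> \<partial>lborel)"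
  proof (rule integral_dominated_convergence)
    \<comment> \<open>With steps of size at most 1 the second differences vanish outside the ball of
      radius R + 1, and inside it the second derivatives bound the quotients.\<close>
    show "integrable lborel (\<lambda>x::'a. indicator (cball 0 (R + 1)) x *\<^sub>R (M * (\<Sum>i\<in>Basis. B i)))"
      by (rule borel_integrable_compact) auto
    have "lap f \<in> borel_measurable borel"
      unfolding lap_def[abs_def] using smooth_borel[OF smooth_dd[OF smooth_dd[OF f(1)]]] by simp
    then show "(\<lambda>x. b x * \<bar>lap f x\<bar>) \<in> borel_measurable lborel" using b(1) by simp
    have "dlap (s n) f \<in> borel_measurable borel" for n
      unfolding dlap_def[abs_def] using smooth_borel[OF f(1)] by measurable
    then show "(\<lambda>x. b x * \<bar>dlap (s n) f x / (s n)\<^sup>2\<bar>) \<in> borel_measurable lborel" for n using b(1) by simp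
    show "AE x in lborel. (\<lambda>n. b x * \<bar>dlap (s n) f x / (s n)\<^sup>2\<bar>) \<longlonglongrightarrow> b x * \<bar>lap f x\<bar>"
      by (intro AE_I2 tendsto_mult tendsto_const tendsto_rabs dlap_tendsto_lap[OF f(1) s(1) slim])
    show "AE x in lborel. norm (b x * \<bar>dlap (s n) f x / (s n)\<^sup>2\<bar>)
        \<le> indicator (cball 0 (R + 1)) x *\<^sub>R (M * (\<Sum>i\<in>Basis. B i))" for n
    proof (rule AE_I2)
      fix x :: 'a
      show "norm (b x * \<bar>dlap (s n) f x / (s n)\<^sup>2\<bar>)
        \<le> indicator (cball 0 (R + 1)) x *\<^sub>R (M * (\<Sum>i\<in>Basis. B i))"
      proof (cases "norm x \<le> R + 1")
        case True
        obtain t1 t2 where t: "dlap (s n) f x / (s n)\<^sup>2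
            = (\<Sum>i\<in>Basis. (dd i (dd i f) (x + t1 i *\<^sub>R i) + dd i (dd i f) (x + t2 i *\<^sub>R i)) / 2)"
          using dlap_over_square[OF f(1) s(1)] by blast
        have "\<bar>dlap (s n) f x / (s n)\<^sup>2\<bar> \<le> (\<Sum>i\<in>Basis. B i)"
          unfolding t
        proof (rule order_trans[OF sum_abs], rule sum_mono)
          fix i :: 'a
          show "\<bar>(dd i (dd i f) (x + t1 i *\<^sub>R i) + dd i (dd i f) (x + t2 i *\<^sub>R i)) / 2\<bar> \<le> B i"
            using B[of i "x + t1 i *\<^sub>R i"] B[of i "x + t2 i *\<^sub>R i"] by (simp add: abs_le_iff)
        qed
        then have "b x * \<bar>dlap (s n) f x / (s n)\<^sup>2\<bar> \<le> M * (\<Sum>i\<in>Basis. B i)"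
          using b M0 by (intro mult_mono) auto
        then show ?thesis using True b(2)[of x] by (simp add: abs_mult)
      next
        case False
        have "f (x + h) = 0" if "norm h \<le> 1" for h
          using norm_triangle_ineq2[of x "- h"] that False by (intro R(2)) auto
        from this[of 0] this[of "s n *\<^sub>R _"] this[of "- (s n *\<^sub>R _)"]
        have "dlap (s n) f x = 0" using s[of n] by (auto simp: dlap_def intro!: sum.neutral)
        then show ?thesis using False by simp
      qed
    qed
  qed
  moreover have "\<forall>n\<ge>0. c * (\<integral>x. \<bar>f x\<bar> \<partial>lborel) \<le> (\<integral>x. b x * \<bar>dlap (s n) f x / (s n)\<^sup>2\<bar> \<partial>lborel)"
    using disc s by blast
  ultimately show ?thesis by (intro Lim_bounded2)
qed

section \<open>Boundary strips\<close>

definition strip :: "'a::euclidean_space set \<Rightarrow> real \<Rightarrow> 'a set" where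
  "strip \<Omega> \<eta> = {x \<in> \<Omega>. infdist x (- \<Omega>) < \<eta>}"

lemma continuous_infdist_compl: "continuous_on S (\<lambda>x. infdist x A)"
  by (intro continuous_on_infdist continuous_on_id)

lemma strip_borel [measurable]: "open \<Omega> \<Longrightarrow> strip \<Omega> \<eta> \<in> sets borel"
proof -
  assume "open \<Omega>"
  moreover have "open {x. infdist x (- \<Omega>) < \<eta>}"
    by (rule open_Collect_less[OF continuous_infdist_compl continuous_on_const])
  ultimately have "open (\<Omega> \<inter> {x. infdist x (- \<Omega>) < \<eta>})" by (rule open_Int)
  moreover have "strip \<Omega> \<eta> = \<Omega> \<inter> {x. infdist x (- \<Omega>) < \<eta>}" by (auto simp: strip_def)
  ultimately show ?thesis by simp
qed

text \<open>A substitute for boundary charts: a pointwise choice among finitely many directions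
  costs only the factor \<open>card E\<close>. The same directions serve all widths \<eta>, and the
  exit lasts until time r, so that many disjoint translates can be packed into a bounded
  region.\<close>

definition escape_directions :: "'a::euclidean_space set \<Rightarrow> 'a set \<Rightarrow> real \<Rightarrow> bool" where
  "escape_directions \<Omega> E r \<longleftrightarrow> finite E \<and> 0 < r \<and> (\<forall>e\<in>E. norm e = 1) \<and>
     (\<forall>\<eta>>0. \<forall>x\<in>strip \<Omega> \<eta>. \<exists>e\<in>E. \<forall>\<tau>. 6 * \<eta> \<le> \<tau> \<and> \<tau> \<le> r \<longrightarrow> x + \<tau> *\<^sub>R e \<notin> \<Omega>)"

lemma escape_directions_exist:
  fixes \<Omega> :: "'a::euclidean_space set"
  assumes \<Omega>: "open \<Omega>" "bounded \<Omega>" "flat_exterior_cones \<Omega>"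
  obtains E r where "escape_directions \<Omega> E r"
proof -
  have nU: "\<Omega> \<noteq> UNIV" using \<Omega>(2) not_bounded_UNIV by metis
  have half: "(0::real) < 1 / 2" by simp
  obtain r where r: "r > 0" "\<And>x0. x0 \<in> frontier \<Omega> \<Longrightarrow> \<exists>n. norm n = 1 \<and>
     (\<forall>x. norm (x - x0) \<le> r \<and> (1 / 2) * norm (x - x0) \<le> (x - x0) \<bullet> n \<longrightarrow> x \<notin> \<Omega>)"
    using \<Omega>(3)[unfolded flat_exterior_cones_def, rule_format, OF half] by blast
  \<comment> \<open>A 1/4-net of the unit sphere: replacing a cone axis by a nearby net direction
    leaves an inner product of at least 3/4 with that axis.\<close>
  obtain E where E: "E \<subseteq> sphere (0::'a) 1" "finite E" "sphere 0 1 \<subseteq> (\<Union>e\<in>E. ball e (1/4))"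
    by (rule compactE_image[of "sphere (0::'a) 1" "sphere 0 1" "\<lambda>e. ball e (1/4)"]) auto
  have "escape_directions \<Omega> E (r / 2)"
    unfolding escape_directions_def
  proof (intro conjI allI impI ballI)
    show "finite E" by (rule E)
    show "0 < r / 2" using r by simp
    show "norm e = 1" if "e \<in> E" for e using that E(1) by auto
    fix \<eta> x assume \<eta>: "0 < \<eta>" and x: "x \<in> strip \<Omega> \<eta>"
    then have "x \<in> \<Omega>" by (simp add: strip_def)
    obtain x0 where x0: "x0 \<in> frontier \<Omega>" "dist x x0 = infdist x (- \<Omega>)"
      using nearest_frontier_point[OF \<Omega>(1) nU \<open>x \<in> \<Omega>\<close>] by blast
    then have d: "norm (x - x0) < \<eta>" using x by (simp add: strip_def dist_norm)
    obtain n where n: "norm n = 1" "\<And>x. norm (x - x0) \<le> r \<Longrightarrow> (1 / 2) * norm (x - x0) \<le> (x - x0) \<bullet> n \<Longrightarrow> x \<notin> \<Omega>"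
      using r(2)[OF x0(1)] by blast
    have "n \<in> sphere 0 1" using n(1) by simp
    then obtain e where e: "e \<in> E" "dist e n < 1 / 4" using E(3) by fastforce
    have ne: "norm e = 1" using e E(1) by auto
    have en: "3 / 4 \<le> e \<bullet> n"
    proof -
      have "e \<bullet> n = n \<bullet> n + (e - n) \<bullet> n" by (simp add: inner_diff_left)
      moreover have "n \<bullet> n = 1" using n(1) by (simp add: norm_eq_1)
      moreover have "\<bar>(e - n) \<bullet> n\<bar> \<le> 1 / 4"
        using Cauchy_Schwarz_ineq2[of "e - n" n] e(2) n(1) by (simp add: dist_norm)
      ultimately show ?thesis by linarith
    qed
    show "\<exists>e\<in>E. \<forall>\<tau>. 6 * \<eta> \<le> \<tau> \<and> \<tau> \<le> r / 2 \<longrightarrow> x + \<tau> *\<^sub>R e \<notin> \<Omega>"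
    proof (intro bexI[OF _ e(1)] allI impI)
      fix \<tau> assume \<tau>: "6 * \<eta> \<le> \<tau> \<and> \<tau> \<le> r / 2"
      have eq: "x + \<tau> *\<^sub>R e - x0 = (x - x0) + \<tau> *\<^sub>R e" by simp
      have up: "norm (x + \<tau> *\<^sub>R e - x0) \<le> \<eta> + \<tau>"
        unfolding eq using norm_triangle_ineq[of "x - x0" "\<tau> *\<^sub>R e"] d ne \<tau> \<eta> by simp
      have "\<tau> * (3 / 4) \<le> \<tau> * (e \<bullet> n)" using en \<tau> \<eta> by (intro mult_left_mono) auto
      moreover have "- \<eta> \<le> (x - x0) \<bullet> n"
        using Cauchy_Schwarz_ineq2[of "x - x0" n] d n(1) by (simp add: abs_le_iff)
      ultimately have "\<tau> * (3 / 4) - \<eta> \<le> (x + \<tau> *\<^sub>R e - x0) \<bullet> n"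
        unfolding eq by (simp add: inner_add_left)
      \<comment> \<open>The point lies in the exterior cone if (\<eta> + \<tau>) / 2 \<le> 3 \<tau>
        / 4 - \<eta>, that is \<tau> \<ge> 6 \<eta>: the origin of the factor 6. Halving r leaves
        room for the additional \<eta> in the distance to x0.\<close>
      then show "x + \<tau> *\<^sub>R e \<notin> \<Omega>"
        using up \<tau> \<eta> r(1) by (intro n(2)) linarith+
    qed
  qed
  then show ?thesis by (rule that)
qed

text \<open>About r/h translates of A by multiples of h e are pairwise disjoint and fit into the
  ball of radius R + r, so A has at most a share of order h/r of the volume of that ball.\<close>

lemma measure_translates_disjoint:
  fixes A :: "'a::euclidean_space set"
  assumes A: "A \<in> sets borel" "A \<subseteq> ball 0 R" and e: "norm e = 1" and h: "0 < h" "0 < r"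
    and esc: "\<And>x \<tau>. x \<in> A \<Longrightarrow> h \<le> \<tau> \<Longrightarrow> \<tau> \<le> r \<Longrightarrow> x + \<tau> *\<^sub>R e \<notin> A"
  shows "measure lborel A \<le> 2 * measure lborel (ball (0::'a) (R + r)) / r * h"
proof -
  define V where "V = measure lborel (ball (0::'a) (R + r))"
  have Afin: "emeasure lborel A < \<infinity>"
    using le_less_trans[OF emeasure_mono[OF A(2), of lborel] emeasure_lborel_ball_finite[of 0 R]] by simp
  have iA: "integrable lborel (indicator A :: 'a \<Rightarrow> real)" using A Afin by simp
  have AV: "measure lborel A \<le> V" if "R \<ge> 0"
    unfolding V_def
  proof (rule measure_mono_fmeasurable)
    show "A \<subseteq> ball 0 (R + r)" using A(2) h by (force simp: subset_eq)
    show "ball (0::'a) (R + r) \<in> fmeasurable lborel"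
      using emeasure_lborel_ball_finite[of "0::'a" "R + r"] by (simp add: fmeasurable_def)
  qed (use A in auto)
  show ?thesis
  proof (cases "A = {}")
    case True
    then show ?thesis using h by simp
  next
    case False
    then have R: "R > 0" using A(2) by (metis ball_eq_empty not_le subset_empty)
    have V: "V \<ge> 0" by (simp add: V_def)
    show ?thesis
    proof (cases "r < h")
      case True
      have "V * 1 \<le> V * (2 * h / r)" using V True h by (intro mult_left_mono) auto
      moreover have "V * (2 * h / r) = 2 * V / r * h" by simp
      ultimately show ?thesis using AV R unfolding V_def[symmetric] by linarith
    next
      case False
      \<comment> \<open>As r/h is at least 1, rounding down loses at most a factor 2: r/h < N + 1
        \<le> 2 N.\<close>
      define N where "N = nat \<lfloor>r / h\<rfloor>"
      have "1 \<le> r / h" using False h by simp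
      then have N: "real N \<le> r / h" "r / h < real N + 1" "1 \<le> N" unfolding N_def by linarith+
      then have N2: "r / (2 * h) \<le> real N" by (simp add: field_simps)
      have Nh: "real N * h \<le> r" using N(1) h by (simp add: field_simps)
      define g where "g x = (\<Sum>j\<in>{1..N}. indicator A (x + (- (real j * h)) *\<^sub>R e) :: real)" for x
      have "(\<integral>x. g x \<partial>lborel) = (\<Sum>j\<in>{1..N}. (\<integral>x. indicator A (x + (- (real j * h)) *\<^sub>R e) \<partial>lborel))"
        unfolding g_def using iA by (intro Bochner_Integration.integral_sum) (simp only: integrable_translate)
      also have "\<dots> = real N * measure lborel A"
        using A Afin by (simp only: integral_translate) simp
      finally have 1: "(\<integral>x. g x \<partial>lborel) = real N * measure lborel A" .
      have "(\<integral>x. g x \<partial>lborel) \<le> (\<integral>x. indicator (ball (0::'a) (R + r)) x \<partial>lborel)"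
      proof (rule integral_mono)
        show "integrable lborel g" unfolding g_def using iA
          by (intro Bochner_Integration.integrable_sum) (simp only: integrable_translate)
        show "integrable lborel (indicator (ball (0::'a) (R + r)) :: 'a \<Rightarrow> real)"
          using emeasure_lborel_ball_finite[of "0::'a" "R + r"] by simp
        fix x
        define J where "J = {j\<in>{1..N}. x + (- (real j * h)) *\<^sub>R e \<in> A}"
        have gJ: "g x = real (card J)"
          unfolding g_def J_def indicator_def of_bool_def by (subst sum.inter_filter[symmetric]) auto
        have unique: "j = k" if "j \<in> J" "k \<in> J" for j k
        proof -
          have "\<not> j < k" if "j \<in> J" "k \<in> J" for j k
          proof
            assume "j < k"
            have kA: "x + (- (real k * h)) *\<^sub>R e \<in> A" using that by (simp add: J_def)
            have "real k * h - real j * h = real (k - j) * h"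
              using \<open>j < k\<close> by (simp add: of_nat_diff algebra_simps)
            moreover have "1 * h \<le> real (k - j) * h" using \<open>j < k\<close> h by (intro mult_right_mono) auto
            moreover have "real (k - j) * h \<le> real N * h" using that h by (intro mult_right_mono) (auto simp: J_def)
            ultimately have "x + (- (real k * h)) *\<^sub>R e + (real k * h - real j * h) *\<^sub>R e \<notin> A"
              using Nh by (intro esc[OF kA]) auto
            then show False using that by (simp add: J_def algebra_simps)
          qed
          then show ?thesis using that by (metis linorder_neqE_nat)
        qed
        show "g x \<le> indicator (ball 0 (R + r)) x"
        proof (cases "J = {}")
          case False
          then obtain j where j: "j \<in> J" by blast
          then have "J = {j}" using unique by blast
          moreover have "norm x < R + r"
          proof -
            have "real j * h \<le> real N * h" using j h by (intro mult_right_mono) (auto simp: J_def)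
            moreover have "norm (x + (- (real j * h)) *\<^sub>R e) < R" using j A(2) by (auto simp: J_def)
            moreover have "norm x \<le> norm (x + (- (real j * h)) *\<^sub>R e) + norm ((real j * h) *\<^sub>R e)"
              using norm_triangle_ineq[of "x + (- (real j * h)) *\<^sub>R e" "(real j * h) *\<^sub>R e"] by simp
            moreover have "norm ((real j * h) *\<^sub>R e) = real j * h" using e h by simp
            ultimately show ?thesis using Nh by linarith
          qed
          ultimately show ?thesis by (simp add: gJ)
        qed (simp add: gJ)
      qed
      also have "\<dots> = V" by (simp add: V_def)
      finally have "real N * measure lborel A \<le> V" using 1 by simp
      then have "r / (2 * h) * measure lborel A \<le> V"
        using mult_right_mono[OF N2, of "measure lborel A"] by simp
      then show ?thesis using h by (simp add: V_def field_simps)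
    qed
  qed
qed

text \<open>The strip is covered by the sets of points that leave \<Omega> along one given direction
  of \<open>E\<close>; the packing bound applies to each of them with h = 6 \<eta>.\<close>

lemma strip_measure:
  fixes \<Omega> :: "'a::euclidean_space set"
  assumes \<Omega>: "open \<Omega>" "\<Omega> \<subseteq> ball 0 1" and E: "escape_directions \<Omega> E r"
  obtains C where "C > 0" "\<And>\<eta>. \<eta> > 0 \<Longrightarrow> measure lborel (strip \<Omega> \<eta>) \<le> C * \<eta>"
proof -
  define C where "C = 2 * measure lborel (ball (0::'a) (1 + r)) / r * 6"
  have r: "r > 0" and fE: "finite E" using E by (auto simp: escape_directions_def)
  have C0: "C \<ge> 0" using r by (simp add: C_def)
  \<comment> \<open>The summand 1 keeps the constant positive even when the product in front of it
    is 0.\<close>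
  have "measure lborel (strip \<Omega> \<eta>) \<le> (real (card E) * C + 1) * \<eta>" if \<eta>: "\<eta> > 0" for \<eta>
  proof -
    define A where "A e = \<Omega> \<inter> (\<Inter>\<tau>\<in>{6*\<eta>..r}. {x. x + \<tau> *\<^sub>R e \<in> - \<Omega>})" for e
    have Am: "A e \<in> sets borel" for e
    proof -
      have "closed {x. x + \<tau> *\<^sub>R e \<in> - \<Omega>}" for \<tau>
        using continuous_closed_vimage[of "- \<Omega>" "\<lambda>x. x + \<tau> *\<^sub>R e"] \<Omega>(1)
        by (auto simp: vimage_def)
      then have "closed (\<Inter>\<tau>\<in>{6*\<eta>..r}. {x. x + \<tau> *\<^sub>R e \<in> - \<Omega>})" by blast
      then show ?thesis unfolding A_def using \<Omega>(1) by simp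
    qed
    have Aball: "A e \<subseteq> ball 0 1" for e using \<Omega>(2) by (auto simp: A_def)
    have Af: "A e \<in> fmeasurable lborel" for e
      using fmeasurableI2[of "ball 0 1" lborel "A e"] Am Aball emeasure_lborel_ball_finite[of "0::'a" 1]
      by (simp add: fmeasurable_def)
    have "measure lborel (strip \<Omega> \<eta>) \<le> measure lborel (\<Union>e\<in>E. A e)"
    proof (rule measure_mono_fmeasurable)
      show "strip \<Omega> \<eta> \<subseteq> (\<Union>e\<in>E. A e)"
      proof
        fix x assume x: "x \<in> strip \<Omega> \<eta>"
        then obtain e where "e \<in> E" "\<And>\<tau>. 6 * \<eta> \<le> \<tau> \<and> \<tau> \<le> r \<Longrightarrow> x + \<tau> *\<^sub>R e \<notin> \<Omega>"
          using E \<eta> unfolding escape_directions_def by blast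
        then have "x \<in> A e" using x by (auto simp: A_def strip_def)
        then show "x \<in> (\<Union>e\<in>E. A e)" using \<open>e \<in> E\<close> by blast
      qed
      show "strip \<Omega> \<eta> \<in> sets lborel" using \<Omega>(1) by simp
      show "(\<Union>e\<in>E. A e) \<in> fmeasurable lborel" using fE Af by (intro fmeasurable.finite_UN) auto
    qed
    also have "\<dots> \<le> (\<Sum>e\<in>E. measure lborel (A e))"
      using fE Am by (intro measure_UNION_le) auto
    also have "\<dots> \<le> (\<Sum>e\<in>E. C * \<eta>)"
    proof (rule sum_mono)
      fix e assume "e \<in> E"
      then have "norm e = 1" using E by (simp add: escape_directions_def)
      have "measure lborel (A e) \<le> 2 * measure lborel (ball (0::'a) (1 + r)) / r * (6 * \<eta>)"
        using \<eta> r by (intro measure_translates_disjoint[OF Am Aball \<open>norm e = 1\<close>]) (auto simp: A_def)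
      then show "measure lborel (A e) \<le> C * \<eta>" by (simp add: C_def)
    qed
    also have "\<dots> = real (card E) * C * \<eta>" by simp
    also have "\<dots> \<le> (real (card E) * C + 1) * \<eta>" using \<eta> by (simp add: distrib_right)
    finally show ?thesis .
  qed
  moreover have "real (card E) * C + 1 > 0" using C0 by (simp add: add_nonneg_pos)
  ultimately show ?thesis by (rule that[rotated])
qed

text \<open>Along an escape direction the function is 0 after length 6 \<eta>, so its value at x is
  at most the integral of the gradient over that segment. The depth grows by at most 6 \<eta> on the
  way, hence the strip of width 7 \<eta>. Summing over all of \<open>E\<close> removes the
  dependence of the direction on x; Tonelli and translation invariance do the rest.\<close>

lemma strip_poincare:
  fixes \<Omega> :: "'a::euclidean_space set"
  assumes \<Omega>: "open \<Omega>" and E: "escape_directions \<Omega> E r" and \<eta>: "0 < \<eta>" "6 * \<eta> \<le> r"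
    and \<phi>: "\<phi> \<in> test_functions \<Omega>"
  shows "(\<integral>\<^sup>+x. indicator (strip \<Omega> \<eta>) x * ennreal \<bar>\<phi> x\<bar> \<partial>lborel)
    \<le> ennreal (real (card E) * (6 * \<eta>)) * (\<integral>\<^sup>+x. indicator (strip \<Omega> (7 * \<eta>)) x * ennreal (norm (grad \<phi> x)) \<partial>lborel)"
proof -
  define T where "T = 6 * \<eta>"
  have T: "T > 0" using \<eta> by (simp add: T_def)
  obtain K where K: "smooth \<phi>" "compact K" "K \<subseteq> \<Omega>" "\<And>x. x \<notin> K \<Longrightarrow> \<phi> x = 0"
    by (rule test_functionsE[OF \<phi>]) blast
  have gz: "grad \<phi> x = 0" if "x \<notin> \<Omega>" for x
    using that K by (intro grad_zero_off[OF K(1) compact_imp_closed[OF K(2)]]) auto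
  define G where "G x = indicator (strip \<Omega> (7 * \<eta>)) x * ennreal (norm (grad \<phi> x))" for x
  have [measurable]: "grad \<phi> \<in> borel_measurable borel" by (rule grad_borel[OF K(1)])
  have [measurable]: "strip \<Omega> (7 * \<eta>) \<in> sets borel" "strip \<Omega> \<eta> \<in> sets borel" using \<Omega> by simp_all
  have [measurable]: "G \<in> borel_measurable borel" unfolding G_def by measurable
  have ftc: "ennreal \<bar>\<phi> (x + T *\<^sub>R e) - \<phi> x\<bar> \<le> (\<integral>\<^sup>+\<tau>. indicator {0..T} \<tau> * ennreal (norm (grad \<phi> (x + \<tau> *\<^sub>R e))) \<partial>lborel)"
    if e: "norm e = 1" for x e
  proof -
    have cont: "continuous_on {0..T} (\<lambda>\<tau>. dd e \<phi> (x + \<tau> *\<^sub>R e))"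
      by (intro continuous_on_compose2[OF smooth_continuous[OF smooth_dd[OF K(1)], of UNIV]] continuous_intros) auto
    have vd: "((\<lambda>\<tau>. \<phi> (x + \<tau> *\<^sub>R e)) has_vector_derivative dd e \<phi> (x + \<tau> *\<^sub>R e)) (at \<tau> within {0..T})" for \<tau>
      using smooth_line_deriv[OF K(1), of x e \<tau>]
      by (simp add: has_real_derivative_iff_has_vector_derivative has_vector_derivative_at_within)
    have hb: "has_bochner_integral lborel (\<lambda>\<tau>. indicator {0..T} \<tau> *\<^sub>R dd e \<phi> (x + \<tau> *\<^sub>R e)) (\<phi> (x + T *\<^sub>R e) - \<phi> x)"
      using has_bochner_integral_FTC_Icc[OF less_imp_le[OF T] vd cont] by simp
    have "ennreal \<bar>\<phi> (x + T *\<^sub>R e) - \<phi> x\<bar>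
        \<le> (\<integral>\<^sup>+\<tau>. norm (indicator {0..T} \<tau> *\<^sub>R dd e \<phi> (x + \<tau> *\<^sub>R e)) \<partial>lborel)"
      using integral_norm_bound_ennreal[OF integrable.intros[OF hb]]
      by (simp add: has_bochner_integral_integral_eq[OF hb] del: real_scaleR_def)
    also have "\<dots> \<le> (\<integral>\<^sup>+\<tau>. indicator {0..T} \<tau> * ennreal (norm (grad \<phi> (x + \<tau> *\<^sub>R e))) \<partial>lborel)"
    proof (rule nn_integral_mono)
      fix \<tau>
      have "\<bar>dd e \<phi> (x + \<tau> *\<^sub>R e)\<bar> \<le> norm (grad \<phi> (x + \<tau> *\<^sub>R e))"
        using Cauchy_Schwarz_ineq2[of "grad \<phi> (x + \<tau> *\<^sub>R e)" e] e
        by (simp add: grad_inner smooth_differentiable[OF K(1)])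
      then show "ennreal (norm (indicator {0..T} \<tau> *\<^sub>R dd e \<phi> (x + \<tau> *\<^sub>R e)))
          \<le> indicator {0..T} \<tau> * ennreal (norm (grad \<phi> (x + \<tau> *\<^sub>R e)))"
        by (auto simp: indicator_def)
    qed
    finally show ?thesis .
  qed
  have pt: "indicator (strip \<Omega> \<eta>) x * ennreal \<bar>\<phi> x\<bar>
      \<le> (\<Sum>e\<in>E. \<integral>\<^sup>+\<tau>. indicator {0..T} \<tau> * G (x + \<tau> *\<^sub>R e) \<partial>lborel)" for x
  proof (cases "x \<in> strip \<Omega> \<eta>")
    case True
    then obtain e where e: "e \<in> E" "\<And>\<tau>. 6 * \<eta> \<le> \<tau> \<and> \<tau> \<le> r \<Longrightarrow> x + \<tau> *\<^sub>R e \<notin> \<Omega>"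
      using E \<eta> unfolding escape_directions_def by blast
    have ne: "norm e = 1" using e(1) E by (simp add: escape_directions_def)
    have "x + T *\<^sub>R e \<notin> \<Omega>" using e(2)[of T] \<eta> by (simp add: T_def)
    then have "\<phi> (x + T *\<^sub>R e) = 0" using K(3,4) by blast
    then have "ennreal \<bar>\<phi> x\<bar> \<le> (\<integral>\<^sup>+\<tau>. indicator {0..T} \<tau> * ennreal (norm (grad \<phi> (x + \<tau> *\<^sub>R e))) \<partial>lborel)"
      using ftc[OF ne, of x] by simp
    also have "\<dots> \<le> (\<integral>\<^sup>+\<tau>. indicator {0..T} \<tau> * G (x + \<tau> *\<^sub>R e) \<partial>lborel)"
    proof (rule nn_integral_mono)
      fix \<tau> :: real
      show "indicator {0..T} \<tau> * ennreal (norm (grad \<phi> (x + \<tau> *\<^sub>R e))) \<le> indicator {0..T} \<tau> * G (x + \<tau> *\<^sub>R e)"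
      proof (cases "\<tau> \<in> {0..T} \<and> x + \<tau> *\<^sub>R e \<in> \<Omega>")
        case \<tau>: True
        have "infdist (x + \<tau> *\<^sub>R e) (- \<Omega>) \<le> infdist x (- \<Omega>) + dist (x + \<tau> *\<^sub>R e) x" by (rule infdist_triangle)
        also have "dist (x + \<tau> *\<^sub>R e) x = \<tau>" using \<tau> ne by (simp add: dist_norm)
        also have "infdist x (- \<Omega>) + \<tau> < 7 * \<eta>" using True \<tau> by (auto simp: strip_def T_def)
        finally have "x + \<tau> *\<^sub>R e \<in> strip \<Omega> (7 * \<eta>)" using \<tau> by (simp add: strip_def)
        then show ?thesis by (simp add: G_def)
      qed (auto simp: gz indicator_def)
    qed
    also have "\<dots> \<le> (\<Sum>e\<in>E. \<integral>\<^sup>+\<tau>. indicator {0..T} \<tau> * G (x + \<tau> *\<^sub>R e) \<partial>lborel)"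
      using e(1) E by (intro member_le_sum) (auto simp: escape_directions_def)
    finally show ?thesis using True by simp
  qed simp
  have trans: "(\<integral>\<^sup>+x. G (x + h) \<partial>lborel) = (\<integral>\<^sup>+x. G x \<partial>lborel)" for h
  proof -
    have *: "distr lborel lborel ((+) h) = lborel"
      using lborel_distr_plus[of h] by (simp cong: distr_cong)
    have "(\<integral>\<^sup>+x. G x \<partial>distr lborel lborel ((+) h)) = (\<integral>\<^sup>+x. G (h + x) \<partial>lborel)"
      by (rule nn_integral_distr) simp_all
    then show ?thesis by (simp add: * add.commute)
  qed
  have "(\<integral>\<^sup>+x. indicator (strip \<Omega> \<eta>) x * ennreal \<bar>\<phi> x\<bar> \<partial>lborel)
      \<le> (\<integral>\<^sup>+x. (\<Sum>e\<in>E. \<integral>\<^sup>+\<tau>. indicator {0..T} \<tau> * G (x + \<tau> *\<^sub>R e) \<partial>lborel) \<partial>lborel)"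
    by (intro nn_integral_mono pt)
  also have "\<dots> = (\<Sum>e\<in>E. \<integral>\<^sup>+x. \<integral>\<^sup>+\<tau>. indicator {0..T} \<tau> * G (x + \<tau> *\<^sub>R e) \<partial>lborel \<partial>lborel)"
    by (rule nn_integral_sum) measurable
  also have "\<dots> = (\<Sum>e\<in>E. \<integral>\<^sup>+\<tau>. \<integral>\<^sup>+x. indicator {0..T} \<tau> * G (x + \<tau> *\<^sub>R e) \<partial>lborel \<partial>lborel)"
    by (intro sum.cong refl lborel_pair.Fubini') measurable
  also have "\<dots> = (\<Sum>e\<in>E. ennreal T * (\<integral>\<^sup>+x. G x \<partial>lborel))"
  proof (rule sum.cong[OF refl])
    fix e
    have "(\<integral>\<^sup>+\<tau>. \<integral>\<^sup>+x. indicator {0..T} \<tau> * G (x + \<tau> *\<^sub>R e) \<partial>lborel \<partial>lborel)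
        = (\<integral>\<^sup>+\<tau>. (\<integral>\<^sup>+x. G x \<partial>lborel) * indicator {0..T} \<tau> \<partial>lborel)"
      by (simp add: nn_integral_cmult trans mult.commute)
    also have "\<dots> = (\<integral>\<^sup>+x. G x \<partial>lborel) * ennreal T" using T by (simp add: nn_integral_cmult)
    finally show "(\<integral>\<^sup>+\<tau>. \<integral>\<^sup>+x. indicator {0..T} \<tau> * G (x + \<tau> *\<^sub>R e) \<partial>lborel \<partial>lborel) = ennreal T * (\<integral>\<^sup>+x. G x \<partial>lborel)"
      by (simp add: mult.commute)
  qed
  also have "\<dots> = ennreal (real (card E) * (6 * \<eta>)) * (\<integral>\<^sup>+x. G x \<partial>lborel)"
    using T by (simp add: T_def ennreal_mult ennreal_of_nat_eq_real_of_nat mult.assoc)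
  finally show ?thesis by (simp add: G_def)
qed

section \<open>Mollification\<close>

definition conv :: "('a::euclidean_space \<Rightarrow> real) \<Rightarrow> ('a \<Rightarrow> real) \<Rightarrow> 'a \<Rightarrow> real" where
  "conv k g x = (\<integral>y. k (x - y) * g y \<partial>lborel)"

lemma conv_integrable:
  assumes "k \<in> test_functions UNIV" "integrable lborel g"
  shows "integrable lborel (\<lambda>y. k (x - y) * g y)"
proof -
  obtain B where B: "\<And>x. \<bar>k x\<bar> \<le> B" using test_functions_bounded[OF assms(1)] by blast
  have "(\<lambda>y. k (x - y)) \<in> borel_measurable borel"
    using smooth_borel[OF test_functions_smooth[OF assms(1)]] by measurable
  then show ?thesis using B by (rule integrable_bounded_mult[OF _ _ assms(2)])
qed

lemma dd_sum_basis:
  assumes "smooth (f :: 'a::euclidean_space \<Rightarrow> real)"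
  shows "dd v f x = (\<Sum>i\<in>Basis. (v \<bullet> i) * dd i f x)"
proof -
  have "dd v f x = grad f x \<bullet> v" by (simp add: grad_inner smooth_differentiable[OF assms])
  also have "\<dots> = (\<Sum>i\<in>Basis. (v \<bullet> i) * dd i f x)"
    by (simp add: grad_eq smooth_differentiable[OF assms] inner_sum_left)
      (simp add: inner_commute mult.commute)
  finally show ?thesis .
qed

lemma dd_dd_basis:
  assumes "smooth (f :: 'a::euclidean_space \<Rightarrow> real)"
  shows "dd v (dd v f) x = (\<Sum>i\<in>Basis. \<Sum>j\<in>Basis. (v \<bullet> i) * (v \<bullet> j) * dd i (dd j f) x)"
proof -
  have "dd v f = (\<lambda>x. \<Sum>j\<in>Basis. (v \<bullet> j) * dd j f x)" by (intro ext dd_sum_basis[OF assms])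
  moreover have "((\<lambda>x. \<Sum>j\<in>Basis. (v \<bullet> j) * dd j f x) has_derivative (\<lambda>h. \<Sum>j\<in>Basis. (v \<bullet> j) * dd h (dd j f) x)) (at x)"
    by (intro has_derivative_sum has_derivative_mult_right smooth_has_derivative smooth_dd assms)
  ultimately have "dd v (dd v f) x = (\<Sum>j\<in>Basis. (v \<bullet> j) * dd v (dd j f) x)" by (simp add: dd_eqI)
  also have "\<dots> = (\<Sum>j\<in>Basis. (v \<bullet> j) * (\<Sum>i\<in>Basis. (v \<bullet> i) * dd i (dd j f) x))"
    by (intro sum.cong refl arg_cong2[where f="(*)"] dd_sum_basis smooth_dd assms)
  also have "\<dots> = (\<Sum>i\<in>Basis. \<Sum>j\<in>Basis. (v \<bullet> i) * (v \<bullet> j) * dd i (dd j f) x)"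
    by (subst sum.swap) (simp add: sum_distrib_left mult_ac)
  finally show ?thesis .
qed

lemma test_functions_second_bound:
  assumes "k \<in> test_functions \<Omega>"
  obtains M where "M \<ge> 0" "\<And>x h. \<bar>k (x + h) - k x - dd h k x\<bar> \<le> M * (norm h)\<^sup>2"
proof -
  have sm: "smooth k" by (rule test_functions_smooth[OF assms])
  have "\<forall>i j. \<exists>B. \<forall>x. \<bar>dd i (dd j k) x\<bar> \<le> B"
    using test_functions_bounded[OF test_functions_dd[OF test_functions_dd[OF assms]]] by metis
  then obtain B where B: "\<And>i j x. \<bar>dd i (dd j k) x\<bar> \<le> B i j" by metis
  have B0: "0 \<le> B i j" for i j using B[of i j 0] by linarith
  define M where "M = (\<Sum>i\<in>Basis. \<Sum>j\<in>Basis. B i j)"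
  have M0: "M \<ge> 0" unfolding M_def by (intro sum_nonneg B0)
  have b: "\<bar>dd h (dd h k) x\<bar> \<le> M * (norm h)\<^sup>2" for h x
  proof -
    have "\<bar>dd h (dd h k) x\<bar> \<le> (\<Sum>i\<in>Basis. \<Sum>j\<in>Basis. \<bar>(h \<bullet> i) * (h \<bullet> j) * dd i (dd j k) x\<bar>)"
      unfolding dd_dd_basis[OF sm] by (intro order_trans[OF sum_abs] sum_mono order_refl)
    also have "\<dots> \<le> (\<Sum>i\<in>Basis. \<Sum>j\<in>Basis. (norm h * norm h) * B i j)"
      unfolding abs_mult using B B0 Basis_le_norm by (intro sum_mono mult_mono) auto
    also have "\<dots> = M * (norm h)\<^sup>2"
      unfolding M_def by (simp add: sum_distrib_left sum_distrib_right power2_eq_square mult_ac)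
    finally show ?thesis .
  qed
  show ?thesis
  proof (rule that[OF M0])
    fix x h
    obtain t where "k (x + 1 *\<^sub>R h) = k x + 1 * dd h k x + 1\<^sup>2 / 2 * dd h (dd h k) (x + t *\<^sub>R h)"
      by (rule second_order_taylor[OF sm])
    then have "\<bar>k (x + h) - k x - dd h k x\<bar> = \<bar>dd h (dd h k) (x + t *\<^sub>R h)\<bar> / 2" by simp
    also have "\<dots> \<le> M * (norm h)\<^sup>2 / 2" using b by (intro divide_right_mono) auto
    also have "\<dots> \<le> M * (norm h)\<^sup>2" using M0 by (simp add: mult_nonneg_nonneg)
    finally show "\<bar>k (x + h) - k x - dd h k x\<bar> \<le> M * (norm h)\<^sup>2" .
  qed
qed

text \<open>The derivative falls on the smooth kernel, so \<open>g\<close> need only be integrable.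
  The quadratic Taylor remainder of the kernel is uniform in the point, which gives
  differentiability by a direct estimate.\<close>

lemma conv_has_derivative:
  assumes k: "k \<in> test_functions UNIV" and g: "integrable lborel g"
  shows "(conv k g has_derivative (\<lambda>h. conv (dd h k) g x)) (at x)"
proof -
  have sm: "smooth k" by (rule test_functions_smooth[OF k])
  have ki: "integrable lborel (\<lambda>y. dd h k (x - y) * g y)" for h x
    by (rule conv_integrable[OF test_functions_dd[OF k] g])
  obtain M where M: "M \<ge> 0" "\<And>x h. \<bar>k (x + h) - k x - dd h k x\<bar> \<le> M * (norm h)\<^sup>2"
    using test_functions_second_bound[OF k] by blast
  define I where "I = (\<integral>y. \<bar>g y\<bar> \<partial>lborel)"
  have lin: "linear (\<lambda>h. conv (dd h k) g x)"
  proof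
    fix a b
    show "conv (dd (a + b) k) g x = conv (dd a k) g x + conv (dd b k) g x"
      using ki by (simp add: conv_def linear_add[OF dd_linear[OF sm]] distrib_right)
  next
    fix r b
    show "conv (dd (r *\<^sub>R b) k) g x = r *\<^sub>R conv (dd b k) g x"
      by (simp add: conv_def linear_scale[OF dd_linear[OF sm]] mult.assoc)
  qed
  have err: "\<bar>conv k g (x + h) - conv k g x - conv (dd h k) g x\<bar> \<le> M * I * (norm h)\<^sup>2" for h
  proof -
    have eq: "conv k g (x + h) - conv k g x - conv (dd h k) g x
        = (\<integral>y. (k ((x - y) + h) - k (x - y) - dd h k (x - y)) * g y \<partial>lborel)"
    proof -
      have e: "(k ((x - y) + h) - k (x - y) - dd h k (x - y)) * g y
          = k (x + h - y) * g y - k (x - y) * g y - dd h k (x - y) * g y" for y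
        by (simp add: left_diff_distrib diff_add_eq)
      show ?thesis
        unfolding e using conv_integrable[OF k g, of "x + h"] conv_integrable[OF k g, of x] ki
        by (simp add: conv_def)
    qed
    have "\<bar>conv k g (x + h) - conv k g x - conv (dd h k) g x\<bar> \<le> (\<integral>y. M * (norm h)\<^sup>2 * \<bar>g y\<bar> \<partial>lborel)"
      unfolding eq
    proof (rule integral_abs_bound_integral)
      show "integrable lborel (\<lambda>y. (k (x - y + h) - k (x - y) - dd h k (x - y)) * g y)"
      proof -
        have "integrable lborel (\<lambda>y. k (x + h - y) * g y - k (x - y) * g y - dd h k (x - y) * g y)"
          using conv_integrable[OF k g, of "x + h"] conv_integrable[OF k g, of x] ki by simp
        then show ?thesis by (simp add: left_diff_distrib diff_add_eq)
      qed
      show "integrable lborel (\<lambda>y. M * (norm h)\<^sup>2 * \<bar>g y\<bar>)" using g by simp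
      show "\<bar>(k (x - y + h) - k (x - y) - dd h k (x - y)) * g y\<bar> \<le> M * (norm h)\<^sup>2 * \<bar>g y\<bar>" for y
        unfolding abs_mult using M(2) by (intro mult_right_mono) auto
    qed
    also have "\<dots> = M * I * (norm h)\<^sup>2" by (simp add: I_def)
    finally show ?thesis .
  qed
  show ?thesis
    unfolding has_derivative_at
  proof (intro conjI)
    show "bounded_linear (\<lambda>h. conv (dd h k) g x)" using lin by (simp add: linear_conv_bounded_linear)
    show "(\<lambda>h. norm (conv k g (x + h) - conv k g x - conv (dd h k) g x) / norm h) \<midarrow>0\<rightarrow> 0"
    proof (rule Lim_null_comparison)
      show "\<forall>\<^sub>F h in at 0. norm (norm (conv k g (x + h) - conv k g x - conv (dd h k) g x) / norm h) \<le> M * I * norm h"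
      proof (rule always_eventually, rule allI)
        fix h
        show "norm (norm (conv k g (x + h) - conv k g x - conv (dd h k) g x) / norm h) \<le> M * I * norm h"
        proof (cases "h = 0")
          case False
          then have "norm h > 0" by simp
          then show ?thesis using err[of h] by (simp add: field_simps power2_eq_square)
        qed simp
      qed
      have "((\<lambda>h::'a. M * I * norm h) \<longlongrightarrow> M * I * norm (0::'a)) (at 0)"
        by (intro tendsto_mult tendsto_const tendsto_norm tendsto_ident_at)
      then show "((\<lambda>h::'a. M * I * norm h) \<longlongrightarrow> 0) (at 0)" by simp
    qed
  qed
qed

lemma dd_conv:
  assumes "k \<in> test_functions UNIV" "integrable lborel g"
  shows "dd v (conv k g) = conv (dd v k) g"
  using dd_eqI[OF conv_has_derivative[OF assms]] by auto

lemma smooth_conv: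
  assumes "k \<in> test_functions UNIV" "integrable lborel g"
  shows "smooth (conv k g)"
proof -
  have "Ck_on n UNIV (conv k g)" if "k \<in> test_functions UNIV" for n k
    using that
  proof (induction n arbitrary: k)
    case 0
    then show ?case
      using has_derivative_continuous[OF conv_has_derivative[OF 0 assms(2)]]
      by (simp add: continuous_at_imp_continuous_on)
  next
    case (Suc n)
    have "conv k g differentiable (at x)" for x
      using conv_has_derivative[OF Suc.prems assms(2)] by (auto simp: differentiable_def)
    moreover have "Ck_on n UNIV (dd v (conv k g))" for v
      unfolding dd_conv[OF Suc.prems assms(2)] by (intro Suc.IH test_functions_dd Suc.prems)
    ultimately show ?case by (simp add: Ck_on_Suc_dd)
  qed
  then show ?thesis using assms(1) by (simp add: smooth_on_def)
qed

lemma integral_reflect: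
  fixes f :: "'a::euclidean_space \<Rightarrow> 'b::euclidean_space"
  assumes "f \<in> borel_measurable borel"
  shows "(\<integral>y. f (x - y) \<partial>lborel) = (\<integral>y. f y \<partial>lborel)"
proof -
  have "(lborel :: 'a measure) = distr lborel borel (\<lambda>y. x + (-1) *\<^sub>R y)"
    using lborel_affine[of "-1" x] by (simp add: density_1)
  then have "(\<integral>y. f y \<partial>lborel) = (\<integral>y. f y \<partial>distr lborel borel (\<lambda>y. x + (-1) *\<^sub>R y))" by simp
  also have "\<dots> = (\<integral>y. f (x + (-1) *\<^sub>R y) \<partial>lborel)"
    by (rule integral_distr) (use assms in simp_all)
  finally show ?thesis by simp
qed

lemma conv_const:
  assumes "k \<in> test_functions UNIV"
  shows "(\<integral>y. k (x - y) \<partial>lborel) = (\<integral>y. k y \<partial>lborel)"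
  by (rule integral_reflect) (use assms test_functions_smooth smooth_borel in blast)

text \<open>Young's inequality in L^1, localised: \<open>A'\<close> contains every point that
  contributes to the convolution on \<open>A\<close>. With nonnegative integrals Tonelli needs no
  prior integrability of the convolution.\<close>

lemma conv_L1_bound:
  fixes g k :: "'a::euclidean_space \<Rightarrow> real"
  assumes k: "k \<in> test_functions UNIV" "\<And>z. 0 \<le> k z" and g: "g \<in> borel_measurable borel" "integrable lborel g"
    and A: "A \<in> sets borel" "A' \<in> sets borel"
    and supp: "\<And>x y. x \<in> A \<Longrightarrow> y \<notin> A' \<Longrightarrow> k (x - y) * g y = 0"
  shows "(\<integral>\<^sup>+x. indicator A x * ennreal \<bar>conv k g x\<bar> \<partial>lborel)
    \<le> ennreal (\<integral>y. k y \<partial>lborel) * (\<integral>\<^sup>+y. indicator A' y * ennreal \<bar>g y\<bar> \<partial>lborel)"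
proof -
  have [measurable]: "k \<in> borel_measurable borel" "g \<in> borel_measurable borel" "A \<in> sets borel" "A' \<in> sets borel"
    using k g A smooth_borel[OF test_functions_smooth[OF k(1)]] by auto
  define F where "F x y = ennreal (k (x - y)) * (indicator A' y * ennreal \<bar>g y\<bar>)" for x y
  have [measurable]: "case_prod F \<in> borel_measurable (lborel \<Otimes>\<^sub>M lborel)"
    unfolding F_def by measurable
  have "(\<integral>\<^sup>+x. indicator A x * ennreal \<bar>conv k g x\<bar> \<partial>lborel) \<le> (\<integral>\<^sup>+x. \<integral>\<^sup>+y. F x y \<partial>lborel \<partial>lborel)"
  proof (rule nn_integral_mono)
    fix x
    show "indicator A x * ennreal \<bar>conv k g x\<bar> \<le> (\<integral>\<^sup>+y. F x y \<partial>lborel)"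
    proof (cases "x \<in> A")
      case True
      have "ennreal \<bar>conv k g x\<bar> \<le> (\<integral>\<^sup>+y. norm (k (x - y) * g y) \<partial>lborel)"
        using integral_norm_bound_ennreal[OF conv_integrable[OF k(1) g(2)]] by (simp add: conv_def)
      also have "\<dots> = (\<integral>\<^sup>+y. F x y \<partial>lborel)"
      proof (rule nn_integral_cong)
        fix y
        show "ennreal (norm (k (x - y) * g y)) = F x y"
        proof (cases "y \<in> A'")
          case True
          then show ?thesis using k(2) by (simp add: F_def abs_mult ennreal_mult)
        qed (use supp[OF True] in \<open>simp add: F_def\<close>)
      qed
      finally show ?thesis using True by simp
    qed simp
  qed
  also have "\<dots> = (\<integral>\<^sup>+y. \<integral>\<^sup>+x. F x y \<partial>lborel \<partial>lborel)"
    by (rule lborel_pair.Fubini'[symmetric]) measurable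
  also have "\<dots> = (\<integral>\<^sup>+y. ennreal (\<integral>y. k y \<partial>lborel) * (indicator A' y * ennreal \<bar>g y\<bar>) \<partial>lborel)"
  proof (rule nn_integral_cong)
    fix y
    have ki: "integrable lborel (\<lambda>x. k (x - y))"
      using test_functions_integrable[OF k(1)] integrable_translate[of k "- y"] by simp
    have "(\<integral>\<^sup>+x. ennreal (k (x - y)) \<partial>lborel) = ennreal (\<integral>x. k (x - y) \<partial>lborel)"
      using ki k(2) by (intro nn_integral_eq_integral) auto
    also have "(\<integral>x. k (x - y) \<partial>lborel) = (\<integral>y. k y \<partial>lborel)"
      using integral_translate[of k "- y"] by simp
    finally show "(\<integral>\<^sup>+x. F x y \<partial>lborel) = ennreal (\<integral>y. k y \<partial>lborel) * (indicator A' y * ennreal \<bar>g y\<bar>)"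
      unfolding F_def using nn_integral_multc[of "\<lambda>x. ennreal (k (x - y))" lborel "indicator A' y * ennreal \<bar>g y\<bar>"]
      by simp
  qed
  also have "\<dots> = ennreal (\<integral>y. k y \<partial>lborel) * (\<integral>\<^sup>+y. indicator A' y * ennreal \<bar>g y\<bar> \<partial>lborel)"
    by (rule nn_integral_cmult) measurable
  finally show ?thesis .
qed

definition bump :: "'a::euclidean_space \<Rightarrow> real" where
  "bump x = expm 0 (1 - x \<bullet> x)"

definition mollifier :: "real \<Rightarrow> 'a::euclidean_space \<Rightarrow> real" where
  "mollifier s x = bump ((1 / s) *\<^sub>R x) / (\<integral>y. bump ((1 / s) *\<^sub>R (y :: 'a)) \<partial>lborel)"

lemma smooth_bump: "smooth (bump :: 'a::euclidean_space \<Rightarrow> real)"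
  unfolding bump_def[abs_def]
  by (intro smooth_compose[OF smooth_diff[OF smooth_const smooth_inner_self] smooth_expm])

lemma bump_zero: "1 \<le> norm x \<Longrightarrow> bump x = 0"
  by (simp add: bump_def expm_def norm_eq_sqrt_inner)

lemma bump_nonneg: "0 \<le> bump x"
  by (simp add: bump_def expm_def)

lemma bump_test: "(bump :: 'a::euclidean_space \<Rightarrow> real) \<in> test_functions UNIV"
  by (rule test_functionsI[OF smooth_bump, of "cball 0 1"]) (auto intro: bump_zero)

lemma scaled_test:
  fixes f :: "'a::euclidean_space \<Rightarrow> real"
  assumes "f \<in> test_functions UNIV" "\<And>x. 1 \<le> norm x \<Longrightarrow> f x = 0" "s > 0"
  shows "(\<lambda>x. f ((1 / s) *\<^sub>R x)) \<in> test_functions UNIV" "\<And>x. s \<le> norm x \<Longrightarrow> f ((1 / s) *\<^sub>R x) = 0"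
proof -
  show *: "f ((1 / s) *\<^sub>R x) = 0" if "s \<le> norm x" for x
    using that assms(3) by (intro assms(2)) (simp add: field_simps)
  show "(\<lambda>x. f ((1 / s) *\<^sub>R x)) \<in> test_functions UNIV"
  proof (rule test_functionsI[of _ "cball 0 s"])
    show "smooth (\<lambda>x. f ((1 / s) *\<^sub>R x))"
      using smooth_affine[OF test_functions_smooth[OF assms(1)], of "1 / s" 0] by simp
  qed (use * in auto)
qed

text \<open>A lower bound of the right order replaces the exact scaling of the integral: on the ball
  of radius s/2 the rescaled point has squared norm at most 1/4, which explains the value
  3/4.\<close>

lemma bump_integral_lower:
  obtains c where "c > 0" "\<And>s. s > 0 \<Longrightarrow> c * s ^ DIM('a) \<le> (\<integral>y. bump ((1 / s) *\<^sub>R (y :: 'a::euclidean_space)) \<partial>lborel)"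
proof -
  define c where "c = expm 0 (3/4) * (unit_ball_vol (real DIM('a)) * (1/2) ^ DIM('a))"
  have e: "expm 0 (3/4) > 0" by (simp add: expm_def)
  have "c > 0" using e by (simp add: c_def)
  moreover have "c * s ^ DIM('a) \<le> (\<integral>y. bump ((1 / s) *\<^sub>R (y :: 'a)) \<partial>lborel)" if s: "s > 0" for s
  proof -
    have "c * s ^ DIM('a) = expm 0 (3/4) * measure lborel (ball (0::'a) (s / 2))"
      using s by (simp add: c_def content_ball power_divide)
    also have "\<dots> = (\<integral>y. expm 0 (3/4) * indicator (ball (0::'a) (s/2)) y \<partial>lborel)" by simp
    also have "\<dots> \<le> (\<integral>y. bump ((1 / s) *\<^sub>R (y :: 'a)) \<partial>lborel)"
    proof (rule integral_mono)
      show "integrable lborel (\<lambda>y::'a. expm 0 (3/4) * indicator (ball 0 (s/2)) y)"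
        using emeasure_lborel_ball_finite[of "0::'a" "s/2"] by simp
      show "integrable lborel (\<lambda>y::'a. bump ((1 / s) *\<^sub>R y))"
        by (rule test_functions_integrable[OF scaled_test(1)[OF bump_test bump_zero s]])
      fix y :: 'a
      show "expm 0 (3/4) * indicator (ball 0 (s/2)) y \<le> bump ((1 / s) *\<^sub>R y)"
      proof (cases "norm y < s / 2")
        case True
        define z where "z = (1 / s) *\<^sub>R y"
        have "norm z \<le> 1 / 2" using True s by (simp add: z_def field_simps)
        then have "(norm z)\<^sup>2 \<le> (1 / 2)\<^sup>2" by (intro power_mono) auto
        moreover have "(1 / 2 :: real)\<^sup>2 = 1 / 4" by (simp add: power2_eq_square)
        ultimately have zz: "z \<bullet> z \<le> 1 / 4" by (simp only: power2_norm_eq_inner)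
        then have "inverse (1 - z \<bullet> z) \<le> inverse (3 / 4)" by (intro le_imp_inverse_le) auto
        then have "expm 0 (3/4) \<le> bump z" using zz by (simp add: bump_def expm_def)
        then show ?thesis using True by (simp add: z_def)
      qed (simp add: bump_nonneg)
    qed
    finally show ?thesis .
  qed
  ultimately show ?thesis by (rule that)
qed

lemma mollifier:
  assumes s: "s > 0"
  shows mollifier_test: "(mollifier s :: 'a::euclidean_space \<Rightarrow> real) \<in> test_functions UNIV"
    and mollifier_nonneg: "0 \<le> mollifier s (x :: 'a)"
    and mollifier_zero: "s \<le> norm (x :: 'a) \<Longrightarrow> mollifier s x = 0"
    and mollifier_integral: "(\<integral>y. mollifier s (y :: 'a) \<partial>lborel) = 1"
proof -
  define I where "I = (\<integral>y. bump ((1 / s) *\<^sub>R (y :: 'a)) \<partial>lborel)"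
  have I: "I > 0"
  proof -
    obtain c where "c > 0" "c * s ^ DIM('a) \<le> I"
      using bump_integral_lower[where 'a='a] s unfolding I_def by metis
    moreover have "c * s ^ DIM('a) > 0" using s \<open>c > 0\<close> by simp
    ultimately show ?thesis by linarith
  qed
  have eq: "mollifier s = (\<lambda>x::'a. bump ((1 / s) *\<^sub>R x) / I)" by (auto simp: mollifier_def I_def)
  have bt: "(\<lambda>x::'a. bump ((1 / s) *\<^sub>R x)) \<in> test_functions UNIV"
    by (rule scaled_test(1)[OF bump_test bump_zero s])
  show "(mollifier s :: 'a \<Rightarrow> real) \<in> test_functions UNIV"
    using test_functions_add[OF bt bt, of "1 / I" 0] by (simp add: eq)
  show "0 \<le> mollifier s x" unfolding eq using I by (intro divide_nonneg_pos bump_nonneg)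
  show "mollifier s x = 0" if "s \<le> norm x"
    using scaled_test(2)[OF bump_test bump_zero s that] by (simp add: eq)
  show "(\<integral>y. mollifier s (y :: 'a) \<partial>lborel) = 1" using I by (simp add: eq I_def[symmetric])
qed

text \<open>Each derivative brings a factor 1/s. The volume of the support and the lower bound of
  the normalising integral are of the same order in s, so the dimension cancels in the L^1
  norm.\<close>

lemma mollifier_derivative_bounds:
  obtains C where "C > 0"
    "\<And>s i. s > 0 \<Longrightarrow> i \<in> Basis \<Longrightarrow> (\<integral>y. \<bar>dd i (mollifier s) (y :: 'a::euclidean_space)\<bar> \<partial>lborel) \<le> C / s"
    "\<And>s i. s > 0 \<Longrightarrow> i \<in> Basis \<Longrightarrow> (\<integral>y. \<bar>dd i (dd i (mollifier s)) (y :: 'a)\<bar> \<partial>lborel) \<le> C / s\<^sup>2"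
proof -
  obtain c where c: "c > 0" "\<And>s. s > 0 \<Longrightarrow> c * s ^ DIM('a) \<le> (\<integral>y. bump ((1 / s) *\<^sub>R (y :: 'a)) \<partial>lborel)"
    using bump_integral_lower[where 'a='a] by blast
  have "\<forall>i::'a. \<exists>B. \<forall>x. \<bar>dd i bump x\<bar> \<le> B"
    using test_functions_bounded[OF test_functions_dd[OF bump_test]] by metis
  then obtain B1 where B1: "\<And>(i::'a) x. \<bar>dd i bump x\<bar> \<le> B1 i" by metis
  have "\<forall>i::'a. \<exists>B. \<forall>x. \<bar>dd i (dd i bump) x\<bar> \<le> B"
    using test_functions_bounded[OF test_functions_dd[OF test_functions_dd[OF bump_test]]] by metis
  then obtain B2 where B2: "\<And>(i::'a) x. \<bar>dd i (dd i bump) x\<bar> \<le> B2 i" by metis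
  define B where "B = (\<Sum>i\<in>(Basis::'a set). B1 i + B2 i)"
  have B10: "0 \<le> B1 i" "0 \<le> B2 i" for i using B1[of i 0] B2[of i 0] by linarith+
  have BB: "\<bar>dd i bump x\<bar> \<le> B" "\<bar>dd i (dd i bump) x\<bar> \<le> B" if "i \<in> Basis" for i x :: 'a
  proof -
    have "B1 i + B2 i \<le> B" unfolding B_def using that B10 by (intro member_le_sum) auto
    then show "\<bar>dd i bump x\<bar> \<le> B" "\<bar>dd i (dd i bump) x\<bar> \<le> B"
      using B1[of i x] B2[of i x] B10[of i] by linarith+
  qed
  define V where "V = unit_ball_vol (real DIM('a))"
  have V: "V > 0" by (simp add: V_def)
  define C where "C = B * V / c + 1"
  have B0: "B \<ge> 0" unfolding B_def using B10 by (intro sum_nonneg) auto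
  have C: "C > 0" using B0 V c by (simp add: C_def add_nonneg_pos)
  \<comment> \<open>Both orders of differentiation are instances, with q = 1/s and q =
    1/s^2.\<close>
  have main: "(\<integral>y. \<bar>f y\<bar> \<partial>lborel) \<le> C * q"
    if s: "s > 0" and q: "q \<ge> 0" and f: "\<And>y::'a. \<bar>f y\<bar> \<le> q * B / (\<integral>y. bump ((1 / s) *\<^sub>R (y :: 'a)) \<partial>lborel)"
      and f0: "\<And>y. s < norm y \<Longrightarrow> f y = 0" and ft: "f \<in> test_functions UNIV" for s q and f :: "'a \<Rightarrow> real"
  proof -
    define I where "I = (\<integral>y. bump ((1 / s) *\<^sub>R (y :: 'a)) \<partial>lborel)"
    have cs: "c * s ^ DIM('a) > 0" using c s by simp
    have I: "c * s ^ DIM('a) \<le> I" "I > 0" using c(2)[OF s] cs unfolding I_def by linarith+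
    have "(\<integral>y. \<bar>f y\<bar> \<partial>lborel) \<le> (\<integral>y. (q * B / I) * indicator (cball (0::'a) s) y \<partial>lborel)"
    proof (rule integral_mono)
      show "integrable lborel (\<lambda>y. \<bar>f y\<bar>)" using test_functions_integrable[OF ft] by simp
      show "integrable lborel (\<lambda>y::'a. (q * B / I) * indicator (cball 0 s) y)"
        using emeasure_lborel_cball_finite[of "0::'a" s] by simp
      show "\<bar>f y\<bar> \<le> (q * B / I) * indicator (cball 0 s) y" for y
        using f[of y] f0[of y] by (cases "norm y \<le> s") (auto simp: I_def)
    qed
    also have "\<dots> = (q * B / I) * (V * s ^ DIM('a))" using s by (simp add: content_cball V_def)
    also have "\<dots> \<le> (q * B / (c * s ^ DIM('a))) * (V * s ^ DIM('a))"
      using I cs q B0 V s by (intro mult_right_mono divide_left_mono) auto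
    also have "\<dots> = (B * V / c) * q" using s c by (simp add: field_simps)
    also have "\<dots> \<le> C * q" using q by (intro mult_right_mono) (auto simp: C_def)
    finally show ?thesis .
  qed
  have sm: "smooth (bump :: 'a \<Rightarrow> real)" by (rule smooth_bump)
  have d1: "dd i (mollifier s) = (\<lambda>x. dd i bump ((1 / s) *\<^sub>R x) * (1 / s) / (\<integral>y. bump ((1 / s) *\<^sub>R (y :: 'a)) \<partial>lborel))"
    for s and i :: 'a
  proof
    fix x :: 'a
    let ?c = "1 / (\<integral>y. bump ((1 / s) *\<^sub>R (y :: 'a)) \<partial>lborel)"
    have meq: "mollifier s = (\<lambda>x::'a. bump ((1 / s) *\<^sub>R x + 0) * ?c)" by (intro ext) (simp add: mollifier_def)
    have "((\<lambda>x. bump ((1 / s) *\<^sub>R x + 0)) has_derivative (\<lambda>v. dd v (\<lambda>x. bump ((1 / s) *\<^sub>R x + 0)) x)) (at x)"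
      by (intro differentiable_dd dd_affine(2) smooth_differentiable sm)
    then have "((\<lambda>x. bump ((1 / s) *\<^sub>R x + 0) * ?c) has_derivative
        (\<lambda>v. dd v (\<lambda>x. bump ((1 / s) *\<^sub>R x + 0)) x * ?c)) (at x)"
      by (rule has_derivative_mult_left)
    then have "dd i (mollifier s) x = dd i (\<lambda>x. bump ((1 / s) *\<^sub>R x + 0)) x * ?c"
      unfolding meq by (rule dd_eqI)
    then show "dd i (mollifier s) x = dd i bump ((1 / s) *\<^sub>R x) * (1 / s) / (\<integral>y. bump ((1 / s) *\<^sub>R (y :: 'a)) \<partial>lborel)"
      using dd_affine(1)[OF smooth_differentiable[OF sm], of i "1/s" 0 x] by (simp add: mult.commute)
  qed
  have d2: "dd i (dd i (mollifier s)) = (\<lambda>x. dd i (dd i bump) ((1 / s) *\<^sub>R x) * (1 / s) * (1 / s) / (\<integral>y. bump ((1 / s) *\<^sub>R (y :: 'a)) \<partial>lborel))"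
    for s and i :: 'a
  proof
    fix x :: 'a
    let ?c = "1 / s / (\<integral>y. bump ((1 / s) *\<^sub>R (y :: 'a)) \<partial>lborel)"
    have d1eq: "dd i (mollifier s) = (\<lambda>x. dd i bump ((1 / s) *\<^sub>R x + 0) * ?c)" by (intro ext) (simp add: d1)
    have "((\<lambda>x. dd i bump ((1 / s) *\<^sub>R x + 0)) has_derivative (\<lambda>v. dd v (\<lambda>x. dd i bump ((1 / s) *\<^sub>R x + 0)) x)) (at x)"
      by (intro differentiable_dd dd_affine(2) smooth_differentiable smooth_dd sm)
    then have "((\<lambda>x. dd i bump ((1 / s) *\<^sub>R x + 0) * ?c) has_derivative
        (\<lambda>v. dd v (\<lambda>x. dd i bump ((1 / s) *\<^sub>R x + 0)) x * ?c)) (at x)"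
      by (rule has_derivative_mult_left)
    then have "dd i (dd i (mollifier s)) x = dd i (\<lambda>x. dd i bump ((1 / s) *\<^sub>R x + 0)) x * ?c"
      unfolding d1eq by (rule dd_eqI)
    then show "dd i (dd i (mollifier s)) x = dd i (dd i bump) ((1 / s) *\<^sub>R x) * (1 / s) * (1 / s) / (\<integral>y. bump ((1 / s) *\<^sub>R (y :: 'a)) \<partial>lborel)"
      using dd_affine(1)[OF smooth_differentiable[OF smooth_dd[OF sm]], of i i "1/s" 0 x] by (simp add: mult_ac)
  qed
  show ?thesis
  proof (rule that[OF C])
    fix s :: real and i :: 'a assume s: "s > 0" and i: "i \<in> Basis"
    define I where "I = (\<integral>y. bump ((1 / s) *\<^sub>R (y :: 'a)) \<partial>lborel)"
    have "c * s ^ DIM('a) > 0" using c s by simp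
    then have I: "I > 0" using c(2)[OF s] unfolding I_def by linarith
    have mt: "dd i (mollifier s) \<in> test_functions UNIV" "dd i (dd i (mollifier s)) \<in> test_functions UNIV"
      by (intro test_functions_dd mollifier_test[OF s])+
    have z1: "dd i (mollifier s) y = 0" if "y \<notin> cball 0 s" for y
      by (rule dd_zero_off[OF closed_cball _ that]) (auto intro: mollifier_zero[OF s])
    have z2: "dd i (dd i (mollifier s)) y = 0" if "y \<notin> cball 0 s" for y
      by (rule dd_zero_off[OF closed_cball z1 that])
    have "\<bar>dd i (mollifier s) y\<bar> \<le> (1 / s) * B / I" for y
      unfolding d1 I_def[symmetric] using BB(1)[OF i, of "(1 / s) *\<^sub>R y"] s I
      by (simp add: abs_mult field_simps)
    then have "(\<integral>y. \<bar>dd i (mollifier s) y\<bar> \<partial>lborel) \<le> C * (1 / s)"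
      using s by (intro main[OF s _ _ _ mt(1)] z1) (auto simp: I_def)
    then show "(\<integral>y. \<bar>dd i (mollifier s) (y :: 'a)\<bar> \<partial>lborel) \<le> C / s" by simp
    have "\<bar>dd i (dd i (mollifier s)) y\<bar> \<le> (1 / s\<^sup>2) * B / I" for y
      unfolding d2 I_def[symmetric] using BB(2)[OF i, of "(1 / s) *\<^sub>R y"] s I
      by (simp add: abs_mult field_simps power2_eq_square)
    then have "(\<integral>y. \<bar>dd i (dd i (mollifier s)) y\<bar> \<partial>lborel) \<le> C * (1 / s\<^sup>2)"
      using s by (intro main[OF s _ _ _ mt(2)] z2) (auto simp: I_def)
    then show "(\<integral>y. \<bar>dd i (dd i (mollifier s)) (y :: 'a)\<bar> \<partial>lborel) \<le> C / s\<^sup>2" by simp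
  qed
qed

section \<open>Hoelder's inequality, estimates in L^1 and cut-off functions\<close>

lemma holder_inequality:
  fixes f g :: "'a \<Rightarrow> real"
  assumes p: "1 < p" "1 / p + 1 / q = 1" "1 < q"
    and f: "f \<in> borel_measurable M" "\<And>x. 0 \<le> f x" "integrable M (\<lambda>x. f x powr p)"
    and g: "g \<in> borel_measurable M" "\<And>x. 0 \<le> g x" "integrable M (\<lambda>x. g x powr q)"
  shows "integrable M (\<lambda>x. f x * g x)"
    and "(\<integral>x. f x * g x \<partial>M) \<le> (\<integral>x. f x powr p \<partial>M) powr (1 / p) * (\<integral>x. g x powr q \<partial>M) powr (1 / q)"
proof -
  have young: "a * b \<le> a powr p / p + b powr q / q" if "0 \<le> a" "0 \<le> b" for a b
    using Youngs_inequality[of p q a b] p that by auto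
  show int: "integrable M (\<lambda>x. f x * g x)"
  proof (rule Bochner_Integration.integrable_bound)
    show "integrable M (\<lambda>x. f x powr p / p + g x powr q / q)" using f g by auto
    show "(\<lambda>x. f x * g x) \<in> borel_measurable M" using f g by auto
    show "AE x in M. norm (f x * g x) \<le> norm (f x powr p / p + g x powr q / q)"
      using young f(2) g(2) p by (intro AE_I2) (auto simp: abs_mult intro!: order_trans[OF _ abs_ge_self])
  qed
  define F where "F = (\<integral>x. f x powr p \<partial>M)"
  define H where "H = (\<integral>x. g x powr q \<partial>M)"
  have F0: "F \<ge> 0" and H0: "H \<ge> 0" by (simp_all add: F_def H_def)
  show "(\<integral>x. f x * g x \<partial>M) \<le> (\<integral>x. f x powr p \<partial>M) powr (1 / p) * (\<integral>x. g x powr q \<partial>M) powr (1 / q)"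
  proof (cases "F = 0 \<or> H = 0")
    case True
    have "AE x in M. f x * g x = 0"
      using True
    proof
      assume "F = 0"
      then have "AE x in M. f x powr p = 0"
        using integral_nonneg_eq_0_iff_AE[OF f(3)] by (simp add: F_def)
      then show ?thesis by eventually_elim auto
    next
      assume "H = 0"
      then have "AE x in M. g x powr q = 0"
        using integral_nonneg_eq_0_iff_AE[OF g(3)] by (simp add: H_def)
      then show ?thesis by eventually_elim auto
    qed
    then have "(\<integral>x. f x * g x \<partial>M) = 0" by (rule integral_eq_zero_AE)
    then show ?thesis by simp
  next
    case False
    then have FH: "F > 0" "H > 0" using F0 H0 by auto
    define a where "a = F powr (1 / p)"
    define b where "b = H powr (1 / q)"
    have ab: "a > 0" "b > 0" "a powr p = F" "b powr q = H"
      using FH p by (simp_all add: a_def b_def powr_powr)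
    have "(\<integral>x. f x * g x \<partial>M) \<le> (\<integral>x. (a * b) * (f x powr p / (p * F) + g x powr q / (q * H)) \<partial>M)"
    proof (rule integral_mono[OF int])
      show "integrable M (\<lambda>x. (a * b) * (f x powr p / (p * F) + g x powr q / (q * H)))" using f g by auto
      fix x
      have "(f x / a) * (g x / b) \<le> (f x / a) powr p / p + (g x / b) powr q / q"
        using f(2) g(2) ab by (intro young) auto
      moreover have "(f x / a) powr p = f x powr p / F" "(g x / b) powr q = g x powr q / H"
        using f(2)[of x] g(2)[of x] ab by (simp_all add: powr_divide)
      ultimately have "(f x / a) * (g x / b) \<le> f x powr p / (p * F) + g x powr q / (q * H)"
        by (simp add: mult.commute)
      then have "(a * b) * ((f x / a) * (g x / b)) \<le> (a * b) * (f x powr p / (p * F) + g x powr q / (q * H))"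
        using ab by (intro mult_left_mono) auto
      then show "f x * g x \<le> (a * b) * (f x powr p / (p * F) + g x powr q / (q * H))" using ab by simp
    qed
    also have "\<dots> = (a * b) * (F / (p * F) + H / (q * H))"
      using f g by (simp add: F_def H_def)
    also have "F / (p * F) + H / (q * H) = 1" using FH p by simp
    finally show ?thesis by (simp add: a_def b_def F_def H_def)
  qed
qed

lemma integral_le_of_nn_integral_le:
  assumes "integrable M f" "integrable M g" "\<And>x. 0 \<le> f x" "\<And>x. 0 \<le> g x" "0 \<le> c"
    and "(\<integral>\<^sup>+x. ennreal (f x) \<partial>M) \<le> ennreal c * (\<integral>\<^sup>+x. ennreal (g x) \<partial>M)"
  shows "(\<integral>x. f x \<partial>M) \<le> c * (\<integral>x. g x \<partial>M)"
proof -
  have "ennreal (\<integral>x. f x \<partial>M) \<le> ennreal (c * (\<integral>x. g x \<partial>M))"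
    using assms by (simp add: nn_integral_eq_integral ennreal_mult integral_nonneg)
  then show ?thesis
    using assms by (subst (asm) ennreal_le_iff) (auto intro!: mult_nonneg_nonneg Bochner_Integration.integral_nonneg)
qed

lemma strip_poincare_real:
  fixes \<Omega> :: "'a::euclidean_space set"
  assumes \<Omega>: "open \<Omega>" and E: "escape_directions \<Omega> E r" and \<eta>: "0 < \<eta>" "6 * \<eta> \<le> r"
    and \<phi>: "\<phi> \<in> test_functions \<Omega>"
  shows "(\<integral>x. indicator (strip \<Omega> \<eta>) x * \<bar>\<phi> x\<bar> \<partial>lborel)
    \<le> (real (card E) * (6 * \<eta>)) * (\<integral>x. indicator (strip \<Omega> (7 * \<eta>)) x * norm (grad \<phi> x) \<partial>lborel)"
proof (rule integral_le_of_nn_integral_le)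
  show "integrable lborel (\<lambda>x. indicator (strip \<Omega> \<eta>) x * \<bar>\<phi> x\<bar>)"
    using integrable_mult_indicator[of "strip \<Omega> \<eta>" lborel "\<lambda>x. \<bar>\<phi> x\<bar>"] test_functions_integrable[OF \<phi>] \<Omega> by simp
  show "integrable lborel (\<lambda>x. indicator (strip \<Omega> (7 * \<eta>)) x * norm (grad \<phi> x))"
    using integrable_mult_indicator[of "strip \<Omega> (7 * \<eta>)" lborel "\<lambda>x. norm (grad \<phi> x)"] test_functions_grad_integrable[OF \<phi>] \<Omega> by simp
  show "(\<integral>\<^sup>+x. ennreal (indicator (strip \<Omega> \<eta>) x * \<bar>\<phi> x\<bar>) \<partial>lborel)
      \<le> ennreal (real (card E) * (6 * \<eta>)) * (\<integral>\<^sup>+x. ennreal (indicator (strip \<Omega> (7 * \<eta>)) x * norm (grad \<phi> x)) \<partial>lborel)"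
    using strip_poincare[OF assms] by (simp add: ennreal_mult ennreal_indicator)
qed (use \<eta> in auto)

lemma conv_borel:
  assumes "k \<in> test_functions UNIV" "integrable lborel g"
  shows "conv k g \<in> borel_measurable borel"
  by (rule smooth_borel[OF smooth_conv[OF assms]])

lemma conv_mollifier_L1:
  fixes g :: "'a::euclidean_space \<Rightarrow> real"
  assumes s: "s > 0" and g: "g \<in> borel_measurable borel" "integrable lborel g"
    and A: "A \<in> sets borel" "A' \<in> sets borel"
    and supp: "\<And>x y. x \<in> A \<Longrightarrow> norm (x - y) < s \<Longrightarrow> y \<notin> A' \<Longrightarrow> g y = 0"
  shows "integrable lborel (\<lambda>x. indicator A x * \<bar>conv (mollifier s) g x\<bar>)"
    and "(\<integral>x. indicator A x * \<bar>conv (mollifier s) g x\<bar> \<partial>lborel) \<le> (\<integral>x. indicator A' x * \<bar>g x\<bar> \<partial>lborel)"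
proof -
  have supp': "mollifier s (x - y) * g y = 0" if "x \<in> A" "y \<notin> A'" for x y
    using supp[OF that(1) _ that(2)] mollifier_zero[OF s, of "x - y"] by (cases "norm (x - y) < s") auto
  have nn: "(\<integral>\<^sup>+x. ennreal (indicator A x * \<bar>conv (mollifier s) g x\<bar>) \<partial>lborel)
      \<le> ennreal 1 * (\<integral>\<^sup>+y. ennreal (indicator A' y * \<bar>g y\<bar>) \<partial>lborel)"
    using conv_L1_bound[OF mollifier_test[OF s] mollifier_nonneg[OF s] g A supp'] mollifier_integral[OF s, where 'a='a]
    by (simp add: ennreal_mult ennreal_indicator)
  have gi: "integrable lborel (\<lambda>x. indicator A' x * \<bar>g x\<bar>)"
    using integrable_mult_indicator[of A' lborel "\<lambda>x. \<bar>g x\<bar>"] g A by simp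
  show i: "integrable lborel (\<lambda>x. indicator A x * \<bar>conv (mollifier s) g x\<bar>)"
  proof (rule integrableI_nonneg)
    show "(\<lambda>x. indicator A x * \<bar>conv (mollifier s) g x\<bar>) \<in> borel_measurable lborel"
      using conv_borel[OF mollifier_test[OF s] g(2)] A by simp
    have "(\<integral>\<^sup>+y. ennreal (indicator A' y * \<bar>g y\<bar>) \<partial>lborel) < \<infinity>"
      using gi by (simp add: nn_integral_eq_integral)
    then show "(\<integral>\<^sup>+x. ennreal (indicator A x * \<bar>conv (mollifier s) g x\<bar>) \<partial>lborel) < \<infinity>"
      using nn by (simp add: le_less_trans)
  qed simp
  show "(\<integral>x. indicator A x * \<bar>conv (mollifier s) g x\<bar> \<partial>lborel) \<le> (\<integral>x. indicator A' x * \<bar>g x\<bar> \<partial>lborel)"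
    using integral_le_of_nn_integral_le[OF i gi _ _ _ nn] by simp
qed

lemma L1_limit_bounded_mult:
  fixes f :: "'a::euclidean_space \<Rightarrow> real"
  assumes f: "integrable lborel f" "\<And>n. integrable lborel (F n)" "(\<lambda>n::nat. \<integral>x. \<bar>f x - F n x\<bar> \<partial>lborel) \<longlonglongrightarrow> 0"
    and h: "h \<in> borel_measurable borel" "\<And>x. \<bar>h x\<bar> \<le> B"
  shows "(\<lambda>n. \<integral>x. h x * F n x \<partial>lborel) \<longlonglongrightarrow> (\<integral>x. h x * f x \<partial>lborel)"
proof -
  have i1: "integrable lborel (\<lambda>x. h x * f x)" "integrable lborel (\<lambda>x. h x * F n x)" for n
    using integrable_bounded_mult[OF h] f by blast+
  have "(\<lambda>n. (\<integral>x. h x * F n x \<partial>lborel) - (\<integral>x. h x * f x \<partial>lborel)) \<longlonglongrightarrow> 0"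
  proof (rule Lim_null_comparison)
    show "(\<lambda>n. B * (\<integral>x. \<bar>f x - F n x\<bar> \<partial>lborel)) \<longlonglongrightarrow> 0"
      using tendsto_mult_right_zero[OF f(3)] by simp
    show "\<forall>\<^sub>F n in sequentially. norm ((\<integral>x. h x * F n x \<partial>lborel) - (\<integral>x. h x * f x \<partial>lborel)) \<le> B * (\<integral>x. \<bar>f x - F n x\<bar> \<partial>lborel)"
    proof (rule always_eventually, rule allI)
      fix n
      have "(\<integral>x. h x * F n x \<partial>lborel) - (\<integral>x. h x * f x \<partial>lborel) = (\<integral>x. h x * F n x - h x * f x \<partial>lborel)"
        using i1 by simp
      also have "norm \<dots> \<le> (\<integral>x. B * \<bar>f x - F n x\<bar> \<partial>lborel)"
        unfolding real_norm_def
      proof (rule integral_abs_bound_integral)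
        show "integrable lborel (\<lambda>x. h x * F n x - h x * f x)" using i1 by simp
        show "integrable lborel (\<lambda>x. B * \<bar>f x - F n x\<bar>)" using f by simp
        show "\<bar>h x * F n x - h x * f x\<bar> \<le> B * \<bar>f x - F n x\<bar>" for x
          unfolding right_diff_distrib[symmetric] abs_mult using h(2)
          by (subst abs_minus_commute) (intro mult_right_mono; simp)
      qed
      finally show "norm ((\<integral>x. h x * F n x \<partial>lborel) - (\<integral>x. h x * f x \<partial>lborel)) \<le> B * (\<integral>x. \<bar>f x - F n x\<bar> \<partial>lborel)"
        by simp
    qed
  qed
  then show ?thesis by (simp add: LIM_zero_iff)
qed

lemma lap_mult:
  assumes "smooth f" "smooth g"
  shows "lap (\<lambda>x. f x * g x) x = f x * lap g x + 2 * (\<Sum>i\<in>Basis. dd i f x * dd i g x) + g x * lap f x"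
proof -
  have "dd i (\<lambda>x. f x * g x) = (\<lambda>x. f x * dd i g x + dd i f x * g x)" for i
    using assms by (auto simp: dd_mult smooth_differentiable)
  then have "dd i (dd i (\<lambda>x. f x * g x)) x
      = f x * dd i (dd i g) x + 2 * (dd i f x * dd i g x) + g x * dd i (dd i f) x" for i
    using assms by (simp add: dd_add dd_mult smooth_differentiable smooth_dd smooth_mult)
  then show ?thesis
    by (simp add: lap_def sum.distrib sum_distrib_left)
qed

lemma test_reflect:
  assumes k: "k \<in> test_functions UNIV"
  shows "(\<lambda>y. k (x - y)) \<in> test_functions UNIV" "dd v (\<lambda>y. k (x - y)) y = - dd v k (x - y)"
proof -
  have sm: "smooth k" by (rule test_functions_smooth[OF k])
  obtain R where R: "R > 0" "\<And>x. norm x \<ge> R \<Longrightarrow> k x = 0" using test_functions_support_bounded[OF k] by blast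
  have eq: "(\<lambda>y. k (x - y)) = (\<lambda>y. k ((-1) *\<^sub>R y + x))" by simp
  show "(\<lambda>y. k (x - y)) \<in> test_functions UNIV"
  proof (rule test_functionsI[of _ "cball x R"])
    show "smooth (\<lambda>y. k (x - y))" unfolding eq by (rule smooth_affine[OF sm])
    show "k (x - y) = 0" if "y \<notin> cball x R" for y using that by (intro R(2)) (simp add: dist_norm)
  qed auto
  show "dd v (\<lambda>y. k (x - y)) y = - dd v k (x - y)"
    unfolding eq using dd_affine(1)[OF smooth_differentiable[OF sm], of v "-1" x y] by simp
qed

lemma test_lipschitz:
  assumes "\<phi> \<in> test_functions \<Omega>"
  obtains L where "L \<ge> 0" "\<And>x y. \<bar>\<phi> x - \<phi> y\<bar> \<le> L * norm (x - y)"
proof -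
  have sm: "smooth \<phi>" by (rule test_functions_smooth[OF assms])
  have "\<forall>i. \<exists>B. \<forall>x. \<bar>dd i \<phi> x\<bar> \<le> B"
    using test_functions_bounded[OF test_functions_dd[OF assms]] by metis
  then obtain B where B: "\<And>i x. \<bar>dd i \<phi> x\<bar> \<le> B i" by metis
  have B0: "0 \<le> B i" for i using B[of i 0] by linarith
  define L where "L = (\<Sum>i\<in>Basis. B i)"
  have b: "\<bar>dd h \<phi> x\<bar> \<le> L * norm h" for h x
  proof -
    have "\<bar>dd h \<phi> x\<bar> = \<bar>\<Sum>i\<in>Basis. (h \<bullet> i) * dd i \<phi> x\<bar>" by (subst dd_sum_basis[OF sm]) simp
    also have "\<dots> \<le> (\<Sum>i\<in>Basis. norm h * B i)"
      by (intro order_trans[OF sum_abs] sum_mono) (simp add: abs_mult mult_mono B Basis_le_norm)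
    finally show ?thesis by (simp add: L_def sum_distrib_left mult.commute)
  qed
  show ?thesis
  proof (rule that[of L])
    show "L \<ge> 0" unfolding L_def by (intro sum_nonneg B0)
    fix x y
    obtain z where "\<phi> (y + 1 *\<^sub>R (x - y)) - \<phi> (y + 0 *\<^sub>R (x - y)) = (1 - 0) * dd (x - y) \<phi> (y + z *\<^sub>R (x - y))"
      using MVT2[of 0 1, OF zero_less_one smooth_line_deriv[OF sm]] by blast
    then show "\<bar>\<phi> x - \<phi> y\<bar> \<le> L * norm (x - y)" using b[of "x - y"] by simp
  qed
qed

text \<open>The indicator of the set at depth at least 3 \<delta> is mollified at scale \<delta>,
  which leaves 0 below depth 2 \<delta> and 1 above 4 \<delta>. As an indicator is at most 1, the
  derivatives are bounded by the L^1 norms of those of the mollifier.\<close>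

lemma cutoff_function:
  fixes \<Omega> :: "'a::euclidean_space set"
  assumes \<Omega>: "open \<Omega>" "bounded \<Omega>" and \<delta>: "\<delta> > 0"
    and C: "\<And>i. i \<in> Basis \<Longrightarrow> (\<integral>y. \<bar>dd i (mollifier \<delta>) (y :: 'a)\<bar> \<partial>lborel) \<le> C1"
    "\<And>i. i \<in> Basis \<Longrightarrow> (\<integral>y. \<bar>dd i (dd i (mollifier \<delta>)) (y :: 'a)\<bar> \<partial>lborel) \<le> C2"
  obtains \<zeta> :: "'a \<Rightarrow> real" where "smooth \<zeta>" "\<And>x. 0 \<le> \<zeta> x" "\<And>x. \<zeta> x \<le> 1"
    "\<And>x. infdist x (- \<Omega>) < 2 * \<delta> \<Longrightarrow> \<zeta> x = 0" "\<And>x. 4 * \<delta> < infdist x (- \<Omega>) \<Longrightarrow> \<zeta> x = 1"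
    "\<And>x i. i \<in> Basis \<Longrightarrow> \<bar>dd i \<zeta> x\<bar> \<le> C1" "\<And>x i. i \<in> Basis \<Longrightarrow> \<bar>dd i (dd i \<zeta>) x\<bar> \<le> C2"
proof -
  define A where "A = {x. 3 * \<delta> \<le> infdist x (- \<Omega>)}"
  have A\<Omega>: "A \<subseteq> \<Omega>"
  proof
    fix x assume "x \<in> A"
    then have "infdist x (- \<Omega>) \<noteq> 0" using \<delta> by (simp add: A_def)
    then show "x \<in> \<Omega>" using infdist_zero by blast
  qed
  have "closed A" unfolding A_def by (rule closed_Collect_le[OF continuous_on_const continuous_infdist_compl])
  then have "compact A" using \<Omega>(2) A\<Omega> bounded_subset compact_eq_bounded_closed by blast
  then have A: "A \<in> sets borel" "emeasure lborel A < \<infinity>"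
    using emeasure_compact_finite borel_compact by auto
  then have iA: "integrable lborel (indicator A :: 'a \<Rightarrow> real)" by simp
  have mt: "(mollifier \<delta> :: 'a \<Rightarrow> real) \<in> test_functions UNIV" by (rule mollifier_test[OF \<delta>])
  define \<zeta> where "\<zeta> = conv (mollifier \<delta>) (indicator A :: 'a \<Rightarrow> real)"
  have bound: "\<bar>conv k (indicator A) x\<bar> \<le> (\<integral>y. \<bar>k y\<bar> \<partial>lborel)" if k: "k \<in> test_functions UNIV" for k :: "'a \<Rightarrow> real" and x
  proof -
    have kb: "k \<in> borel_measurable borel" by (rule smooth_borel[OF test_functions_smooth[OF k]])
    have "\<bar>conv k (indicator A) x\<bar> \<le> (\<integral>y. \<bar>k (x - y)\<bar> \<partial>lborel)"
      unfolding conv_def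
    proof (rule integral_abs_bound_integral[OF conv_integrable[OF k iA]])
      show "integrable lborel (\<lambda>y. \<bar>k (x - y)\<bar>)"
        using test_functions_integrable[OF test_reflect(1)[OF k]] by simp
      show "\<bar>k (x - y) * indicator A y\<bar> \<le> \<bar>k (x - y)\<bar>" for y by (simp add: indicator_def)
    qed
    also have "\<dots> = (\<integral>y. \<bar>k y\<bar> \<partial>lborel)" using kb by (intro integral_reflect[of "\<lambda>y. \<bar>k y\<bar>"]) simp
    finally show ?thesis .
  qed
  show ?thesis
  proof (rule that[of \<zeta>])
    show "smooth \<zeta>" unfolding \<zeta>_def by (rule smooth_conv[OF mt iA])
    show "0 \<le> \<zeta> x" for x
      unfolding \<zeta>_def conv_def by (intro Bochner_Integration.integral_nonneg mult_nonneg_nonneg mollifier_nonneg[OF \<delta>]) auto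
    have "(\<integral>y. \<bar>mollifier \<delta> (y :: 'a)\<bar> \<partial>lborel) = 1"
      using mollifier_integral[OF \<delta>, where 'a='a] by (simp add: mollifier_nonneg[OF \<delta>])
    then show "\<zeta> x \<le> 1" for x using bound[OF mt, of x] by (simp add: \<zeta>_def)
    show "\<zeta> x = 0" if x: "infdist x (- \<Omega>) < 2 * \<delta>" for x
    proof -
      have "mollifier \<delta> (x - y) * indicator A y = (0::real)" for y
      proof (cases "y \<in> A")
        case True
        have "infdist y (- \<Omega>) \<le> infdist x (- \<Omega>) + dist y x" by (rule infdist_triangle)
        then have "\<delta> \<le> norm (x - y)" using True x by (simp add: A_def dist_norm norm_minus_commute)
        then show ?thesis using mollifier_zero[OF \<delta>, of "x - y"] by simp
      qed simp
      then show ?thesis unfolding \<zeta>_def conv_def by (simp only: Bochner_Integration.integral_zero)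
    qed
    show "\<zeta> x = 1" if x: "4 * \<delta> < infdist x (- \<Omega>)" for x
    proof -
      have "mollifier \<delta> (x - y) * indicator A y = mollifier \<delta> (x - y)" for y
      proof (cases "y \<in> A")
        case False
        have "infdist x (- \<Omega>) \<le> infdist y (- \<Omega>) + dist x y" by (rule infdist_triangle)
        then have "\<delta> \<le> norm (x - y)" using False x by (simp add: A_def dist_norm)
        then show ?thesis using mollifier_zero[OF \<delta>, of "x - y"] by simp
      qed simp
      then show ?thesis unfolding \<zeta>_def conv_def
        by (simp only: conv_const[OF mt] mollifier_integral[OF \<delta>])
    qed
    show "\<bar>dd i \<zeta> x\<bar> \<le> C1" if "i \<in> Basis" for i x
      unfolding \<zeta>_def dd_conv[OF mt iA] using bound[OF test_functions_dd[OF mt], of i x] C(1)[OF that] by simp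
    show "\<bar>dd i (dd i \<zeta>) x\<bar> \<le> C2" if "i \<in> Basis" for i x
      unfolding \<zeta>_def dd_conv[OF mt iA] dd_conv[OF test_functions_dd[OF mt] iA]
      using bound[OF test_functions_dd[OF test_functions_dd[OF mt]], of i i x] C(2)[OF that] by simp
  qed
qed

section \<open>Weakly harmonic functions with zero boundary values\<close>

text \<open>Kato's inequality applied to a cut-off mollification \<open>\<zeta> u\<^sub>\<delta>\<close> of a weakly harmonic
  \<open>u\<close> with zero boundary values: only the commutator terms in a boundary strip of width \<open>O(\<delta>)\<close>
  survive, where the barrier is \<open>O(\<delta>\<^sup>\<alpha>)\<close>.  The strip estimates bound them by a positive power of
  \<open>\<delta>\<close> as soon as \<open>1 - \<alpha> < 1/q\<close>.\<close>

locale weakly_harmonic_zero_trace =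
  fixes \<Omega> :: "'a::euclidean_space set" and p q :: real and u :: "'a \<Rightarrow> real" and G :: "'a \<Rightarrow> 'a"
    and \<phi> :: "nat \<Rightarrow> 'a \<Rightarrow> real"
  assumes \<Omega>: "open \<Omega>" "\<Omega> \<subseteq> ball 0 1" "flat_exterior_cones \<Omega>"
    and p: "1 < p" "1 < q" "1 / p + 1 / q = 1"
    and u: "u \<in> borel_measurable borel" "integrable lborel u" "\<And>x. x \<notin> \<Omega> \<Longrightarrow> u x = 0"
    and G: "G \<in> borel_measurable borel" "integrable lborel G" "\<And>x. x \<notin> \<Omega> \<Longrightarrow> G x = 0"
      "integrable lborel (\<lambda>x. norm (G x) powr p)"
    and \<phi>: "\<And>n. \<phi> n \<in> test_functions \<Omega>"
      "(\<lambda>n. \<integral>x. \<bar>u x - \<phi> n x\<bar> \<partial>lborel) \<longlonglongrightarrow> 0"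
      "(\<lambda>n. \<integral>x. norm (G x - grad (\<phi> n) x) \<partial>lborel) \<longlonglongrightarrow> 0"
    and harmonic: "\<And>\<chi>'. \<chi>' \<in> test_functions \<Omega> \<Longrightarrow> (\<integral>x. G x \<bullet> grad \<chi>' x \<partial>lborel) = 0"
begin

lemma bounded_\<Omega>: "bounded \<Omega>"
  using \<Omega>(2) bounded_subset bounded_ball by blast

lemma compl_\<Omega>: "- \<Omega> \<noteq> {}"
  using bounded_\<Omega> not_bounded_UNIV by (metis Compl_empty_eq double_complement)

lemma in_\<Omega>: "0 < infdist x (- \<Omega>) \<Longrightarrow> x \<in> \<Omega>"
  using infdist_zero[of x "- \<Omega>"] by (cases "x \<in> \<Omega>") simp_all

lemma comp_integrable: "integrable lborel (\<lambda>x. G x \<bullet> i)" "(\<lambda>x. G x \<bullet> i) \<in> borel_measurable borel"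
  using G(1,2) by auto

lemma comp_limit:
  assumes "norm i = 1"
  shows "(\<lambda>n. \<integral>x. \<bar>G x \<bullet> i - dd i (\<phi> n) x\<bar> \<partial>lborel) \<longlonglongrightarrow> 0"
proof (rule Lim_null_comparison[OF always_eventually \<phi>(3)], rule allI)
  fix n
  have sm: "smooth (\<phi> n)" by (rule test_functions_smooth[OF \<phi>(1)])
  have "(\<integral>x. \<bar>G x \<bullet> i - dd i (\<phi> n) x\<bar> \<partial>lborel) \<le> (\<integral>x. norm (G x - grad (\<phi> n) x) \<partial>lborel)"
  proof (rule integral_mono)
    show "integrable lborel (\<lambda>x. \<bar>G x \<bullet> i - dd i (\<phi> n) x\<bar>)"
      using comp_integrable test_functions_integrable[OF test_functions_dd[OF \<phi>(1)]] by simp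
    show "integrable lborel (\<lambda>x. norm (G x - grad (\<phi> n) x))"
      using G(2) test_functions_grad_integrable[OF \<phi>(1)] by simp
    fix x
    have "\<bar>(G x - grad (\<phi> n) x) \<bullet> i\<bar> \<le> norm (G x - grad (\<phi> n) x)"
      using Cauchy_Schwarz_ineq2[of "G x - grad (\<phi> n) x" i] assms by simp
    then show "\<bar>G x \<bullet> i - dd i (\<phi> n) x\<bar> \<le> norm (G x - grad (\<phi> n) x)"
      by (simp add: inner_diff_left grad_inner smooth_differentiable[OF sm])
  qed
  then show "norm (\<integral>x. \<bar>G x \<bullet> i - dd i (\<phi> n) x\<bar> \<partial>lborel) \<le> (\<integral>x. norm (G x - grad (\<phi> n) x) \<partial>lborel)"
    by simp
qed

text \<open>The kernel \<open>k\<close> need not vanish on the boundary of \<Omega>. The identity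
  holds for the approximating test functions and survives in the L^1 limit. This is how zero
  boundary values enter: extended by zero, u has the weak gradient G on the whole space.\<close>

lemma weak_derivative:
  assumes "k \<in> test_functions UNIV" "i \<in> Basis"
  shows "(\<integral>x. dd i k x * u x \<partial>lborel) = - (\<integral>x. k x * (G x \<bullet> i) \<partial>lborel)"
proof -
  have sm: "smooth k" by (rule test_functions_smooth[OF assms(1)])
  obtain B1 where B1: "\<And>x. \<bar>k x\<bar> \<le> B1" using test_functions_bounded[OF assms(1)] by blast
  obtain B2 where B2: "\<And>x. \<bar>dd i k x\<bar> \<le> B2" using test_functions_bounded[OF test_functions_dd[OF assms(1)]] by blast
  have "(\<lambda>n. \<integral>x. dd i k x * \<phi> n x \<partial>lborel) \<longlonglongrightarrow> (\<integral>x. dd i k x * u x \<partial>lborel)"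
    by (rule L1_limit_bounded_mult[OF u(2) test_functions_integrable[OF \<phi>(1)] \<phi>(2) _ B2])
      (rule smooth_borel[OF smooth_dd[OF sm]])
  moreover have "(\<lambda>n. \<integral>x. k x * dd i (\<phi> n) x \<partial>lborel) \<longlonglongrightarrow> (\<integral>x. k x * (G x \<bullet> i) \<partial>lborel)"
    by (rule L1_limit_bounded_mult[OF comp_integrable(1) test_functions_integrable[OF test_functions_dd[OF \<phi>(1)]] comp_limit _ B1])
      (use assms(2) smooth_borel[OF sm] in auto)
  then have "(\<lambda>n. - (\<integral>x. k x * dd i (\<phi> n) x \<partial>lborel)) \<longlonglongrightarrow> - (\<integral>x. k x * (G x \<bullet> i) \<partial>lborel)"
    by (rule tendsto_minus)
  moreover have "(\<integral>x. dd i k x * \<phi> n x \<partial>lborel) = - (\<integral>x. k x * dd i (\<phi> n) x \<partial>lborel)" for n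
  proof -
    have "\<phi> n \<in> test_functions UNIV" using \<phi>(1) test_functions_mono[of \<Omega> UNIV] by auto
    then show ?thesis using integral_by_parts[of "\<phi> n" k i] sm by simp
  qed
  ultimately show ?thesis by (simp add: LIMSEQ_unique)
qed

lemma dd_mollified:
  assumes "k \<in> test_functions UNIV" "i \<in> Basis"
  shows "dd i (conv k u) = conv k (\<lambda>x. G x \<bullet> i)"
proof
  fix x
  have "dd i (conv k u) x = (\<integral>y. dd i k (x - y) * u y \<partial>lborel)"
    by (simp add: dd_conv[OF assms(1) u(2)] conv_def)
  also have "\<dots> = - (\<integral>y. dd i (\<lambda>y. k (x - y)) y * u y \<partial>lborel)"
    by (simp add: test_reflect(2)[OF assms(1)])
  also have "\<dots> = (\<integral>y. k (x - y) * (G y \<bullet> i) \<partial>lborel)"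
    using weak_derivative[OF test_reflect(1)[OF assms(1)] assms(2)] by simp
  finally show "dd i (conv k u) x = conv k (\<lambda>x. G x \<bullet> i) x" by (simp add: conv_def)
qed

text \<open>At depth greater than \<delta> the reflected mollifier is itself a test function on
  \<Omega>. One derivative passes to u and becomes G, the other stays on the kernel, and the sum
  over all directions is the weak equation.\<close>

lemma lap_mollified:
  assumes \<delta>: "\<delta> > 0" and x: "\<delta> < infdist x (- \<Omega>)"
  shows "lap (conv (mollifier \<delta>) u) x = 0"
proof -
  have mt: "(mollifier \<delta> :: 'a \<Rightarrow> real) \<in> test_functions UNIV" by (rule mollifier_test[OF \<delta>])
  define k where "k y = mollifier \<delta> (x - y)" for y
  have ktU: "k \<in> test_functions UNIV" unfolding k_def by (rule test_reflect(1)[OF mt])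
  have kt: "k \<in> test_functions \<Omega>"
  proof (rule test_functionsI[of _ "cball x \<delta>"])
    show "smooth k" by (rule test_functions_smooth[OF ktU])
    show "cball x \<delta> \<subseteq> \<Omega>"
    proof
      fix y assume "y \<in> cball x \<delta>"
      moreover have "infdist x (- \<Omega>) \<le> infdist y (- \<Omega>) + dist x y" by (rule infdist_triangle)
      ultimately show "y \<in> \<Omega>" using x by (intro in_\<Omega>) simp
    qed
    show "k y = 0" if "y \<notin> cball x \<delta>" for y
      unfolding k_def using that by (intro mollifier_zero[OF \<delta>]) (simp add: dist_norm)
  qed simp
  have int: "integrable lborel (\<lambda>y. dd i (mollifier \<delta>) (x - y) * (G y \<bullet> i))" for i
    by (rule conv_integrable[OF test_functions_dd[OF mt] comp_integrable(1)])
  have "lap (conv (mollifier \<delta>) u) x = (\<Sum>i\<in>Basis. conv (dd i (mollifier \<delta>)) (\<lambda>x. G x \<bullet> i) x)"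
    unfolding lap_def by (intro sum.cong refl) (simp add: dd_mollified[OF mt] dd_conv[OF mt comp_integrable(1)])
  also have "\<dots> = (\<integral>y. (\<Sum>i\<in>Basis. dd i (mollifier \<delta>) (x - y) * (G y \<bullet> i)) \<partial>lborel)"
    unfolding conv_def using int by (intro Bochner_Integration.integral_sum[symmetric])
  also have "\<dots> = (\<integral>y. - (G y \<bullet> grad k y) \<partial>lborel)"
  proof (rule Bochner_Integration.integral_cong[OF refl])
    fix y
    have "G y \<bullet> grad k y = (\<Sum>i\<in>Basis. dd i k y * (G y \<bullet> i))"
      by (simp add: grad_eq smooth_differentiable[OF test_functions_smooth[OF ktU]] inner_sum_right)
    also have "\<dots> = (\<Sum>i\<in>Basis. - (dd i (mollifier \<delta>) (x - y) * (G y \<bullet> i)))"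
      unfolding k_def[abs_def] test_reflect(2)[OF mt] by simp
    finally show "(\<Sum>i\<in>Basis. dd i (mollifier \<delta>) (x - y) * (G y \<bullet> i)) = - (G y \<bullet> grad k y)"
      by (simp add: sum_negf)
  qed
  also have "\<dots> = 0" using harmonic[OF kt] by simp
  finally show ?thesis .
qed

lemma strip_integrable:
  "integrable lborel f \<Longrightarrow> integrable lborel (\<lambda>x. indicator (strip \<Omega> \<eta>) x * f x :: real)"
  using integrable_mult_indicator[of "strip \<Omega> \<eta>" lborel f] \<Omega>(1) by simp

text \<open>Both sides are continuous under the L^1 convergence of the approximations and their
  gradients, so the inequality for test functions passes to the limit.\<close>

lemma strip_poincare_u:
  assumes E: "escape_directions \<Omega> E r" and \<eta>: "0 < \<eta>" "6 * \<eta> \<le> r"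
  shows "(\<integral>x. indicator (strip \<Omega> \<eta>) x * \<bar>u x\<bar> \<partial>lborel)
    \<le> (real (card E) * (6 * \<eta>)) * (\<integral>x. indicator (strip \<Omega> (7 * \<eta>)) x * norm (G x) \<partial>lborel)"
proof -
  let ?K = "real (card E) * (6 * \<eta>)"
  define a where "a n = (\<integral>x. \<bar>u x - \<phi> n x\<bar> \<partial>lborel)" for n
  define b where "b n = (\<integral>x. norm (G x - grad (\<phi> n) x) \<partial>lborel)" for n
  define U where "U = (\<integral>x. indicator (strip \<Omega> \<eta>) x * \<bar>u x\<bar> \<partial>lborel)"
  define V where "V = (\<integral>x. indicator (strip \<Omega> (7 * \<eta>)) x * norm (G x) \<partial>lborel)"
  have le: "U \<le> ?K * (V + b n) + a n" for n
  proof -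
    have iu: "integrable lborel (\<lambda>x. \<bar>u x - \<phi> n x\<bar>)" using u(2) test_functions_integrable[OF \<phi>(1)] by simp
    have i\<phi>: "integrable lborel (\<lambda>x. \<bar>\<phi> n x\<bar>)" using test_functions_integrable[OF \<phi>(1)] by simp
    have iG: "integrable lborel (\<lambda>x. norm (G x - grad (\<phi> n) x))" using G(2) test_functions_grad_integrable[OF \<phi>(1)] by simp
    have ig: "integrable lborel (\<lambda>x. norm (grad (\<phi> n) x))" "integrable lborel (\<lambda>x. norm (G x))"
      using test_functions_grad_integrable[OF \<phi>(1)] G(2) by simp_all
    have "U \<le> (\<integral>x. indicator (strip \<Omega> \<eta>) x * \<bar>\<phi> n x\<bar> + \<bar>u x - \<phi> n x\<bar> \<partial>lborel)"
      unfolding U_def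
    proof (rule integral_mono)
      show "integrable lborel (\<lambda>x. indicator (strip \<Omega> \<eta>) x * \<bar>u x\<bar>)" using u(2) by (intro strip_integrable) simp
      show "integrable lborel (\<lambda>x. indicator (strip \<Omega> \<eta>) x * \<bar>\<phi> n x\<bar> + \<bar>u x - \<phi> n x\<bar>)"
        using strip_integrable[OF i\<phi>] iu by simp
      show "indicator (strip \<Omega> \<eta>) x * \<bar>u x\<bar> \<le> indicator (strip \<Omega> \<eta>) x * \<bar>\<phi> n x\<bar> + \<bar>u x - \<phi> n x\<bar>" for x
        by (auto simp: indicator_def)
    qed
    also have "\<dots> = (\<integral>x. indicator (strip \<Omega> \<eta>) x * \<bar>\<phi> n x\<bar> \<partial>lborel) + a n"
      unfolding a_def using strip_integrable[OF i\<phi>] iu by simp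
    also have "(\<integral>x. indicator (strip \<Omega> \<eta>) x * \<bar>\<phi> n x\<bar> \<partial>lborel)
        \<le> ?K * (\<integral>x. indicator (strip \<Omega> (7 * \<eta>)) x * norm (grad (\<phi> n) x) \<partial>lborel)"
      by (rule strip_poincare_real[OF \<Omega>(1) E \<eta> \<phi>(1)])
    also have "(\<integral>x. indicator (strip \<Omega> (7 * \<eta>)) x * norm (grad (\<phi> n) x) \<partial>lborel) \<le> V + b n"
    proof -
      have "(\<integral>x. indicator (strip \<Omega> (7 * \<eta>)) x * norm (grad (\<phi> n) x) \<partial>lborel)
          \<le> (\<integral>x. indicator (strip \<Omega> (7 * \<eta>)) x * norm (G x) + norm (G x - grad (\<phi> n) x) \<partial>lborel)"
      proof (rule integral_mono)
        show "integrable lborel (\<lambda>x. indicator (strip \<Omega> (7 * \<eta>)) x * norm (grad (\<phi> n) x))" by (rule strip_integrable[OF ig(1)])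
        show "integrable lborel (\<lambda>x. indicator (strip \<Omega> (7 * \<eta>)) x * norm (G x) + norm (G x - grad (\<phi> n) x))"
          using strip_integrable[OF ig(2)] iG by simp
        show "indicator (strip \<Omega> (7 * \<eta>)) x * norm (grad (\<phi> n) x)
            \<le> indicator (strip \<Omega> (7 * \<eta>)) x * norm (G x) + norm (G x - grad (\<phi> n) x)" for x
          using norm_triangle_ineq2[of "grad (\<phi> n) x" "G x"] by (auto simp: indicator_def norm_minus_commute)
      qed
      also have "\<dots> = V + b n" unfolding V_def b_def using strip_integrable[OF ig(2)] iG by simp
      finally show ?thesis .
    qed
    finally show ?thesis using \<eta> by (simp add: mult_left_mono)
  qed
  have "(\<lambda>n. ?K * (V + b n) + a n) \<longlonglongrightarrow> ?K * (V + 0) + 0"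
    using \<phi>(2,3) unfolding a_def b_def by (intro tendsto_intros)
  then have "U \<le> ?K * (V + 0) + 0"
    using le by (intro Lim_bounded2[of _ _ 0]) auto
  then show ?thesis by (simp add: U_def V_def)
qed

text \<open>Where \<zeta> is nonzero the mollified function is harmonic, so the Laplacian of the
  product has only terms with derivatives of \<zeta>, at depth between 2 \<delta> and 4 \<delta>.
  One derivative of \<zeta> costs 1/\<delta>; two cost 1/\<delta>^2, of which the strip inequality
  returns one power. The width 42 \<delta> is 5 \<delta>, plus \<delta> for mollification, times 7
  from the strip inequality.\<close>

lemma kato_estimate:
  assumes b: "b \<in> borel_measurable borel" "\<And>x. 0 \<le> b x" "\<And>x. b x \<le> C0 * infdist x (- \<Omega>) powr \<alpha>" "C0 > 0" "0 < \<alpha>"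
    and super: "\<And>K. compact K \<Longrightarrow> K \<subseteq> \<Omega> \<Longrightarrow> \<exists>s0>0. \<forall>x\<in>K. \<forall>s. 0 < s \<and> s \<le> s0 \<longrightarrow> dlap s b x \<le> - c * s\<^sup>2"
    and E: "escape_directions \<Omega> E r" and \<delta>: "0 < \<delta>" "36 * \<delta> \<le> r" and C: "C > 0"
    and \<zeta>: "smooth \<zeta>" "\<And>x. 0 \<le> \<zeta> x" "\<And>x. \<zeta> x \<le> 1"
    "\<And>x. infdist x (- \<Omega>) < 2 * \<delta> \<Longrightarrow> \<zeta> x = 0" "\<And>x. 4 * \<delta> < infdist x (- \<Omega>) \<Longrightarrow> \<zeta> x = 1"
    "\<And>x i. i \<in> Basis \<Longrightarrow> \<bar>dd i \<zeta> x\<bar> \<le> C / \<delta>" "\<And>x i. i \<in> Basis \<Longrightarrow> \<bar>dd i (dd i \<zeta>) x\<bar> \<le> C / \<delta>\<^sup>2"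
  shows "c * (\<integral>x. \<bar>\<zeta> x * conv (mollifier \<delta>) u x\<bar> \<partial>lborel)
    \<le> C0 * 5 powr \<alpha> * C * real DIM('a) * (2 + real (card E) * 36) * \<delta> powr (\<alpha> - 1)
        * (\<integral>x. indicator (strip \<Omega> (42 * \<delta>)) x * norm (G x) \<partial>lborel)"
proof -
  define v where "v = conv (mollifier \<delta>) u"
  define Q where "Q = (\<integral>x. indicator (strip \<Omega> (42 * \<delta>)) x * norm (G x) \<partial>lborel)"
  have mt: "(mollifier \<delta> :: 'a \<Rightarrow> real) \<in> test_functions UNIV" by (rule mollifier_test[OF \<delta>(1)])
  have smv: "smooth v" unfolding v_def by (rule smooth_conv[OF mt u(2)])
  define K where "K = {x. 2 * \<delta> \<le> infdist x (- \<Omega>)}"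
  have K\<Omega>: "K \<subseteq> \<Omega>" using \<delta> by (auto simp: K_def intro!: in_\<Omega>)
  have "closed K" unfolding K_def by (rule closed_Collect_le[OF continuous_on_const continuous_infdist_compl])
  then have cK: "compact K" using bounded_\<Omega> K\<Omega> bounded_subset compact_eq_bounded_closed by blast
  \<comment> \<open>A unit basis vector lies outside \<Omega>, so the depth is at most 2; this
    yields the global bound on \<open>b\<close> that \<open>kato_barrier\<close> asks for.\<close>
  have infb: "infdist x (- \<Omega>) \<le> 2" if "x \<in> \<Omega>" for x
  proof -
    obtain e :: 'a where e: "e \<in> Basis" using nonempty_Basis by blast
    then have "e \<in> - \<Omega>" using \<Omega>(2) by auto
    then have "infdist x (- \<Omega>) \<le> dist x e" by (rule infdist_le)
    also have "\<dots> \<le> norm x + norm e" unfolding dist_norm by (rule norm_triangle_ineq4)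
    also have "\<dots> \<le> 2" using that \<Omega>(2) e by auto
    finally show ?thesis .
  qed
  have bM: "b x \<le> C0 * 2 powr \<alpha>" for x
  proof -
    have "infdist x (- \<Omega>) \<le> 2" using infb[of x] infdist_zero[of x "- \<Omega>"] by (cases "x \<in> \<Omega>") auto
    then have "infdist x (- \<Omega>) powr \<alpha> \<le> 2 powr \<alpha>" using b(5) by (intro powr_mono2) (auto simp: infdist_nonneg)
    then show ?thesis using b(3)[of x] b(4) mult_left_mono[of _ "2 powr \<alpha>" C0] by (meson less_imp_le order_trans)
  qed
  have step1: "c * (\<integral>x. \<bar>\<zeta> x * v x\<bar> \<partial>lborel) \<le> (\<integral>x. b x * \<bar>lap (\<lambda>x. \<zeta> x * v x) x\<bar> \<partial>lborel)"
  proof (rule kato_barrier[OF b(1,2) bM _ cK])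
    show "smooth (\<lambda>x. \<zeta> x * v x)" by (rule smooth_mult[OF \<zeta>(1) smv])
    show "\<zeta> x * v x = 0" if "x \<notin> K" for x using that \<zeta>(4)[of x] by (simp add: K_def)
    show "\<exists>s0>0. \<forall>x\<in>K. \<forall>s. 0 < s \<and> s \<le> s0 \<longrightarrow> dlap s b x \<le> - c * s\<^sup>2" by (rule super[OF cK K\<Omega>])
  qed
  define H where "H x = 2 * C / \<delta> * (\<Sum>i\<in>Basis. indicator (strip \<Omega> (5 * \<delta>)) x * \<bar>conv (mollifier \<delta>) (\<lambda>x. G x \<bullet> i) x\<bar>)
      + real DIM('a) * C / \<delta>\<^sup>2 * (indicator (strip \<Omega> (5 * \<delta>)) x * \<bar>v x\<bar>)" for x
  have lapb: "\<bar>lap (\<lambda>x. \<zeta> x * v x) x\<bar> \<le> H x" for x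
  proof -
    have H0: "0 \<le> H x" unfolding H_def using C \<delta> by (intro add_nonneg_nonneg mult_nonneg_nonneg sum_nonneg) auto
    have op: "open {x. infdist x (- \<Omega>) < 2 * \<delta>}" "open {x. 4 * \<delta> < infdist x (- \<Omega>)}"
      by (rule open_Collect_less[OF continuous_infdist_compl continuous_on_const]
          open_Collect_less[OF continuous_on_const continuous_infdist_compl])+
    have out1: "dd i \<zeta> x = 0" if "infdist x (- \<Omega>) < 2 * \<delta>" for i x
      using dd_cong_open[OF op(1), of x \<zeta> "\<lambda>_. 0" i] \<zeta>(4) that by (simp add: dd_def)
    have out2: "dd i \<zeta> x = 0" if "4 * \<delta> < infdist x (- \<Omega>)" for i x
      using dd_cong_open[OF op(2), of x \<zeta> "\<lambda>_. 1" i] \<zeta>(5) that by (simp add: dd_def)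
    have out1': "dd i (dd i \<zeta>) x = 0" if "infdist x (- \<Omega>) < 2 * \<delta>" for i x
      using dd_cong_open[OF op(1), of x "dd i \<zeta>" "\<lambda>_. 0" i] out1 that by (simp add: dd_def)
    have out2': "dd i (dd i \<zeta>) x = 0" if "4 * \<delta> < infdist x (- \<Omega>)" for i x
      using dd_cong_open[OF op(2), of x "dd i \<zeta>" "\<lambda>_. 0" i] out2 that by (simp add: dd_def)
    have zl: "\<zeta> x * lap v x = 0"
      using lap_mollified[OF \<delta>(1), of x] \<zeta>(4)[of x] \<delta> by (cases "\<delta> < infdist x (- \<Omega>)") (auto simp: v_def)
    have L: "lap (\<lambda>x. \<zeta> x * v x) x = 2 * (\<Sum>i\<in>Basis. dd i \<zeta> x * dd i v x) + v x * lap \<zeta> x"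
      using lap_mult[OF \<zeta>(1) smv, of x] zl by simp
    consider "infdist x (- \<Omega>) < 2 * \<delta>" | "4 * \<delta> < infdist x (- \<Omega>)" | "2 * \<delta> \<le> infdist x (- \<Omega>)" "infdist x (- \<Omega>) \<le> 4 * \<delta>"
      by linarith
    then show ?thesis
    proof cases
      case 1
      then have "lap \<zeta> x = 0" by (simp add: lap_def out1')
      then show ?thesis using H0 1 by (simp add: L out1)
    next
      case 2
      then have "lap \<zeta> x = 0" by (simp add: lap_def out2')
      then show ?thesis using H0 2 by (simp add: L out2)
    next
      case 3
      then have xs: "x \<in> strip \<Omega> (5 * \<delta>)" using \<delta> by (auto simp: strip_def intro!: in_\<Omega>)
      have "\<bar>\<Sum>i\<in>Basis. dd i \<zeta> x * dd i v x\<bar> \<le> (\<Sum>i\<in>Basis. C / \<delta> * \<bar>conv (mollifier \<delta>) (\<lambda>x. G x \<bullet> i) x\<bar>)"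
      proof (rule order_trans[OF sum_abs], rule sum_mono)
        fix i :: 'a assume i: "i \<in> Basis"
        show "\<bar>dd i \<zeta> x * dd i v x\<bar> \<le> C / \<delta> * \<bar>conv (mollifier \<delta>) (\<lambda>x. G x \<bullet> i) x\<bar>"
          unfolding v_def dd_mollified[OF mt i] abs_mult using \<zeta>(6)[OF i] by (intro mult_right_mono) auto
      qed
      moreover have "\<bar>lap \<zeta> x\<bar> \<le> real DIM('a) * C / \<delta>\<^sup>2"
      proof -
        have "\<bar>lap \<zeta> x\<bar> \<le> (\<Sum>i\<in>(Basis::'a set). C / \<delta>\<^sup>2)"
          unfolding lap_def by (rule order_trans[OF sum_abs], rule sum_mono) (rule \<zeta>(7))
        then show ?thesis by simp
      qed
      then have "\<bar>v x * lap \<zeta> x\<bar> \<le> real DIM('a) * C / \<delta>\<^sup>2 * \<bar>v x\<bar>"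
        unfolding abs_mult mult.commute[of "\<bar>v x\<bar>"] by (rule mult_right_mono) simp
      ultimately have "\<bar>lap (\<lambda>x. \<zeta> x * v x) x\<bar> \<le> 2 * (\<Sum>i\<in>Basis. C / \<delta> * \<bar>conv (mollifier \<delta>) (\<lambda>x. G x \<bullet> i) x\<bar>)
          + real DIM('a) * C / \<delta>\<^sup>2 * \<bar>v x\<bar>"
        unfolding L by (intro order_trans[OF abs_triangle_ineq] add_mono) (auto simp: abs_mult)
      also have "\<dots> = H x" using xs by (simp add: H_def sum_distrib_left mult.assoc)
      finally show ?thesis .
    qed
  qed
  have nbhd: "y \<in> strip \<Omega> (6 * \<delta>)" if "x \<in> strip \<Omega> (5 * \<delta>)" "norm (x - y) < \<delta>" "y \<in> \<Omega>" for x y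
  proof -
    have "infdist y (- \<Omega>) \<le> infdist x (- \<Omega>) + dist y x" by (rule infdist_triangle)
    then show ?thesis using that by (simp add: strip_def dist_norm norm_minus_commute)
  qed
  have st: "strip \<Omega> \<eta> \<in> sets borel" for \<eta> using \<Omega>(1) by simp
  have cG: "integrable lborel (\<lambda>x. indicator (strip \<Omega> (5 * \<delta>)) x * \<bar>conv (mollifier \<delta>) (\<lambda>x. G x \<bullet> i) x\<bar>)"
    "(\<integral>x. indicator (strip \<Omega> (5 * \<delta>)) x * \<bar>conv (mollifier \<delta>) (\<lambda>x. G x \<bullet> i) x\<bar> \<partial>lborel) \<le> Q" if i: "i \<in> Basis" for i
  proof -
    have supp: "G y \<bullet> i = 0" if "x \<in> strip \<Omega> (5 * \<delta>)" "norm (x - y) < \<delta>" "y \<notin> strip \<Omega> (6 * \<delta>)" for x y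
      using nbhd[OF that(1,2)] that(3) G(3)[of y] by fastforce
    show "integrable lborel (\<lambda>x. indicator (strip \<Omega> (5 * \<delta>)) x * \<bar>conv (mollifier \<delta>) (\<lambda>x. G x \<bullet> i) x\<bar>)"
      by (rule conv_mollifier_L1(1)[OF \<delta>(1) comp_integrable(2,1) st st supp])
    have "(\<integral>x. indicator (strip \<Omega> (5 * \<delta>)) x * \<bar>conv (mollifier \<delta>) (\<lambda>x. G x \<bullet> i) x\<bar> \<partial>lborel)
        \<le> (\<integral>x. indicator (strip \<Omega> (6 * \<delta>)) x * \<bar>G x \<bullet> i\<bar> \<partial>lborel)"
      by (rule conv_mollifier_L1(2)[OF \<delta>(1) comp_integrable(2,1) st st supp])
    also have "\<dots> \<le> Q" unfolding Q_def
    proof (rule integral_mono)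
      show "integrable lborel (\<lambda>x. indicator (strip \<Omega> (6 * \<delta>)) x * \<bar>G x \<bullet> i\<bar>)"
        using comp_integrable(1) by (intro strip_integrable) simp
      show "integrable lborel (\<lambda>x. indicator (strip \<Omega> (42 * \<delta>)) x * norm (G x))"
        using G(2) by (intro strip_integrable) simp
      show "indicator (strip \<Omega> (6 * \<delta>)) x * \<bar>G x \<bullet> i\<bar> \<le> indicator (strip \<Omega> (42 * \<delta>)) x * norm (G x)" for x
        using Basis_le_norm[OF i, of "G x"] \<delta> by (auto simp: indicator_def strip_def)
    qed
    finally show "(\<integral>x. indicator (strip \<Omega> (5 * \<delta>)) x * \<bar>conv (mollifier \<delta>) (\<lambda>x. G x \<bullet> i) x\<bar> \<partial>lborel) \<le> Q" .
  qed
  have cu: "integrable lborel (\<lambda>x. indicator (strip \<Omega> (5 * \<delta>)) x * \<bar>v x\<bar>)"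
    "(\<integral>x. indicator (strip \<Omega> (5 * \<delta>)) x * \<bar>v x\<bar> \<partial>lborel) \<le> real (card E) * (36 * \<delta>) * Q"
  proof -
    have supp: "u y = 0" if "x \<in> strip \<Omega> (5 * \<delta>)" "norm (x - y) < \<delta>" "y \<notin> strip \<Omega> (6 * \<delta>)" for x y
      using nbhd[OF that(1,2)] that(3) u(3)[of y] by blast
    show "integrable lborel (\<lambda>x. indicator (strip \<Omega> (5 * \<delta>)) x * \<bar>v x\<bar>)"
      unfolding v_def by (rule conv_mollifier_L1(1)[OF \<delta>(1) u(1,2) st st supp])
    have "(\<integral>x. indicator (strip \<Omega> (5 * \<delta>)) x * \<bar>v x\<bar> \<partial>lborel) \<le> (\<integral>x. indicator (strip \<Omega> (6 * \<delta>)) x * \<bar>u x\<bar> \<partial>lborel)"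
      unfolding v_def by (rule conv_mollifier_L1(2)[OF \<delta>(1) u(1,2) st st supp])
    also have "\<dots> \<le> real (card E) * (36 * \<delta>) * Q"
      using strip_poincare_u[OF E, of "6 * \<delta>"] \<delta> by (simp add: Q_def mult.assoc)
    finally show "(\<integral>x. indicator (strip \<Omega> (5 * \<delta>)) x * \<bar>v x\<bar> \<partial>lborel) \<le> real (card E) * (36 * \<delta>) * Q" .
  qed
  have iH: "integrable lborel H"
    unfolding H_def using cG(1) cu(1)
    by (intro Bochner_Integration.integrable_add integrable_mult_right Bochner_Integration.integrable_sum) auto
  have H0: "0 \<le> H x" for x unfolding H_def using C \<delta> by (intro add_nonneg_nonneg mult_nonneg_nonneg sum_nonneg) auto
  have intH: "(\<integral>x. H x \<partial>lborel) \<le> C * real DIM('a) * (2 + real (card E) * 36) * Q / \<delta>"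
  proof -
    have "(\<integral>x. H x \<partial>lborel) = 2 * C / \<delta> * (\<Sum>i\<in>Basis. \<integral>x. indicator (strip \<Omega> (5 * \<delta>)) x * \<bar>conv (mollifier \<delta>) (\<lambda>x. G x \<bullet> i) x\<bar> \<partial>lborel)
      + real DIM('a) * C / \<delta>\<^sup>2 * (\<integral>x. indicator (strip \<Omega> (5 * \<delta>)) x * \<bar>v x\<bar> \<partial>lborel)"
    proof -
      define W where "W i x = indicator (strip \<Omega> (5 * \<delta>)) x * \<bar>conv (mollifier \<delta>) (\<lambda>x. G x \<bullet> i) x\<bar>" for i x
      define Z where "Z x = indicator (strip \<Omega> (5 * \<delta>)) x * \<bar>v x\<bar>" for x
      have W: "integrable lborel (W i)" if "i \<in> Basis" for i unfolding W_def[abs_def] by (rule cG(1)[OF that])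
      have Z: "integrable lborel Z" unfolding Z_def[abs_def] by (rule cu(1))
      show ?thesis
        unfolding H_def W_def[symmetric] Z_def[symmetric] using W Z
        by (simp add: Bochner_Integration.integrable_sum Bochner_Integration.integral_sum)
    qed
    also have "\<dots> \<le> 2 * C / \<delta> * (\<Sum>i\<in>(Basis::'a set). Q) + real DIM('a) * C / \<delta>\<^sup>2 * (real (card E) * (36 * \<delta>) * Q)"
      using C \<delta> cG(2) cu(2) by (intro add_mono mult_left_mono sum_mono) auto
    also have "\<dots> = C * real DIM('a) * (2 + real (card E) * 36) * Q / \<delta>"
      using \<delta> by (simp add: field_simps power2_eq_square)
    finally show ?thesis .
  qed
  have "(\<integral>x. b x * \<bar>lap (\<lambda>x. \<zeta> x * v x) x\<bar> \<partial>lborel) \<le> (\<integral>x. C0 * (5 * \<delta>) powr \<alpha> * H x \<partial>lborel)"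
  proof (rule integral_mono_AE')
    show "integrable lborel (\<lambda>x. C0 * (5 * \<delta>) powr \<alpha> * H x)" using iH by simp
    show "AE x in lborel. b x * \<bar>lap (\<lambda>x. \<zeta> x * v x) x\<bar> \<le> C0 * (5 * \<delta>) powr \<alpha> * H x"
    proof (rule AE_I2)
      fix x
      show "b x * \<bar>lap (\<lambda>x. \<zeta> x * v x) x\<bar> \<le> C0 * (5 * \<delta>) powr \<alpha> * H x"
      proof (cases "x \<in> strip \<Omega> (5 * \<delta>)")
        case True
        then have "infdist x (- \<Omega>) powr \<alpha> \<le> (5 * \<delta>) powr \<alpha>"
          using b(5) by (intro powr_mono2) (auto simp: infdist_nonneg strip_def)
        then have "b x \<le> C0 * (5 * \<delta>) powr \<alpha>"
          using b(3)[of x] b(4) mult_left_mono[of _ "(5 * \<delta>) powr \<alpha>" C0] by (meson less_imp_le order_trans)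
        then show ?thesis using lapb[of x] b(4) by (intro mult_mono) auto
      next
        case False
        then have "H x = 0" by (simp add: H_def)
        then show ?thesis using lapb[of x] by simp
      qed
    qed
    show "AE x in lborel. 0 \<le> C0 * (5 * \<delta>) powr \<alpha> * H x" using b(4) H0 by (intro AE_I2 mult_nonneg_nonneg) auto
  qed
  also have "\<dots> = C0 * (5 * \<delta>) powr \<alpha> * (\<integral>x. H x \<partial>lborel)" by simp
  also have "\<dots> \<le> C0 * (5 * \<delta>) powr \<alpha> * (C * real DIM('a) * (2 + real (card E) * 36) * Q / \<delta>)"
    using b(4) intH by (intro mult_left_mono) auto
  also have "\<dots> = C0 * 5 powr \<alpha> * C * real DIM('a) * (2 + real (card E) * 36) * \<delta> powr (\<alpha> - 1) * Q"
    using \<delta> by (simp add: powr_mult powr_diff)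
  finally show ?thesis using step1 by (simp add: v_def Q_def)
qed

text \<open>Hoelder's inequality against the indicator of the strip turns integrability to the power
  p into smallness of order \<eta>^(1/q).\<close>

lemma strip_gradient_bound:
  assumes C: "C > 0" "\<And>\<eta>. \<eta> > 0 \<Longrightarrow> measure lborel (strip \<Omega> \<eta>) \<le> C * \<eta>" and \<eta>: "\<eta> > 0"
  shows "(\<integral>x. indicator (strip \<Omega> \<eta>) x * norm (G x) \<partial>lborel)
    \<le> (\<integral>x. norm (G x) powr p \<partial>lborel) powr (1 / p) * (C * \<eta>) powr (1 / q)"
proof -
  have st: "strip \<Omega> \<eta> \<in> sets borel" using \<Omega>(1) by simp
  have "emeasure lborel (strip \<Omega> \<eta>) \<le> emeasure lborel (ball (0::'a) 1)"
    using \<Omega>(2) by (intro emeasure_mono) (auto simp: strip_def)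
  then have fin: "emeasure lborel (strip \<Omega> \<eta>) < \<infinity>"
    using emeasure_lborel_ball_finite[of "0::'a" 1] by (rule le_less_trans)
  have eq: "(\<lambda>x. (indicator (strip \<Omega> \<eta>) x :: real) powr q) = indicator (strip \<Omega> \<eta>)"
    using p by (auto simp: indicator_def)
  have "(\<integral>x. norm (G x) * indicator (strip \<Omega> \<eta>) x \<partial>lborel)
    \<le> (\<integral>x. norm (G x) powr p \<partial>lborel) powr (1 / p) * (\<integral>x. indicator (strip \<Omega> \<eta>) x powr q \<partial>lborel) powr (1 / q)"
    using p G st fin by (intro holder_inequality) (auto simp: eq)
  also have "(\<integral>x. indicator (strip \<Omega> \<eta>) x powr q \<partial>lborel) = measure lborel (strip \<Omega> \<eta>)" by (simp add: eq)
  also have "(\<integral>x. norm (G x) powr p \<partial>lborel) powr (1 / p) * measure lborel (strip \<Omega> \<eta>) powr (1 / q)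
      \<le> (\<integral>x. norm (G x) powr p \<partial>lborel) powr (1 / p) * (C * \<eta>) powr (1 / q)"
    using C(2)[OF \<eta>] p by (intro mult_left_mono powr_mono2) auto
  finally show ?thesis by (simp only: mult.commute[of "norm _"])
qed

text \<open>Beyond depth 4 \<delta> the cut-off is 1, and mollification changes a Lipschitz function
  by at most L \<delta>. At smaller depth both terms vanish: the support of \<psi> lies at depth at
  least 6 \<delta>, and mollification reaches only \<delta> further.\<close>

lemma mollification_error:
  assumes \<phi>: "\<psi> \<in> test_functions \<Omega>"
    and L: "L \<ge> 0" "\<And>x y. \<bar>\<psi> x - \<psi> y\<bar> \<le> L * norm (x - y)"
    and d: "d > 0" "\<And>x. \<psi> x \<noteq> 0 \<Longrightarrow> d \<le> infdist x (- \<Omega>)" and \<delta>: "0 < \<delta>" "6 * \<delta> \<le> d"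
    and \<zeta>: "\<And>x. 4 * \<delta> < infdist x (- \<Omega>) \<Longrightarrow> \<zeta> x = 1"
  shows "\<bar>\<psi> x - \<zeta> x * conv (mollifier \<delta>) \<psi> x\<bar> \<le> L * \<delta> * indicator (ball 0 1) x"
proof -
  have mt: "(mollifier \<delta> :: 'a \<Rightarrow> real) \<in> test_functions UNIV" by (rule mollifier_test[OF \<delta>(1)])
  have i: "integrable lborel \<psi>" by (rule test_functions_integrable[OF \<phi>])
  show ?thesis
  proof (cases "4 * \<delta> < infdist x (- \<Omega>)")
    case True
    then have "x \<in> \<Omega>" using \<delta> by (intro in_\<Omega>) simp
    then have x1: "x \<in> ball 0 1" using \<Omega>(2) by blast
    have mi: "integrable lborel (\<lambda>y. mollifier \<delta> (x - y))" by (rule test_functions_integrable[OF test_reflect(1)[OF mt]])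
    have m1: "(\<integral>y. mollifier \<delta> (x - y) \<partial>lborel) = 1"
      using conv_const[OF mt, of x] mollifier_integral[OF \<delta>(1), where 'a='a] by simp
    have ci: "integrable lborel (\<lambda>y. mollifier \<delta> (x - y) * \<psi> y)" by (rule conv_integrable[OF mt i])
    have "\<psi> x - conv (mollifier \<delta>) \<psi> x = (\<integral>y. mollifier \<delta> (x - y) * \<psi> x - mollifier \<delta> (x - y) * \<psi> y \<partial>lborel)"
      using mi ci m1 by (simp add: conv_def)
    moreover have "\<bar>\<integral>y. mollifier \<delta> (x - y) * \<psi> x - mollifier \<delta> (x - y) * \<psi> y \<partial>lborel\<bar>
        \<le> (\<integral>y. L * \<delta> * mollifier \<delta> (x - y) \<partial>lborel)"
    proof (rule integral_abs_bound_integral)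
      show "integrable lborel (\<lambda>y. mollifier \<delta> (x - y) * \<psi> x - mollifier \<delta> (x - y) * \<psi> y)" using mi ci by simp
      show "integrable lborel (\<lambda>y. L * \<delta> * mollifier \<delta> (x - y))" using mi by simp
      fix y
      show "\<bar>mollifier \<delta> (x - y) * \<psi> x - mollifier \<delta> (x - y) * \<psi> y\<bar> \<le> L * \<delta> * mollifier \<delta> (x - y)"
      proof (cases "norm (x - y) < \<delta>")
        case True
        then have "L * norm (x - y) \<le> L * \<delta>" using L(1) by (intro mult_left_mono) auto
        then have "\<bar>\<psi> x - \<psi> y\<bar> \<le> L * \<delta>" using L(2)[of x y] by simp
        then have "mollifier \<delta> (x - y) * \<bar>\<psi> x - \<psi> y\<bar> \<le> mollifier \<delta> (x - y) * (L * \<delta>)"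
          by (intro mult_left_mono mollifier_nonneg[OF \<delta>(1)])
        then show ?thesis
          unfolding right_diff_distrib[symmetric] abs_mult abs_of_nonneg[OF mollifier_nonneg[OF \<delta>(1)]]
          by (simp only: mult.commute)
      next
        case False
        then have "mollifier \<delta> (x - y) = 0" by (intro mollifier_zero[OF \<delta>(1)]) simp
        then show ?thesis by simp
      qed
    qed
    ultimately show ?thesis using x1 \<zeta>[OF True] m1 by simp
  next
    case False
    then have "\<psi> x = 0" using d(2)[of x] \<delta> by force
    moreover have "mollifier \<delta> (x - y) * \<psi> y = 0" for y
    proof (cases "\<psi> y = 0")
      case nz: False
      have "infdist y (- \<Omega>) \<le> infdist x (- \<Omega>) + dist y x" by (rule infdist_triangle)
      then have "\<delta> \<le> norm (x - y)" using d(2)[OF nz] \<delta> False by (simp add: dist_norm norm_minus_commute)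
      then have "mollifier \<delta> (x - y) = 0" by (rule mollifier_zero[OF \<delta>(1)])
      then show ?thesis by simp
    qed simp
    then have "(\<lambda>y. mollifier \<delta> (x - y) * \<psi> y) = (\<lambda>y. 0)" by (rule ext)
    then have "conv (mollifier \<delta>) \<psi> x = 0" unfolding conv_def by (simp only: Bochner_Integration.integral_zero)
    ultimately show ?thesis using L \<delta> by simp
  qed
qed

text \<open>u is split into u - \<phi> n, the mollification error of \<phi> n, the cut-off
  mollification of u - \<phi> n, and that of u itself. For fixed n the second and the fourth part
  vanish as \<delta> tends to 0, while the other two are bounded by the L^1 distance of u and \<phi>
  n. The order of the limits matters, since the Lipschitz constant and the admissible \<delta>
  depend on n.\<close>

theorem u_zero: "AE x in lborel. u x = 0"
proof -
  \<comment> \<open>With this choice the total exponent (\<alpha> - 1) + 1/q of \<delta> equals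
    1/(2q) and is positive.\<close>
  define \<alpha> where "\<alpha> = 1 - 1 / (2 * q)"
  have \<alpha>: "0 < \<alpha>" "\<alpha> < 1" using p by (auto simp: \<alpha>_def field_simps)
  obtain b C0 c where b: "C0 > 0" "c > 0" "b \<in> borel_measurable borel"
    "\<And>x. 0 \<le> b x" "\<And>x. b x \<le> C0 * infdist x (- \<Omega>) powr \<alpha>"
    "\<And>K. compact K \<Longrightarrow> K \<subseteq> \<Omega> \<Longrightarrow> \<exists>s0>0. \<forall>x\<in>K. \<forall>s. 0 < s \<and> s \<le> s0 \<longrightarrow> dlap s b x \<le> - c * s\<^sup>2"
    by (rule superharmonic_barrier[OF \<Omega> \<alpha>]) metis
  obtain E r where E: "escape_directions \<Omega> E r"
    using escape_directions_exist[OF \<Omega>(1) bounded_\<Omega> \<Omega>(3)] by blast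
  then have r: "r > 0" by (simp add: escape_directions_def)
  obtain Cs where Cs: "Cs > 0" "\<And>\<eta>. \<eta> > 0 \<Longrightarrow> measure lborel (strip \<Omega> \<eta>) \<le> Cs * \<eta>"
    using strip_measure[OF \<Omega>(1,2) E] by blast
  obtain C where C: "C > 0"
    "\<And>s i. s > 0 \<Longrightarrow> i \<in> Basis \<Longrightarrow> (\<integral>y. \<bar>dd i (mollifier s) (y :: 'a)\<bar> \<partial>lborel) \<le> C / s"
    "\<And>s i. s > 0 \<Longrightarrow> i \<in> Basis \<Longrightarrow> (\<integral>y. \<bar>dd i (dd i (mollifier s)) (y :: 'a)\<bar> \<partial>lborel) \<le> C / s\<^sup>2"
    using mollifier_derivative_bounds[where 'a='a] by blast
  define A where "A = C0 * 5 powr \<alpha> * C * real DIM('a) * (2 + real (card E) * 36)"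
  define Np where "Np = (\<integral>x. norm (G x) powr p \<partial>lborel) powr (1 / p)"
  define rate where "rate \<delta> = A / c * Np * (Cs * 42) powr (1 / q) * \<delta> powr (1 / (2 * q))" for \<delta>
  define V where "V = measure lborel (ball (0::'a) 1)"
  have A0: "A \<ge> 0" using b(1) C(1) by (simp add: A_def)
  define I where "I = (\<integral>x. \<bar>u x\<bar> \<partial>lborel)"
  have main: "\<exists>d>0. \<forall>\<delta>. 0 < \<delta> \<and> \<delta> \<le> d \<longrightarrow> I \<le> 2 * (\<integral>x. \<bar>u x - \<phi> n x\<bar> \<partial>lborel) + L n * \<delta> * V + rate \<delta>"
    if Ln: "L n \<ge> 0" "\<And>x y. \<bar>\<phi> n x - \<phi> n y\<bar> \<le> L n * norm (x - y)" for n and L :: "nat \<Rightarrow> real"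
  proof -
    obtain K where K: "smooth (\<phi> n)" "compact K" "K \<subseteq> \<Omega>" "\<And>x. x \<notin> K \<Longrightarrow> \<phi> n x = 0"
      by (rule test_functionsE[OF \<phi>(1)]) blast
    obtain e where e: "e > 0" "(\<Union>x\<in>K. ball x e) \<subseteq> \<Omega>"
      by (rule compact_subset_open_imp_ball_epsilon_subset[OF K(2) \<Omega>(1) K(3)])
    have de: "e \<le> infdist x (- \<Omega>)" if "\<phi> n x \<noteq> 0" for x
    proof -
      have "x \<in> K" using K(4) that by blast
      then have "ball x e \<subseteq> \<Omega>" using e(2) by blast
      then have "e \<le> dist x y" if "y \<in> - \<Omega>" for y using that by (force simp: subset_eq not_less[symmetric])
      then show ?thesis unfolding infdist_notempty[OF compl_\<Omega>] by (intro cINF_greatest[OF compl_\<Omega>]) auto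
    qed
    define d where "d = min (e / 6) (r / 36)"
    have "d > 0" using e r by (simp add: d_def)
    moreover have "I \<le> 2 * (\<integral>x. \<bar>u x - \<phi> n x\<bar> \<partial>lborel) + L n * \<delta> * V + rate \<delta>" if \<delta>: "0 < \<delta>" "\<delta> \<le> d" for \<delta>
    proof -
      have \<delta>': "6 * \<delta> \<le> e" "36 * \<delta> \<le> r" using \<delta> by (auto simp: d_def)
      obtain \<zeta> :: "'a \<Rightarrow> real" where \<zeta>: "smooth \<zeta>" "\<And>x. 0 \<le> \<zeta> x" "\<And>x. \<zeta> x \<le> 1"
        "\<And>x. infdist x (- \<Omega>) < 2 * \<delta> \<Longrightarrow> \<zeta> x = 0" "\<And>x. 4 * \<delta> < infdist x (- \<Omega>) \<Longrightarrow> \<zeta> x = 1"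
        "\<And>x i. i \<in> Basis \<Longrightarrow> \<bar>dd i \<zeta> x\<bar> \<le> C / \<delta>" "\<And>x i. i \<in> Basis \<Longrightarrow> \<bar>dd i (dd i \<zeta>) x\<bar> \<le> C / \<delta>\<^sup>2"
        using cutoff_function[OF \<Omega>(1) bounded_\<Omega> \<delta>(1) C(2)[OF \<delta>(1)] C(3)[OF \<delta>(1)]] by blast
      have mt: "(mollifier \<delta> :: 'a \<Rightarrow> real) \<in> test_functions UNIV" by (rule mollifier_test[OF \<delta>(1)])
      let ?v = "conv (mollifier \<delta>) u" and ?w = "conv (mollifier \<delta>) (\<phi> n)" and ?z = "conv (mollifier \<delta>) (\<lambda>x. u x - \<phi> n x)"
      have i\<phi>: "integrable lborel (\<phi> n)" by (rule test_functions_integrable[OF \<phi>(1)])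
      have iu\<phi>: "integrable lborel (\<lambda>x. u x - \<phi> n x)" using u(2) i\<phi> by simp
      have mu\<phi>: "(\<lambda>x. u x - \<phi> n x) \<in> borel_measurable borel" using u(1) smooth_borel[OF K(1)] by simp
      have z: "?z x = ?v x - ?w x" for x
        unfolding conv_def using conv_integrable[OF mt u(2), of x] conv_integrable[OF mt i\<phi>, of x]
        by (simp add: right_diff_distrib)
      have zi: "integrable lborel (\<lambda>x. \<bar>?z x\<bar>)" "(\<integral>x. \<bar>?z x\<bar> \<partial>lborel) \<le> (\<integral>x. \<bar>u x - \<phi> n x\<bar> \<partial>lborel)"
        using conv_mollifier_L1[OF \<delta>(1) mu\<phi> iu\<phi>, of UNIV UNIV] by auto
      have vi: "integrable lborel (\<lambda>x. \<bar>?v x\<bar>)"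
        using conv_mollifier_L1(1)[OF \<delta>(1) u(1,2), of UNIV UNIV] by auto
      have \<zeta>vi: "integrable lborel (\<lambda>x. \<bar>\<zeta> x * ?v x\<bar>)"
      proof -
        have "integrable lborel (\<lambda>x. \<zeta> x * \<bar>?v x\<bar>)"
          using \<zeta>(2,3) by (intro integrable_bounded_mult[OF smooth_borel[OF \<zeta>(1)] _ vi, of 1]) (simp add: abs_le_iff order_trans[of _ 0])
        then show ?thesis using \<zeta>(2) by (simp add: abs_mult)
      qed
      have bi: "integrable lborel (\<lambda>x. L n * \<delta> * indicator (ball (0::'a) 1) x)"
        using emeasure_lborel_ball_finite[of "0::'a" 1] by simp
      have "I \<le> (\<integral>x. \<bar>u x - \<phi> n x\<bar> + L n * \<delta> * indicator (ball 0 1) x + \<bar>?z x\<bar> + \<bar>\<zeta> x * ?v x\<bar> \<partial>lborel)"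
        unfolding I_def
      proof (rule integral_mono)
        show "integrable lborel (\<lambda>x. \<bar>u x\<bar>)" using u(2) by simp
        show "integrable lborel (\<lambda>x. \<bar>u x - \<phi> n x\<bar> + L n * \<delta> * indicator (ball 0 1) x + \<bar>?z x\<bar> + \<bar>\<zeta> x * ?v x\<bar>)"
          using iu\<phi> bi zi(1) \<zeta>vi by (intro Bochner_Integration.integrable_add) auto
        fix x
        have "\<bar>\<phi> n x - \<zeta> x * ?w x\<bar> \<le> L n * \<delta> * indicator (ball 0 1) x"
          by (rule mollification_error[OF \<phi>(1) Ln e(1) de \<delta>(1) \<delta>'(1) \<zeta>(5)])
        moreover have "\<bar>\<zeta> x * ?z x\<bar> \<le> \<bar>?z x\<bar>"
          unfolding abs_mult using \<zeta>(2,3)[of x] by (simp add: mult_left_le_one_le)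
        moreover have "u x = (u x - \<phi> n x) + (\<phi> n x - \<zeta> x * ?w x) - \<zeta> x * ?z x + \<zeta> x * ?v x"
          unfolding z by (simp add: algebra_simps)
        ultimately show "\<bar>u x\<bar> \<le> \<bar>u x - \<phi> n x\<bar> + L n * \<delta> * indicator (ball 0 1) x + \<bar>?z x\<bar> + \<bar>\<zeta> x * ?v x\<bar>"
          by linarith
      qed
      also have "\<dots> = (\<integral>x. \<bar>u x - \<phi> n x\<bar> \<partial>lborel) + L n * \<delta> * V + (\<integral>x. \<bar>?z x\<bar> \<partial>lborel) + (\<integral>x. \<bar>\<zeta> x * ?v x\<bar> \<partial>lborel)"
        using iu\<phi> bi zi(1) \<zeta>vi by (simp add: V_def)
      also have "(\<integral>x. \<bar>\<zeta> x * ?v x\<bar> \<partial>lborel) \<le> rate \<delta>"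
      proof -
        have "c * (\<integral>x. \<bar>\<zeta> x * ?v x\<bar> \<partial>lborel) \<le> A * \<delta> powr (\<alpha> - 1) * (\<integral>x. indicator (strip \<Omega> (42 * \<delta>)) x * norm (G x) \<partial>lborel)"
          unfolding A_def by (rule kato_estimate[OF b(3-5,1) \<alpha>(1) b(6) E \<delta>(1) \<delta>'(2) C(1) \<zeta>])
        also have "\<dots> \<le> A * \<delta> powr (\<alpha> - 1) * (Np * (Cs * (42 * \<delta>)) powr (1 / q))"
          unfolding Np_def using A0 \<delta> by (intro mult_left_mono strip_gradient_bound[OF Cs]) auto
        also have "\<dots> = A * Np * (Cs * 42) powr (1 / q) * (\<delta> powr (\<alpha> - 1) * \<delta> powr (1 / q))"
        proof -
          have "(Cs * (42 * \<delta>)) powr (1 / q) = (Cs * 42) powr (1 / q) * \<delta> powr (1 / q)"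
            using Cs(1) \<delta>(1) by (simp add: powr_mult[symmetric] mult.assoc)
          then show ?thesis by simp
        qed
        also have "\<delta> powr (\<alpha> - 1) * \<delta> powr (1 / q) = \<delta> powr (1 / (2 * q))"
        proof -
          have "\<alpha> - 1 + 1 / q = 1 / (2 * q)" using p by (simp add: \<alpha>_def field_simps)
          then show ?thesis by (simp add: powr_add[symmetric])
        qed
        finally show ?thesis using b(2) by (simp add: rate_def field_simps)
      qed
      finally show ?thesis using zi(2) by simp
    qed
    ultimately show ?thesis by blast
  qed
  have "I \<le> 2 * (\<integral>x. \<bar>u x - \<phi> n x\<bar> \<partial>lborel)" for n
  proof -
    obtain L where L: "L \<ge> 0" "\<And>x y. \<bar>\<phi> n x - \<phi> n y\<bar> \<le> L * norm (x - y)"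
      using test_lipschitz[OF \<phi>(1)] by blast
    obtain d where d: "d > 0" "\<And>\<delta>. 0 < \<delta> \<Longrightarrow> \<delta> \<le> d \<Longrightarrow> I \<le> 2 * (\<integral>x. \<bar>u x - \<phi> n x\<bar> \<partial>lborel) + L * \<delta> * V + rate \<delta>"
      using main[of "\<lambda>_. L" n] L by blast
    have "((\<lambda>\<delta>. \<delta> powr (1 / (2 * q))) \<longlongrightarrow> 0 powr (1 / (2 * q))) (at_right 0)"
    proof (rule tendsto_powr'[OF tendsto_ident_at tendsto_const])
      show "(0::real) \<noteq> 0 \<or> 0 < 1 / (2 * q) \<and> (\<forall>\<^sub>F \<delta> in at_right (0::real). 0 \<le> \<delta>)"
        using p by (auto simp: eventually_at_filter)
    qed
    then have "((\<lambda>\<delta>. 2 * (\<integral>x. \<bar>u x - \<phi> n x\<bar> \<partial>lborel) + L * \<delta> * V + rate \<delta>) \<longlongrightarrow>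
        2 * (\<integral>x. \<bar>u x - \<phi> n x\<bar> \<partial>lborel) + L * 0 * V + A / c * Np * (Cs * 42) powr (1 / q) * 0 powr (1 / (2 * q))) (at_right 0)"
      unfolding rate_def by (intro tendsto_add tendsto_mult tendsto_const tendsto_ident_at)
    moreover have "\<forall>\<^sub>F \<delta> in at_right 0. I \<le> 2 * (\<integral>x. \<bar>u x - \<phi> n x\<bar> \<partial>lborel) + L * \<delta> * V + rate \<delta>"
      using d by (auto simp: eventually_at_right intro!: exI[of _ d])
    ultimately have "I \<le> 2 * (\<integral>x. \<bar>u x - \<phi> n x\<bar> \<partial>lborel) + L * 0 * V + A / c * Np * (Cs * 42) powr (1 / q) * 0 powr (1 / (2 * q))"
      by (rule tendsto_lowerbound) simp
    then show ?thesis using p by simp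
  qed
  moreover have "(\<lambda>n. 2 * (\<integral>x. \<bar>u x - \<phi> n x\<bar> \<partial>lborel)) \<longlonglongrightarrow> 0"
    using tendsto_mult_right_zero[OF \<phi>(2)] by simp
  ultimately have "I \<le> 0"
    using Lim_bounded2[of "\<lambda>n. 2 * (\<integral>x. \<bar>u x - \<phi> n x\<bar> \<partial>lborel)" 0 0 I] by blast
  moreover have "I \<ge> 0" unfolding I_def by simp
  ultimately have "I = 0" by simp
  then have "AE x in lborel. \<bar>u x\<bar> = 0"
    using integral_nonneg_eq_0_iff_AE[of lborel "\<lambda>x. \<bar>u x\<bar>"] u(2) by (simp add: I_def)
  then show ?thesis by simp
qed

end

section \<open>Uniqueness of weak solutions\<close>

text \<open>Elements of L^p are only Lebesgue measurable on \<Omega>. A Borel version vanishing off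
  \<Omega> is assembled from its coordinates and makes convolution and product measurability
  available.\<close>

lemma borel_representative:
  fixes f :: "'a::euclidean_space \<Rightarrow> 'b::euclidean_space"
  assumes f: "f \<in> borel_measurable (lebesgue_on \<Omega>)" and \<Omega>: "\<Omega> \<in> sets borel"
  obtains f' where "f' \<in> borel_measurable borel" "\<And>x. x \<notin> \<Omega> \<Longrightarrow> f' x = 0" "AE x in lebesgue_on \<Omega>. f x = f' x"
proof -
  have \<Omega>l: "\<Omega> \<in> sets lebesgue" using \<Omega> by simp
  have "\<exists>h\<in>borel_measurable lborel. AE x in lborel. indicator \<Omega> x * (f x \<bullet> b) = h x" for b
  proof (rule completion_ex_borel_measurable_real)
    have "(\<lambda>x. f x \<bullet> b) \<in> borel_measurable (lebesgue_on \<Omega>)" using f by simp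
    then show "(\<lambda>x. indicator \<Omega> x * (f x \<bullet> b)) \<in> borel_measurable lebesgue"
      using \<Omega>l borel_measurable_restrict_space_iff[of \<Omega> lebesgue "\<lambda>x. f x \<bullet> b"] by simp
  qed
  then obtain h where h: "\<And>b. h b \<in> borel_measurable lborel"
    "\<And>b. AE x in lborel. indicator \<Omega> x * (f x \<bullet> b) = h b x" by metis
  define f' where "f' x = (\<Sum>b\<in>Basis. (indicator \<Omega> x * h b x) *\<^sub>R b)" for x
  show ?thesis
  proof (rule that[of f'])
    show "f' \<in> borel_measurable borel" unfolding f'_def[abs_def] using h(1) \<Omega> by measurable
    show "f' x = 0" if "x \<notin> \<Omega>" for x using that by (simp add: f'_def)
    have "AE x in lborel. \<forall>b\<in>(Basis::'b set). indicator \<Omega> x * (f x \<bullet> b) = h b x"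
      by (rule AE_finite_allI) (simp_all add: h(2))
    then have "AE x in lebesgue. \<forall>b\<in>(Basis::'b set). indicator \<Omega> x * (f x \<bullet> b) = h b x" by (rule AE_completion)
    then have "AE x in lebesgue. x \<in> \<Omega> \<longrightarrow> f x = f' x"
    proof eventually_elim
      case (elim x)
      show ?case
      proof
        assume "x \<in> \<Omega>"
        then have "f' x = (\<Sum>b\<in>Basis. (f x \<bullet> b) *\<^sub>R b)"
          using elim unfolding f'_def by (intro sum.cong) auto
        then show "f x = f' x" by (simp add: euclidean_representation)
      qed
    qed
    then show "AE x in lebesgue_on \<Omega>. f x = f' x" using \<Omega>l by (simp add: AE_restrict_space_iff)
  qed
qed

lemma L1_le_Lp:
  fixes f :: "'a::euclidean_space \<Rightarrow> 'b::euclidean_space"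
  assumes p: "1 < p" "1 < q" "1 / p + 1 / q = 1" and \<Omega>: "\<Omega> \<in> sets borel" "\<Omega> \<subseteq> ball 0 1"
    and f: "f \<in> borel_measurable borel" "\<And>x. x \<notin> \<Omega> \<Longrightarrow> f x = 0" "integrable lborel (\<lambda>x. norm (f x) powr p)"
  shows "integrable lborel f"
    "(\<integral>x. norm (f x) \<partial>lborel) \<le> (\<integral>x. norm (f x) powr p \<partial>lborel) powr (1 / p) * measure lborel (ball (0::'a) 1) powr (1 / q)"
proof -
  let ?B = "ball (0::'a) 1"
  have eq: "(\<lambda>x. (indicator ?B x :: real) powr q) = indicator ?B"
    using p by (auto simp: indicator_def)
  have eq2: "(\<lambda>x. norm (f x) * indicator ?B x) = (\<lambda>x. norm (f x))"
    using f(2) \<Omega>(2) by (intro ext) (force simp: indicator_def)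
  have fin: "integrable lborel (indicator ?B :: 'a \<Rightarrow> real)"
    using emeasure_lborel_ball_finite[of "0::'a" 1] by simp
  have h: "integrable lborel (\<lambda>x. norm (f x) * indicator ?B x)"
    "(\<integral>x. norm (f x) * indicator ?B x \<partial>lborel)
     \<le> (\<integral>x. norm (f x) powr p \<partial>lborel) powr (1 / p) * (\<integral>x. indicator ?B x powr q \<partial>lborel) powr (1 / q)"
    using holder_inequality[of p q "\<lambda>x. norm (f x)" lborel "indicator ?B"] p f fin by (auto simp: eq)
  show "integrable lborel f"
    using h(1) f(1) unfolding eq2 by (simp add: integrable_norm_iff)
  show "(\<integral>x. norm (f x) \<partial>lborel) \<le> (\<integral>x. norm (f x) powr p \<partial>lborel) powr (1 / p) * measure lborel ?B powr (1 / q)"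
    using h(2) unfolding eq eq2 by simp
qed

lemma Lp_representative:
  fixes f f' :: "'a::euclidean_space \<Rightarrow> 'b::euclidean_space"
  assumes \<Omega>: "\<Omega> \<in> sets borel" and f: "f \<in> borel_measurable (lebesgue_on \<Omega>)"
    and f': "f' \<in> borel_measurable borel" "\<And>x. x \<notin> \<Omega> \<Longrightarrow> f' x = 0" "AE x in lebesgue_on \<Omega>. f x = f' x"
    and p: "p > 0"
  shows "f \<in> Lp p \<Omega> \<Longrightarrow> integrable lborel (\<lambda>x. norm (f' x) powr p)"
    "Lp_norm p \<Omega> f = (\<integral>x. norm (f' x) powr p \<partial>lborel) powr (1 / p)"
proof -
  have \<Omega>l: "\<Omega> \<in> sets lebesgue" using \<Omega> by simp
  have f'm: "f' \<in> borel_measurable (lebesgue_on \<Omega>)"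
    by (rule measurable_restrict_space1[OF borel_imp_lebesgue[OF f'(1)]])
  have np: "(\<lambda>x. norm (f' x) powr p) \<in> borel_measurable borel" using f'(1) by simp
  have nz: "norm (f' x) powr p = 0" if "x \<notin> \<Omega>" for x using f'(2)[OF that] by simp
  show "integrable lborel (\<lambda>x. norm (f' x) powr p)" if "f \<in> Lp p \<Omega>"
  proof -
    have "f' \<in> Lp p \<Omega>" using Lp_cong_AE(1)[OF f f'm f'(3)] that by simp
    then show ?thesis
      using integrable_lebesgue_on_eq[OF \<Omega>l np nz] by (simp add: Lp_def)
  qed
  show "Lp_norm p \<Omega> f = (\<integral>x. norm (f' x) powr p \<partial>lborel) powr (1 / p)"
    unfolding Lp_norm_cong_AE[OF f f'm f'(3)] using integral_lebesgue_on_eq[OF \<Omega>l np nz] by (simp add: Lp_norm_def)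
qed

text \<open>Prepares a solution for the analysis on \<open>lborel\<close>: Borel representatives
  extended by zero, and approximation in L^p weakened to L^1, which Hoelder's inequality permits on
  a bounded domain. The L^p norm of the gradient is kept exactly, since it is the quantity that
  blows up.\<close>

lemma weak_solution_data:
  fixes \<Omega> :: "'a::euclidean_space set"
  assumes p: "1 < p" "1 < q" "1 / p + 1 / q = 1" and \<Omega>: "open \<Omega>" "\<Omega> \<subseteq> ball 0 1"
    and sol: "weak_solution p \<Omega> f u"
  obtains u' G \<phi> where "u' \<in> borel_measurable borel" "\<And>x. x \<notin> \<Omega> \<Longrightarrow> u' x = 0" "integrable lborel u'"
    "AE x in lebesgue_on \<Omega>. u x = u' x"
    "G \<in> borel_measurable borel" "\<And>x. x \<notin> \<Omega> \<Longrightarrow> G x = 0" "integrable lborel G"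
    "integrable lborel (\<lambda>x. norm (G x) powr p)"
    "Lp_norm p \<Omega> (weak_gradient \<Omega> u) = (\<integral>x. norm (G x) powr p \<partial>lborel) powr (1 / p)"
    "\<And>n::nat. \<phi> n \<in> test_functions \<Omega>"
    "(\<lambda>n. \<integral>x. \<bar>u' x - \<phi> n x\<bar> \<partial>lborel) \<longlonglongrightarrow> 0"
    "(\<lambda>n. \<integral>x. norm (G x - grad (\<phi> n) x) \<partial>lborel) \<longlonglongrightarrow> 0"
    "\<And>\<psi>. \<psi> \<in> test_functions \<Omega> \<Longrightarrow> (\<integral>x. G x \<bullet> grad \<psi> x \<partial>lborel) = - (LINT x|lebesgue_on \<Omega>. f x \<bullet> grad \<psi> x)"
proof -
  have \<Omega>b: "\<Omega> \<in> sets borel" and \<Omega>l: "\<Omega> \<in> sets lebesgue" using \<Omega>(1) by simp_all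
  note approx = weak_solution_approx[OF \<Omega>(1) sol]
  define W where "W = weak_gradient \<Omega> u"
  have um: "u \<in> borel_measurable (lebesgue_on \<Omega>)" using approx(1) by (simp add: Lp_def)
  have Wm: "W \<in> borel_measurable (lebesgue_on \<Omega>)" using approx(2) by (simp add: Lp_def W_def)
  obtain u' where u': "u' \<in> borel_measurable borel" "\<And>x. x \<notin> \<Omega> \<Longrightarrow> u' x = 0" "AE x in lebesgue_on \<Omega>. u x = u' x"
    using borel_representative[OF um \<Omega>b] by blast
  obtain G where G: "G \<in> borel_measurable borel" "\<And>x. x \<notin> \<Omega> \<Longrightarrow> G x = 0" "AE x in lebesgue_on \<Omega>. W x = G x"
    using borel_representative[OF Wm \<Omega>b] by blast
  have p0: "p > 0" using p by simp
  have u'p: "integrable lborel (\<lambda>x. norm (u' x) powr p)"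
    by (rule Lp_representative(1)[OF \<Omega>b um u' p0 approx(1)])
  have Gp: "integrable lborel (\<lambda>x. norm (G x) powr p)"
    by (rule Lp_representative(1)[OF \<Omega>b Wm G p0 approx(2)[folded W_def]])
  obtain \<phi> where \<phi>: "\<And>n. \<phi> n \<in> test_functions \<Omega>" "(\<lambda>n::nat. Lp_norm p \<Omega> (\<lambda>x. u x - \<phi> n x)) \<longlonglongrightarrow> 0"
      "(\<lambda>n. Lp_norm p \<Omega> (\<lambda>x. W x - grad (\<phi> n) x)) \<longlonglongrightarrow> 0"
    using approx(4) unfolding W_def by blast
  have \<phi>z: "\<phi> n x = 0" "grad (\<phi> n) x = 0" if x: "x \<notin> \<Omega>" for n x
  proof -
    obtain K where K: "smooth (\<phi> n)" "compact K" "K \<subseteq> \<Omega>" "\<And>x. x \<notin> K \<Longrightarrow> \<phi> n x = 0"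
      by (rule test_functionsE[OF \<phi>(1)]) blast
    then show "\<phi> n x = 0" "grad (\<phi> n) x = 0"
      using x grad_zero_off[OF K(1) compact_imp_closed[OF K(2)] K(4)] by auto
  qed
  have sm: "smooth (\<phi> n)" for n by (rule test_functions_smooth[OF \<phi>(1)])
  have pow_sum: "norm (a - b) powr p \<le> 2 powr p * (norm a powr p + norm b powr p)" for a b :: "'c::real_normed_vector"
  proof -
    have "norm (a - b) powr p \<le> (2 * max (norm a) (norm b)) powr p"
      using norm_triangle_ineq4[of a b] p0 by (intro powr_mono2) auto
    also have "\<dots> = 2 powr p * max (norm a) (norm b) powr p" by (simp add: powr_mult)
    also have "\<dots> \<le> 2 powr p * (norm a powr p + norm b powr p)" by (intro mult_left_mono) (auto simp: max_def)
    finally show ?thesis .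
  qed
  let ?V = "measure lborel (ball (0::'a) 1) powr (1 / q)"
  have conv1: "(\<lambda>n. \<integral>x. norm (h x - \<psi> n x) \<partial>lborel) \<longlonglongrightarrow> 0"
    if h: "h \<in> borel_measurable borel" "\<And>x. x \<notin> \<Omega> \<Longrightarrow> h x = 0" "integrable lborel (\<lambda>x. norm (h x) powr p)"
      and \<psi>: "\<And>n. \<psi> n \<in> borel_measurable borel" "\<And>n x. x \<notin> \<Omega> \<Longrightarrow> \<psi> n x = 0" "\<And>n. integrable lborel (\<lambda>x. norm (\<psi> n x) powr p)"
      and H: "H \<in> borel_measurable (lebesgue_on \<Omega>)" "AE x in lebesgue_on \<Omega>. H x = h x"
      and lim: "(\<lambda>n. Lp_norm p \<Omega> (\<lambda>x. H x - \<psi> n x)) \<longlonglongrightarrow> 0"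
    for h H :: "'a \<Rightarrow> 'c::euclidean_space" and \<psi> :: "nat \<Rightarrow> 'a \<Rightarrow> 'c"
  proof (rule Lim_null_comparison)
    have i: "integrable lborel (\<lambda>x. norm (h x - \<psi> n x) powr p)" for n
    proof (rule Bochner_Integration.integrable_bound)
      show "integrable lborel (\<lambda>x. 2 powr p * (norm (h x) powr p + norm (\<psi> n x) powr p))" using h \<psi> by simp
      show "(\<lambda>x. norm (h x - \<psi> n x) powr p) \<in> borel_measurable lborel" using h(1) \<psi>(1) by simp
      show "AE x in lborel. norm (norm (h x - \<psi> n x) powr p) \<le> norm (2 powr p * (norm (h x) powr p + norm (\<psi> n x) powr p))"
        using pow_sum by (intro AE_I2) simp
    qed
    have eq: "Lp_norm p \<Omega> (\<lambda>x. H x - \<psi> n x) = (\<integral>x. norm (h x - \<psi> n x) powr p \<partial>lborel) powr (1 / p)" for n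
    proof (rule Lp_representative(2)[OF \<Omega>b _ _ _ _ p0])
      have "\<psi> n \<in> borel_measurable (lebesgue_on \<Omega>)" by (rule measurable_restrict_space1[OF borel_imp_lebesgue[OF \<psi>(1)]])
      then show "(\<lambda>x. H x - \<psi> n x) \<in> borel_measurable (lebesgue_on \<Omega>)" using H(1) by simp
      show "(\<lambda>x. h x - \<psi> n x) \<in> borel_measurable borel" using h(1) \<psi>(1) by simp
      show "AE x in lebesgue_on \<Omega>. H x - \<psi> n x = h x - \<psi> n x" using H(2) by eventually_elim simp
    qed (use h(2) \<psi>(2) in simp)
    show "(\<lambda>n. Lp_norm p \<Omega> (\<lambda>x. H x - \<psi> n x) * ?V) \<longlonglongrightarrow> 0"
      using tendsto_mult_left_zero[OF lim] by simp
    have "(\<integral>x. norm (h x - \<psi> n x) \<partial>lborel) \<le> Lp_norm p \<Omega> (\<lambda>x. H x - \<psi> n x) * ?V" for n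
      unfolding eq using h(1,2) \<psi>(1,2) by (intro L1_le_Lp(2)[OF p \<Omega>b \<Omega>(2) _ _ i]) auto
    then show "\<forall>\<^sub>F n in sequentially. norm (\<integral>x. norm (h x - \<psi> n x) \<partial>lborel) \<le> Lp_norm p \<Omega> (\<lambda>x. H x - \<psi> n x) * ?V"
      by (intro always_eventually) simp
  qed
  have tp: "integrable lborel (\<lambda>x. norm (\<phi> n x) powr p)" "integrable lborel (\<lambda>x. norm (grad (\<phi> n) x) powr p)" for n
  proof -
    obtain K where K: "smooth (\<phi> n)" "compact K" "K \<subseteq> \<Omega>" "\<And>x. x \<notin> K \<Longrightarrow> \<phi> n x = 0"
      by (rule test_functionsE[OF \<phi>(1)]) blast
    have gz: "grad (\<phi> n) x = 0" if "x \<notin> K" for x by (rule grad_zero_off[OF K(1) compact_imp_closed[OF K(2)] K(4) that])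
    have c: "continuous_on UNIV (\<phi> n)" "continuous_on UNIV (grad (\<phi> n))"
      by (rule smooth_continuous[OF K(1)] grad_continuous[OF K(1)])+
    have cp: "continuous_on UNIV (\<lambda>x. norm (\<phi> n x) powr p)" "continuous_on UNIV (\<lambda>x. norm (grad (\<phi> n) x) powr p)"
      using c p0 by (auto intro!: continuous_on_powr' continuous_on_norm continuous_on_rabs continuous_on_const)
    show "integrable lborel (\<lambda>x. norm (\<phi> n x) powr p)" "integrable lborel (\<lambda>x. norm (grad (\<phi> n) x) powr p)"
      using integrable_cont_compact_support[OF cp(1) K(2)] integrable_cont_compact_support[OF cp(2) K(2)] K(4) gz
      by auto
  qed
  show ?thesis
  proof (rule that[of u' G \<phi>])
    show "integrable lborel u'" by (rule L1_le_Lp(1)[OF p \<Omega>b \<Omega>(2) u'(1,2) u'p])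
    show "integrable lborel G" by (rule L1_le_Lp(1)[OF p \<Omega>b \<Omega>(2) G(1,2) Gp])
    show "Lp_norm p \<Omega> (weak_gradient \<Omega> u) = (\<integral>x. norm (G x) powr p \<partial>lborel) powr (1 / p)"
      using Lp_representative(2)[OF \<Omega>b Wm G p0] by (simp add: W_def)
    show "(\<lambda>n. \<integral>x. \<bar>u' x - \<phi> n x\<bar> \<partial>lborel) \<longlonglongrightarrow> 0"
      using conv1[OF u'(1,2) u'p smooth_borel[OF sm] \<phi>z(1) tp(1) um u'(3) \<phi>(2)] by simp
    show "(\<lambda>n. \<integral>x. norm (G x - grad (\<phi> n) x) \<partial>lborel) \<longlonglongrightarrow> 0"
      by (rule conv1[OF G(1,2) Gp grad_borel[OF sm] \<phi>z(2) tp(2) Wm G(3) \<phi>(3)])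
    fix \<psi> assume \<psi>: "\<psi> \<in> test_functions \<Omega>"
    have gb: "grad \<psi> \<in> borel_measurable borel" by (rule grad_borel[OF test_functions_smooth[OF \<psi>]])
    have gl: "grad \<psi> \<in> borel_measurable (lebesgue_on \<Omega>)" by (rule measurable_restrict_space1[OF borel_imp_lebesgue[OF gb]])
    have Gl: "G \<in> borel_measurable (lebesgue_on \<Omega>)" by (rule measurable_restrict_space1[OF borel_imp_lebesgue[OF G(1)]])
    have "(\<integral>x. G x \<bullet> grad \<psi> x \<partial>lborel) = (LINT x|lebesgue_on \<Omega>. G x \<bullet> grad \<psi> x)"
      using G gb by (intro integral_lebesgue_on_eq(1)[symmetric, OF \<Omega>l]) auto
    also have "\<dots> = (LINT x|lebesgue_on \<Omega>. W x \<bullet> grad \<psi> x)"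
    proof (rule integral_cong_AE)
      show "AE x in lebesgue_on \<Omega>. G x \<bullet> grad \<psi> x = W x \<bullet> grad \<psi> x" using G(3) by eventually_elim simp
    qed (use Gl Wm gl in \<open>auto intro!: borel_measurable_inner\<close>)
    also have "\<dots> = - (LINT x|lebesgue_on \<Omega>. f x \<bullet> grad \<psi> x)"
      using sol \<psi> by (simp add: weak_solution_def W_def)
    finally show "(\<integral>x. G x \<bullet> grad \<psi> x \<partial>lborel) = - (LINT x|lebesgue_on \<Omega>. f x \<bullet> grad \<psi> x)" .
  qed (fact u' G Gp \<phi>(1))+
qed

theorem weak_solution_unique:
  fixes \<Omega> :: "'a::euclidean_space set"
  assumes \<Omega>: "open \<Omega>" "\<Omega> \<subseteq> ball 0 1" "flat_exterior_cones \<Omega>" and p: "1 < p"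
    and sol: "weak_solution p \<Omega> f u" "weak_solution p \<Omega> f v"
  shows "AE x in lebesgue_on \<Omega>. u x = v x"
proof -
  define q where "q = p / (p - 1)"
  have q: "1 < q" "1 / p + 1 / q = 1" using p by (auto simp: q_def field_simps)
  obtain u1 G1 \<phi>1 where 1: "u1 \<in> borel_measurable borel" "\<And>x. x \<notin> \<Omega> \<Longrightarrow> u1 x = 0" "integrable lborel u1"
    "AE x in lebesgue_on \<Omega>. u x = u1 x"
    "G1 \<in> borel_measurable borel" "\<And>x. x \<notin> \<Omega> \<Longrightarrow> G1 x = 0" "integrable lborel G1"
    "integrable lborel (\<lambda>x. norm (G1 x) powr p)"
    "Lp_norm p \<Omega> (weak_gradient \<Omega> u) = (\<integral>x. norm (G1 x) powr p \<partial>lborel) powr (1 / p)"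
    "\<And>n::nat. \<phi>1 n \<in> test_functions \<Omega>"
    "(\<lambda>n. \<integral>x. \<bar>u1 x - \<phi>1 n x\<bar> \<partial>lborel) \<longlonglongrightarrow> 0"
    "(\<lambda>n. \<integral>x. norm (G1 x - grad (\<phi>1 n) x) \<partial>lborel) \<longlonglongrightarrow> 0"
    "\<And>\<psi>. \<psi> \<in> test_functions \<Omega> \<Longrightarrow> (\<integral>x. G1 x \<bullet> grad \<psi> x \<partial>lborel) = - (LINT x|lebesgue_on \<Omega>. f x \<bullet> grad \<psi> x)"
    using weak_solution_data[OF p q \<Omega>(1,2) sol(1)] by blast
  obtain u2 G2 \<phi>2 where 2: "u2 \<in> borel_measurable borel" "\<And>x. x \<notin> \<Omega> \<Longrightarrow> u2 x = 0" "integrable lborel u2"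
    "AE x in lebesgue_on \<Omega>. v x = u2 x"
    "G2 \<in> borel_measurable borel" "\<And>x. x \<notin> \<Omega> \<Longrightarrow> G2 x = 0" "integrable lborel G2"
    "integrable lborel (\<lambda>x. norm (G2 x) powr p)"
    "Lp_norm p \<Omega> (weak_gradient \<Omega> v) = (\<integral>x. norm (G2 x) powr p \<partial>lborel) powr (1 / p)"
    "\<And>n::nat. \<phi>2 n \<in> test_functions \<Omega>"
    "(\<lambda>n. \<integral>x. \<bar>u2 x - \<phi>2 n x\<bar> \<partial>lborel) \<longlonglongrightarrow> 0"
    "(\<lambda>n. \<integral>x. norm (G2 x - grad (\<phi>2 n) x) \<partial>lborel) \<longlonglongrightarrow> 0"
    "\<And>\<psi>. \<psi> \<in> test_functions \<Omega> \<Longrightarrow> (\<integral>x. G2 x \<bullet> grad \<psi> x \<partial>lborel) = - (LINT x|lebesgue_on \<Omega>. f x \<bullet> grad \<psi> x)"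
    using weak_solution_data[OF p q \<Omega>(1,2) sol(2)] by blast
  define \<phi> where "\<phi> n x = 1 * \<phi>1 n x + (-1) * \<phi>2 n x" for n x
  have \<phi>t: "\<phi> n \<in> test_functions \<Omega>" for n
    unfolding \<phi>_def[abs_def] by (rule test_functions_add[OF 1(10) 2(10)])
  have sm: "smooth (\<phi>1 n)" "smooth (\<phi>2 n)" "smooth (\<phi> n)" for n
    using 1(10) 2(10) \<phi>t test_functions_smooth by blast+
  have grad\<phi>: "grad (\<phi> n) x = grad (\<phi>1 n) x - grad (\<phi>2 n) x" for n x
  proof -
    have "((\<lambda>x. \<phi>1 n x - \<phi>2 n x) has_derivative (\<lambda>h. dd h (\<phi>1 n) x - dd h (\<phi>2 n) x)) (at x)"
      by (intro has_derivative_diff smooth_has_derivative sm)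
    then have "dd i (\<phi> n) x = dd i (\<phi>1 n) x - dd i (\<phi>2 n) x" for i
      unfolding \<phi>_def[abs_def] by (simp add: dd_eqI)
    then show ?thesis
      using sm by (simp add: grad_eq smooth_differentiable scaleR_diff_left sum_subtractf)
  qed
  have conv: "(\<lambda>n. \<integral>x. norm ((h1 x - h2 x) - (\<psi>1 n x - \<psi>2 n x)) \<partial>lborel) \<longlonglongrightarrow> 0"
    if "integrable lborel h1" "integrable lborel h2" "\<And>n. integrable lborel (\<psi>1 n)" "\<And>n. integrable lborel (\<psi>2 n)"
      "(\<lambda>n. \<integral>x. norm (h1 x - \<psi>1 n x) \<partial>lborel) \<longlonglongrightarrow> 0" "(\<lambda>n. \<integral>x. norm (h2 x - \<psi>2 n x) \<partial>lborel) \<longlonglongrightarrow> 0"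
    for h1 h2 :: "'a \<Rightarrow> 'c::euclidean_space" and \<psi>1 \<psi>2 :: "nat \<Rightarrow> 'a \<Rightarrow> 'c"
  proof (rule Lim_null_comparison)
    show "(\<lambda>n. (\<integral>x. norm (h1 x - \<psi>1 n x) \<partial>lborel) + (\<integral>x. norm (h2 x - \<psi>2 n x) \<partial>lborel)) \<longlonglongrightarrow> 0"
      using tendsto_add[OF that(5,6)] by simp
    show "\<forall>\<^sub>F n in sequentially. norm (\<integral>x. norm ((h1 x - h2 x) - (\<psi>1 n x - \<psi>2 n x)) \<partial>lborel)
        \<le> (\<integral>x. norm (h1 x - \<psi>1 n x) \<partial>lborel) + (\<integral>x. norm (h2 x - \<psi>2 n x) \<partial>lborel)"
    proof (rule always_eventually, rule allI)
      fix n
      have "(\<integral>x. norm ((h1 x - h2 x) - (\<psi>1 n x - \<psi>2 n x)) \<partial>lborel)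
          \<le> (\<integral>x. norm (h1 x - \<psi>1 n x) + norm (h2 x - \<psi>2 n x) \<partial>lborel)"
      proof (rule integral_mono)
        show "norm ((h1 x - h2 x) - (\<psi>1 n x - \<psi>2 n x)) \<le> norm (h1 x - \<psi>1 n x) + norm (h2 x - \<psi>2 n x)" for x
          using norm_triangle_ineq4[of "h1 x - \<psi>1 n x" "h2 x - \<psi>2 n x"] by (simp add: algebra_simps)
      qed (use that(1-4) in auto)
      also have "\<dots> = (\<integral>x. norm (h1 x - \<psi>1 n x) \<partial>lborel) + (\<integral>x. norm (h2 x - \<psi>2 n x) \<partial>lborel)"
        using that(1-4) by (intro Bochner_Integration.integral_add) auto
      finally show "norm (\<integral>x. norm ((h1 x - h2 x) - (\<psi>1 n x - \<psi>2 n x)) \<partial>lborel)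
        \<le> (\<integral>x. norm (h1 x - \<psi>1 n x) \<partial>lborel) + (\<integral>x. norm (h2 x - \<psi>2 n x) \<partial>lborel)" by simp
    qed
  qed
  \<comment> \<open>The source cancels in the difference of the two solutions, and the differences
    of the approximating test functions approximate it.\<close>
  interpret weakly_harmonic_zero_trace \<Omega> p q "\<lambda>x. u1 x - u2 x" "\<lambda>x. G1 x - G2 x" \<phi>
  proof
    show "integrable lborel (\<lambda>x. norm (G1 x - G2 x) powr p)"
    proof (rule Bochner_Integration.integrable_bound)
      show "integrable lborel (\<lambda>x. 2 powr p * (norm (G1 x) powr p + norm (G2 x) powr p))" using 1(8) 2(8) by simp
      show "(\<lambda>x. norm (G1 x - G2 x) powr p) \<in> borel_measurable lborel" using 1(5) 2(5) by simp
      have "norm (G1 x - G2 x) powr p \<le> 2 powr p * (norm (G1 x) powr p + norm (G2 x) powr p)" for x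
      proof -
        have "norm (G1 x - G2 x) powr p \<le> (2 * max (norm (G1 x)) (norm (G2 x))) powr p"
          using norm_triangle_ineq4[of "G1 x" "G2 x"] p by (intro powr_mono2) auto
        also have "\<dots> = 2 powr p * max (norm (G1 x)) (norm (G2 x)) powr p" by (simp add: powr_mult)
        also have "\<dots> \<le> 2 powr p * (norm (G1 x) powr p + norm (G2 x) powr p)" by (intro mult_left_mono) (auto simp: max_def)
        finally show ?thesis .
      qed
      then show "AE x in lborel. norm (norm (G1 x - G2 x) powr p) \<le> norm (2 powr p * (norm (G1 x) powr p + norm (G2 x) powr p))"
        by (intro AE_I2) simp
    qed
    show "(\<lambda>n. \<integral>x. \<bar>u1 x - u2 x - \<phi> n x\<bar> \<partial>lborel) \<longlonglongrightarrow> 0"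
      using conv[OF 1(3) 2(3) test_functions_integrable[OF 1(10)] test_functions_integrable[OF 2(10)]] 1(11) 2(11)
      by (simp add: \<phi>_def)
    show "(\<lambda>n. \<integral>x. norm (G1 x - G2 x - grad (\<phi> n) x) \<partial>lborel) \<longlonglongrightarrow> 0"
      using conv[OF 1(7) 2(7) test_functions_grad_integrable[OF 1(10)] test_functions_grad_integrable[OF 2(10)] 1(12) 2(12)]
      by (simp add: grad\<phi>)
    fix \<psi> assume \<psi>: "\<psi> \<in> test_functions \<Omega>"
    have i: "integrable lborel (\<lambda>x. G x \<bullet> grad \<psi> x)" if "integrable lborel G" for G :: "'a \<Rightarrow> 'a"
    proof -
      have sm\<psi>: "smooth \<psi>" by (rule test_functions_smooth[OF \<psi>])
      have "integrable lborel (\<lambda>x. dd i \<psi> x * (G x \<bullet> i))" for i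
      proof -
        obtain B where B: "\<And>x. \<bar>dd i \<psi> x\<bar> \<le> B" using test_functions_bounded[OF test_functions_dd[OF \<psi>]] by blast
        show ?thesis using that by (intro integrable_bounded_mult[OF smooth_borel[OF smooth_dd[OF sm\<psi>]] B]) simp
      qed
      then have "integrable lborel (\<lambda>x. \<Sum>i\<in>Basis. dd i \<psi> x * (G x \<bullet> i))" by simp
      then show ?thesis by (simp add: grad_eq smooth_differentiable[OF sm\<psi>] inner_sum_right)
    qed
    show "(\<integral>x. (G1 x - G2 x) \<bullet> grad \<psi> x \<partial>lborel) = 0"
      using i[OF 1(7)] i[OF 2(7)] 1(13)[OF \<psi>] 2(13)[OF \<psi>] by (simp add: inner_diff_left)
  qed (use \<Omega> p q 1 2 \<phi>t in auto)
  have "AE x in lebesgue. u1 x - u2 x = 0" by (rule AE_completion[OF u_zero])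
  then have "AE x in lebesgue_on \<Omega>. u1 x - u2 x = 0"
    using \<Omega>(1) by (auto simp: AE_restrict_space_iff)
  then show ?thesis using 1(4) 2(4) by eventually_elim simp
qed

section \<open>Exterior cones of the perforated ball\<close>

text \<open>Since the gradient of \<open>\<gamma>\<close> is continuous, a single direction serves all boundary points near
  \<open>x1\<close>.\<close>

lemma C1_graph_cone:
  fixes Q :: "real^3 \<Rightarrow> real^3" and \<gamma> :: "real^2 \<Rightarrow> real"
  assumes Q: "orthogonal_transformation Q" and r: "0 < r" "0 < h" and \<gamma>: "Ck_on 1 (ball 0 r) \<gamma>"
    and graph: "\<And>y t. y \<in> ball 0 r \<Longrightarrow> \<bar>t\<bar> < h \<Longrightarrow> (x1 + Q (vector [y $ 1, y $ 2, t]) \<in> T \<longleftrightarrow> \<gamma> y \<le> t)"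
    and \<kappa>: "0 < \<kappa>"
  obtains \<rho> n where "\<rho> > 0" "norm n = 1"
    "\<And>x0 x. x0 \<in> T \<Longrightarrow> norm (x0 - x1) < \<rho> \<Longrightarrow> norm (x - x0) \<le> \<rho> \<Longrightarrow> \<kappa> * norm (x - x0) \<le> (x - x0) \<bullet> n \<Longrightarrow> x \<in> T"
proof -
  define D where "D y v = frechet_derivative \<gamma> (at y) v" for y v
  have diff: "\<gamma> differentiable (at y)" if "y \<in> ball 0 r" for y
    using \<gamma> that by (simp add: Ck_on.simps)
  have cont: "continuous_on (ball 0 r) (\<lambda>y. D y v)" for v
    using \<gamma> by (simp add: Ck_on.simps D_def)
  have hd: "(\<gamma> has_derivative D y) (at y)" if "y \<in> ball 0 r" for y
    using diff[OF that] by (simp add: D_def[abs_def] frechet_derivative_works)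
  define a where "a = (\<lambda>i. D 0 (axis i 1))"
  have Dexp: "D y v = v $ 1 * D y (axis 1 1) + v $ 2 * D y (axis 2 1)" if "y \<in> ball 0 r" for y v
  proof -
    have lin: "linear (D y)" using hd[OF that] has_derivative_linear by blast
    have "v = v $ 1 *\<^sub>R axis 1 1 + v $ 2 *\<^sub>R axis 2 1"
      by (simp add: vec_eq_iff forall_2 axis_def)
    then have "D y v = D y (v $ 1 *\<^sub>R axis 1 1 + v $ 2 *\<^sub>R axis 2 1)" by simp
    then show ?thesis by (simp add: linear_add[OF lin] linear_scale[OF lin])
  qed
  have c0: "\<exists>\<delta>>0. \<delta> \<le> r \<and> (\<forall>y\<in>ball 0 \<delta>. \<bar>D y v - D 0 v\<bar> < \<kappa> / 2)" for v
  proof -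
    have "(0::real^2) \<in> ball 0 r" using r by simp
    then obtain d where d: "d > 0" "\<And>y. y \<in> ball 0 r \<Longrightarrow> dist y 0 < d \<Longrightarrow> dist (D y v) (D 0 v) < \<kappa> / 2"
      using cont[of v] \<kappa> unfolding continuous_on_iff by (metis half_gt_zero)
    then show ?thesis using r by (intro exI[of _ "min d r"]) (auto simp: dist_norm norm_minus_commute)
  qed
  obtain d1 where d1: "d1 > 0" "d1 \<le> r" "\<And>y. y \<in> ball 0 d1 \<Longrightarrow> \<bar>D y (axis 1 1) - a 1\<bar> < \<kappa> / 2"
    using c0[of "axis 1 1"] unfolding a_def by blast
  obtain d2 where d2: "d2 > 0" "d2 \<le> r" "\<And>y. y \<in> ball 0 d2 \<Longrightarrow> \<bar>D y (axis 2 1) - a 2\<bar> < \<kappa> / 2"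
    using c0[of "axis 2 1"] unfolding a_def by blast
  define d where "d = min d1 d2"
  have d: "d > 0" "d \<le> r" using d1 d2 by (auto simp: d_def)
  \<comment> \<open>\<gamma> minus its linear part at 0 has derivative of norm at most \<kappa> near
    0, as each of the two partial derivatives varies by less than \<kappa>/2. The estimate holds
    between any two points of the small ball and not only from its centre, which makes the direction
    common to all nearby boundary points.\<close>
  have near: "\<bar>\<gamma> y - \<gamma> y0 - (a 1 * (y $ 1 - y0 $ 1) + a 2 * (y $ 2 - y0 $ 2))\<bar> \<le> \<kappa> * norm (y - y0)"
    if y: "y \<in> ball 0 d" "y0 \<in> ball 0 d" for y y0
  proof -
    define g where "g y = \<gamma> y - (a 1 * y $ 1 + a 2 * y $ 2)" for y
    have "norm (g y - g y0) \<le> \<kappa> * norm (y - y0)"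
    proof (rule differentiable_bound[of "ball 0 d" g "\<lambda>y v. D y v - (a 1 * v $ 1 + a 2 * v $ 2)"])
      show "convex (ball (0::real^2) d)" by simp
      fix z :: "real^2" assume z: "z \<in> ball 0 d"
      then have zr: "z \<in> ball 0 r" using d by auto
      have bl: "bounded_linear (\<lambda>v::real^2. v $ i)" for i by (rule bounded_linear_vec_nth)
      have "((\<lambda>v::real^2. a 1 * v $ 1 + a 2 * v $ 2) has_derivative (\<lambda>v. a 1 * v $ 1 + a 2 * v $ 2)) (at z)"
        by (intro has_derivative_add has_derivative_mult_right bounded_linear_imp_has_derivative bl)
      then have "(g has_derivative (\<lambda>v. D z v - (a 1 * v $ 1 + a 2 * v $ 2))) (at z)"
        unfolding g_def[abs_def] by (intro has_derivative_diff hd[OF zr])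
      then show "(g has_derivative (\<lambda>v. D z v - (a 1 * v $ 1 + a 2 * v $ 2))) (at z within ball 0 d)"
        by (rule has_derivative_at_withinI)
      show "onorm (\<lambda>v. D z v - (a 1 * v $ 1 + a 2 * v $ 2)) \<le> \<kappa>"
      proof (rule onorm_le)
        fix v :: "real^2"
        have "D z v - (a 1 * v $ 1 + a 2 * v $ 2) = v $ 1 * (D z (axis 1 1) - a 1) + v $ 2 * (D z (axis 2 1) - a 2)"
          by (simp add: Dexp[OF zr, of v] algebra_simps)
        moreover have "\<bar>v $ 1 * (D z (axis 1 1) - a 1)\<bar> \<le> norm v * (\<kappa> / 2)"
          unfolding abs_mult using d1(3)[of z] z by (intro mult_mono) (auto simp: component_le_norm_cart d_def)
        moreover have "\<bar>v $ 2 * (D z (axis 2 1) - a 2)\<bar> \<le> norm v * (\<kappa> / 2)"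
          unfolding abs_mult using d2(3)[of z] z by (intro mult_mono) (auto simp: component_le_norm_cart d_def)
        moreover have "norm v * (\<kappa> / 2) + norm v * (\<kappa> / 2) = \<kappa> * norm v" by simp
        ultimately show "norm (D z v - (a 1 * v $ 1 + a 2 * v $ 2)) \<le> \<kappa> * norm v"
          using abs_triangle_ineq[of "v $ 1 * (D z (axis 1 1) - a 1)" "v $ 2 * (D z (axis 2 1) - a 2)"]
          unfolding real_norm_def by linarith
      qed
    qed (use y in auto)
    then show ?thesis by (simp add: g_def algebra_simps)
  qed
  \<comment> \<open>In chart coordinates, the normal of the tangent plane at the centre that points
    into T. Its length is at least 1, so normalising it preserves the cone inequality in the
    required direction.\<close>
  define w :: "real^3" where "w = vector [- a 1, - a 2, 1]"
  have w1: "norm w \<ge> 1"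
    using component_le_norm_cart[of w 3] by (simp add: w_def)
  have linQ: "linear Q" using Q by (simp add: orthogonal_transformation_def)
  define n where "n = (1 / norm w) *\<^sub>R Q w"
  have nn: "norm n = 1"
    using w1 orthogonal_transformation_norm[OF Q, of w] by (auto simp: n_def)
  \<comment> \<open>The chart coordinates of x0 and x then have norm below 2 \<rho>, within the
    range of the chart.\<close>
  define \<rho> where "\<rho> = min (d / 2) (h / 2)"
  have \<rho>: "\<rho> > 0" using d r by (simp add: \<rho>_def)
  have surjQ: "\<exists>z. Q z = x" for x using orthogonal_transformation_surj[OF Q] by (metis surjD)
  show ?thesis
  proof (rule that[OF \<rho> nn])
    fix x0 x assume x0: "x0 \<in> T" "norm (x0 - x1) < \<rho>" and x: "norm (x - x0) \<le> \<rho>" "\<kappa> * norm (x - x0) \<le> (x - x0) \<bullet> n"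
    obtain z0 where z0: "Q z0 = x0 - x1" using surjQ by blast
    obtain z where z: "Q z = x - x1" using surjQ by blast
    define y0 :: "real^2" where "y0 = vector [z0 $ 1, z0 $ 2]"
    define y :: "real^2" where "y = vector [z $ 1, z $ 2]"
    have zv: "z0 = vector [y0 $ 1, y0 $ 2, z0 $ 3]" "z = vector [y $ 1, y $ 2, z $ 3]"
      by (simp_all add: vec_eq_iff forall_3 y0_def y_def)
    have nz0: "norm z0 < \<rho>" using orthogonal_transformation_norm[OF Q, of z0] z0 x0(2) by simp
    have nz: "norm z < 2 * \<rho>"
      using orthogonal_transformation_norm[OF Q, of z] z x0(2) x(1) norm_triangle_ineq[of "x - x0" "x0 - x1"] by simp
    have norm2: "norm (vector [s $ 1, s $ 2] :: real^2) \<le> norm s" for s :: "real^3"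
      unfolding norm_vec_def L2_set_def by (simp add: sum_2 sum_3)
    have yb: "y0 \<in> ball 0 d" "y \<in> ball 0 d"
      using norm2[of z0] norm2[of z] nz0 nz d min.cobounded1[of "d / 2" "h / 2"] norm_ge_zero[of z0]
      unfolding y0_def y_def \<rho>_def mem_ball_0 by linarith+
    have tb: "\<bar>z0 $ 3\<bar> < h" "\<bar>z $ 3\<bar> < h"
      using component_le_norm_cart[of z0 3] component_le_norm_cart[of z 3] nz0 nz unfolding \<rho>_def by auto
    have "x1 + Q z0 \<in> T" using z0 x0 by simp
    then have "x1 + Q (vector [y0 $ 1, y0 $ 2, z0 $ 3]) \<in> T" using zv(1) by simp
    then have g0: "\<gamma> y0 \<le> z0 $ 3" using graph[of y0 "z0 $ 3"] yb(1) d tb(1) by auto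
    have Qzz: "Q (z - z0) = x - x0" by (simp add: linear_diff[OF linQ] z z0)
    have "(x - x0) \<bullet> Q w = (z - z0) \<bullet> w"
      using Q unfolding Qzz[symmetric] orthogonal_transformation_def by blast
    moreover have "norm w * ((x - x0) \<bullet> n) = (x - x0) \<bullet> Q w" using w1 by (auto simp: n_def)
    moreover have "1 * (\<kappa> * norm (x - x0)) \<le> norm w * ((x - x0) \<bullet> n)"
      using w1 x(2) \<kappa> by (intro mult_mono) auto
    moreover have "norm (y - y0) \<le> norm (x - x0)"
    proof -
      have "norm (y - y0) \<le> norm (z - z0)"
      proof -
        have "y - y0 = vector [(z - z0) $ 1, (z - z0) $ 2]" by (simp add: vec_eq_iff forall_2 y_def y0_def)
        then show ?thesis using norm2[of "z - z0"] by simp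
      qed
      also have "\<dots> = norm (x - x0)" using orthogonal_transformation_norm[OF Q, of "z - z0"] Qzz by simp
      finally show ?thesis .
    qed
    ultimately have "\<kappa> * norm (y - y0) \<le> (z - z0) \<bullet> w"
      using mult_left_mono[of "norm (y - y0)" "norm (x - x0)" \<kappa>] \<kappa> by linarith
    also have "(z - z0) \<bullet> w = z $ 3 - z0 $ 3 - (a 1 * (y $ 1 - y0 $ 1) + a 2 * (y $ 2 - y0 $ 2))"
      by (simp add: inner_vec_def sum_3 w_def y_def y0_def algebra_simps)
    finally have "\<gamma> y \<le> z $ 3" using near[OF yb(2,1)] g0 by linarith
    then have "x1 + Q (vector [y $ 1, y $ 2, z $ 3]) \<in> T" using graph[of y "z $ 3"] yb(2) d tb(2) by auto
    then show "x \<in> T" using zv(2) z by simp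
  qed
qed

text \<open>Compactness of the frontier: finitely many charts suffice, each boundary point borrows
  the direction of a nearby centre, and the smallest radius serves all.\<close>

lemma C1_boundary_cones:
  assumes T: "compact T" "C1_boundary T" and \<kappa>: "0 < \<kappa>"
  obtains r where "r > 0" "\<And>x0. x0 \<in> frontier T \<Longrightarrow> \<exists>n. norm n = 1 \<and>
    (\<forall>x. norm (x - x0) \<le> r \<and> \<kappa> * norm (x - x0) \<le> (x - x0) \<bullet> n \<longrightarrow> x \<in> T)"
proof -
  have frT: "frontier T \<subseteq> T" using T(1) by (simp add: compact_imp_closed frontier_subset_closed)
  have "\<exists>\<rho> n. \<rho> > 0 \<and> norm n = 1 \<and> (\<forall>x0 x. x0 \<in> T \<and> norm (x0 - x1) < \<rho> \<and> norm (x - x0) \<le> \<rho> \<and>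
      \<kappa> * norm (x - x0) \<le> (x - x0) \<bullet> n \<longrightarrow> x \<in> T)" if x1: "x1 \<in> frontier T" for x1
  proof -
    obtain Q :: "real^3 \<Rightarrow> real^3" and \<gamma> :: "real^2 \<Rightarrow> real" and r h where Q: "orthogonal_transformation Q" "0 < r" "0 < h"
      "Ck_on 1 (ball 0 r) \<gamma>"
      "\<And>y t. y \<in> ball 0 r \<Longrightarrow> \<bar>t\<bar> < h \<Longrightarrow> (x1 + Q (vector [y $ 1, y $ 2, t]) \<in> T \<longleftrightarrow> \<gamma> y \<le> t)"
      using T(2) x1 unfolding C1_boundary_def boundary_locally_graph_def by blast
    obtain \<rho> n where "\<rho> > 0" "norm n = 1"
      "\<And>x0 x. x0 \<in> T \<Longrightarrow> norm (x0 - x1) < \<rho> \<Longrightarrow> norm (x - x0) \<le> \<rho> \<Longrightarrow> \<kappa> * norm (x - x0) \<le> (x - x0) \<bullet> n \<Longrightarrow> x \<in> T"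
      using C1_graph_cone[OF Q \<kappa>] by blast
    then show ?thesis by blast
  qed
  then obtain \<rho> n where \<rho>: "\<And>x1. x1 \<in> frontier T \<Longrightarrow> \<rho> x1 > 0" "\<And>x1. x1 \<in> frontier T \<Longrightarrow> norm (n x1) = 1"
    "\<And>x1 x0 x. x1 \<in> frontier T \<Longrightarrow> x0 \<in> T \<Longrightarrow> norm (x0 - x1) < \<rho> x1 \<Longrightarrow> norm (x - x0) \<le> \<rho> x1 \<Longrightarrow>
      \<kappa> * norm (x - x0) \<le> (x - x0) \<bullet> n x1 \<Longrightarrow> x \<in> T"
    by metis
  have "compact (frontier T)" by (rule compact_frontier[OF T(1)])
  then obtain F where F: "F \<subseteq> frontier T" "finite F" "frontier T \<subseteq> (\<Union>x1\<in>F. ball x1 (\<rho> x1))"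
    by (rule compactE_image[of _ "frontier T" "\<lambda>x1. ball x1 (\<rho> x1)"]) (use \<rho>(1) in force)+
  \<comment> \<open>The inserted 1 keeps the minimum meaningful if the cover is empty.\<close>
  define r where "r = Min (insert 1 (\<rho> ` F))"
  have r: "r > 0" unfolding r_def using F \<rho>(1) by (subst Min_gr_iff) auto
  have rle: "r \<le> \<rho> x1" if "x1 \<in> F" for x1 unfolding r_def using F that by (intro Min_le) auto
  show ?thesis
  proof (rule that[OF r])
    fix x0 assume x0: "x0 \<in> frontier T"
    then obtain x1 where x1: "x1 \<in> F" "norm (x0 - x1) < \<rho> x1" using F(3) by (auto simp: dist_norm norm_minus_commute)
    have "x1 \<in> frontier T" using x1 F by blast
    then show "\<exists>n. norm n = 1 \<and> (\<forall>x. norm (x - x0) \<le> r \<and> \<kappa> * norm (x - x0) \<le> (x - x0) \<bullet> n \<longrightarrow> x \<in> T)"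
      using \<rho>(2,3)[of x1] x1 rle[OF x1(1)] x0 frT by (intro exI[of _ "n x1"]) (auto intro: order_trans)
  qed
qed

lemma perforated_ball_open:
  assumes "compact T"
  shows "open (perforated_ball T \<epsilon>)" "perforated_ball T \<epsilon> \<subseteq> ball 0 1"
  unfolding perforated_ball_def
  using compact_scaling[OF assms, of \<epsilon>] by (auto intro!: open_Diff compact_imp_closed)

text \<open>At a point of the unit sphere an exterior half space exists, with the position vector as
  axis. Every other boundary point lies on the scaled frontier of T, and the cones inside T scale
  along with it, the radius becoming \<epsilon> r.\<close>

lemma perforated_ball_cones:
  assumes T: "compact T" "C1_boundary T" and \<epsilon>: "0 < \<epsilon>"
  shows "flat_exterior_cones (perforated_ball T \<epsilon>)"
  unfolding flat_exterior_cones_def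
proof (intro allI impI)
  fix \<kappa> :: real assume \<kappa>: "0 < \<kappa>"
  let ?S = "(\<lambda>x. \<epsilon> *\<^sub>R x) ` T"
  obtain r where r: "r > 0" "\<And>x0. x0 \<in> frontier T \<Longrightarrow> \<exists>n. norm n = 1 \<and>
    (\<forall>x. norm (x - x0) \<le> r \<and> \<kappa> * norm (x - x0) \<le> (x - x0) \<bullet> n \<longrightarrow> x \<in> T)"
    using C1_boundary_cones[OF T \<kappa>] by blast
  have op: "open (perforated_ball T \<epsilon>)" by (rule perforated_ball_open[OF T(1)])
  show "\<exists>r>0. \<forall>x0\<in>frontier (perforated_ball T \<epsilon>). \<exists>n. norm n = 1 \<and>
      (\<forall>x. norm (x - x0) \<le> r \<and> \<kappa> * norm (x - x0) \<le> (x - x0) \<bullet> n \<longrightarrow> x \<notin> perforated_ball T \<epsilon>)"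
  proof (intro exI[of _ "\<epsilon> * r"] conjI ballI)
    show "0 < \<epsilon> * r" using \<epsilon> r by simp
    fix x0 assume x0: "x0 \<in> frontier (perforated_ball T \<epsilon>)"
    have x0n: "x0 \<notin> perforated_ball T \<epsilon>" using x0 op by (simp add: frontier_def interior_open)
    have "x0 \<in> closure (perforated_ball T \<epsilon>)" using x0 by (simp add: frontier_def)
    also have "closure (perforated_ball T \<epsilon>) \<subseteq> cball 0 1"
      by (rule closure_minimal) (auto simp: perforated_ball_def)
    finally have x01: "norm x0 \<le> 1" by simp
    show "\<exists>n. norm n = 1 \<and> (\<forall>x. norm (x - x0) \<le> \<epsilon> * r \<and> \<kappa> * norm (x - x0) \<le> (x - x0) \<bullet> n \<longrightarrow> x \<notin> perforated_ball T \<epsilon>)"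
    proof (cases "norm x0 < 1")
      case False
      then have n1: "norm x0 = 1" using x01 by simp
      have "x \<notin> perforated_ball T \<epsilon>" if "\<kappa> * norm (x - x0) \<le> (x - x0) \<bullet> x0" for x
      proof -
        have "0 \<le> \<kappa> * norm (x - x0)" using \<kappa> by simp
        then have "0 \<le> (x - x0) \<bullet> x0" using that by linarith
        then have "1 \<le> x \<bullet> x0" using n1 by (simp add: inner_diff_left norm_eq_1)
        also have "\<dots> \<le> norm x * norm x0" by (rule norm_cauchy_schwarz)
        finally show ?thesis using n1 by (simp add: perforated_ball_def)
      qed
      then show ?thesis using n1 by blast
    next
      case True
      then obtain t0 where t0: "t0 \<in> T" "x0 = \<epsilon> *\<^sub>R t0" using x0n by (auto simp: perforated_ball_def)
      \<comment> \<open>The scaled interior of T is open and disjoint from the domain, so it does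
        not meet the closure of the domain.\<close>
      have "t0 \<notin> interior T"
      proof
        assume "t0 \<in> interior T"
        have "open ((\<lambda>x. \<epsilon> *\<^sub>R x) ` interior T)" using \<epsilon> by (intro open_scaling) auto
        moreover have "x0 \<in> (\<lambda>x. \<epsilon> *\<^sub>R x) ` interior T" using t0 \<open>t0 \<in> interior T\<close> by blast
        moreover have "(\<lambda>x. \<epsilon> *\<^sub>R x) ` interior T \<inter> perforated_ball T \<epsilon> = {}"
          using interior_subset[of T] by (auto simp: perforated_ball_def)
        ultimately have "x0 \<notin> closure (perforated_ball T \<epsilon>)"
          by (metis IntI disjoint_iff open_Int_closure_eq_empty)
        then show False using x0 by (simp add: frontier_def)
      qed
      then have "t0 \<in> frontier T" using t0(1) closure_subset by (auto simp: frontier_def)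
      then obtain n where n: "norm n = 1" "\<And>x. norm (x - t0) \<le> r \<Longrightarrow> \<kappa> * norm (x - t0) \<le> (x - t0) \<bullet> n \<Longrightarrow> x \<in> T"
        using r(2) by blast
      have "x \<notin> perforated_ball T \<epsilon>" if x: "norm (x - x0) \<le> \<epsilon> * r" "\<kappa> * norm (x - x0) \<le> (x - x0) \<bullet> n" for x
      proof -
        define t where "t = (1 / \<epsilon>) *\<^sub>R x"
        have xt: "x = \<epsilon> *\<^sub>R t" using \<epsilon> by (simp add: t_def)
        have e: "x - x0 = \<epsilon> *\<^sub>R (t - t0)" by (simp add: xt t0 scaleR_diff_right)
        have "norm (t - t0) \<le> r" using x(1) \<epsilon> unfolding e by simp
        moreover have "\<kappa> * norm (t - t0) \<le> (t - t0) \<bullet> n"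
        proof -
          have "\<epsilon> * (\<kappa> * norm (t - t0)) \<le> \<epsilon> * ((t - t0) \<bullet> n)" using x(2) \<epsilon> unfolding e by (simp add: mult_ac)
          then show ?thesis using \<epsilon> by simp
        qed
        ultimately have "t \<in> T" by (rule n(2))
        then show ?thesis using xt by (auto simp: perforated_ball_def)
      qed
      then show ?thesis using n(1) by blast
    qed
  qed
qed

section \<open>The Newton field and its cut-off potential\<close>

lemma dd_times_powr:
  fixes f :: "'a::euclidean_space \<Rightarrow> real"
  assumes "f differentiable (at x)" "x \<noteq> 0"
  shows "dd v (\<lambda>x. f x * (x \<bullet> x) powr b) x =
      dd v f x * (x \<bullet> x) powr b + (2 * b * (x \<bullet> v)) * f x * (x \<bullet> x) powr (b - 1)"
    and "(\<lambda>x. f x * (x \<bullet> x) powr b) differentiable (at x)"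
proof -
  have x: "0 < x \<bullet> x" using assms by simp
  have i: "((\<lambda>x::'a. x \<bullet> x) has_derivative (\<lambda>v. 2 * (x \<bullet> v))) (at x)"
    by (auto intro!: derivative_eq_intros simp: inner_commute)
  have p: "((\<lambda>t. t powr b) has_derivative (\<lambda>h. h * (b * (x \<bullet> x) powr (b - 1)))) (at (x \<bullet> x))"
    using has_real_derivative_powr[OF x, of b] by (simp add: has_field_derivative_def mult_commute_abs)
  have c: "((\<lambda>x. (x \<bullet> x) powr b) has_derivative (\<lambda>v. 2 * (x \<bullet> v) * (b * (x \<bullet> x) powr (b - 1)))) (at x)"
    using has_derivative_compose[OF i p] .
  have m: "((\<lambda>x. f x * (x \<bullet> x) powr b) has_derivative
      (\<lambda>v. f x * (2 * (x \<bullet> v) * (b * (x \<bullet> x) powr (b - 1))) + dd v f x * (x \<bullet> x) powr b)) (at x)"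
    by (rule has_derivative_mult[OF differentiable_dd[OF assms(1)] c])
  show "dd v (\<lambda>x. f x * (x \<bullet> x) powr b) x =
      dd v f x * (x \<bullet> x) powr b + (2 * b * (x \<bullet> v)) * f x * (x \<bullet> x) powr (b - 1)"
    unfolding dd_eqI[OF m] by simp
  show "(\<lambda>x. f x * (x \<bullet> x) powr b) differentiable (at x)" using m by (rule differentiableI)
qed

text \<open>Products of this form are closed under differentiation: the derivative is a sum of two
  of them, with exponents b and b - 1 and smooth factors that again vanish near the origin. Hence
  the induction on the order varies both f and b.\<close>

lemma smooth_times_powr:
  fixes f :: "'a::euclidean_space \<Rightarrow> real"
  assumes "smooth f" and \<tau>: "0 < \<tau>" and "\<And>x. x \<bullet> x < \<tau> \<Longrightarrow> f x = 0"
  shows "smooth (\<lambda>x. f x * (x \<bullet> x) powr b)"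
proof -
  define U where "U = {x::'a. x \<bullet> x < \<tau>}"
  have U: "open U" unfolding U_def by (intro open_Collect_less continuous_intros)
  have diff: "(\<lambda>x. f x * (x \<bullet> x) powr b) differentiable (at x)"
    and ddv: "dd v (\<lambda>x. f x * (x \<bullet> x) powr b) x =
      dd v f x * (x \<bullet> x) powr b + (2 * b * (x \<bullet> v)) * f x * (x \<bullet> x) powr (b - 1)"
    if f: "smooth f" "\<And>x. x \<in> U \<Longrightarrow> f x = 0" for f :: "'a \<Rightarrow> real" and b x v
  proof -
    have "(\<lambda>x. f x * (x \<bullet> x) powr b) differentiable (at x) \<and> dd v (\<lambda>x. f x * (x \<bullet> x) powr b) x =
      dd v f x * (x \<bullet> x) powr b + (2 * b * (x \<bullet> v)) * f x * (x \<bullet> x) powr (b - 1)"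
    proof (cases "x \<in> U")
      case True
      have "((\<lambda>x. f x * (x \<bullet> x) powr b) has_derivative (\<lambda>v. 0)) (at x)"
        by (rule has_derivative_transform_within_open[OF has_derivative_const U True]) (simp add: f)
      moreover have "dd v f x = dd v (\<lambda>x. 0) x" by (rule dd_cong_open[OF U True]) (auto simp: f)
      moreover have "dd v (\<lambda>x::'a. 0::real) x = 0" by (rule dd_eqI) (rule has_derivative_const)
      ultimately show ?thesis using f(2)[OF True] by (auto dest: dd_eqI simp: differentiable_def)
    next
      case False
      then have "x \<noteq> 0" using \<tau> by (auto simp: U_def)
      then show ?thesis using dd_times_powr[OF smooth_differentiable[OF f(1)]] by blast
    qed
    then show "(\<lambda>x. f x * (x \<bullet> x) powr b) differentiable (at x)"
      "dd v (\<lambda>x. f x * (x \<bullet> x) powr b) x =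
      dd v f x * (x \<bullet> x) powr b + (2 * b * (x \<bullet> v)) * f x * (x \<bullet> x) powr (b - 1)" by auto
  qed
  have "Ck_on k UNIV (\<lambda>x. f x * (x \<bullet> x) powr b)"
    if f: "smooth f" "\<And>x. x \<in> U \<Longrightarrow> f x = 0" for k b and f :: "'a \<Rightarrow> real"
    using f
  proof (induction k arbitrary: f b)
    case 0
    show ?case using diff[OF 0] by (auto intro!: differentiable_imp_continuous_on simp: differentiable_on_def)
  next
    case (Suc k)
    have "Ck_on k UNIV (dd v (\<lambda>x. f x * (x \<bullet> x) powr b))" for v
    proof -
      have z: "dd v f x = 0" if "x \<in> U" for x
      proof -
        have "dd v f x = dd v (\<lambda>x. 0) x" by (rule dd_cong_open[OF U that]) (auto simp: Suc.prems)
        also have "\<dots> = 0" by (rule dd_eqI) (rule has_derivative_const)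
        finally show ?thesis .
      qed
      have "smooth (\<lambda>x. 2 * b * (x \<bullet> v) * f x)"
        by (intro smooth_mult smooth_cmult smooth_linear bounded_linear_inner_left Suc.prems)
      then have "Ck_on k UNIV (\<lambda>x. dd v f x * (x \<bullet> x) powr b + (2 * b * (x \<bullet> v) * f x) * (x \<bullet> x) powr (b - 1))"
        using Suc.prems z by (intro Ck_on_add Suc.IH) (auto intro: smooth_dd)
      moreover have "dd v (\<lambda>x. f x * (x \<bullet> x) powr b) =
          (\<lambda>x. dd v f x * (x \<bullet> x) powr b + (2 * b * (x \<bullet> v) * f x) * (x \<bullet> x) powr (b - 1))"
        by (intro ext ddv[OF Suc.prems])
      ultimately show ?thesis by simp
    qed
    then show ?case using diff[OF Suc.prems] by (simp add: Ck_on_Suc_dd)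
  qed
  then show ?thesis using assms by (auto simp: smooth_on_def U_def)
qed

text \<open>Dyadic shells: with c_n = 2^(-n), the integrand is at most c_n^(-b) where c_n \<le> |x|
  < 2 c_n, a set of measure of order c_n^N in dimension N. The resulting series is geometric with
  ratio 2^(b - N), which is below 1.\<close>

lemma integrable_norm_powr:
  fixes b :: real
  assumes b: "0 \<le> b" "b < DIM('a::euclidean_space)"
  shows "integrable lborel (\<lambda>x::'a. indicator (ball 0 2) x * norm x powr (- b))"
proof (rule integrableI_bounded)
  show "(\<lambda>x::'a. indicator (ball 0 2) x * norm x powr (- b)) \<in> borel_measurable lborel"
    unfolding measurable_lborel1
    by (intro borel_measurable_times borel_measurable_indicator powr_real_measurable borel_measurable_norm) auto
  define N where "N = DIM('a)"
  define V where "V = unit_ball_vol N"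
  define \<theta> where "\<theta> = (1/2::real) powr (N - b)"
  have \<theta>: "0 \<le> \<theta>" "\<theta> < 1" unfolding \<theta>_def N_def using b powr01_less_one[of "1/2" "DIM('a) - b"] by auto
  have V: "0 \<le> V" by (simp add: V_def)
  define c where "c n = (1/2::real) ^ n" for n :: nat
  have c: "0 < c n" for n by (simp add: c_def)
  define F where "F n = (\<lambda>x::'a. ennreal (c n powr (- b)) * indicator (ball 0 (2 * c n)) x)" for n
  have Fm: "F n \<in> borel_measurable lborel" for n
    unfolding F_def measurable_lborel1 by (intro borel_measurable_times_ennreal borel_measurable_indicator) auto
  have pt: "ennreal (indicator (ball 0 2) x * norm x powr (- b)) \<le> (\<Sum>n. F n x)" for x :: 'a
  proof (cases "x \<noteq> 0 \<and> norm x < 2")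
    case True
    obtain m where "(1/2::real) ^ m < norm x" using real_arch_pow_inv[of "norm x" "1/2"] True by auto
    then have ex: "\<exists>n. c n \<le> norm x" using less_imp_le by (auto simp: c_def)
    \<comment> \<open>Minimality of n gives the upper bound \<open>2 * c n\<close> of the shell; for
      n = 0 that bound is the radius 2 of the ball.\<close>
    define n where "n = (LEAST n. c n \<le> norm x)"
    have n1: "c n \<le> norm x" unfolding n_def using ex by (rule LeastI_ex)
    have n2: "norm x < 2 * c n"
    proof (cases n)
      case 0
      then show ?thesis using True by (simp add: c_def)
    next
      case (Suc k)
      then have "\<not> c k \<le> norm x" using not_less_Least[of k "\<lambda>n. c n \<le> norm x"] by (simp add: n_def)
      then show ?thesis using Suc by (simp add: c_def)
    qed
    have "ennreal (indicator (ball 0 2) x * norm x powr (- b)) \<le> F n x"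
      using n1 n2 c[of n] b True by (auto simp: indicator_def F_def intro!: ennreal_leI powr_mono2')
    also have "F n x = sum (\<lambda>n. F n x) {n}" by simp
    also have "\<dots> \<le> (\<Sum>n. F n x)" by (rule sum_le_suminf) auto
    finally show ?thesis .
  qed (auto simp: indicator_def)
  have term_eq: "c n powr (- b) * (V * (2 * c n) ^ N) = V * 2 ^ N * \<theta> ^ n" for n
  proof -
    have cp: "c n = (1/2) powr real n" by (simp add: c_def powr_realpow)
    have "\<theta> ^ n = \<theta> powr real n" by (rule powr_realpow[symmetric]) (simp add: \<theta>_def)
    also have "\<dots> = (1/2) powr ((N - b) * n)" unfolding \<theta>_def by (rule powr_powr)
    also have "(N - b) * n = n * - b + real n * real N" by (simp add: algebra_simps)
    also have "(1/2::real) powr (n * - b + real n * real N) = c n powr (- b) * c n powr N"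
      unfolding powr_add cp powr_powr ..
    also have "c n powr N = c n ^ N" using c by (rule powr_realpow)
    finally show ?thesis by (simp add: power_mult_distrib)
  qed
  have FI: "(\<integral>\<^sup>+x. F n x \<partial>lborel) = ennreal (V * 2 ^ N * \<theta> ^ n)" for n
  proof -
    have "(\<integral>\<^sup>+x. F n x \<partial>lborel) = ennreal (c n powr (- b)) * emeasure lborel (ball (0::'a) (2 * c n))"
      unfolding F_def by (rule nn_integral_cmult_indicator) simp
    also have "\<dots> = ennreal (c n powr (- b) * (V * (2 * c n) ^ N))"
      using less_imp_le[OF c, of n] by (simp add: emeasure_ball V_def N_def ennreal_mult')
    finally show ?thesis unfolding term_eq .
  qed
  have "(\<integral>\<^sup>+x. ennreal (norm (indicator (ball 0 2) x * norm (x::'a) powr (- b))) \<partial>lborel)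
      \<le> (\<integral>\<^sup>+x. (\<Sum>n. F n x) \<partial>lborel)"
    using pt by (intro nn_integral_mono) simp
  also have "\<dots> = (\<Sum>n. \<integral>\<^sup>+x. F n x \<partial>lborel)" by (rule nn_integral_suminf[OF Fm])
  also have "\<dots> = (\<Sum>n. ennreal (V * 2 ^ N * \<theta> ^ n))" unfolding FI ..
  also have "\<dots> = ennreal (\<Sum>n. V * 2 ^ N * \<theta> ^ n)"
    using \<theta> V by (intro suminf_ennreal_eq summable_sums summable_mult summable_geometric) auto
  also have "\<dots> < \<infinity>" by simp
  finally show "(\<integral>\<^sup>+x. ennreal (norm (indicator (ball 0 2) x * norm (x::'a) powr (- b))) \<partial>lborel) < \<infinity>" .
qed

text \<open>The gradient of 1/|z|, written with a power of z \<bullet> z so that the results on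
  products with such powers apply. At the origin its value is 0.\<close>

definition newton_field :: "real^3 \<Rightarrow> real^3" where
  "newton_field z = - ((z \<bullet> z) powr (- 3 / 2)) *\<^sub>R z"

lemma newton_field_borel [measurable]: "newton_field \<in> borel_measurable borel"
  unfolding newton_field_def by measurable

lemma norm_newton_field: "norm (newton_field z) = 1 / (z \<bullet> z)"
proof (cases "z = 0")
  case False
  have "(z \<bullet> z) powr (- 3 / 2) * norm z = (z \<bullet> z) powr (- 3 / 2) * (z \<bullet> z) powr (1 / 2)"
    by (simp add: powr_half_sqrt norm_eq_sqrt_inner)
  also have "\<dots> = (z \<bullet> z) powr (- 3 / 2 + 1 / 2)" by (rule powr_add[symmetric])
  also have "\<dots> = (z \<bullet> z) powr (- 1)" by simp
  also have "\<dots> = 1 / (z \<bullet> z)" using False by (simp add: powr_minus_divide)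
  finally show ?thesis by (simp add: newton_field_def)
qed (simp add: newton_field_def)

text \<open>A cut-off that is 1 near the support of \<psi> and 0 near the origin makes the
  components of the field globally smooth without changing the integral. Integration by parts then
  meets the divergence -3 t^(-3/2) + 3 t t^(-5/2) = 0, where t = z \<bullet> z.\<close>

lemma newton_field_div_free:
  assumes \<psi>: "\<psi> \<in> test_functions (- {0})"
  shows "(\<integral>z. newton_field z \<bullet> grad \<psi> z \<partial>lborel) = 0"
proof -
  obtain K where K: "smooth \<psi>" "compact K" "K \<subseteq> - {0}" "\<And>x. x \<notin> K \<Longrightarrow> \<psi> x = 0"
    using test_functionsE[OF \<psi>] by blast
  have "open (- K)" "0 \<in> - K" using K compact_imp_closed by auto
  then obtain r where r: "r > 0" "ball 0 r \<subseteq> - K" by (meson openE)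
  \<comment> \<open>Half the squared radius of a ball avoiding the support. The cut-off is already 1
    on the open set \<open>\<tau> < z \<bullet> z\<close>, which contains the support, so
    derivatives there can be computed without it.\<close>
  define \<tau> where "\<tau> = r\<^sup>2 / 2"
  have \<tau>: "\<tau> > 0" using r by (simp add: \<tau>_def)
  have far: "2 * \<tau> \<le> z \<bullet> z" if "z \<in> K" for z
  proof -
    have "z \<notin> ball 0 r" using that r by blast
    then have "r \<le> norm z" by simp
    then have "r\<^sup>2 \<le> (norm z)\<^sup>2" using r by (intro power_mono) auto
    then show ?thesis by (simp add: \<tau>_def power2_norm_eq_inner)
  qed
  have \<psi>U: "\<psi> \<in> test_functions UNIV" using \<psi> test_functions_mono[of "- {0}" UNIV] by blast
  define \<xi> :: "real^3 \<Rightarrow> real" where "\<xi> z = smooth_step (2 / \<tau> * (z \<bullet> z))" for z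
  have \<xi>s: "smooth \<xi>" unfolding \<xi>_def[abs_def]
    by (rule smooth_compose[OF smooth_cmult[OF smooth_inner_self] smooth_smooth_step])
  have \<xi>0: "\<xi> z = 0" if "z \<bullet> z < \<tau> / 2" for z
    unfolding \<xi>_def using that \<tau> by (intro smooth_step_zero) (simp add: field_simps)
  have \<xi>1: "\<xi> z = 1" if "\<tau> \<le> z \<bullet> z" for z
    unfolding \<xi>_def using that \<tau> by (intro smooth_step_one) (simp add: field_simps)
  define F where "F i z = (\<xi> z * (- (z \<bullet> i))) * (z \<bullet> z) powr (- 3 / 2)" for i z :: "real^3"
  have lin: "smooth (\<lambda>z::real^3. - (z \<bullet> i))" for i
    by (intro smooth_linear bounded_linear_minus bounded_linear_inner_left)
  have Fs: "smooth (F i)" for i unfolding F_def[abs_def]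
    using smooth_times_powr[OF smooth_mult[OF \<xi>s lin], of "\<tau> / 2"] \<tau> \<xi>0 by simp
  have XF: "newton_field z \<bullet> grad \<psi> z = (\<Sum>i\<in>Basis. F i z * dd i \<psi> z)" for z
  proof (cases "z \<in> K")
    case True
    have "\<xi> z = 1" using \<xi>1 far[OF True] \<tau> by simp
    then have "F i z = newton_field z \<bullet> i" for i by (simp add: F_def newton_field_def)
    moreover have "dd i \<psi> z = grad \<psi> z \<bullet> i" for i by (rule grad_inner[OF smooth_differentiable[OF K(1)], symmetric])
    ultimately show ?thesis by (simp add: euclidean_inner[of "newton_field z" "grad \<psi> z"])
  next
    case False
    have "dd i \<psi> z = 0" for i by (rule dd_zero_off[OF compact_imp_closed[OF K(2)] K(4) False])
    moreover have "grad \<psi> z = 0" by (rule grad_zero_off[OF K(1) compact_imp_closed[OF K(2)] K(4) False])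
    ultimately show ?thesis by simp
  qed
  have divF: "(\<Sum>i\<in>Basis. dd i (F i) z * \<psi> z) = 0" for z
  proof (cases "z \<in> K")
    case True
    have z: "z \<bullet> z > \<tau>" "z \<noteq> 0" using far[OF True] \<tau> by auto
    have op: "open {z::real^3. \<tau> < z \<bullet> z}" by (intro open_Collect_less continuous_intros)
    have "dd i (F i) z = - ((z \<bullet> z) powr (- 3 / 2)) + 3 * (z \<bullet> i)\<^sup>2 * (z \<bullet> z) powr (- 3 / 2 - 1)"
      if i: "i \<in> Basis" for i
    proof -
      have l: "((\<lambda>z::real^3. - (z \<bullet> i)) has_derivative (\<lambda>v. - (v \<bullet> i))) (at z)"
        by (auto intro!: derivative_eq_intros)
      have "dd i (F i) z = dd i (\<lambda>z. - (z \<bullet> i) * (z \<bullet> z) powr (- 3 / 2)) z"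
      proof (rule dd_cong_open[OF op])
        show "(\<lambda>z. - (z \<bullet> i) * (z \<bullet> z) powr (- 3 / 2)) differentiable at z"
          using dd_times_powr(2)[OF differentiableI[OF l] z(2)] .
      qed (use z \<xi>1 in \<open>auto simp: F_def\<close>)
      also have "\<dots> = - (i \<bullet> i) * (z \<bullet> z) powr (- 3 / 2) + 2 * (- 3 / 2) * (z \<bullet> i) * - (z \<bullet> i) * (z \<bullet> z) powr (- 3 / 2 - 1)"
        unfolding dd_times_powr(1)[OF differentiableI[OF l] z(2)] dd_eqI[OF l] ..
      finally show ?thesis using i by (simp add: power2_eq_square)
    qed
    then have "(\<Sum>i\<in>Basis. dd i (F i) z) =
        (\<Sum>i\<in>(Basis::(real^3) set). - ((z \<bullet> z) powr (- 3 / 2)) + 3 * (z \<bullet> i)\<^sup>2 * (z \<bullet> z) powr (- 3 / 2 - 1))"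
      by (intro sum.cong refl) blast
    also have "\<dots> = - 3 * (z \<bullet> z) powr (- 3 / 2) + 3 * (\<Sum>i\<in>Basis. (z \<bullet> i)\<^sup>2) * (z \<bullet> z) powr (- 3 / 2 - 1)"
      by (simp only: sum.distrib sum_distrib_left sum_distrib_right) simp
    also have "(\<Sum>i\<in>Basis. (z \<bullet> i)\<^sup>2) = (z \<bullet> z)" by (simp add: euclidean_inner[of z z] power2_eq_square)
    also have "3 * (z \<bullet> z) * (z \<bullet> z) powr (- 3 / 2 - 1) = 3 * (z \<bullet> z) powr (- 3 / 2)"
    proof -
      have "(z \<bullet> z) powr (1 + (- 3 / 2 - 1)) = (z \<bullet> z) powr 1 * (z \<bullet> z) powr (- 3 / 2 - 1)" by (rule powr_add)
      then show ?thesis using z by simp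
    qed
    finally show ?thesis by (simp add: sum_distrib_right[symmetric])
  qed (simp add: K)
  have int1: "integrable lborel (\<lambda>z. F i z * dd i \<psi> z)" for i
    by (rule test_functions_integrable[OF test_functions_mult[OF test_functions_dd[OF \<psi>U] Fs]])
  have int2: "integrable lborel (\<lambda>z. dd i (F i) z * \<psi> z)" for i
    by (rule test_functions_integrable[OF test_functions_mult[OF \<psi>U smooth_dd[OF Fs]]])
  have "(\<integral>z. newton_field z \<bullet> grad \<psi> z \<partial>lborel) = (\<Sum>i\<in>Basis. \<integral>z. F i z * dd i \<psi> z \<partial>lborel)"
    unfolding XF by (rule Bochner_Integration.integral_sum) (rule int1)
  also have "\<dots> = (\<Sum>i\<in>Basis. - (\<integral>z. dd i (F i) z * \<psi> z \<partial>lborel))"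
    by (intro sum.cong refl integral_by_parts[OF \<psi>U Fs])
  also have "\<dots> = - (\<integral>z. (\<Sum>i\<in>Basis. dd i (F i) z * \<psi> z) \<partial>lborel)"
    by (simp add: sum_negf Bochner_Integration.integral_sum[OF int2])
  also have "\<dots> = 0" by (simp add: divF)
  finally show ?thesis .
qed

text \<open>The potential \<open>1 / |z| - 1\<close> is normalised to vanish on the unit sphere, so that the second
  cut-off, at distance of order \<open>e\<close> from the sphere, contributes only a bounded term to the
  gradient.\<close>

definition newton_cutoff :: "real \<Rightarrow> real^3 \<Rightarrow> real" where
  "newton_cutoff e z = smooth_step ((z \<bullet> z) / (4 * e\<^sup>2)) * smooth_step ((1 - z \<bullet> z) / (4 * e)) *
     ((z \<bullet> z) powr (- 1 / 2) - 1)"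

lemma newton_cutoff_zero: "0 < e \<Longrightarrow> z \<bullet> z \<le> 4 * e\<^sup>2 \<or> 1 - 4 * e \<le> z \<bullet> z \<Longrightarrow> newton_cutoff e z = 0"
  unfolding newton_cutoff_def
  using smooth_step_zero[of "(z \<bullet> z) / (4 * e\<^sup>2)"] smooth_step_zero[of "(1 - z \<bullet> z) / (4 * e)"]
  by (auto simp: field_simps)

lemma smooth_newton_cutoff:
  assumes e: "0 < e"
  shows "smooth (newton_cutoff e)"
proof -
  define f where "f z = smooth_step (1 / (4 * e\<^sup>2) * (z \<bullet> z)) * smooth_step (1 / (4 * e) - 1 / (4 * e) * (z \<bullet> z))"
    for z :: "real^3"
  have f: "smooth f" unfolding f_def[abs_def]
    by (rule smooth_mult[OF smooth_compose[OF smooth_cmult[OF smooth_inner_self] smooth_smooth_step]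
        smooth_compose[OF smooth_diff[OF smooth_const smooth_cmult[OF smooth_inner_self]] smooth_smooth_step]])
  have f0: "f z = 0" if "z \<bullet> z < 4 * e\<^sup>2" for z
    using smooth_step_zero[of "1 / (4 * e\<^sup>2) * (z \<bullet> z)"] e that by (simp add: f_def field_simps)
  have "smooth (\<lambda>z. f z * (z \<bullet> z) powr (- 1 / 2))"
    using smooth_times_powr[OF f, of "4 * e\<^sup>2"] e f0 by simp
  then have "smooth (\<lambda>z. f z * (z \<bullet> z) powr (- 1 / 2) - f z)" by (rule smooth_diff[OF _ f])
  moreover have "newton_cutoff e = (\<lambda>z. f z * (z \<bullet> z) powr (- 1 / 2) - f z)"
    by (simp add: fun_eq_iff newton_cutoff_def f_def algebra_simps diff_divide_distrib)
  ultimately show ?thesis by simp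
qed

lemma newton_cutoff_nonneg:
  assumes e: "0 < e"
  shows "0 \<le> newton_cutoff e z"
proof (cases "z = 0 \<or> 1 \<le> z \<bullet> z")
  case True
  then show ?thesis using newton_cutoff_zero[OF e, of z] e by auto
next
  case False
  then have "(z \<bullet> z) powr 0 \<le> (z \<bullet> z) powr (- 1 / 2)" by (intro powr_mono') auto
  then show ?thesis using False unfolding newton_cutoff_def
    by (intro mult_nonneg_nonneg smooth_step_nonneg) auto
qed

lemma smooth_step_derivative: "(smooth_step has_real_derivative dd 1 smooth_step t) (at t)"
proof -
  obtain D where D: "(smooth_step has_real_derivative D) (at t)"
    using smooth_differentiable[OF smooth_smooth_step, of t] by (auto simp: real_differentiable_def)
  then have "dd 1 smooth_step t = D * 1" unfolding has_field_derivative_def by (rule dd_eqI)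
  then show ?thesis using D by simp
qed

lemma smooth_step_deriv_zero: "t < 1 \<or> 2 < t \<Longrightarrow> dd 1 smooth_step t = 0"
proof -
  have c: "dd 1 (\<lambda>t::real. c::real) t = 0" for c by (rule dd_eqI) (rule has_derivative_const)
  assume "t < 1 \<or> 2 < t"
  then show ?thesis
  proof
    assume "t < 1"
    then have "dd 1 smooth_step t = dd 1 (\<lambda>t. 0) t"
      by (intro dd_cong_open[of "{..<1}"]) (auto simp: smooth_step_zero)
    then show ?thesis by (simp add: c)
  next
    assume "2 < t"
    then have "dd 1 smooth_step t = dd 1 (\<lambda>t. 1) t"
      by (intro dd_cong_open[of "{2<..}"]) (auto simp: smooth_step_one)
    then show ?thesis by (simp add: c)
  qed
qed

text \<open>The function is radial and is differentiated in the variable t = z \<bullet> z. The last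
  summand is the Newton field damped by the cut-offs; the first collects the terms in which a
  derivative falls on a cut-off.\<close>

lemma grad_newton_cutoff:
  assumes e: "0 < e" and z: "z \<noteq> 0"
  defines "t \<equiv> z \<bullet> z"
  shows "grad (newton_cutoff e) z =
    (2 * (dd 1 smooth_step (t / (4 * e\<^sup>2)) / (4 * e\<^sup>2) * smooth_step ((1 - t) / (4 * e)) -
      smooth_step (t / (4 * e\<^sup>2)) * (dd 1 smooth_step ((1 - t) / (4 * e)) / (4 * e))) * (t powr (- 1 / 2) - 1)) *\<^sub>R z +
    (smooth_step (t / (4 * e\<^sup>2)) * smooth_step ((1 - t) / (4 * e))) *\<^sub>R newton_field z" (is "_ = (2 * ?g' * _) *\<^sub>R z + ?g *\<^sub>R _")
proof -
  have t: "0 < t" using z by (simp add: t_def)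
  define h where "h t = smooth_step (t / (4 * e\<^sup>2)) * smooth_step ((1 - t) / (4 * e)) * (t powr (- 1 / 2) - 1)" for t
  define h' where "h' = ?g' * (t powr (- 1 / 2) - 1) + ?g * (- 1 / 2 * t powr (- 1 / 2 - 1))"
  have s1: "((\<lambda>t. smooth_step (t / (4 * e\<^sup>2))) has_real_derivative dd 1 smooth_step (t / (4 * e\<^sup>2)) * (1 / (4 * e\<^sup>2))) (at t)"
    by (rule DERIV_chain2[OF smooth_step_derivative DERIV_cdivide[OF DERIV_ident]])
  have s2: "((\<lambda>t. smooth_step ((1 - t) / (4 * e))) has_real_derivative dd 1 smooth_step ((1 - t) / (4 * e)) * (- 1 / (4 * e))) (at t)"
    using e by (intro DERIV_chain2[OF smooth_step_derivative]) (auto intro!: derivative_eq_intros)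
  have s3: "((\<lambda>t. t powr (- 1 / 2) - 1) has_real_derivative (- 1 / 2 * t powr (- 1 / 2 - 1)) - 0) (at t)"
    by (intro DERIV_diff has_real_derivative_powr[OF t] DERIV_const)
  have h: "(h has_real_derivative h') (at t)"
    unfolding h_def[abs_def] h'_def
    by (rule DERIV_cong[OF DERIV_mult[OF DERIV_mult[OF s1 s2] s3]]) (simp add: mult_ac)
  have i: "((\<lambda>z::real^3. z \<bullet> z) has_derivative (\<lambda>v. 2 * (z \<bullet> v))) (at z)"
    by (auto intro!: derivative_eq_intros simp: inner_commute)
  have hd: "(h has_derivative (*) h') (at (z \<bullet> z))"
    using h by (simp add: has_field_derivative_def t_def)
  have W: "(newton_cutoff e has_derivative (\<lambda>v. h' * (2 * (z \<bullet> v)))) (at z)"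
    using has_derivative_compose[OF i hd] by (simp add: h_def newton_cutoff_def[abs_def])
  have "grad (newton_cutoff e) z = (\<Sum>i\<in>Basis. dd i (newton_cutoff e) z *\<^sub>R i)"
    by (rule grad_eq(1)[OF differentiableI[OF W]])
  also have "\<dots> = (\<Sum>i\<in>Basis. (2 * h') *\<^sub>R ((z \<bullet> i) *\<^sub>R i))"
    unfolding dd_eqI[OF W] by (intro sum.cong refl) simp
  also have "\<dots> = (2 * h') *\<^sub>R z" by (simp only: scaleR_right.sum[symmetric] euclidean_representation)
  also have "2 * h' = 2 * ?g' * (t powr (- 1 / 2) - 1) + ?g * - (t powr (- 3 / 2))"
  proof -
    have "2 * (G * p + g * (- 1 / 2 * q)) = 2 * G * p + g * - q" for G p g q :: real by (simp add: algebra_simps)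
    moreover have "- 1 / 2 - 1 = (- 3 / 2 :: real)" by simp
    ultimately show ?thesis unfolding h'_def by (simp only:)
  qed
  finally show ?thesis by (simp only: scaleR_add_left newton_field_def t_def) simp
qed

lemma
  assumes e: "0 < e"
  shows grad_newton_cutoff_inside: "8 * e\<^sup>2 < z \<bullet> z \<Longrightarrow> z \<bullet> z < 1 - 8 * e \<Longrightarrow> grad (newton_cutoff e) z = newton_field z"
    and grad_newton_cutoff_outside: "z \<bullet> z < 4 * e\<^sup>2 \<or> 1 - 4 * e < z \<bullet> z \<Longrightarrow> grad (newton_cutoff e) z = 0"
proof -
  assume t: "8 * e\<^sup>2 < z \<bullet> z" "z \<bullet> z < 1 - 8 * e"
  then have "2 < (z \<bullet> z) / (4 * e\<^sup>2)" "2 < (1 - z \<bullet> z) / (4 * e)" "z \<noteq> 0" using e by (auto simp: field_simps)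
  then show "grad (newton_cutoff e) z = newton_field z"
    by (simp add: grad_newton_cutoff[OF e] smooth_step_deriv_zero smooth_step_one)
next
  assume t: "z \<bullet> z < 4 * e\<^sup>2 \<or> 1 - 4 * e < z \<bullet> z"
  have "closed {z::real^3. 4 * e\<^sup>2 \<le> z \<bullet> z \<and> z \<bullet> z \<le> 1 - 4 * e}"
    by (intro closed_Collect_conj closed_Collect_le continuous_intros)
  moreover have "newton_cutoff e y = 0" if "y \<notin> {z. 4 * e\<^sup>2 \<le> z \<bullet> z \<and> z \<bullet> z \<le> 1 - 4 * e}" for y
    using that newton_cutoff_zero[OF e, of y] by auto
  ultimately show "grad (newton_cutoff e) z = 0"
    by (rule grad_zero_off[OF smooth_newton_cutoff[OF e]]) (use t in auto)
qed

text \<open>The bound is uniform in e and thus a majorant. With t = z \<bullet> z, the inner cut-off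
  varies only for t \<le> 8 e^2, so its slope is at most of order 1/t. The outer one varies only for
  1 - t \<le> 8 e, so its slope is at most of order 1/(1 - t), and the potential compensates for it:
  (1/|z| - 1) |z| = 1 - sqrt t \<le> 1 - t.\<close>

lemma grad_newton_cutoff_error:
  obtains C where "0 \<le> C" "\<And>e z. 0 < e \<Longrightarrow> norm (grad (newton_cutoff e) z - newton_field z) \<le> C / (z \<bullet> z)"
proof -
  obtain C where C: "\<And>t. \<bar>dd 1 smooth_step t\<bar> \<le> C" using smooth_step_deriv_bounded by blast
  have C0: "0 \<le> C" using C[of 0] abs_ge_zero order_trans by blast
  have "norm (grad (newton_cutoff e) z - newton_field z) \<le> (8 * C + 1) / (z \<bullet> z)" if e: "0 < e" for e z
  proof (cases "z = 0 \<or> 1 \<le> z \<bullet> z")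
    case True
    then have "grad (newton_cutoff e) z = 0" using grad_newton_cutoff_outside[OF e, of z] e by auto
    then show ?thesis using C0 by (simp add: norm_newton_field divide_right_mono)
  next
    case False
    define t where "t = z \<bullet> z"
    have t: "0 < t" "t < 1" using False by (auto simp: t_def)
    define a where "a = dd 1 smooth_step (t / (4 * e\<^sup>2)) / (4 * e\<^sup>2) * smooth_step ((1 - t) / (4 * e))"
    define b where "b = smooth_step (t / (4 * e\<^sup>2)) * (dd 1 smooth_step ((1 - t) / (4 * e)) / (4 * e))"
    define g where "g = smooth_step (t / (4 * e\<^sup>2)) * smooth_step ((1 - t) / (4 * e))"
    have S: "\<bar>smooth_step s\<bar> \<le> 1" for s using smooth_step_nonneg[of s] smooth_step_le_1[of s] by simp
    have g: "0 \<le> g" "g \<le> 1" unfolding g_def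
      using smooth_step_nonneg smooth_step_le_1 by (auto intro: mult_le_one)
    have a: "\<bar>a\<bar> \<le> 2 * C / t"
    proof (cases "t / (4 * e\<^sup>2) \<le> 2")
      case True
      then have "1 / (4 * e\<^sup>2) \<le> 2 / t" using e t by (simp add: field_simps)
      then have "\<bar>dd 1 smooth_step (t / (4 * e\<^sup>2))\<bar> * (1 / (4 * e\<^sup>2)) * \<bar>smooth_step ((1 - t) / (4 * e))\<bar> \<le> C * (2 / t) * 1"
        using e t C S C0 by (intro mult_mono) auto
      then show ?thesis by (simp add: a_def abs_mult mult.commute)
    next
      case False
      then show ?thesis using t C0 by (simp add: a_def smooth_step_deriv_zero)
    qed
    have b: "\<bar>b\<bar> \<le> 2 * C / (1 - t)"
    proof (cases "(1 - t) / (4 * e) \<le> 2")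
      case True
      then have "1 / (4 * e) \<le> 2 / (1 - t)" using e t by (simp add: field_simps)
      then have "\<bar>smooth_step (t / (4 * e\<^sup>2))\<bar> * (\<bar>dd 1 smooth_step ((1 - t) / (4 * e))\<bar> * (1 / (4 * e))) \<le> 1 * (C * (2 / (1 - t)))"
        using e t C S C0 by (intro mult_mono) auto
      then show ?thesis using e by (simp add: b_def abs_mult mult.commute)
    next
      case False
      then show ?thesis using t C0 by (simp add: b_def smooth_step_deriv_zero)
    qed
    have nz: "norm z = sqrt t" by (simp add: t_def norm_eq_sqrt_inner)
    have rt: "\<bar>t powr (- 1 / 2) - 1\<bar> * norm z = 1 - sqrt t"
    proof -
      have "t powr (- 1 / 2) = 1 / sqrt t" using t powr_minus_divide[of t "1 / 2"] by (simp add: powr_half_sqrt)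
      then have "t powr (- 1 / 2) * sqrt t = 1" using t by simp
      moreover have "1 \<le> t powr (- 1 / 2)" using powr_mono'[of "- 1 / 2" 0 t] t by simp
      ultimately show ?thesis by (simp add: nz left_diff_distrib)
    qed
    have "t \<le> sqrt t" using t by (intro real_le_rsqrt) (auto simp: power2_eq_square mult_le_one)
    then have rt': "1 - sqrt t \<le> 1 - t" "0 \<le> 1 - sqrt t" using t by auto
    have "grad (newton_cutoff e) z - newton_field z = (2 * (a - b) * (t powr (- 1 / 2) - 1)) *\<^sub>R z + (g - 1) *\<^sub>R newton_field z"
      using False grad_newton_cutoff[OF e, of z] unfolding a_def b_def g_def t_def by (simp add: algebra_simps)
    then have "norm (grad (newton_cutoff e) z - newton_field z) \<le>
        norm ((2 * (a - b) * (t powr (- 1 / 2) - 1)) *\<^sub>R z) + norm ((g - 1) *\<^sub>R newton_field z)"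
      using norm_triangle_ineq by metis
    also have "norm ((2 * (a - b) * (t powr (- 1 / 2) - 1)) *\<^sub>R z) = 2 * \<bar>a - b\<bar> * (1 - sqrt t)"
      unfolding rt[symmetric] by (simp add: abs_mult del: right_diff_distrib_numeral)
    also have "2 * \<bar>a - b\<bar> * (1 - sqrt t) \<le> 2 * (2 * C / t + 2 * C / (1 - t)) * (1 - t)"
      using a b rt' t C0 by (intro mult_mono) auto
    also have "\<dots> = 4 * C / t * (1 - t) + 4 * C" using t by (simp add: field_simps)
    also have "\<dots> \<le> 4 * C / t + 4 * C / t"
      using t C0 by (simp add: field_simps mult_left_le)
    also have "norm ((g - 1) *\<^sub>R newton_field z) \<le> 1 * (1 / t)"
      unfolding norm_scaleR norm_newton_field t_def[symmetric] using g t by (intro mult_mono) auto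
    finally show ?thesis by (simp add: t_def add_divide_distrib)
  qed
  then show ?thesis using C0 by (intro that[of "8 * C + 1"]) auto
qed

lemma grad_translate:
  fixes f :: "'a::euclidean_space \<Rightarrow> real"
  assumes "smooth f"
  shows "grad (\<lambda>x. f (x + a)) x = grad f (x + a)" and "smooth (\<lambda>x. f (x + a))"
proof -
  have s: "smooth (\<lambda>x. f (x + a))" using smooth_affine[OF assms, of 1 a] by simp
  have "dd v (\<lambda>x. f (x + a)) x = dd v f (x + a)" for v
    using dd_affine(1)[where f = f and v = v and c = 1 and x = x and a = a] smooth_differentiable[OF assms] by simp
  then show "grad (\<lambda>x. f (x + a)) x = grad f (x + a)"
    by (simp add: grad_eq(1)[OF smooth_differentiable[OF s]] grad_eq(1)[OF smooth_differentiable[OF assms]])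
  show "smooth (\<lambda>x. f (x + a))" by (rule s)
qed

text \<open>In coordinates centred at the pole e a, the ball of radius 1 + e contains the perforated
  ball for every hole T, so the error is estimated once and for all holes.\<close>

definition newton_error :: "real \<Rightarrow> real \<Rightarrow> real^3 \<Rightarrow> real" where
  "newton_error q e z = indicator (ball 0 (1 + e)) z * norm (grad (newton_cutoff e) z - newton_field z) powr q"

lemma norm_powr_borel:
  fixes f :: "'a \<Rightarrow> 'b::euclidean_space"
  shows "f \<in> borel_measurable M \<Longrightarrow> (\<lambda>x. norm (f x) powr q) \<in> borel_measurable M"
  by simp

lemma newton_error_borel: "0 < e \<Longrightarrow> newton_error q e \<in> borel_measurable lborel"
  unfolding newton_error_def[abs_def] measurable_lborel2
  by (intro borel_measurable_times borel_measurable_indicator norm_powr_borel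
      borel_measurable_diff grad_borel smooth_newton_cutoff newton_field_borel borel_open open_ball)

text \<open>The majorant is a multiple of |z|^(-2q) on the ball of radius 2, integrable in dimension
  3 because 2q < 3.\<close>

lemma newton_error_dominated:
  assumes q: "0 < q" "q < 3 / 2"
  obtains g where "integrable lborel g"
    "\<And>e z. 0 < e \<Longrightarrow> e < 1 \<Longrightarrow> 0 \<le> newton_error q e z \<and> newton_error q e z \<le> g z"
proof -
  obtain C where C: "0 \<le> C" "\<And>e z. 0 < e \<Longrightarrow> norm (grad (newton_cutoff e) z - newton_field z) \<le> C / (z \<bullet> z)"
    using grad_newton_cutoff_error by blast
  have pw: "(C / (z \<bullet> z)) powr q = C powr q * norm z powr (- (2 * q))" for z :: "real^3"
  proof (cases "z = 0")
    case False
    have "z \<bullet> z = norm z powr 2" using False by (simp add: powr_realpow power2_norm_eq_inner[symmetric])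
    then have "C / (z \<bullet> z) = C * norm z powr (- 2)" by (simp add: powr_minus_divide)
    then show ?thesis using C by (simp add: powr_mult powr_powr)
  qed simp
  define g where "g z = C powr q * (indicator (ball 0 2) z * norm z powr (- (2 * q)))" for z :: "real^3"
  have "integrable lborel g" unfolding g_def[abs_def]
    using integrable_norm_powr[where 'a = "real^3", of "2 * q"] q by (intro integrable_mult_right) auto
  moreover have "0 \<le> newton_error q e z \<and> newton_error q e z \<le> g z" if e: "0 < e" "e < 1" for e z
  proof -
    have "norm (grad (newton_cutoff e) z - newton_field z) powr q \<le> (C / (z \<bullet> z)) powr q"
      using C(2)[OF e(1)] q by (intro powr_mono2) auto
    then have "norm (grad (newton_cutoff e) z - newton_field z) powr q \<le> C powr q * norm z powr (- (2 * q))"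
      unfolding pw .
    then show ?thesis using e unfolding newton_error_def g_def by (auto simp: indicator_def)
  qed
  ultimately show ?thesis by (rule that)
qed

lemma newton_error_integrable:
  assumes "0 < q" "q < 3 / 2" "0 < e" "e < 1"
  shows "integrable lborel (newton_error q e)"
proof -
  obtain g where g: "integrable lborel g"
    "\<And>e z. 0 < e \<Longrightarrow> e < 1 \<Longrightarrow> 0 \<le> newton_error q e z \<and> newton_error q e z \<le> g z"
    using newton_error_dominated[OF assms(1,2)] by blast
  show ?thesis
  proof (rule Bochner_Integration.integrable_bound[OF g(1) newton_error_borel[OF assms(3)]], rule AE_I2)
    show "norm (newton_error q e z) \<le> norm (g z)" for z using g(2)[OF assms(3,4), of z] by simp
  qed
qed

text \<open>For fixed z off the unit sphere the integrand is exactly 0 once e is small: inside, the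
  gradient equals the field; outside, the indicator is 0; at the origin both fields vanish. The
  sphere is a null set.\<close>

lemma newton_error_tendsto:
  assumes q: "0 < q" "q < 3 / 2"
  shows "((\<lambda>e. \<integral>z. newton_error q e z \<partial>lborel) \<longlongrightarrow> 0) (at_right 0)"
proof (rule tendsto_at_right_sequentially[of 0 1])
  show "(0::real) < 1" by simp
  fix S :: "nat \<Rightarrow> real" assume S: "\<And>n. 0 < S n" "\<And>n. S n < 1" "S \<longlonglongrightarrow> 0"
  obtain g where g: "integrable lborel g"
    "\<And>e z. 0 < e \<Longrightarrow> e < 1 \<Longrightarrow> 0 \<le> newton_error q e z \<and> newton_error q e z \<le> g z"
    using newton_error_dominated[OF q] by blast
  have lim: "(\<lambda>n. newton_error q (S n) z) \<longlonglongrightarrow> 0" if z: "norm z \<noteq> 1" for z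
  proof (rule tendsto_eventually)
    consider "z = 0" | "1 < norm z" | "z \<noteq> 0" "norm z < 1" using z by linarith
    then show "\<forall>\<^sub>F n in sequentially. newton_error q (S n) z = 0"
    proof cases
      case 1
      have "grad (newton_cutoff (S n)) 0 = 0" for n using grad_newton_cutoff_outside[OF S(1), of 0 n] S(1)[of n] by simp
      then show ?thesis using 1 by (simp add: newton_error_def newton_field_def)
    next
      case 2
      have "\<forall>\<^sub>F n in sequentially. S n < norm z - 1" using 2 by (intro order_tendstoD(2)[OF S(3)]) simp
      then show ?thesis by eventually_elim (simp add: newton_error_def indicator_def)
    next
      case 3
      have t: "0 < z \<bullet> z" "z \<bullet> z < 1" using 3 by (auto simp: norm_eq_sqrt_inner)
      have l: "(\<lambda>n. 8 * (S n)\<^sup>2) \<longlonglongrightarrow> 8 * 0\<^sup>2" by (intro tendsto_intros S)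
      have "\<forall>\<^sub>F n in sequentially. 8 * (S n)\<^sup>2 < z \<bullet> z" using order_tendstoD(2)[OF l, of "z \<bullet> z"] t by simp
      moreover have "\<forall>\<^sub>F n in sequentially. S n < (1 - z \<bullet> z) / 8" using t by (intro order_tendstoD(2)[OF S(3)]) simp
      ultimately show ?thesis
        by eventually_elim (use S(1) in \<open>simp add: newton_error_def grad_newton_cutoff_inside\<close>)
    qed
  qed
  have "sphere (0::real^3) 1 \<in> null_sets lborel"
    using negligible_sphere[of "0::real^3" 1] by (simp add: null_sets_completion_iff negligible_iff_null_sets)
  then have "AE z in lborel. z \<notin> sphere (0::real^3) 1" by (rule AE_not_in)
  then have ae: "AE z in lborel. (\<lambda>n. newton_error q (S n) z) \<longlonglongrightarrow> 0"
    by eventually_elim (use lim in simp)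
  have "(\<lambda>n. \<integral>z. newton_error q (S n) z \<partial>lborel) \<longlonglongrightarrow> (\<integral>z. 0 \<partial>(lborel :: (real^3) measure))"
    by (rule integral_dominated_convergence[OF _ _ g(1) ae])
      (use g(2) S newton_error_borel in \<open>auto intro!: AE_I2\<close>)
  then show "(\<lambda>n. \<integral>z. newton_error q (S n) z \<partial>lborel) \<longlonglongrightarrow> 0" by simp
qed

section \<open>The cut-off potential on the perforated ball\<close>

locale perforation =
  fixes T :: "(real^3) set" and a :: "real^3"
  assumes compact: "compact T" and in_ball: "T \<subseteq> ball 0 1" and pole: "a \<in> interior T"
begin

definition X :: "real \<Rightarrow> real^3 \<Rightarrow> real^3" where "X e x = newton_field (x - e *\<^sub>R a)"

definition w :: "real \<Rightarrow> real^3 \<Rightarrow> real" where "w e x = newton_cutoff e (x - e *\<^sub>R a)"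

abbreviation \<Omega> :: "real \<Rightarrow> (real^3) set" where "\<Omega> \<equiv> perforated_ball T"

definition err :: "real \<Rightarrow> real \<Rightarrow> real" where
  "err q e = (\<integral>x. indicator (\<Omega> e) x * norm (grad (w e) x - X e x) powr q \<partial>lborel)"

lemma pole_norm: "norm a < 1" and pole_in: "a \<in> T"
  using pole in_ball interior_subset by (auto simp: subset_iff)

lemma \<Omega>_open: "open (\<Omega> e)" and \<Omega>_ball: "\<Omega> e \<subseteq> ball 0 1"
  using perforated_ball_open[OF compact] by auto

lemma grad_w: "0 < e \<Longrightarrow> grad (w e) x = grad (newton_cutoff e) (x - e *\<^sub>R a)"
  and smooth_w: "0 < e \<Longrightarrow> smooth (w e)"
  using grad_translate[OF smooth_newton_cutoff, of e "- (e *\<^sub>R a)"] by (simp_all add: w_def[abs_def])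

text \<open>The pole and all points of the hole have norm below e, so the hole lies within distance
  2 e of the pole, where the inner cut-off vanishes. The outer one leaves |x - e a| \<le> 1 - 2 e,
  hence |x| < 1. For e > 1/4 the set \<open>K\<close> is empty and the function is zero.\<close>

lemma w_test:
  assumes e: "0 < e"
  shows "w e \<in> test_functions (\<Omega> e)"
proof (rule test_functionsI)
  define K where "K = {x. 4 * e\<^sup>2 \<le> (x - e *\<^sub>R a) \<bullet> (x - e *\<^sub>R a) \<and> (x - e *\<^sub>R a) \<bullet> (x - e *\<^sub>R a) \<le> 1 - 4 * e}"
  show "smooth (w e)" by (rule smooth_w[OF e])
  have "closed K" unfolding K_def by (intro closed_Collect_conj closed_Collect_le continuous_intros)
  moreover have nK: "2 * e \<le> norm (x - e *\<^sub>R a)" "norm (x - e *\<^sub>R a) \<le> 1 - 2 * e" if "x \<in> K" for x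
  proof -
    have *: "(2 * e)\<^sup>2 \<le> (norm (x - e *\<^sub>R a))\<^sup>2" "(norm (x - e *\<^sub>R a))\<^sup>2 \<le> 1 - 4 * e"
      using that by (auto simp: K_def power2_norm_eq_inner power_mult_distrib)
    then show "2 * e \<le> norm (x - e *\<^sub>R a)" by (rule_tac power2_le_imp_le) auto
    have "0 \<le> 1 - 4 * e" using * by (meson order_trans zero_le_power2)
    moreover have "(norm (x - e *\<^sub>R a))\<^sup>2 \<le> (1 - 2 * e)\<^sup>2"
      using *(2) by (simp add: power2_eq_square algebra_simps) (use zero_le_square[of e] in linarith)
    ultimately show "norm (x - e *\<^sub>R a) \<le> 1 - 2 * e" using e power2_le_imp_le[of "norm (x - e *\<^sub>R a)" "1 - 2 * e"] by auto
  qed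
  moreover have "bounded K"
    using nK(2) e by (intro bounded_subset[OF bounded_cball[of "e *\<^sub>R a" 1]]) (force simp: dist_norm norm_minus_commute)
  ultimately show "compact K" using compact_eq_bounded_closed by blast
  show "K \<subseteq> \<Omega> e"
  proof
    fix x assume x: "x \<in> K"
    have ea: "norm (e *\<^sub>R a) < e" using e pole_norm by simp
    have "norm x \<le> norm (x - e *\<^sub>R a) + norm (e *\<^sub>R a)" using norm_triangle_ineq[of "x - e *\<^sub>R a" "e *\<^sub>R a"] by simp
    then have n1: "norm x < 1" using nK(2)[OF x] ea e by linarith
    have "x \<noteq> e *\<^sub>R t" if "t \<in> T" for t
    proof
      assume "x = e *\<^sub>R t"
      then have "norm (x - e *\<^sub>R a) \<le> norm (e *\<^sub>R t) + norm (e *\<^sub>R a)" using norm_triangle_ineq4 by blast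
      also have "norm (e *\<^sub>R t) < e" using that in_ball e by auto
      finally show False using nK(1)[OF x] ea by simp
    qed
    then have "x \<notin> (\<lambda>x. e *\<^sub>R x) ` T" by blast
    then show "x \<in> \<Omega> e" using n1 by (simp add: perforated_ball_def)
  qed
  show "w e x = 0" if "x \<notin> K" for x
    using newton_cutoff_zero[OF e, of "x - e *\<^sub>R a"] that by (auto simp: K_def w_def)
qed

lemma X_div_free:
  assumes \<phi>: "\<phi> \<in> test_functions (\<Omega> e)"
  shows "(\<integral>x. X e x \<bullet> grad \<phi> x \<partial>lborel) = 0"
proof -
  obtain K where K: "smooth \<phi>" "compact K" "K \<subseteq> \<Omega> e" "\<And>x. x \<notin> K \<Longrightarrow> \<phi> x = 0"
    using test_functionsE[OF \<phi>] by blast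
  have "e *\<^sub>R a \<notin> \<Omega> e" using pole_in by (auto simp: perforated_ball_def)
  then have "0 \<notin> (\<lambda>x. - (e *\<^sub>R a) + x) ` K" using K(3) by (auto simp: eq_neg_iff_add_eq_0 algebra_simps)
  have \<psi>: "(\<lambda>z. \<phi> (z + e *\<^sub>R a)) \<in> test_functions (- {0})"
  proof (rule test_functionsI)
    show "smooth (\<lambda>z. \<phi> (z + e *\<^sub>R a))" by (rule grad_translate(2)[OF K(1)])
    show "compact ((\<lambda>x. - (e *\<^sub>R a) + x) ` K)" by (rule compact_translation[OF K(2)])
    show "(\<lambda>x. - (e *\<^sub>R a) + x) ` K \<subseteq> - {0}"
      using \<open>0 \<notin> (\<lambda>x. - (e *\<^sub>R a) + x) ` K\<close> by blast
    fix z assume "z \<notin> (\<lambda>x. - (e *\<^sub>R a) + x) ` K"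
    then have "z + e *\<^sub>R a \<notin> K" by (auto simp: image_iff)
    then show "\<phi> (z + e *\<^sub>R a) = 0" by (rule K(4))
  qed
  have "(\<integral>x. X e x \<bullet> grad \<phi> x \<partial>lborel) = (\<integral>z. X e (z + e *\<^sub>R a) \<bullet> grad \<phi> (z + e *\<^sub>R a) \<partial>lborel)"
    by (rule integral_translate(1)[symmetric])
  also have "\<dots> = (\<integral>z. newton_field z \<bullet> grad (\<lambda>z. \<phi> (z + e *\<^sub>R a)) z \<partial>lborel)"
    by (simp add: X_def grad_translate(1)[OF K(1)])
  also have "\<dots> = 0" by (rule newton_field_div_free[OF \<psi>])
  finally show ?thesis .
qed

lemma X_borel: "X e \<in> borel_measurable borel"
  unfolding X_def[abs_def] by (rule measurable_compose[OF _ newton_field_borel]) measurable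

text \<open>A ball around a inside T scales to a ball of radius e r inside the hole, which keeps the
  domain away from the pole. The bound degenerates with e and is used for limits at fixed e.\<close>

lemma X_bounded:
  assumes e: "0 < e"
  obtains B where "\<And>x. x \<in> \<Omega> e \<Longrightarrow> norm (X e x) \<le> B"
proof -
  obtain r where r: "0 < r" "ball a r \<subseteq> T" using pole by (meson mem_interior)
  have "norm (X e x) \<le> 1 / (e * r)\<^sup>2" if x: "x \<in> \<Omega> e" for x
  proof -
    have "(1 / e) *\<^sub>R x \<notin> T" using x e by (auto simp: perforated_ball_def image_iff)
    then have "(1 / e) *\<^sub>R x \<notin> ball a r" using r by blast
    then have "r \<le> norm ((1 / e) *\<^sub>R x - a)" by (simp add: dist_norm norm_minus_commute)
    then have "e * r \<le> e * norm ((1 / e) *\<^sub>R x - a)" using e by simp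
    also have "\<dots> = norm (e *\<^sub>R ((1 / e) *\<^sub>R x - a))" using e by simp
    also have "e *\<^sub>R ((1 / e) *\<^sub>R x - a) = x - e *\<^sub>R a" using e by (simp add: scaleR_diff_right)
    finally have "(e * r)\<^sup>2 \<le> (norm (x - e *\<^sub>R a))\<^sup>2" using e r by (intro power_mono) auto
    moreover have "0 < (e * r)\<^sup>2" using e r by simp
    ultimately show ?thesis unfolding X_def norm_newton_field power2_norm_eq_inner
      by (intro divide_left_mono mult_pos_pos) auto
  qed
  then show ?thesis by (rule that)
qed

lemma err_integrand:
  assumes e: "0 < e" "e < 1"
  shows "indicator (\<Omega> e) x * norm (grad (w e) x - X e x) powr q \<le> newton_error q e (x + - (e *\<^sub>R a))"
proof (cases "x \<in> \<Omega> e")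
  case True
  then have "norm x < 1" using \<Omega>_ball[of e] by auto
  then have "norm (x - e *\<^sub>R a) < 1 + e"
    using norm_triangle_ineq4[of x "e *\<^sub>R a"] mult_strict_left_mono[OF pole_norm e(1)] e
    unfolding norm_scaleR by linarith
  then show ?thesis using True by (simp add: newton_error_def grad_w[OF e(1)] X_def)
next
  case False
  then show ?thesis by (simp add: newton_error_def)
qed

lemma err_borel:
  assumes "0 < e"
  shows "(\<lambda>x. indicator (\<Omega> e) x * norm (grad (w e) x - X e x) powr q) \<in> borel_measurable borel"
  by (intro borel_measurable_times borel_measurable_indicator norm_powr_borel
      borel_measurable_diff grad_borel smooth_w assms X_borel borel_open \<Omega>_open)

lemma err_integrable:
  assumes q: "0 < q" "q < 3 / 2" and e: "0 < e" "e < 1"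
  shows "integrable lborel (\<lambda>x. indicator (\<Omega> e) x * norm (grad (w e) x - X e x) powr q)"
    and "err q e \<le> (\<integral>z. newton_error q e z \<partial>lborel)"
proof -
  have i: "integrable lborel (\<lambda>x. newton_error q e (x + - (e *\<^sub>R a)))"
    using newton_error_integrable[OF q e] by (simp only: integrable_translate)
  show i': "integrable lborel (\<lambda>x. indicator (\<Omega> e) x * norm (grad (w e) x - X e x) powr q)"
    by (rule Bochner_Integration.integrable_bound[OF i])
      (use err_borel[OF e(1)] err_integrand[OF e] in \<open>auto simp: newton_error_def intro!: AE_I2\<close>)
  have "err q e \<le> (\<integral>x. newton_error q e (x + - (e *\<^sub>R a)) \<partial>lborel)"
    unfolding err_def by (intro integral_mono i i' err_integrand[OF e])
  also have "\<dots> = (\<integral>z. newton_error q e z \<partial>lborel)" by (rule integral_translate(1))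
  finally show "err q e \<le> (\<integral>z. newton_error q e z \<partial>lborel)" .
qed

lemma err_nonneg: "0 \<le> err q e" unfolding err_def by (rule Bochner_Integration.integral_nonneg) simp

lemma err_tendsto:
  assumes q: "0 < q" "q < 3 / 2"
  shows "((\<lambda>e. err q e) \<longlongrightarrow> 0) (at_right 0)"
proof (rule tendsto_sandwich[OF _ _ tendsto_const newton_error_tendsto[OF q]])
  show "\<forall>\<^sub>F e in at_right 0. 0 \<le> err q e" by (simp add: err_nonneg)
  show "\<forall>\<^sub>F e in at_right 0. err q e \<le> (\<integral>z. newton_error q e z \<partial>lborel)"
    unfolding eventually_at_right_field using err_integrable(2)[OF q] by (intro exI[of _ 1]) auto
qed

text \<open>Division by the norm of the error must be possible for every e below 1, not only for
  small e.\<close>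

lemma err_pos:
  assumes q: "0 < q" "q < 3 / 2" and e: "0 < e" "e < 1"
  shows "0 < err q e"
proof (rule ccontr)
  assume "\<not> 0 < err q e"
  then have "err q e = 0" using err_nonneg[of q e] by simp
  then have ae: "AE x in lborel. indicator (\<Omega> e) x * norm (grad (w e) x - X e x) powr q = 0"
    unfolding err_def using integral_nonneg_eq_0_iff_AE[OF err_integrable(1)[OF q e]] by simp
  \<comment> \<open>A shell next to the unit sphere. Norm above e avoids the hole; norm above 1 - e
    gives distance more than 1 - 2 e from the pole, where the gradient of the cut-off potential
    vanishes and the Newton field does not.\<close>
  define A where "A = {x::real^3. max e (1 - e) < norm x} \<inter> ball 0 1"
  have A: "open A" unfolding A_def by (intro open_Int open_Collect_less continuous_intros open_ball)
  have nz: "indicator (\<Omega> e) x * norm (grad (w e) x - X e x) powr q \<noteq> 0" if x: "x \<in> A" for x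
  proof -
    have nx: "norm x < 1" "e < norm x" "1 - e < norm x" using x by (auto simp: A_def)
    have "x \<noteq> e *\<^sub>R t" if "t \<in> T" for t
    proof
      assume "x = e *\<^sub>R t"
      moreover have "norm (e *\<^sub>R t) < e" using that in_ball e by auto
      ultimately show False using nx by simp
    qed
    then have x\<Omega>: "x \<in> \<Omega> e" using nx by (auto simp: perforated_ball_def)
    have ea: "norm (e *\<^sub>R a) < e" using e pole_norm by simp
    have n1: "1 - 2 * e < norm (x - e *\<^sub>R a)" using norm_triangle_ineq2[of x "e *\<^sub>R a"] nx ea by linarith
    have z0: "x - e *\<^sub>R a \<noteq> 0" using nx ea by auto
    have "1 - 4 * e < (norm (x - e *\<^sub>R a))\<^sup>2"
    proof (cases "2 * e \<le> 1")
      case True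
      then have "(1 - 2 * e)\<^sup>2 < (norm (x - e *\<^sub>R a))\<^sup>2" using n1 by (intro power_strict_mono) auto
      moreover have "1 - 4 * e \<le> (1 - 2 * e)\<^sup>2" by (simp add: power2_eq_square algebra_simps)
      ultimately show ?thesis by linarith
    next
      case False
      then show ?thesis using zero_le_power2[of "norm (x - e *\<^sub>R a)"] by linarith
    qed
    then have "grad (w e) x = 0"
      unfolding grad_w[OF e(1)] power2_norm_eq_inner by (intro grad_newton_cutoff_outside[OF e(1)]) simp
    moreover have "norm (X e x) \<noteq> 0" unfolding X_def norm_newton_field using z0 by simp
    ultimately show ?thesis using x\<Omega> by simp
  qed
  obtain s where s: "max e (1 - e) < s" "s < 1" using dense[of "max e (1 - e)" 1] e by auto
  have "s *\<^sub>R (axis 1 1 :: real^3) \<in> A" using s e by (auto simp: A_def)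
  then have "\<not> negligible A" using open_not_negligible[OF A] by blast
  moreover have "AE x in lborel. x \<notin> A" using ae by eventually_elim (use nz in blast)
  then have "A \<in> null_sets lborel" using AE_iff_null_sets[of A lborel] A by simp
  then have "negligible A" using negligible_iff_null_sets null_sets_completionI by blast
  ultimately show False by blast
qed

text \<open>One ball, with centre at distance 3/8 from the pole, suffices: on it 1/4 < |z| < 1/2,
  where z is measured from the pole, and both cut-offs are 1 for e < 1/32. Hence w = 1/|z| - 1 \<ge>
  1, and the gradient has norm 1/|z|^2 \<ge> 1. The constant is the volume of this ball, independent
  of e and q.\<close>

lemma w_lower_bound:
  obtains c where "0 < c" "\<And>e. 0 < e \<Longrightarrow> e < 1 / 32 \<Longrightarrow> c \<le> (\<integral>x. w e x \<partial>lborel)"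
    "\<And>e q. 0 < e \<Longrightarrow> e < 1 / 32 \<Longrightarrow> 0 < q \<Longrightarrow> c \<le> (\<integral>x. norm (grad (w e) x) powr q \<partial>lborel)"
proof -
  define b :: "real^3" where "b = (3 / 8) *\<^sub>R axis 1 1"
  define c where "c = measure lborel (ball b (1 / 8))"
  have c: "0 < c" unfolding c_def using content_ball_pos[of "1 / 8" b] by simp
  have nz: "1 / 4 < norm z" "norm z < 1 / 2" if "z \<in> ball b (1 / 8)" for z
  proof -
    have nb: "norm b = 3 / 8" by (simp add: b_def)
    have "norm (b - z) < 1 / 8" using that by (simp add: dist_norm)
    then show "1 / 4 < norm z" "norm z < 1 / 2"
      using norm_triangle_ineq2[of b z] norm_triangle_ineq2[of z b] nb by (auto simp: norm_minus_commute)
  qed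
  have tz: "1 / 16 < z \<bullet> z" "z \<bullet> z < 1 / 4" if "z \<in> ball b (1 / 8)" for z
  proof -
    have "(1 / 4)\<^sup>2 < (norm z)\<^sup>2" "(norm z)\<^sup>2 < (1 / 2)\<^sup>2"
      using nz[OF that] by (intro power_strict_mono; simp)+
    then show "1 / 16 < z \<bullet> z" "z \<bullet> z < 1 / 4" unfolding power2_norm_eq_inner by (simp_all add: power2_eq_square)
  qed
  have ec: "8 * e\<^sup>2 \<le> 1 / 16" "1 / 4 \<le> 1 - 8 * e" if "0 < e" "e < 1 / 32" for e :: real
  proof -
    have "e\<^sup>2 \<le> (1 / 32)\<^sup>2" using that by (intro power_mono) auto
    then show "8 * e\<^sup>2 \<le> 1 / 16" "1 / 4 \<le> 1 - 8 * e" using that by (auto simp: power2_eq_square)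
  qed
  have key: "c \<le> (\<integral>x. f x \<partial>lborel)"
    if f: "integrable lborel f" "\<And>x. 0 \<le> f x" "\<And>x. x - e *\<^sub>R a \<in> ball b (1 / 8) \<Longrightarrow> 1 \<le> f x" for f e
  proof -
    have "c = (\<integral>x. indicator (ball (b + e *\<^sub>R a) (1 / 8)) x \<partial>lborel)"
      by (simp add: c_def content_ball)
    also have "\<dots> \<le> (\<integral>x. f x \<partial>lborel)"
    proof (rule integral_mono[OF _ f(1)])
      show "integrable lborel (indicator (ball (b + e *\<^sub>R a) (1 / 8)) :: real^3 \<Rightarrow> real)"
        using emeasure_lborel_ball_finite[of "b + e *\<^sub>R a" "1 / 8"] by (simp add: integrable_indicator_iff)
      show "indicator (ball (b + e *\<^sub>R a) (1 / 8)) x \<le> f x" for x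
        using f(2,3)[of x] by (auto simp: indicator_def dist_norm algebra_simps)
    qed
    finally show ?thesis .
  qed
  show ?thesis
  proof (rule that[OF c])
    fix e :: real assume e: "0 < e" "e < 1 / 32"
    show "c \<le> (\<integral>x. w e x \<partial>lborel)"
    proof (rule key[where e = e])
      show "integrable lborel (w e)" by (rule test_functions_integrable[OF w_test[OF e(1)]])
      show "0 \<le> w e x" for x unfolding w_def by (rule newton_cutoff_nonneg[OF e(1)])
      fix x assume x: "x - e *\<^sub>R a \<in> ball b (1 / 8)"
      define z where "z = x - e *\<^sub>R a"
      have z: "1 / 16 < z \<bullet> z" "z \<bullet> z < 1 / 4" using tz[OF x] by (auto simp: z_def)
      have "(z \<bullet> z) powr (- 1 / 2) = 1 / norm z"
        using z powr_minus_divide[of "z \<bullet> z" "1 / 2"] by (simp add: powr_half_sqrt norm_eq_sqrt_inner)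
      moreover have "2 \<le> 1 / norm z"
      proof -
        have "0 < norm z" "norm z * 2 \<le> 1" using nz[OF x] unfolding z_def by linarith+
        then show ?thesis by (simp add: pos_le_divide_eq mult.commute)
      qed
      moreover have "smooth_step ((z \<bullet> z) / (4 * e\<^sup>2)) = 1"
      proof (rule smooth_step_one)
        have "2 * (4 * e\<^sup>2) \<le> z \<bullet> z" using z(1) ec(1)[OF e] by linarith
        then show "2 \<le> (z \<bullet> z) / (4 * e\<^sup>2)" using e(1) by (subst pos_le_divide_eq) auto
      qed
      moreover have "smooth_step ((1 - z \<bullet> z) / (4 * e)) = 1"
      proof (rule smooth_step_one)
        have "2 * (4 * e) \<le> 1 - z \<bullet> z" using z(2) ec(2)[OF e] by linarith
        then show "2 \<le> (1 - z \<bullet> z) / (4 * e)" using e(1) by (subst pos_le_divide_eq) auto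
      qed
      ultimately show "1 \<le> w e x" by (simp add: w_def newton_cutoff_def z_def)
    qed
    fix q :: real assume q: "0 < q"
    show "c \<le> (\<integral>x. norm (grad (w e) x) powr q \<partial>lborel)"
    proof (rule key[where e = e])
      obtain K where K: "smooth (w e)" "compact K" "K \<subseteq> \<Omega> e" "\<And>x. x \<notin> K \<Longrightarrow> w e x = 0"
        using test_functionsE[OF w_test[OF e(1)]] by blast
      show "integrable lborel (\<lambda>x. norm (grad (w e) x) powr q)"
      proof (rule integrable_cont_compact_support[OF _ K(2)])
        show "continuous_on UNIV (\<lambda>x. norm (grad (w e) x) powr q)"
          using q by (intro continuous_on_powr' continuous_on_norm grad_continuous K(1) continuous_on_const) auto
        show "norm (grad (w e) x) powr q = 0" if "x \<notin> K" for x
          using grad_zero_off[OF K(1) compact_imp_closed[OF K(2)] K(4) that] by simp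
      qed
      fix x assume x: "x - e *\<^sub>R a \<in> ball b (1 / 8)"
      define z where "z = x - e *\<^sub>R a"
      have z: "1 / 16 < z \<bullet> z" "z \<bullet> z < 1 / 4" using tz[OF x] by (auto simp: z_def)
      have "grad (w e) x = newton_field z" unfolding grad_w[OF e(1)] z_def[symmetric]
        using z ec[OF e] by (intro grad_newton_cutoff_inside[OF e(1)]) auto
      then have "norm (grad (w e) x) = 1 / (z \<bullet> z)" by (simp add: norm_newton_field)
      then have "1 \<le> norm (grad (w e) x)" using z pos_le_divide_eq[of "z \<bullet> z" 1 1] by linarith
      then show "1 \<le> norm (grad (w e) x) powr q" using q by (simp add: ge_one_powr_ge_zero)
    qed simp
  qed
qed

end

section \<open>Blow-up of the gradient\<close>

lemma grad_cmult:
  assumes "smooth f"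
  shows "grad (\<lambda>x. c * f x) x = c *\<^sub>R grad f x"
proof -
  have "((\<lambda>x. c * f x) has_derivative (\<lambda>v. c * dd v f x)) (at x)"
    by (rule has_derivative_mult_right[OF smooth_has_derivative[OF assms]])
  then have "dd v (\<lambda>x. c * f x) x = c * dd v f x" for v by (rule dd_eqI)
  then show ?thesis
    by (simp add: grad_eq(1)[OF smooth_differentiable[OF assms]]
        grad_eq(1)[OF smooth_differentiable[OF smooth_cmult[OF assms]]] scaleR_sum_right)
qed

text \<open>The identity field has the dimension as its divergence; testing the equation of (i) with
  w therefore detects the integral of w.\<close>

lemma integral_position_grad:
  fixes \<psi> :: "'a::euclidean_space \<Rightarrow> real"
  assumes "\<psi> \<in> test_functions UNIV"
  shows "(\<integral>x. x \<bullet> grad \<psi> x \<partial>lborel) = - (DIM('a) * (\<integral>x. \<psi> x \<partial>lborel))"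
proof -
  note s = test_functions_smooth[OF assms]
  have l: "smooth (\<lambda>x::'a. x \<bullet> i)" for i by (rule smooth_linear[OF bounded_linear_inner_left])
  have d: "dd i (\<lambda>x::'a. x \<bullet> i) x = 1" if "i \<in> Basis" for i x
  proof -
    have "((\<lambda>x::'a. x \<bullet> i) has_derivative (\<lambda>v. v \<bullet> i)) (at x)" by (auto intro!: derivative_eq_intros)
    then show ?thesis using that by (simp add: dd_eqI)
  qed
  have e: "x \<bullet> grad \<psi> x = (\<Sum>i\<in>Basis. (x \<bullet> i) * dd i \<psi> x)" for x
    using euclidean_inner[of x "grad \<psi> x"] by (simp add: grad_inner[OF smooth_differentiable[OF s]])
  have int: "integrable lborel (\<lambda>x. (x \<bullet> i) * dd i \<psi> x)" for i
    by (rule test_functions_integrable[OF test_functions_mult[OF test_functions_dd[OF assms] l]])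
  have ibp: "(\<integral>x. (x \<bullet> i) * dd i \<psi> x \<partial>lborel) = - (\<integral>x. \<psi> x \<partial>lborel)" if "i \<in> Basis" for i
    using integral_by_parts[OF assms l, of i i] d[OF that] by simp
  have "(\<integral>x. x \<bullet> grad \<psi> x \<partial>lborel) = (\<Sum>i\<in>Basis. \<integral>x. (x \<bullet> i) * dd i \<psi> x \<partial>lborel)"
    unfolding e by (rule Bochner_Integration.integral_sum[OF int])
  also have "\<dots> = (\<Sum>i\<in>(Basis::'a set). - (\<integral>x. \<psi> x \<partial>lborel))" by (rule sum.cong[OF refl ibp])
  finally show ?thesis by simp
qed

lemma Liminf_infinity:
  assumes "F \<noteq> bot" "\<And>M::real. \<forall>\<^sub>F x in F. M \<le> f x"
  shows "Liminf F (\<lambda>x. ereal (f x)) = \<infinity>"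
proof (rule lim_imp_Liminf[OF assms(1)])
  have "\<forall>\<^sub>F x in F. ereal r < ereal (f x)" for r
    using assms(2)[of "r + 1"] by eventually_elim simp
  then show "((\<lambda>x. ereal (f x)) \<longlongrightarrow> \<infinity>) F" by (simp add: tendsto_PInfty)
qed

context perforation
begin

lemma \<Omega>_sets: "\<Omega> e \<in> sets lebesgue"
  by (rule sets_completionI_sets) (simp add: \<Omega>_open borel_open)

lemma grad_test_zero:
  assumes "\<phi> \<in> test_functions (\<Omega> e)" "x \<notin> \<Omega> e"
  shows "grad \<phi> x = 0"
proof -
  obtain K where K: "smooth \<phi>" "compact K" "K \<subseteq> \<Omega> e" "\<And>x. x \<notin> K \<Longrightarrow> \<phi> x = 0"
    using test_functionsE[OF assms(1)] by blast
  show ?thesis using K(3) assms(2) by (intro grad_zero_off[OF K(1) compact_imp_closed[OF K(2)] K(4)]) auto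
qed

lemma X_inner_integrable:
  assumes e: "0 < e" and G: "integrable lborel G" "\<And>x. x \<notin> \<Omega> e \<Longrightarrow> G x = 0"
    and B: "\<And>x. x \<in> \<Omega> e \<Longrightarrow> norm (X e x) \<le> B"
  shows "integrable lborel (\<lambda>x. X e x \<bullet> G x)" "\<bar>\<integral>x. X e x \<bullet> G x \<partial>lborel\<bar> \<le> B * (\<integral>x. norm (G x) \<partial>lborel)"
proof -
  have m: "(\<lambda>x. X e x \<bullet> G x) \<in> borel_measurable lborel"
    using G(1) X_borel by (intro borel_measurable_inner) auto
  have b: "\<bar>X e x \<bullet> G x\<bar> \<le> B * norm (G x)" for x
  proof (cases "x \<in> \<Omega> e")
    case True
    have "\<bar>X e x \<bullet> G x\<bar> \<le> norm (X e x) * norm (G x)" by (rule Cauchy_Schwarz_ineq2)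
    also have "\<dots> \<le> B * norm (G x)" using B[OF True] by (intro mult_right_mono) auto
    finally show ?thesis .
  qed (simp add: G(2))
  have i: "integrable lborel (\<lambda>x. B * norm (G x))" using G(1) by (intro integrable_mult_right integrable_norm)
  show "integrable lborel (\<lambda>x. X e x \<bullet> G x)"
    by (rule Bochner_Integration.integrable_bound[OF i m]) (use b in \<open>auto intro!: AE_I2 intro: order_trans[OF _ abs_ge_self]\<close>)
  then have "norm (\<integral>x. X e x \<bullet> G x \<partial>lborel) \<le> (\<integral>x. B * norm (G x) \<partial>lborel)"
    using b by (intro Bochner_Integration.integral_norm_bound_integral[OF _ i]) auto
  then show "\<bar>\<integral>x. X e x \<bullet> G x \<partial>lborel\<bar> \<le> B * (\<integral>x. norm (G x) \<partial>lborel)" by simp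
qed

lemma gradient_lower_bound:
  assumes p: "3 < p" "1 < q" "1 / p + 1 / q = 1" and q: "q < 3 / 2"
  obtains c where "0 < c" "\<And>e u. 0 < e \<Longrightarrow> e < 1 / 32 \<Longrightarrow> weak_solution p (\<Omega> e) (\<lambda>x. x) u \<Longrightarrow>
    c \<le> Lp_norm p (\<Omega> e) (weak_gradient (\<Omega> e) u) * err q e powr (1 / q)"
proof -
  obtain c where c: "0 < c" "\<And>e. 0 < e \<Longrightarrow> e < 1 / 32 \<Longrightarrow> c \<le> (\<integral>x. w e x \<partial>lborel)"
    "\<And>e q. 0 < e \<Longrightarrow> e < 1 / 32 \<Longrightarrow> 0 < q \<Longrightarrow> c \<le> (\<integral>x. norm (grad (w e) x) powr q \<partial>lborel)"
    by (rule w_lower_bound, rule that) (assumption | blast)+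
  have p1: "1 < p" using p by simp
  have "3 * c \<le> Lp_norm p (\<Omega> e) (weak_gradient (\<Omega> e) u) * err q e powr (1 / q)"
    if e: "0 < e" "e < 1 / 32" and sol: "weak_solution p (\<Omega> e) (\<lambda>x. x) u" for e u
  proof -
    obtain u' G \<phi> where "u' \<in> borel_measurable borel" "\<And>x. x \<notin> \<Omega> e \<Longrightarrow> u' x = 0" "integrable lborel u'"
      "AE x in lebesgue_on (\<Omega> e). u x = u' x"
      and G: "G \<in> borel_measurable borel" "\<And>x. x \<notin> \<Omega> e \<Longrightarrow> G x = 0" "integrable lborel G"
      "integrable lborel (\<lambda>x. norm (G x) powr p)"
      "Lp_norm p (\<Omega> e) (weak_gradient (\<Omega> e) u) = (\<integral>x. norm (G x) powr p \<partial>lborel) powr (1 / p)"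
      and \<phi>: "\<And>n::nat. \<phi> n \<in> test_functions (\<Omega> e)"
      "(\<lambda>n. \<integral>x. \<bar>u' x - \<phi> n x\<bar> \<partial>lborel) \<longlonglongrightarrow> 0"
      "(\<lambda>n. \<integral>x. norm (G x - grad (\<phi> n) x) \<partial>lborel) \<longlonglongrightarrow> 0"
      and eq: "\<And>\<psi>. \<psi> \<in> test_functions (\<Omega> e) \<Longrightarrow>
        (\<integral>x. G x \<bullet> grad \<psi> x \<partial>lborel) = - (LINT x|lebesgue_on (\<Omega> e). x \<bullet> grad \<psi> x)"
      using weak_solution_data[OF p1 p(2,3) \<Omega>_open \<Omega>_ball sol] by blast
    note [measurable] = G(1) X_borel grad_borel[OF smooth_w[OF e(1)]]
    obtain B where B: "\<And>x. x \<in> \<Omega> e \<Longrightarrow> norm (X e x) \<le> B" using X_bounded[OF e(1)] by blast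
    note sL = \<Omega>_sets[of e]
    \<comment> \<open>At fixed e the field is bounded on the domain, so its orthogonality to
      gradients of test functions extends to G by L^1 approximation.\<close>
    have XG: "(\<integral>x. X e x \<bullet> G x \<partial>lborel) = 0"
    proof -
      have "\<bar>\<integral>x. X e x \<bullet> G x \<partial>lborel\<bar> \<le> B * (\<integral>x. norm (G x - grad (\<phi> n) x) \<partial>lborel)" for n
      proof -
        note gi = test_functions_grad_integrable[OF \<phi>(1)[of n]]
        have "(\<integral>x. X e x \<bullet> (G x - grad (\<phi> n) x) \<partial>lborel) =
            (\<integral>x. X e x \<bullet> G x \<partial>lborel) - (\<integral>x. X e x \<bullet> grad (\<phi> n) x \<partial>lborel)"
          unfolding inner_diff_right
          by (rule Bochner_Integration.integral_diff
              [OF X_inner_integrable(1)[OF e(1) G(3,2) B] X_inner_integrable(1)[OF e(1) gi grad_test_zero[OF \<phi>(1)] B]])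
        moreover have "(\<integral>x. X e x \<bullet> grad (\<phi> n) x \<partial>lborel) = 0" by (rule X_div_free[OF \<phi>(1)])
        moreover have "\<bar>\<integral>x. X e x \<bullet> (G x - grad (\<phi> n) x) \<partial>lborel\<bar> \<le> B * (\<integral>x. norm (G x - grad (\<phi> n) x) \<partial>lborel)"
          by (rule X_inner_integrable(2)[OF e(1) Bochner_Integration.integrable_diff[OF G(3) gi] _ B])
            (use G(2) grad_test_zero[OF \<phi>(1)] in auto)
        ultimately show ?thesis by simp
      qed
      moreover have "(\<lambda>n. B * (\<integral>x. norm (G x - grad (\<phi> n) x) \<partial>lborel)) \<longlonglongrightarrow> B * 0"
        by (intro tendsto_mult_left \<phi>(3))
      ultimately have "\<bar>\<integral>x. X e x \<bullet> G x \<partial>lborel\<bar> \<le> B * 0"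
        by (intro LIMSEQ_le_const[of _ "B * 0"]) auto
      then show ?thesis by simp
    qed
    have wU: "w e \<in> test_functions UNIV" using w_test[OF e(1)] test_functions_mono[of "\<Omega> e" UNIV] by blast
    have gw0: "grad (w e) x = 0" if "x \<notin> \<Omega> e" for x by (rule grad_test_zero[OF w_test[OF e(1)] that])
    have "(LINT x|lebesgue_on (\<Omega> e). x \<bullet> grad (w e) x) = (\<integral>x. x \<bullet> grad (w e) x \<partial>lborel)"
      by (rule integral_lebesgue_on_eq(1)[OF sL]) (use gw0 in auto)
    also have "\<dots> = - (3 * (\<integral>x. w e x \<partial>lborel))" using integral_position_grad[OF wU] by simp
    finally have Gw: "(\<integral>x. G x \<bullet> grad (w e) x \<partial>lborel) = 3 * (\<integral>x. w e x \<partial>lborel)"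
      using eq[OF w_test[OF e(1)]] by simp
    define g where "g x = indicator (\<Omega> e) x * norm (grad (w e) x - X e x)" for x
    have gq: "g x powr q = indicator (\<Omega> e) x * norm (grad (w e) x - X e x) powr q" for x
      by (auto simp: g_def indicator_def)
    have gm: "g \<in> borel_measurable lborel"
      unfolding g_def[abs_def] using \<Omega>_open by (auto intro!: borel_measurable_times borel_measurable_indicator)
    have gi: "integrable lborel (\<lambda>x. g x powr q)"
      unfolding gq using err_integrable(1)[of q e] p q e by simp
    have g0: "0 \<le> g x" for x by (simp add: g_def)
    have Gm: "(\<lambda>x. norm (G x)) \<in> borel_measurable lborel" by simp
    note hoelder = holder_inequality[OF p1 p(3,2) Gm norm_ge_zero G(4) gm g0 gi]
    have bnd: "norm (G x \<bullet> grad (w e) x - X e x \<bullet> G x) \<le> norm (G x) * g x" for x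
    proof (cases "x \<in> \<Omega> e")
      case True
      have "G x \<bullet> grad (w e) x - X e x \<bullet> G x = G x \<bullet> (grad (w e) x - X e x)"
        by (simp add: inner_diff_right inner_commute)
      then show ?thesis using True Cauchy_Schwarz_ineq2[of "G x" "grad (w e) x - X e x"] by (simp add: g_def)
    qed (simp add: G(2))
    have XGi: "integrable lborel (\<lambda>x. X e x \<bullet> G x)" by (rule X_inner_integrable(1)[OF e(1) G(3,2) B])
    have di: "integrable lborel (\<lambda>x. G x \<bullet> grad (w e) x - X e x \<bullet> G x)"
      by (rule Bochner_Integration.integrable_bound[OF hoelder(1)]) (use bnd g0 in \<open>auto intro!: AE_I2 simp: abs_mult\<close>)
    have Gwi: "integrable lborel (\<lambda>x. G x \<bullet> grad (w e) x)"
      using Bochner_Integration.integrable_add[OF di XGi] by simp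
    have "3 * c \<le> 3 * (\<integral>x. w e x \<partial>lborel)" using c(2)[OF e] by simp
    also have "\<dots> = (\<integral>x. G x \<bullet> grad (w e) x - X e x \<bullet> G x \<partial>lborel)"
      using Bochner_Integration.integral_diff[OF Gwi XGi] XG Gw by simp
    also have "\<dots> \<le> (\<integral>x. norm (G x) * g x \<partial>lborel)"
      using bnd by (intro integral_mono[OF di hoelder(1)]) (auto intro: order_trans[OF abs_ge_self])
    also have "\<dots> \<le> (\<integral>x. norm (G x) powr p \<partial>lborel) powr (1 / p) * (\<integral>x. g x powr q \<partial>lborel) powr (1 / q)"
      by (rule hoelder(2))
    also have "\<dots> = Lp_norm p (\<Omega> e) (weak_gradient (\<Omega> e) u) * err q e powr (1 / q)"
      unfolding G(5) gq err_def ..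
    finally show ?thesis .
  qed
  then show ?thesis using c(1) by (intro that[of "3 * c"]) auto
qed

lemma err_root_small:
  assumes q: "0 < q" "q < 3 / 2" and d: "0 < d"
  shows "\<forall>\<^sub>F e in at_right 0. 0 < e \<and> e < 1 / 32 \<and> err q e powr (1 / q) < d"
proof -
  have "\<forall>\<^sub>F e in at_right 0. err q e < d powr q" using d by (intro order_tendstoD(2)[OF err_tendsto[OF q]]) simp
  moreover have "\<forall>\<^sub>F e in at_right (0::real). 0 < e \<and> e < 1 / 32"
    unfolding eventually_at_right_field by (intro exI[of _ "1 / 32"]) auto
  ultimately show ?thesis
  proof eventually_elim
    case (elim e)
    have "err q e powr (1 / q) < (d powr q) powr (1 / q)" using elim q err_nonneg[of q e] by (intro powr_less_mono2) auto
    also have "\<dots> = d" using q d by (simp add: powr_powr)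
    finally show ?case using elim by simp
  qed
qed

lemma identity_source_blowup:
  assumes p: "3 < p" and sol: "\<forall>\<^sub>F e in at_right 0. weak_solution p (\<Omega> e) (\<lambda>x. x) (u e)"
  shows "Liminf (at_right 0) (\<lambda>e. ereal (Lp_norm p (\<Omega> e) (weak_gradient (\<Omega> e) (u e)))) = \<infinity>"
proof (rule Liminf_infinity)
  define q where "q = p / (p - 1)"
  \<comment> \<open>For the conjugate exponent, q < 3/2 is equivalent to p > 3.\<close>
  have q: "1 < q" "q < 3 / 2" "1 / p + 1 / q = 1" using p by (auto simp: q_def field_simps)
  obtain c where c: "0 < c" "\<And>e u. 0 < e \<Longrightarrow> e < 1 / 32 \<Longrightarrow> weak_solution p (\<Omega> e) (\<lambda>x. x) u \<Longrightarrow>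
    c \<le> Lp_norm p (\<Omega> e) (weak_gradient (\<Omega> e) u) * err q e powr (1 / q)"
    using gradient_lower_bound[OF p q(1,3,2)] by blast
  fix M :: real
  have d: "0 < c / (\<bar>M\<bar> + 1)" using c by (intro divide_pos_pos) auto
  have "0 < q" using q by simp
  show "\<forall>\<^sub>F e in at_right 0. M \<le> Lp_norm p (\<Omega> e) (weak_gradient (\<Omega> e) (u e))"
    using err_root_small[OF \<open>0 < q\<close> q(2) d] sol
  proof eventually_elim
    case (elim e)
    define L where "L = Lp_norm p (\<Omega> e) (weak_gradient (\<Omega> e) (u e))"
    have "c \<le> L * err q e powr (1 / q)" unfolding L_def using c(2) elim by blast
    also have "\<dots> \<le> L * (c / (\<bar>M\<bar> + 1))"
      using elim by (intro mult_left_mono) (auto simp: L_def Lp_norm_nonneg)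
    finally have "c * (\<bar>M\<bar> + 1) \<le> c * L" by (simp add: pos_le_divide_eq mult.commute)
    then have "\<bar>M\<bar> + 1 \<le> L" using c(1) by simp
    then show ?case unfolding L_def by simp
  qed
qed simp

text \<open>\<open>err p e\<close> is the p-th power of the norm of the error, so its root
  normalises. The exponent is p itself: in (ii) it takes the part that the conjugate exponent has in
  (i).\<close>

definition source :: "real \<Rightarrow> real \<Rightarrow> real^3 \<Rightarrow> real^3" where
  "source p e x = (1 / err p e powr (1 / p)) *\<^sub>R (X e x - grad (w e) x)"

lemma source_norm:
  assumes p: "1 < p" "p < 3 / 2" and e: "0 < e" "e < 1"
  shows "source p e \<in> Lp p (\<Omega> e)" "Lp_norm p (\<Omega> e) (source p e) = 1"
proof -
  have pos: "0 < err p e" using err_pos[of p e] p e by simp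
  note sL = \<Omega>_sets[of e]
  note [measurable] = X_borel grad_borel[OF smooth_w[OF e(1)]]
  define F where "F x = (1 / err p e) * (indicator (\<Omega> e) x * norm (grad (w e) x - X e x) powr p)" for x
  have Fi: "integrable lborel F"
    unfolding F_def[abs_def] using err_integrable(1)[of p e] p e by (intro integrable_mult_right) auto
  have FI: "(\<integral>x. F x \<partial>lborel) = 1" unfolding F_def using pos by (simp add: err_def[symmetric])
  have Fb: "F \<in> borel_measurable borel" using borel_measurable_integrable[OF Fi] by simp
  have F0: "F x = 0" if "x \<notin> \<Omega> e" for x using that by (simp add: F_def)
  have eq: "norm (source p e x) powr p = F x" if "x \<in> \<Omega> e" for x
  proof -
    define k where "k = 1 / err p e powr (1 / p)"
    have k: "0 \<le> k" "k powr p = 1 / err p e" using pos p by (simp_all add: k_def powr_divide powr_powr)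
    have "norm (source p e x) = k * norm (grad (w e) x - X e x)"
      using k(1) unfolding source_def k_def[symmetric] by (simp add: norm_minus_commute)
    then show ?thesis using that k by (simp add: F_def powr_mult)
  qed
  have sb: "source p e \<in> borel_measurable borel" unfolding source_def[abs_def] by simp
  have "integrable (lebesgue_on (\<Omega> e)) F" using integrable_lebesgue_on_eq[OF sL Fb F0] Fi by simp
  then have "integrable (lebesgue_on (\<Omega> e)) (\<lambda>x. norm (source p e x) powr p)"
    by (rule Bochner_Integration.integrable_cong[THEN iffD1, OF refl, rotated]) (simp add: eq)
  then show "source p e \<in> Lp p (\<Omega> e)"
    using sb by (simp add: Lp_def measurable_restrict_space1)
  have "(LINT x|lebesgue_on (\<Omega> e). norm (source p e x) powr p) = (LINT x|lebesgue_on (\<Omega> e). F x)"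
    by (rule Bochner_Integration.integral_cong[OF refl]) (simp add: eq)
  also have "\<dots> = 1" using integral_lebesgue_on_eq(1)[OF sL Fb F0] FI by simp
  finally show "Lp_norm p (\<Omega> e) (source p e) = 1" by (simp add: Lp_norm_def)
qed

lemma source_solution:
  assumes p: "1 < p" "p < 3 / 2" and e: "0 < e" "e < 1"
  shows "weak_solution p (\<Omega> e) (source p e) (\<lambda>x. 1 / err p e powr (1 / p) * w e x)"
proof (rule weak_solution_testI)
  let ?N = "1 / err p e powr (1 / p)"
  show "open (\<Omega> e)" by (rule \<Omega>_open)
  show "0 < p" using p by simp
  show "(\<lambda>x. ?N * w e x) \<in> test_functions (\<Omega> e)"
    by (rule test_functions_mult[OF w_test[OF e(1)] smooth_const])
  fix \<phi> assume \<phi>: "\<phi> \<in> test_functions (\<Omega> e)"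
  note g0 = grad_test_zero[OF \<phi>]
  note sL = \<Omega>_sets[of e]
  note [measurable] = X_borel grad_borel[OF smooth_w[OF e(1)]] grad_borel[OF test_functions_smooth[OF \<phi>]]
  obtain B where B: "\<And>x. x \<in> \<Omega> e \<Longrightarrow> norm (X e x) \<le> B" using X_bounded[OF e(1)] by blast
  have gw: "grad (\<lambda>x. ?N * w e x) x = ?N *\<^sub>R grad (w e) x" for x by (rule grad_cmult[OF smooth_w[OF e(1)]])
  have Xi: "integrable lborel (\<lambda>x. X e x \<bullet> grad \<phi> x)"
    by (rule X_inner_integrable(1)[OF e(1) test_functions_grad_integrable[OF \<phi>] g0 B])
  have wi: "integrable lborel (\<lambda>x. grad (w e) x \<bullet> grad \<phi> x)"
  proof -
    obtain K where K: "smooth \<phi>" "compact K" "K \<subseteq> \<Omega> e" "\<And>x. x \<notin> K \<Longrightarrow> \<phi> x = 0"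
      using test_functionsE[OF \<phi>] by blast
    show ?thesis
      by (rule integrable_cont_compact_support[OF _ K(2)])
        (auto intro!: continuous_on_inner grad_continuous smooth_w[OF e(1)] K(1)
          simp: grad_zero_off[OF K(1) compact_imp_closed[OF K(2)] K(4)])
  qed
  have "(LINT x|lebesgue_on (\<Omega> e). source p e x \<bullet> grad \<phi> x) = (\<integral>x. source p e x \<bullet> grad \<phi> x \<partial>lborel)"
    by (rule integral_lebesgue_on_eq(1)[OF sL]) (auto simp: source_def[abs_def] g0)
  also have "\<dots> = (\<integral>x. ?N * (X e x \<bullet> grad \<phi> x - grad (w e) x \<bullet> grad \<phi> x) \<partial>lborel)"
    by (simp add: source_def inner_diff_left)
  also have "\<dots> = ?N * ((\<integral>x. X e x \<bullet> grad \<phi> x \<partial>lborel) - (\<integral>x. grad (w e) x \<bullet> grad \<phi> x \<partial>lborel))"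
    by (simp only: integral_mult_right_zero Bochner_Integration.integral_diff[OF Xi wi])
  also have "\<dots> = - (?N * (\<integral>x. grad (w e) x \<bullet> grad \<phi> x \<partial>lborel))" by (simp add: X_div_free[OF \<phi>])
  also have "?N * (\<integral>x. grad (w e) x \<bullet> grad \<phi> x \<partial>lborel) = (\<integral>x. grad (\<lambda>x. ?N * w e x) x \<bullet> grad \<phi> x \<partial>lborel)"
    unfolding gw by simp
  also have "\<dots> = (LINT x|lebesgue_on (\<Omega> e). grad (\<lambda>x. ?N * w e x) x \<bullet> grad \<phi> x)"
    unfolding gw by (rule integral_lebesgue_on_eq(1)[OF sL, symmetric]) (auto simp: g0)
  finally show "(LINT x|lebesgue_on (\<Omega> e). grad (\<lambda>x. ?N * w e x) x \<bullet> grad \<phi> x) =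
      - (LINT x|lebesgue_on (\<Omega> e). source p e x \<bullet> grad \<phi> x)" by simp
qed

lemma source_unique:
  assumes "C1_boundary T" "0 < e" "1 < p" "weak_solution p (\<Omega> e) f u" "weak_solution p (\<Omega> e) f v"
  shows "AE x in lebesgue_on (\<Omega> e). u x = v x"
  using weak_solution_unique[OF \<Omega>_open \<Omega>_ball perforated_ball_cones[OF compact assms(1,2)] assms(3-5)] .

lemma source_blowup:
  assumes C1: "C1_boundary T" and p: "1 < p" "p < 3 / 2"
    and sol: "\<And>e. 0 < e \<Longrightarrow> e < 1 \<Longrightarrow> weak_solution p (\<Omega> e) (source p e) (u e)"
  shows "Liminf (at_right 0) (\<lambda>e. ereal (Lp_norm p (\<Omega> e) (weak_gradient (\<Omega> e) (u e)))) = \<infinity>"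
proof (rule Liminf_infinity)
  obtain c where c: "0 < c" "\<And>e. 0 < e \<Longrightarrow> e < 1 / 32 \<Longrightarrow> c \<le> (\<integral>x. w e x \<partial>lborel)"
    "\<And>e q. 0 < e \<Longrightarrow> e < 1 / 32 \<Longrightarrow> 0 < q \<Longrightarrow> c \<le> (\<integral>x. norm (grad (w e) x) powr q \<partial>lborel)"
    by (rule w_lower_bound, rule that) (assumption | blast)+
  have p0: "0 < p" using p by simp
  fix M :: real
  have d: "0 < c powr (1 / p) / (\<bar>M\<bar> + 1)" using c by (intro divide_pos_pos) auto
  show "\<forall>\<^sub>F e in at_right 0. M \<le> Lp_norm p (\<Omega> e) (weak_gradient (\<Omega> e) (u e))"
    using err_root_small[OF p0 p(2) d]
  proof eventually_elim
    case (elim e)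
    have e: "0 < e" "e < 1" "e < 1 / 32" using elim by auto
    \<comment> \<open>By uniqueness every solution agrees with w / E. The norm of the gradient of w
      is bounded below, and E tends to 0 because the error does.\<close>
    define E where "E = err p e powr (1 / p)"
    have E: "0 < E" "E < c powr (1 / p) / (\<bar>M\<bar> + 1)" using elim err_pos[OF p0 p(2) e(1,2)] by (auto simp: E_def)
    note sL = \<Omega>_sets[of e]
    have v: "smooth (\<lambda>x. 1 / E * w e x)" by (rule smooth_cmult[OF smooth_w[OF e(1)]])
    have ae: "AE x in lebesgue_on (\<Omega> e). u e x = 1 / E * w e x"
      using source_unique[OF C1 e(1) p(1) sol[OF e(1,2)] source_solution[OF p e(1,2)]] by (simp add: E_def)
    have gm: "grad (w e) \<in> borel_measurable borel" by (rule grad_borel[OF smooth_w[OF e(1)]])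
    have "Lp_norm p (\<Omega> e) (weak_gradient (\<Omega> e) (u e)) = Lp_norm p (\<Omega> e) (grad (\<lambda>x. 1 / E * w e x))"
      by (rule weak_gradient_eq_smooth_AE[OF \<Omega>_open sol[OF e(1,2)] v ae])
    also have "\<dots> = (LINT x|lebesgue_on (\<Omega> e). (1 / E) powr p * norm (grad (w e) x) powr p) powr (1 / p)"
      unfolding Lp_norm_def grad_cmult[OF smooth_w[OF e(1)]] using E by (simp add: powr_mult powr_divide)
    also have "(LINT x|lebesgue_on (\<Omega> e). (1 / E) powr p * norm (grad (w e) x) powr p) =
        (\<integral>x. (1 / E) powr p * norm (grad (w e) x) powr p \<partial>lborel)"
      by (rule integral_lebesgue_on_eq(1)[OF sL])
        (use gm grad_test_zero[OF w_test[OF e(1)]] in \<open>auto intro!: borel_measurable_times norm_powr_borel\<close>)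
    also have "\<dots> = (1 / E) powr p * (\<integral>x. norm (grad (w e) x) powr p \<partial>lborel)" by simp
    also have "((1 / E) powr p * (\<integral>x. norm (grad (w e) x) powr p \<partial>lborel)) powr (1 / p) =
        1 / E * (\<integral>x. norm (grad (w e) x) powr p \<partial>lborel) powr (1 / p)"
      using E p by (simp add: powr_mult powr_powr)
    finally have L: "Lp_norm p (\<Omega> e) (weak_gradient (\<Omega> e) (u e)) =
        1 / E * (\<integral>x. norm (grad (w e) x) powr p \<partial>lborel) powr (1 / p)" .
    have "c powr (1 / p) \<le> (\<integral>x. norm (grad (w e) x) powr p \<partial>lborel) powr (1 / p)"
      using c(3)[OF e(1,3) p0] c(1) p by (intro powr_mono2) auto
    then have "1 / E * c powr (1 / p) \<le> Lp_norm p (\<Omega> e) (weak_gradient (\<Omega> e) (u e))"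
      unfolding L using E by (intro mult_left_mono) auto
    moreover have "\<bar>M\<bar> + 1 \<le> 1 / E * c powr (1 / p)" using E by (simp add: field_simps)
    ultimately show ?case by linarith
  qed
qed simp

end

text \<open>Existence and uniqueness for the constructed sources are part of the conclusion, so the
  quantification over families of solutions in (ii) is not vacuous.\<close>

theorem theorem1p3:
  fixes T :: "(real^3) set"
  assumes "closed_domain T" and "lipschitz_boundary T" and "T \<subseteq> ball 0 1"
  shows "(\<exists>f :: real^3 \<Rightarrow> real^3. smooth_on_closed (cball 0 1) f \<and>
      (\<forall>p>3. \<forall>u :: real \<Rightarrow> real^3 \<Rightarrow> real.
        (\<forall>\<^sub>F \<epsilon> in at_right 0. weak_solution p (perforated_ball T \<epsilon>) f (u \<epsilon>)) \<longrightarrow>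
        Liminf (at_right 0) (\<lambda>\<epsilon>. ereal (Lp_norm p (perforated_ball T \<epsilon>)
          (weak_gradient (perforated_ball T \<epsilon>) (u \<epsilon>)))) = \<infinity>)) \<and>
    (C1_boundary T \<longrightarrow>
      (\<forall>p. 1 < p \<and> p < 3 / 2 \<longrightarrow>
        (\<exists>f :: real \<Rightarrow> real^3 \<Rightarrow> real^3.
          (\<forall>\<epsilon>\<in>{0<..<1}. f \<epsilon> \<in> Lp p (perforated_ball T \<epsilon>) \<and>
            Lp_norm p (perforated_ball T \<epsilon>) (f \<epsilon>) = 1) \<and>
          (\<forall>\<epsilon>\<in>{0<..<1}.
            (\<exists>u. weak_solution p (perforated_ball T \<epsilon>) (f \<epsilon>) u) \<and>
            (\<forall>u v. weak_solution p (perforated_ball T \<epsilon>) (f \<epsilon>) u \<and>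
              weak_solution p (perforated_ball T \<epsilon>) (f \<epsilon>) v \<longrightarrow>
              (AE x in lebesgue_on (perforated_ball T \<epsilon>). u x = v x))) \<and>
          (\<forall>u :: real \<Rightarrow> real^3 \<Rightarrow> real.
            (\<forall>\<epsilon>\<in>{0<..<1}. weak_solution p (perforated_ball T \<epsilon>) (f \<epsilon>) (u \<epsilon>)) \<longrightarrow>
            Liminf (at_right 0) (\<lambda>\<epsilon>. ereal (Lp_norm p (perforated_ball T \<epsilon>)
              (weak_gradient (perforated_ball T \<epsilon>) (u \<epsilon>)))) = \<infinity>))))"
proof -
  obtain a where a: "a \<in> interior T" using assms(1) by (auto simp: closed_domain_def)
  have "closed T" using assms(1) by (metis closed_closure closed_domain_def)
  moreover have "bounded T" using assms(3) bounded_ball bounded_subset by blast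
  ultimately interpret perforation T a
    using assms(3) a by unfold_locales (auto simp: compact_eq_bounded_closed)
  show ?thesis
  proof (intro conjI impI allI)
    have "smooth_on_closed (cball 0 1) (\<lambda>x::real^3. x)"
      unfolding smooth_on_closed_def by (intro exI[of _ UNIV]) (auto intro: smooth_linear bounded_linear_ident)
    then show "\<exists>f :: real^3 \<Rightarrow> real^3. smooth_on_closed (cball 0 1) f \<and>
      (\<forall>p>3. \<forall>u :: real \<Rightarrow> real^3 \<Rightarrow> real.
        (\<forall>\<^sub>F \<epsilon> in at_right 0. weak_solution p (\<Omega> \<epsilon>) f (u \<epsilon>)) \<longrightarrow>
        Liminf (at_right 0) (\<lambda>\<epsilon>. ereal (Lp_norm p (\<Omega> \<epsilon>) (weak_gradient (\<Omega> \<epsilon>) (u \<epsilon>)))) = \<infinity>)"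
      using identity_source_blowup by blast
  next
    fix p :: real assume C1: "C1_boundary T" and p: "1 < p \<and> p < 3 / 2"
    then have p': "1 < p" "p < 3 / 2" by auto
    show "\<exists>f :: real \<Rightarrow> real^3 \<Rightarrow> real^3.
          (\<forall>\<epsilon>\<in>{0<..<1}. f \<epsilon> \<in> Lp p (\<Omega> \<epsilon>) \<and> Lp_norm p (\<Omega> \<epsilon>) (f \<epsilon>) = 1) \<and>
          (\<forall>\<epsilon>\<in>{0<..<1}. (\<exists>u. weak_solution p (\<Omega> \<epsilon>) (f \<epsilon>) u) \<and>
            (\<forall>u v. weak_solution p (\<Omega> \<epsilon>) (f \<epsilon>) u \<and> weak_solution p (\<Omega> \<epsilon>) (f \<epsilon>) v \<longrightarrow>
              (AE x in lebesgue_on (\<Omega> \<epsilon>). u x = v x))) \<and>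
          (\<forall>u :: real \<Rightarrow> real^3 \<Rightarrow> real.
            (\<forall>\<epsilon>\<in>{0<..<1}. weak_solution p (\<Omega> \<epsilon>) (f \<epsilon>) (u \<epsilon>)) \<longrightarrow>
            Liminf (at_right 0) (\<lambda>\<epsilon>. ereal (Lp_norm p (\<Omega> \<epsilon>) (weak_gradient (\<Omega> \<epsilon>) (u \<epsilon>)))) = \<infinity>)"
    proof (intro exI[of _ "source p"] conjI ballI allI impI)
      fix \<epsilon> :: real assume "\<epsilon> \<in> {0<..<1}"
      then have \<epsilon>: "0 < \<epsilon>" "\<epsilon> < 1" by auto
      show "source p \<epsilon> \<in> Lp p (\<Omega> \<epsilon>)" "Lp_norm p (\<Omega> \<epsilon>) (source p \<epsilon>) = 1"
        using source_norm[OF p' \<epsilon>] by auto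
      show "\<exists>u. weak_solution p (\<Omega> \<epsilon>) (source p \<epsilon>) u" using source_solution[OF p' \<epsilon>] by blast
      show "AE x in lebesgue_on (\<Omega> \<epsilon>). u x = v x"
        if "weak_solution p (\<Omega> \<epsilon>) (source p \<epsilon>) u \<and> weak_solution p (\<Omega> \<epsilon>) (source p \<epsilon>) v" for u v
        using source_unique[OF C1 \<epsilon>(1) p'(1)] that by blast
    next
      fix u :: "real \<Rightarrow> real^3 \<Rightarrow> real" assume "\<forall>\<epsilon>\<in>{0<..<1}. weak_solution p (\<Omega> \<epsilon>) (source p \<epsilon>) (u \<epsilon>)"
      then show "Liminf (at_right 0) (\<lambda>\<epsilon>. ereal (Lp_norm p (\<Omega> \<epsilon>) (weak_gradient (\<Omega> \<epsilon>) (u \<epsilon>)))) = \<infinity>"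
        by (intro source_blowup[OF C1 p']) auto
    qed
  qed
qed

end
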